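(* Let $(R,\mathfrak m)$ be a universally catenary, analytically unramified Noetherian local ring. Suppose $g\in R[t]$ has Dedekind--Mertens number $\mu_R(g)=k$. If $\dim(R/\mathfrak p)\ge k$ for each minimal prime $\mathfrak p$ of $R$, then the polarized Dedekind--Mertens number of $g$ satisfies $\widetilde\mu_R(g)\le k$. Therefore $\widetilde\mu_R(g)=\mu_R(g)$.
   Context: Rings are commutative with identity and $t$ is an indeterminate. For $f\in R[t]$, the content ideal $c(f)$ is the ideal of $R$ generated by the coefficients of $f$. For an ideal $I$ of a ring, $I^0$ is the whole ring. The Dedekind--Mertens number $\mu_R(g)$ of $g\in R[t]$ is the smallest positive integer $k$ such that $c(fg)\,c(f)^{k-1}=c(f)^k c(g)$ for every $f\in R[t]$. (By the classical Dedekind--Mertens Lemma, such $k$ exists.) The polarized Dedekind--Mertens number $\widetilde\mu_R(g)$ is the smallest positive integer $k$ such that $$\sum_{i=1}^k c(f_ig)\,c(f_1)\cdots\widehat{c(f_i)}\cdots c(f_k)=c(f_1)\cdots c(f_k)\,c(g)$$ for all $f_1,\dots,f_k\in R[t]$, where $\widehat{c(f_i)}$ means that the factor $c(f_i)$ is omitted (an empty product of ideals is $R$). The assertion $\widetilde\mu_R(g)\le k$ includes the existence of such an integer. A Noetherian local ring is analytically unramified if its $\mathfrak m$-adic completion is reduced. *)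

theory Defs
  imports "HOL-Algebra.Algebra" "HOL-Library.Extended_Nat"
begin

section \<open>Content ideals and Dedekind--Mertens numbers\<close>

text \<open>
  Products, powers and sums of ideals are taken in the library's commutative semiring
  \<^const>\<open>ideals_set\<close>, whose zero is the zero ideal and whose one is the whole ring. In particular
  the empty product and the zeroth power of an ideal are the whole ring.
\<close>

definition content_ideal :: "('a, 'b) ring_scheme \<Rightarrow> (nat \<Rightarrow> 'a) \<Rightarrow> 'a set" where
  "content_ideal R f = Idl\<^bsub>R\<^esub> {coeff (UP R) f n | n. True}"

definition dm_identity :: "('a, 'b) ring_scheme \<Rightarrow> (nat \<Rightarrow> 'a) \<Rightarrow> nat \<Rightarrow> bool" where
  "dm_identity R g k \<longleftrightarrow>
     (\<forall>f \<in> carrier (UP R).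
        content_ideal R (f \<otimes>\<^bsub>UP R\<^esub> g) \<otimes>\<^bsub>ideals_set R\<^esub> content_ideal R f [^]\<^bsub>ideals_set R\<^esub> (k - 1)
        = content_ideal R f [^]\<^bsub>ideals_set R\<^esub> k \<otimes>\<^bsub>ideals_set R\<^esub> content_ideal R g)"

definition polarized_dm_identity :: "('a, 'b) ring_scheme \<Rightarrow> (nat \<Rightarrow> 'a) \<Rightarrow> nat \<Rightarrow> bool" where
  "polarized_dm_identity R g k \<longleftrightarrow>
     (\<forall>f \<in> {1..k} \<rightarrow> carrier (UP R).
        (\<Oplus>\<^bsub>ideals_set R\<^esub> i \<in> {1..k}.
           content_ideal R (f i \<otimes>\<^bsub>UP R\<^esub> g)
           \<otimes>\<^bsub>ideals_set R\<^esub> (\<Otimes>\<^bsub>ideals_set R\<^esub> j \<in> {1..k} - {i}. content_ideal R (f j)))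
        = (\<Otimes>\<^bsub>ideals_set R\<^esub> j \<in> {1..k}. content_ideal R (f j)) \<otimes>\<^bsub>ideals_set R\<^esub> content_ideal R g)"

text \<open>
  Both numbers are extended naturals, equal to \<^term>\<open>\<infinity>\<close> exactly when no positive integer with the
  required property exists. Hence an equation or inequality with a finite right-hand side includes
  the existence of such an integer.
\<close>

definition dm_number :: "('a, 'b) ring_scheme \<Rightarrow> (nat \<Rightarrow> 'a) \<Rightarrow> enat" where
  "dm_number R g = Inf {enat k | k. 0 < k \<and> dm_identity R g k}"

definition polarized_dm_number :: "('a, 'b) ring_scheme \<Rightarrow> (nat \<Rightarrow> 'a) \<Rightarrow> enat" where
  "polarized_dm_number R g = Inf {enat k | k. 0 < k \<and> polarized_dm_identity R g k}"

section \<open>Chains of primes, dimension and catenarity\<close>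

definition prime_chain :: "('a, 'b) ring_scheme \<Rightarrow> (nat \<Rightarrow> 'a set) \<Rightarrow> nat \<Rightarrow> bool" where
  "prime_chain R P n \<longleftrightarrow> (\<forall>i\<le>n. primeideal (P i) R) \<and> (\<forall>i<n. P i \<subset> P (Suc i))"

definition saturated_prime_chain :: "('a, 'b) ring_scheme \<Rightarrow> (nat \<Rightarrow> 'a set) \<Rightarrow> nat \<Rightarrow> bool" where
  "saturated_prime_chain R P n \<longleftrightarrow> prime_chain R P n \<and>
     (\<forall>i<n. \<nexists>Q. primeideal Q R \<and> P i \<subset> Q \<and> Q \<subset> P (Suc i))"

text \<open>The zero ring gets dimension \<open>0\<close> here.\<close>

definition krull_dim :: "('a, 'b) ring_scheme \<Rightarrow> enat" where
  "krull_dim R = Sup {enat n | n. \<exists>P. prime_chain R P n}"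

definition minimal_prime :: "('a, 'b) ring_scheme \<Rightarrow> 'a set \<Rightarrow> bool" where
  "minimal_prime R p \<longleftrightarrow> primeideal p R \<and> (\<forall>q. primeideal q R \<and> q \<subseteq> p \<longrightarrow> q = p)"

definition catenary :: "('a, 'b) ring_scheme \<Rightarrow> bool" where
  "catenary R \<longleftrightarrow>
     (\<forall>p q. primeideal p R \<and> primeideal q R \<and> p \<subseteq> q \<longrightarrow>
        (\<exists>d. (\<forall>P n. prime_chain R P n \<and> P 0 = p \<and> P n = q \<longrightarrow> n \<le> d) \<and>
             (\<forall>P n. saturated_prime_chain R P n \<and> P 0 = p \<and> P n = q \<longrightarrow> n = d)))"

definition finite_type_algebra ::
    "('a, 'b) ring_scheme \<Rightarrow> ('c, 'd) ring_scheme \<Rightarrow> ('a \<Rightarrow> 'c) \<Rightarrow> bool" where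
  "finite_type_algebra R A h \<longleftrightarrow> cring A \<and> h \<in> ring_hom R A \<and>
     (\<exists>S \<subseteq> carrier A. finite S \<and> generate_ring A (h ` carrier R \<union> S) = carrier A)"

text \<open>
  A definition cannot quantify over the carrier type of the algebra, so one type that is large
  enough is used. Every algebra of finite type over \<open>R\<close> is isomorphic to a quotient of some
  \<open>R[X\<^sub>0, \<dots>, X\<^sub>r]\<close>. A polynomial is a coefficient function of type \<^typ>\<open>nat multiset \<Rightarrow> 'a\<close>
  (monomials are multisets of variables), and a residue class is a set of such functions.
\<close>

definition universally_catenary :: "('a, 'b) ring_scheme \<Rightarrow> bool" where
  "universally_catenary R \<longleftrightarrow> cring R \<and> noetherian_ring R \<and>
     (\<forall>(A :: (nat multiset \<Rightarrow> 'a) set ring) h. finite_type_algebra R A h \<longrightarrow> catenary A)"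

section \<open>Local rings and completion\<close>

definition noetherian_local_ring :: "('a, 'b) ring_scheme \<Rightarrow> 'a set \<Rightarrow> bool" where
  "noetherian_local_ring R m \<longleftrightarrow> cring R \<and> noetherian_ring R \<and>
     maximalideal m R \<and> (\<forall>M. maximalideal M R \<longrightarrow> M = m)"

text \<open>
  The inverse limit of the rings \<open>R/I\<^sup>n\<close>. The transition map sends a coset of \<open>I\<^sup>n\<^sup>+\<^sup>1\<close> to the
  unique coset of \<open>I\<^sup>n\<close> containing it, so compatibility of a family is expressed by inclusion.
\<close>

definition adic_completion :: "('a, 'b) ring_scheme \<Rightarrow> 'a set \<Rightarrow> (nat \<Rightarrow> 'a set) ring" where
  "adic_completion R I =
     (let Q = (\<lambda>n::nat. R Quot (I [^]\<^bsub>ideals_set R\<^esub> n)) in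
      \<lparr>carrier = {x. \<forall>n. x n \<in> carrier (Q n) \<and> x (Suc n) \<subseteq> x n},
       monoid.mult = (\<lambda>x y n. x n \<otimes>\<^bsub>Q n\<^esub> y n),
       monoid.one = (\<lambda>n. \<one>\<^bsub>Q n\<^esub>),
       ring.zero = (\<lambda>n. \<zero>\<^bsub>Q n\<^esub>),
       ring.add = (\<lambda>x y n. x n \<oplus>\<^bsub>Q n\<^esub> y n)\<rparr>)"

definition reduced_ring :: "('a, 'b) ring_scheme \<Rightarrow> bool" where
  "reduced_ring R \<longleftrightarrow> (\<forall>x \<in> carrier R. \<forall>n::nat. x [^]\<^bsub>R\<^esub> n = \<zero>\<^bsub>R\<^esub> \<longrightarrow> x = \<zero>\<^bsub>R\<^esub>)"

definition analytically_unramified :: "('a, 'b) ring_scheme \<Rightarrow> 'a set \<Rightarrow> bool" where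
  "analytically_unramified R m \<longleftrightarrow>
     noetherian_local_ring R m \<and> reduced_ring (adic_completion R m)"

end

theory Submission imports Defs
begin

no_notation Sum_Type.Plus (infixr "<+>" 65)

text \<open>
  Apply the Dedekind--Mertens identity of order \<open>k\<close> to \<open>f = \<Sum>\<^sub>l a\<^sub>l X\<^sup>l\<^sup>E f\<^sub>l\<close> with \<open>E\<close> large. For \<open>z\<close> in
  \<open>c(f\<^sub>1) \<cdots> c(f\<^sub>k) c(g)\<close>, comparing the terms linear in each parameter gives an \<open>l\<close> in the polarized left-hand
  side with \<open>a\<^sub>1 \<cdots> a\<^sub>k (z - l) \<in> (a\<^sub>1\<^sup>2, \<dots>, a\<^sub>k\<^sup>2)\<close>. By Krull's intersection theorem it suffices to find, for
  every \<open>N\<close>, parameters for which \<open>w a\<^sub>1 \<cdots> a\<^sub>k \<in> (a\<^sub>1\<^sup>2, \<dots>, a\<^sub>k\<^sup>2)\<close> implies \<open>w \<in> m\<^sup>N\<close>. Such parameters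
  exist in the completion \<open>S\<close>, hence in \<open>R\<close> by approximation, as soon as \<open>S\<close> is reduced and all its minimal
  primes have coheight at least \<open>k\<close>: take high powers of elements chosen along prime chains above the minimal primes.

  The coheight bound is Ratliff's theorem that a universally catenary local ring is formally catenary. It is proved
  by induction along prime chains, where the principal ideal theorem and going-down reduce it to one step: if
  \<open>P\<close> is minimal over \<open>pS\<close> with \<open>p = P \<inter> R\<close>, and \<open>p \<subset> p\<^sub>1 \<subset> m\<close> in \<open>R\<close>, then some prime lies strictly between
  \<open>P\<close> and \<open>mS\<close>. This uses catenarity of \<open>R[X]\<close> only, through the kernels of \<open>R[X] \<rightarrow> Frac (R/p)\<close>.
\<close>

section \<open>Ideals, powers and saturation\<close>

text \<open>The identity of order \<open>k\<close> is given over \<open>R\<close> only, so genuine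
  indeterminates cannot be adjoined to keep the polynomials apart. Elements \<open>a\<close> of
  \<open>R\<close> take their place, and \<open>sqid a k\<close> kills every monomial with a
  repeated parameter. For a regular sequence, the colon ideal of the squares by the product is
  \<open>(a_1, ..., a_k)\<close>; this is where a bound by \<open>k\<close> comes from. Regular
  sequences of length \<open>k\<close> need not exist, so the colon ideal is controlled prime by
  prime, along a chain of \<open>k + 1\<close> primes above each minimal prime. Completeness makes
  the resulting conditions uniform (Chevalley), and reducedness lets the minimal primes intersect in
  zero. A minimal prime of the completion with small coheight would leave no room for such a chain;
  this is the obstacle that catenarity removes.

  Localization is always expressed inside the ring, by multipliers outside a prime
  (\<open>sat\<close>), and the completion enters only through the axioms of
  \<open>completion_pair\<close>.\<close>

context cring
begin

lemma ideal_crit: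
  assumes "I \<subseteq> carrier R" "\<zero> \<in> I"
    and add: "\<And>a b. a \<in> I \<Longrightarrow> b \<in> I \<Longrightarrow> a \<oplus> b \<in> I"
    and mult: "\<And>r a. r \<in> carrier R \<Longrightarrow> a \<in> I \<Longrightarrow> r \<otimes> a \<in> I"
  shows "ideal I R"
proof (rule idealI)
  show "ring R" by (rule ring_axioms)
  have neg: "\<ominus> a \<in> I" if "a \<in> I" for a
    using mult[of "\<ominus> \<one>" a] that assms(1) by (auto simp: l_minus)
  show "subgroup I (add_monoid R)"
    using assms neg by (auto simp: subgroup_def a_inv_def[symmetric])
  fix a x assume "a \<in> I" "x \<in> carrier R"
  then show "x \<otimes> a \<in> I" "a \<otimes> x \<in> I"
    using mult assms(1) m_comm[of a x] by auto
qed

lemma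
  assumes I: "ideal I R"
  shows ideal_zero: "\<zero> \<in> I"
    and ideal_carr: "a \<in> I \<Longrightarrow> a \<in> carrier R"
    and ideal_sub: "I \<subseteq> carrier R"
    and ideal_add: "a \<in> I \<Longrightarrow> b \<in> I \<Longrightarrow> a \<oplus> b \<in> I"
    and ideal_neg: "a \<in> I \<Longrightarrow> \<ominus> a \<in> I"
    and ideal_lmult: "a \<in> I \<Longrightarrow> r \<in> carrier R \<Longrightarrow> r \<otimes> a \<in> I"
    and ideal_rmult: "a \<in> I \<Longrightarrow> r \<in> carrier R \<Longrightarrow> a \<otimes> r \<in> I"
    and ideal_minus: "a \<in> I \<Longrightarrow> b \<in> I \<Longrightarrow> a \<ominus> b \<in> I"
proof -
  interpret I: ideal I R by fact
  show "\<zero> \<in> I" "a \<in> I \<Longrightarrow> a \<in> carrier R" "I \<subseteq> carrier R"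
    "a \<in> I \<Longrightarrow> b \<in> I \<Longrightarrow> a \<oplus> b \<in> I" "a \<in> I \<Longrightarrow> \<ominus> a \<in> I"
    "a \<in> I \<Longrightarrow> r \<in> carrier R \<Longrightarrow> r \<otimes> a \<in> I" "a \<in> I \<Longrightarrow> r \<in> carrier R \<Longrightarrow> a \<otimes> r \<in> I"
    "a \<in> I \<Longrightarrow> b \<in> I \<Longrightarrow> a \<ominus> b \<in> I"
    by (auto simp: I.I_l_closed I.I_r_closed a_minus_def)
qed

lemma ideal_cancel_add:
  assumes "ideal I R" "a \<oplus> b \<in> I" "a \<in> I" "b \<in> carrier R" shows "b \<in> I"
proof -
  have c: "a \<in> carrier R" using ideal_carr[OF assms(1)] assms by auto
  have "b = (a \<oplus> b) \<ominus> a" using c assms(4) by algebra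
  then show ?thesis using ideal_minus[OF assms(1) assms(2) assms(3)] by simp
qed

lemma ideal_cancel_minus:
  assumes "ideal I R" "a \<ominus> b \<in> I" "b \<in> I" "a \<in> carrier R" shows "a \<in> I"
proof -
  have c: "b \<in> carrier R" using ideal_carr[OF assms(1)] assms by auto
  have "a = (a \<ominus> b) \<oplus> b" using c assms(4) by algebra
  then show ?thesis using ideal_add[OF assms(1) assms(2) assms(3)] by simp
qed

lemma ideal_minus_swap:
  assumes "ideal I R" "a \<ominus> b \<in> I" "a \<in> carrier R" "b \<in> carrier R" shows "b \<ominus> a \<in> I"
proof -
  have "b \<ominus> a = \<ominus> (a \<ominus> b)" using assms by algebra
  then show ?thesis using ideal_neg[OF assms(1) assms(2)] by simp
qed

lemma mem_PIdl: "z \<in> PIdl x \<longleftrightarrow> (\<exists>r\<in>carrier R. z = r \<otimes> x)"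
  by (auto simp: cgenideal_def)

lemma mem_sum: "z \<in> I <+> J \<longleftrightarrow> (\<exists>i\<in>I. \<exists>j\<in>J. z = i \<oplus> j)"
  by (auto simp: set_add_def')

lemma mem_sum_PIdl: "z \<in> I <+> PIdl x \<longleftrightarrow> (\<exists>i\<in>I. \<exists>r\<in>carrier R. z = i \<oplus> r \<otimes> x)"
proof -
  have "(\<exists>j\<in>PIdl x. z = i \<oplus> j) \<longleftrightarrow> (\<exists>r\<in>carrier R. z = i \<oplus> r \<otimes> x)" for i
    by (auto simp: cgenideal_def)
  then show ?thesis by (simp add: mem_sum)
qed

lemma sum_ub1: "ideal I R \<Longrightarrow> ideal J R \<Longrightarrow> I \<subseteq> I <+> J"
  proof
  fix x assume "ideal I R" "ideal J R" "x \<in> I"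
  then have "x = x \<oplus> \<zero>" "\<zero> \<in> J" using ideal_carr[of I x] ideal_zero[of J] by auto
  then show "x \<in> I <+> J" using \<open>x \<in> I\<close> unfolding mem_sum by blast
qed

lemma sum_ub2: "ideal I R \<Longrightarrow> ideal J R \<Longrightarrow> J \<subseteq> I <+> J"
  proof
  fix x assume "ideal I R" "ideal J R" "x \<in> J"
  then have "x = \<zero> \<oplus> x" "\<zero> \<in> I" using ideal_carr[of J x] ideal_zero[of I] by auto
  then show "x \<in> I <+> J" using \<open>x \<in> J\<close> unfolding mem_sum by blast
qed

lemma sum_least: "ideal K R \<Longrightarrow> I \<subseteq> K \<Longrightarrow> J \<subseteq> K \<Longrightarrow> I <+> J \<subseteq> K"
  by (auto simp: mem_sum) (meson ideal_add subsetD)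

lemma sum_mono: "I \<subseteq> I' \<Longrightarrow> J \<subseteq> J' \<Longrightarrow> I <+> J \<subseteq> I' <+> J'"
  by (fastforce simp: mem_sum)

lemma PIdl_least: "ideal K R \<Longrightarrow> x \<in> K \<Longrightarrow> PIdl x \<subseteq> K"
  by (rule cgenideal_minimal)

lemma PIdl_sum_least: "ideal K R \<Longrightarrow> I \<subseteq> K \<Longrightarrow> x \<in> K \<Longrightarrow> I <+> PIdl x \<subseteq> K"
  by (intro sum_least PIdl_least)

lemma PIdl_sum_ideal: "ideal I R \<Longrightarrow> x \<in> carrier R \<Longrightarrow> ideal (I <+> PIdl x) R"
  by (intro add_ideals cgenideal_ideal)

lemma PIdl_sum_mem: "ideal I R \<Longrightarrow> x \<in> carrier R \<Longrightarrow> x \<in> I <+> PIdl x"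
  using sum_ub2[OF _ cgenideal_ideal] cgenideal_self by blast

lemma PIdl_sum_sub: "ideal I R \<Longrightarrow> x \<in> carrier R \<Longrightarrow> I \<subseteq> I <+> PIdl x"
  using sum_ub1[OF _ cgenideal_ideal] by blast

lemma prod_mono: "I \<subseteq> I' \<Longrightarrow> J \<subseteq> J' \<Longrightarrow> I \<cdot> J \<subseteq> I' \<cdot> J'"
proof
  fix z assume sub: "I \<subseteq> I'" "J \<subseteq> J'" and "z \<in> I \<cdot> J"
  from this(3) show "z \<in> I' \<cdot> J'"
    by induct (use sub in \<open>auto intro: ideal_prod.intros\<close>)
qed

lemma prod_least:
  assumes "ideal K R" "\<And>i j. i \<in> I \<Longrightarrow> j \<in> J \<Longrightarrow> i \<otimes> j \<in> K"
  shows "I \<cdot> J \<subseteq> K"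
proof
  fix z assume "z \<in> I \<cdot> J" then show "z \<in> K"
    by induct (use assms in \<open>auto intro: ideal_add\<close>)
qed

lemma prod_ideal: "ideal I R \<Longrightarrow> ideal J R \<Longrightarrow> ideal (I \<cdot> J) R"
  by (rule ideal_prod_is_ideal)

lemma prod_sub1: "ideal I R \<Longrightarrow> ideal J R \<Longrightarrow> I \<cdot> J \<subseteq> I"
  using ideal_prod_inter by blast

lemma prod_sub2: "ideal I R \<Longrightarrow> ideal J R \<Longrightarrow> I \<cdot> J \<subseteq> J"
  using ideal_prod_inter by blast

text \<open>The power from \<open>ideals_set R\<close> under a short name, so that facts about it
  carry over to the Dedekind--Mertens identities and to the completion.\<close>

definition ipow :: "'a set \<Rightarrow> nat \<Rightarrow> 'a set"
  where "ipow I n = I [^]\<^bsub>ideals_set R\<^esub> n"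

lemma ipow_0: "ipow I 0 = carrier R"
  by (simp add: ipow_def ideals_set_def)

lemma ipow_Suc: "ipow I (Suc n) = ipow I n \<cdot> I"
  by (simp add: ipow_def ideals_set_def)

lemma ipow_ideal: "ideal I R \<Longrightarrow> ideal (ipow I n) R"
  by (induct n) (auto simp: ipow_0 ipow_Suc oneideal prod_ideal)

lemma ipow_1: "ideal I R \<Longrightarrow> ipow I (Suc 0) = I"
  using ideal_prod_one[of I] ideal_prod_commute[OF _ oneideal, of I] by (simp add: ipow_Suc ipow_0)

lemma ipow_add: "ideal I R \<Longrightarrow> ipow I (a + b) = ipow I a \<cdot> ipow I b"
  by (induct b)
     (auto simp: ipow_0 ipow_Suc ideal_prod_one ipow_ideal ideal_prod_assoc[symmetric])

lemma ipow_Suc2: "ideal I R \<Longrightarrow> ipow I (Suc n) = I \<cdot> ipow I n"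
  using ipow_add[of I "Suc 0" n] by (simp add: ipow_1)

lemma ipow_antimono: "ideal I R \<Longrightarrow> a \<le> b \<Longrightarrow> ipow I b \<subseteq> ipow I a"
  using ipow_add[of I a "b - a"] prod_sub1[OF ipow_ideal ipow_ideal, of I I a "b - a"] by simp

lemma ipow_mono: "I \<subseteq> J \<Longrightarrow> ipow I n \<subseteq> ipow J n"
  by (induct n) (auto simp: ipow_0 ipow_Suc prod_mono)

lemma pow_in_ipow: "ideal I R \<Longrightarrow> x \<in> I \<Longrightarrow> x [^] n \<in> ipow I (n::nat)"
  by (induct n) (auto simp: ipow_0 ipow_Suc intro: ideal_prod.prod)

lemma ipow_sub: "ideal I R \<Longrightarrow> n > 0 \<Longrightarrow> ipow I n \<subseteq> I"
  using ipow_antimono[of I "Suc 0" n] by (simp add: ipow_1)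

lemma PIdl_prod:
  assumes "x \<in> carrier R" "y \<in> carrier R" shows "(PIdl x) \<cdot> (PIdl y) = PIdl (x \<otimes> y)"
proof
  show "(PIdl x) \<cdot> (PIdl y) \<subseteq> PIdl (x \<otimes> y)"
  proof (rule prod_least)
    fix i j assume "i \<in> PIdl x" "j \<in> PIdl y"
    then obtain r s where rs: "r \<in> carrier R" "i = r \<otimes> x" "s \<in> carrier R" "j = s \<otimes> y" by (auto simp: mem_PIdl)
    have "r \<otimes> x \<otimes> (s \<otimes> y) = r \<otimes> s \<otimes> (x \<otimes> y)" using rs(1,3) assms by algebra
    then show "i \<otimes> j \<in> PIdl (x \<otimes> y)" unfolding mem_PIdl rs(2,4) using rs(1,3) by blast
  next
    show "ideal (PIdl (x \<otimes> y)) R" using assms by (intro cgenideal_ideal m_closed)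
  qed
  show "PIdl (x \<otimes> y) \<subseteq> (PIdl x) \<cdot> (PIdl y)"
    using assms by (intro PIdl_least prod_ideal ideal_prod.prod cgenideal_ideal cgenideal_self)
qed

lemma ipow_PIdl: "x \<in> carrier R \<Longrightarrow> ipow (PIdl x) n = PIdl (x [^] (n::nat))"
proof (induct n)
  case 0
  have "PIdl \<one> = carrier R"
    using ideal.one_imp_carrier[OF cgenideal_ideal cgenideal_self] by simp
  then show ?case by (simp add: ipow_0)
next
  case (Suc n)
  then show ?case using PIdl_prod[of "x [^] n" x] by (simp add: ipow_Suc)
qed

text \<open>A product of \<open>a + b\<close> factors, each from \<open>I\<close> or from
  \<open>J\<close>, has \<open>a\<close> factors from \<open>I\<close> or \<open>b\<close> factors
  from \<open>J\<close>. In the induction a factor from \<open>I\<close> is multiplied onto the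
  bound for \<open>(a - 1, b)\<close>, and one from \<open>J\<close> onto the bound for
  \<open>(a, b - 1)\<close>.\<close>

lemma ipow_sum_sub:
  assumes I: "ideal I R" and J: "ideal J R"
  shows "ipow (I <+> J) (a + b) \<subseteq> ipow I a <+> ipow J b"
proof (induct "a + b" arbitrary: a b rule: less_induct)
  case less
  note IJ = add_ideals[OF I J]
  show ?case
  proof (cases "a = 0 \<or> b = 0")
    case True
    then show ?thesis
      using ideal_sub[OF ipow_ideal[OF IJ]] sum_ub1[OF oneideal ipow_ideal[OF J]]
        sum_ub2[OF ipow_ideal[OF I] oneideal]
      by (fastforce simp: ipow_0)
  next
    case False
    then obtain a' b' where ab: "a = Suc a'" "b = Suc b'" by (meson not0_implies_Suc)
    note T = add_ideals[OF ipow_ideal[OF I] ipow_ideal[OF J], of a b]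
    have 1: "ipow (I <+> J) (a' + b) \<subseteq> ipow I a' <+> ipow J b"
      and 2: "ipow (I <+> J) (a + b') \<subseteq> ipow I a <+> ipow J b'"
      using less[of a' b] less[of a b'] ab by simp_all
    have mI: "x \<otimes> i \<in> ipow I a <+> ipow J b" if x: "x \<in> ipow I a' <+> ipow J b" and i: "i \<in> I" for x i
    proof -
      obtain u v where uv: "u \<in> ipow I a'" "v \<in> ipow J b" "x = u \<oplus> v" using x by (auto simp: mem_sum)
      have "u \<otimes> i \<in> ipow I a" using uv i by (auto simp: ab ipow_Suc intro: ideal_prod.prod)
      moreover have "v \<otimes> i \<in> ipow J b"
        using uv i ideal_rmult[OF ipow_ideal[OF J]] ideal_carr[OF I] by blast
      moreover have "x \<otimes> i = u \<otimes> i \<oplus> v \<otimes> i"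
        unfolding uv(3) using uv(1,2) i ideal_carr[OF I] ideal_carr[OF ipow_ideal[OF I]] ideal_carr[OF ipow_ideal[OF J]]
        by (intro l_distr) auto
      ultimately show ?thesis unfolding mem_sum by blast
    qed
    have mJ: "x \<otimes> i \<in> ipow I a <+> ipow J b" if x: "x \<in> ipow I a <+> ipow J b'" and i: "i \<in> J" for x i
    proof -
      obtain u v where uv: "u \<in> ipow I a" "v \<in> ipow J b'" "x = u \<oplus> v" using x by (auto simp: mem_sum)
      have "v \<otimes> i \<in> ipow J b" using uv i by (auto simp: ab ipow_Suc intro: ideal_prod.prod)
      moreover have "u \<otimes> i \<in> ipow I a"
        using uv i ideal_rmult[OF ipow_ideal[OF I]] ideal_carr[OF J] by blast
      moreover have "x \<otimes> i = u \<otimes> i \<oplus> v \<otimes> i"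
        unfolding uv(3) using uv(1,2) i ideal_carr[OF J] ideal_carr[OF ipow_ideal[OF I]] ideal_carr[OF ipow_ideal[OF J]]
        by (intro l_distr) auto
      ultimately show ?thesis unfolding mem_sum by blast
    qed
    have "ipow (I <+> J) (a + b) = ipow (I <+> J) (a' + b) \<cdot> (I <+> J)" using ab by (simp add: ipow_Suc)
    also have "\<dots> \<subseteq> ipow I a <+> ipow J b"
    proof (rule prod_least[OF T])
      fix x z assume x: "x \<in> ipow (I <+> J) (a' + b)" and "z \<in> I <+> J"
      then obtain i j where ij: "i \<in> I" "j \<in> J" "z = i \<oplus> j" by (auto simp: mem_sum)
      have "x \<otimes> i \<in> ipow I a <+> ipow J b" using mI[OF subsetD[OF 1 x] ij(1)] .
      moreover have "x \<otimes> j \<in> ipow I a <+> ipow J b" using mJ[OF subsetD[OF 2] ij(2)] x ab by simp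
      ultimately show "x \<otimes> z \<in> ipow I a <+> ipow J b"
        using ideal_add[OF T] ij ideal_carr[OF I] ideal_carr[OF J] ideal_carr[OF ipow_ideal[OF IJ] x]
        by (simp add: r_distr)
    qed
    finally show ?thesis .
  qed
qed

section \<open>Prime ideals, and localization by saturation\<close>

lemma primeideal_ideal: "primeideal P R \<Longrightarrow> ideal P R"
  by (rule primeideal.axioms(1))

lemma prime_one: "primeideal P R \<Longrightarrow> \<one> \<notin> P"
  using ideal.one_imp_carrier[OF primeideal_ideal[of P]] primeideal.I_notcarr[of P R] by auto

lemma prime_mult_iff:
  assumes "primeideal P R" "a \<in> carrier R" "b \<in> carrier R"
  shows "a \<otimes> b \<in> P \<longleftrightarrow> a \<in> P \<or> b \<in> P"
  using primeideal.I_prime[OF assms] ideal_lmult[OF primeideal_ideal[OF assms(1)], of b a]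
    ideal_rmult[OF primeideal_ideal[OF assms(1)], of a b] assms(2,3) by auto

lemma prime_pow:
  assumes "primeideal P R" "a \<in> carrier R" "a [^] (n::nat) \<in> P" shows "a \<in> P"
  using assms(3) by (induct n) (use assms(1,2) prime_mult_iff[of P] prime_one[of P] in auto)

lemma prime_ipow:
  assumes P: "primeideal P R" and I: "ideal I R" and sub: "ipow I n \<subseteq> P" shows "I \<subseteq> P"
proof
  fix x assume "x \<in> I"
  then show "x \<in> P" using prime_pow[OF P ideal_carr[OF I]] pow_in_ipow[OF I] sub by blast
qed

lemma primeideal_crit:
  assumes "ideal P R" "\<one> \<notin> P" 
    and "\<And>a b. a \<in> carrier R \<Longrightarrow> b \<in> carrier R \<Longrightarrow> a \<otimes> b \<in> P \<Longrightarrow> a \<in> P \<or> b \<in> P"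
  shows "primeideal P R"
proof (rule primeidealI[OF assms(1) is_cring])
  show "carrier R \<noteq> P" using assms(2) by auto
qed (rule assms(3))

text \<open>For a prime \<open>q\<close> this is the preimage in \<open>R\<close> of the extension
  of \<open>I\<close> to the local ring at \<open>q\<close>. Working with it keeps every local
  argument inside \<open>R\<close>.\<close>

definition sat :: "'a set \<Rightarrow> 'a set \<Rightarrow> 'a set" where
  "sat q I = {a \<in> carrier R. \<exists>s \<in> carrier R - q. s \<otimes> a \<in> I}"

lemma sat_ideal:
  assumes q: "primeideal q R" and I: "ideal I R" shows "ideal (sat q I) R"
proof (rule ideal_crit)
  show "sat q I \<subseteq> carrier R" by (auto simp: sat_def)
  show "\<zero> \<in> sat q I" using ideal_zero[OF I] prime_one[OF q] by (auto simp: sat_def intro!: bexI[of _ \<one>])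
  fix a assume "a \<in> sat q I"
  then obtain s where s: "a \<in> carrier R" "s \<in> carrier R" "s \<notin> q" "s \<otimes> a \<in> I" by (auto simp: sat_def)
  { fix b assume "b \<in> sat q I"
    then obtain t where t: "b \<in> carrier R" "t \<in> carrier R" "t \<notin> q" "t \<otimes> b \<in> I" by (auto simp: sat_def)
    have "s \<otimes> t \<otimes> (a \<oplus> b) = t \<otimes> (s \<otimes> a) \<oplus> s \<otimes> (t \<otimes> b)" using s(1,2) t(1,2) by algebra
    then have "s \<otimes> t \<otimes> (a \<oplus> b) \<in> I" using s t by (auto intro!: ideal_add[OF I] ideal_lmult[OF I])
    then show "a \<oplus> b \<in> sat q I" using s t prime_mult_iff[OF q] by (auto simp: sat_def intro!: bexI[of _ "s \<otimes> t"]) }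
  { fix r assume r: "r \<in> carrier R"
    have "s \<otimes> (r \<otimes> a) = r \<otimes> (s \<otimes> a)" using s(1,2) r by algebra
    then show "r \<otimes> a \<in> sat q I" using s r ideal_lmult[OF I] by (auto simp: sat_def intro!: bexI[of _ s]) }
qed

lemma sat_ext:
  assumes "primeideal q R" "ideal I R" shows "I \<subseteq> sat q I"
  using assms ideal_carr[OF assms(2)] prime_one[OF assms(1)]
  by (auto simp: sat_def intro!: bexI[of _ \<one>])

lemma sat_mono: "I \<subseteq> J \<Longrightarrow> sat q I \<subseteq> sat q J"
  by (auto simp: sat_def)

lemma sat_closed:
  assumes q: "primeideal q R" and "s \<in> carrier R" "s \<notin> q" "a \<in> carrier R" "s \<otimes> a \<in> sat q I"
  shows "a \<in> sat q I"
proof -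
  obtain t where t: "t \<in> carrier R" "t \<notin> q" "t \<otimes> (s \<otimes> a) \<in> I" using assms(5) by (auto simp: sat_def)
  then show ?thesis using assms prime_mult_iff[OF q, of t s]
    by (auto simp: sat_def m_assoc[symmetric] intro!: bexI[of _ "t \<otimes> s"])
qed

lemma sat_least:
  assumes q: "primeideal q R" and "I \<subseteq> sat q J" shows "sat q I \<subseteq> sat q J"
proof
  fix a assume "a \<in> sat q I"
  then obtain s where s: "a \<in> carrier R" "s \<in> carrier R" "s \<notin> q" "s \<otimes> a \<in> I" by (auto simp: sat_def)
  then show "a \<in> sat q J" using sat_closed[OF q s(2,3,1)] assms(2) by blast
qed

end

section \<open>Noetherian rings\<close>

locale noetherian_cring = cring + noetherian_ring
begin

lemma noeth_max:
  assumes "\<C> \<noteq> {}" "\<And>I. I \<in> \<C> \<Longrightarrow> ideal I R"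
  obtains M where "M \<in> \<C>" "\<And>J. J \<in> \<C> \<Longrightarrow> M \<subseteq> J \<Longrightarrow> J = M"
proof -
  have "\<exists>M\<in>\<C>. \<forall>J\<in>\<C>. M \<subseteq> J \<longrightarrow> J = M"
  proof (rule subset_Zorn_nonempty[OF assms(1)])
    fix C assume C: "C \<noteq> {}" "subset.chain \<C> C"
    then have "\<Union>C \<in> C" using assms(2)
      by (intro ideal_chain_is_trivial) (auto simp: pred_on.chain_def)
    then show "\<Union>C \<in> \<C>" using C(2) by (auto simp: pred_on.chain_def)
  qed
  then show ?thesis using that by blast
qed

lemma noeth_acc:
  assumes "\<And>n. ideal (I n) R" "\<And>n. I n \<subseteq> I (Suc n)"
  obtains n where "\<And>m. m \<ge> n \<Longrightarrow> I m = I (n::nat)"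
proof -
  obtain M where M: "M \<in> range I" "\<And>J. J \<in> range I \<Longrightarrow> M \<subseteq> J \<Longrightarrow> J = M"
    using noeth_max[of "range I"] assms(1) by auto
  then obtain n where n: "M = I n" by auto
  have "I n \<subseteq> I m" if "m \<ge> n" for m using that assms(2) lift_Suc_mono_le by blast
  then show ?thesis using that[of n] M(2) n by blast
qed

text \<open>An ideal maximal among those inside \<open>J\<close> with property \<open>P\<close>
  absorbs every \<open>x\<close> in \<open>J\<close>, so it is \<open>J\<close> itself. This
  replaces induction over a finite list of generators.\<close>

lemma noeth_ideal_induct [consumes 1, case_names zero step]:
  assumes J: "ideal J R" and "P {\<zero>}"
    and "\<And>I x. ideal I R \<Longrightarrow> I \<subseteq> J \<Longrightarrow> P I \<Longrightarrow> x \<in> J \<Longrightarrow> P (I <+> PIdl x)"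
  shows "P J"
proof -
  obtain M where M: "M \<in> {I. ideal I R \<and> I \<subseteq> J \<and> P I}"
     "\<And>I. I \<in> {I. ideal I R \<and> I \<subseteq> J \<and> P I} \<Longrightarrow> M \<subseteq> I \<Longrightarrow> I = M"
    using noeth_max[of "{I. ideal I R \<and> I \<subseteq> J \<and> P I}"] zeroideal ideal_zero[OF J] assms(2) by blast
  have "x \<in> M" if "x \<in> J" for x
  proof -
    have x: "x \<in> carrier R" using that ideal_carr[OF J] by blast
    have "M <+> PIdl x = M"
      using M that assms(3)[of M x] PIdl_sum_ideal[of M x] PIdl_sum_least[OF J, of M x] PIdl_sum_sub[of M x] x
      by blast
    then show ?thesis using PIdl_sum_mem[of M x] M(1) x by auto
  qed
  then have "M = J" using M(1) by blast
  then show ?thesis using M(1) by simp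
qed

text \<open>Generators are adjoined one at a time, and the exponents add up by
  \<open>ipow_sum_sub\<close>.\<close>

lemma pow_sub_of_elem_pow:
  assumes J: "ideal J R" and U: "ideal U R" and "\<And>y. y \<in> J \<Longrightarrow> \<exists>e::nat. y [^] e \<in> U"
  shows "\<exists>n. ipow J n \<subseteq> U"
  using J
proof (induct rule: noeth_ideal_induct)
  case zero
  have "ipow {\<zero>} 1 \<subseteq> U" using ipow_1[OF zeroideal] ideal_zero[OF U] by simp
  then show ?case by blast
next
  case (step I x)
  then obtain n where n: "ipow I n \<subseteq> U" by blast
  obtain e :: nat where e: "x [^] e \<in> U" using assms(3) step by blast
  have x: "x \<in> carrier R" using step ideal_carr[OF J] by blast
  have "ipow (I <+> PIdl x) (n + e) \<subseteq> ipow I n <+> ipow (PIdl x) e"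
    using ipow_sum_sub step x cgenideal_ideal by blast
  also have "\<dots> \<subseteq> U" using n PIdl_least[OF U e] x by (intro sum_least[OF U]) (auto simp: ipow_PIdl)
  finally show ?case by blast
qed

text \<open>An ideal maximal among those that contain \<open>I\<close> and miss the multiplicative
  set \<open>S\<close> is prime.\<close>

lemma exists_prime_avoiding:
  assumes I: "ideal I R" and S: "S \<subseteq> carrier R" "\<one> \<in> S" "\<And>a b. a \<in> S \<Longrightarrow> b \<in> S \<Longrightarrow> a \<otimes> b \<in> S"
    and "I \<inter> S = {}"
  obtains P where "primeideal P R" "I \<subseteq> P" "P \<inter> S = {}"
proof -
  let ?C = "{J. ideal J R \<and> I \<subseteq> J \<and> J \<inter> S = {}}"
  obtain P where P: "P \<in> ?C" and max: "\<And>J. J \<in> ?C \<Longrightarrow> P \<subseteq> J \<Longrightarrow> J = P"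
    using noeth_max[of ?C] I assms(5) by blast
  have Pi: "ideal P R" using P by blast
  have "primeideal P R"
  proof (rule primeideal_crit[OF Pi])
    show "\<one> \<notin> P" using P S by blast
    fix a b assume ab: "a \<in> carrier R" "b \<in> carrier R" "a \<otimes> b \<in> P"
    show "a \<in> P \<or> b \<in> P"
    proof (rule ccontr)
      assume n: "\<not> (a \<in> P \<or> b \<in> P)"
      have meet: "\<exists>p\<in>P. \<exists>r\<in>carrier R. p \<oplus> r \<otimes> x \<in> S" if "x \<in> carrier R" "x \<notin> P" for x
      proof (rule ccontr)
        assume "\<not> ?thesis"
        then have "(P <+> PIdl x) \<inter> S = {}" by (auto simp: mem_sum_PIdl)
        then have "P <+> PIdl x = P"
          using max[of "P <+> PIdl x"] PIdl_sum_ideal[OF Pi that(1)] PIdl_sum_sub[OF Pi that(1)] P by blast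
        then show False using PIdl_sum_mem[OF Pi that(1)] that by blast
      qed
      obtain p r where p: "p \<in> P" "r \<in> carrier R" "p \<oplus> r \<otimes> a \<in> S" using meet[OF ab(1)] n by blast
      obtain p' r' where p': "p' \<in> P" "r' \<in> carrier R" "p' \<oplus> r' \<otimes> b \<in> S" using meet[OF ab(2)] n by blast
      have c: "p \<in> carrier R" "p' \<in> carrier R" using p p' ideal_carr[OF Pi] by auto
      \<comment> \<open>A product of two elements of \<open>S\<close> would land in
        \<open>P\<close>: each term of the expansion contains \<open>p\<close>, \<open>p'\<close> or
        \<open>a \<otimes> b\<close>.\<close>
      have "(p \<oplus> r \<otimes> a) \<otimes> (p' \<oplus> r' \<otimes> b) = (p' \<oplus> r' \<otimes> b) \<otimes> p \<oplus> (r \<otimes> a \<otimes> p' \<oplus> r \<otimes> r' \<otimes> (a \<otimes> b))"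
        using c ab(1,2) p(2) p'(2) by algebra
      also have "\<dots> \<in> P"
        using ideal_lmult[OF Pi p(1), of "p' \<oplus> r' \<otimes> b"] ideal_lmult[OF Pi p'(1), of "r \<otimes> a"]
          ideal_lmult[OF Pi ab(3), of "r \<otimes> r'"] c ab(1,2) p(2) p'(2)
        by (intro ideal_add[OF Pi]) auto
      finally show False using S(3)[OF p(3) p'(3)] P by blast
    qed
  qed
  then show ?thesis using that P by blast
qed

text \<open>Noetherian induction: a maximal counterexample \<open>M\<close> is not prime, and if
  \<open>a b\<close> lies in \<open>M\<close>, a prime over \<open>M\<close> lies over
  \<open>M + (a)\<close> or over \<open>M + (b)\<close>. The family \<open>F\<close> may contain
  non-minimal primes; what matters is that every prime over \<open>I\<close> contains a member of
  it.\<close>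

lemma primes_above_finite:
  assumes "ideal I R"
  obtains F where "finite F" "\<And>P. P \<in> F \<Longrightarrow> primeideal P R \<and> I \<subseteq> P"
    "\<And>Q. primeideal Q R \<Longrightarrow> I \<subseteq> Q \<Longrightarrow> \<exists>P\<in>F. P \<subseteq> Q"
proof -
  define good where "good I \<longleftrightarrow> (\<exists>F. finite F \<and> (\<forall>P\<in>F. primeideal P R \<and> I \<subseteq> P) \<and>
     (\<forall>Q. primeideal Q R \<and> I \<subseteq> Q \<longrightarrow> (\<exists>P\<in>F. P \<subseteq> Q)))" for I
  have "good I"
  proof (rule ccontr)
    assume "\<not> good I"
    then have "{J. ideal J R \<and> \<not> good J} \<noteq> {}" using assms by blast
    then obtain M where "M \<in> {J. ideal J R \<and> \<not> good J}"
      and max': "\<And>J. J \<in> {J. ideal J R \<and> \<not> good J} \<Longrightarrow> M \<subseteq> J \<Longrightarrow> J = M"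
      by (rule noeth_max) auto
    then have M: "ideal M R" "\<not> good M" by auto
    have max: "\<And>J. ideal J R \<Longrightarrow> \<not> good J \<Longrightarrow> M \<subseteq> J \<Longrightarrow> J = M" using max' by simp
    have "\<not> primeideal M R"
    proof
      assume "primeideal M R"
      then have "good M" unfolding good_def by (intro exI[of _ "{M}"]) simp
      then show False using M by simp
    qed
    moreover have "\<one> \<notin> M"
    proof
      assume "\<one> \<in> M"
      then have "\<not> primeideal Q R \<or> \<not> M \<subseteq> Q" for Q using prime_one[of Q] by auto
      then have "good M" unfolding good_def by (intro exI[of _ "{}"]) auto
      then show False using M by simp
    qed
    ultimately obtain a b where ab: "a \<in> carrier R" "b \<in> carrier R" "a \<otimes> b \<in> M" "a \<notin> M" "b \<notin> M"
      using primeideal_crit[OF M(1)] by auto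
    have "good (M <+> PIdl x)" if "x \<in> carrier R" "x \<notin> M" for x
      using max[OF PIdl_sum_ideal[OF M(1) that(1)] _ PIdl_sum_sub[OF M(1) that(1)]]
        PIdl_sum_mem[OF M(1) that(1)] that(2) by auto
    then have ga: "good (M <+> PIdl a)" and gb: "good (M <+> PIdl b)" using ab by auto
    from ga obtain F where F: "finite F" "\<forall>P\<in>F. primeideal P R \<and> M <+> PIdl a \<subseteq> P"
       "\<forall>Q. primeideal Q R \<and> M <+> PIdl a \<subseteq> Q \<longrightarrow> (\<exists>P\<in>F. P \<subseteq> Q)"
      unfolding good_def by (elim exE conjE)
    from gb obtain F' where F': "finite F'" "\<forall>P\<in>F'. primeideal P R \<and> M <+> PIdl b \<subseteq> P"
       "\<forall>Q. primeideal Q R \<and> M <+> PIdl b \<subseteq> Q \<longrightarrow> (\<exists>P\<in>F'. P \<subseteq> Q)"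
      unfolding good_def by (elim exE conjE)
    have "\<exists>P\<in>F \<union> F'. P \<subseteq> Q" if Q: "primeideal Q R" "M \<subseteq> Q" for Q
    proof -
      have "a \<in> Q \<or> b \<in> Q" using subsetD[OF Q(2) ab(3)] prime_mult_iff[OF Q(1) ab(1,2)] by simp
      then have "M <+> PIdl a \<subseteq> Q \<or> M <+> PIdl b \<subseteq> Q"
        using PIdl_sum_least[OF primeideal_ideal[OF Q(1)] Q(2)] by metis
      then obtain P where "P \<in> F \<or> P \<in> F'" "P \<subseteq> Q"
        using F(3)[rule_format, of Q] F'(3)[rule_format, of Q] Q(1) by auto
      then show ?thesis by auto
    qed
    moreover have "M \<subseteq> P" if "P \<in> F \<union> F'" for P
    proof -
      have "M <+> PIdl a \<subseteq> P \<or> M <+> PIdl b \<subseteq> P" using that F(2) F'(2) by auto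
      then show ?thesis using PIdl_sum_sub[OF M(1) ab(1)] PIdl_sum_sub[OF M(1) ab(2)] by auto
    qed
    ultimately have "good M" unfolding good_def
      using F(1,2) F'(1,2) by (intro exI[of _ "F \<union> F'"] conjI ballI allI impI) auto
    then show False using M by blast
  qed
  then obtain F where "finite F" "\<forall>P\<in>F. primeideal P R \<and> I \<subseteq> P"
     "\<forall>Q. primeideal Q R \<and> I \<subseteq> Q \<longrightarrow> (\<exists>P\<in>F. P \<subseteq> Q)"
    unfolding good_def by (elim exE conjE)
  then show ?thesis using that by auto
qed

text \<open>Common source of Artin--Rees and of Krull's intersection theorem. Let \<open>U\<close>
  be maximal with \<open>T \<subseteq> U\<close> and \<open>U \<inter> D \<subseteq> T\<close>. For
  \<open>y\<close> in \<open>J\<close> the colon ideals of \<open>U\<close> by the powers of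
  \<open>y\<close> become stationary at some \<open>e\<close>; then \<open>U + (y^e)\<close> still
  meets \<open>D\<close> inside \<open>T\<close>, so \<open>y^e\<close> lies in \<open>U\<close>.
  Hence a power of \<open>J\<close> lies in \<open>U\<close>, and \<open>T + J^n\<close>, being part
  of \<open>U\<close>, meets \<open>D\<close> inside \<open>T\<close>.\<close>

lemma max_ideal_trick:
  assumes T: "ideal T R" and D: "ideal D R" and J: "ideal J R"
    and yD: "\<And>y d. y \<in> J \<Longrightarrow> d \<in> D \<Longrightarrow> y [^] (N::nat) \<otimes> d \<in> T"
  obtains n where "\<And>z. z \<in> D \<Longrightarrow> z \<in> T <+> ipow J n \<Longrightarrow> z \<in> T"
proof -
  let ?C = "{U. ideal U R \<and> T \<subseteq> U \<and> U \<inter> D \<subseteq> T}"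
  obtain U where U: "U \<in> ?C" and max: "\<And>V. V \<in> ?C \<Longrightarrow> U \<subseteq> V \<Longrightarrow> V = U"
    using noeth_max[of ?C] T by blast
  have Ui: "ideal U R" using U by blast
  have "\<exists>e::nat. y [^] e \<in> U" if y: "y \<in> J" for y
  proof -
    have yc: "y \<in> carrier R" using y ideal_carr[OF J] by blast
    define C where "C e = {r \<in> carrier R. y [^] (e::nat) \<otimes> r \<in> U}" for e
    have Ci: "ideal (C e) R" for e
    proof (rule ideal_crit)
      show "C e \<subseteq> carrier R" "\<zero> \<in> C e" using yc ideal_zero[OF Ui] by (auto simp: C_def)
      fix a assume a: "a \<in> C e"
      { fix b assume "b \<in> C e" then show "a \<oplus> b \<in> C e" 
          using a yc ideal_add[OF Ui] by (auto simp: C_def r_distr) }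
      fix r assume r: "r \<in> carrier R"
      have "y [^] e \<otimes> (r \<otimes> a) = r \<otimes> (y [^] e \<otimes> a)"
        using r a yc by (simp add: C_def m_lcomm)
      then show "r \<otimes> a \<in> C e" using a r ideal_lmult[OF Ui] by (auto simp: C_def)
    qed
    have Cs: "C e \<subseteq> C (Suc e)" for e
    proof
      fix r assume r: "r \<in> C e"
      have "y [^] Suc e \<otimes> r = y \<otimes> (y [^] e \<otimes> r)" using r yc by (simp add: C_def m_ac)
      then show "r \<in> C (Suc e)" using r yc ideal_lmult[OF Ui] by (auto simp: C_def)
    qed
    obtain e where e: "\<And>m. m \<ge> e \<Longrightarrow> C m = C e" using noeth_acc[of C, OF Ci Cs] by blast
    have "(U <+> PIdl (y [^] e)) \<inter> D \<subseteq> T"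
    proof
      fix z assume "z \<in> (U <+> PIdl (y [^] e)) \<inter> D"
      then obtain u r where z: "u \<in> U" "r \<in> carrier R" "z = u \<oplus> r \<otimes> y [^] e" "z \<in> D"
        by (auto simp: mem_sum_PIdl)
      have uc: "u \<in> carrier R" using z ideal_carr[OF Ui] by blast
      \<comment> \<open>Multiplication by \<open>y^N\<close> moves \<open>z\<close> into
        \<open>T\<close>, so \<open>y^(e+N) r\<close> lies in \<open>U\<close>, and stationarity
        lowers the exponent back to \<open>e\<close>.\<close>
      have "y [^] N \<otimes> z = y [^] N \<otimes> u \<oplus> y [^] (e + N) \<otimes> r"
        using z(2,3) uc yc by (simp add: r_distr nat_pow_mult[symmetric] m_ac)
      moreover have "y [^] N \<otimes> z \<in> U" using yD[OF y z(4)] U by blast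
      ultimately have "y [^] (e + N) \<otimes> r \<in> U"
        using ideal_cancel_add[OF Ui, of "y [^] N \<otimes> u" "y [^] (e + N) \<otimes> r"] ideal_lmult[OF Ui z(1), of "y [^] N"] z(2) yc by simp
      then have "r \<in> C (e + N)" using z by (simp add: C_def)
      then have "r \<in> C e" using e[of "e + N"] by simp
      then have "r \<otimes> y [^] e \<in> U" using z yc by (simp add: C_def m_comm)
      then have "z \<in> U" using z ideal_add[OF Ui] by blast
      then show "z \<in> T" using U z by blast
    qed
    then have "U <+> PIdl (y [^] e) = U"
      using max[of "U <+> PIdl (y [^] e)"] PIdl_sum_ideal[OF Ui, of "y [^] e"] PIdl_sum_sub[OF Ui, of "y [^] e"] U yc by auto
    then have "y [^] e \<in> U" using PIdl_sum_mem[OF Ui, of "y [^] e"] yc by simp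
    then show ?thesis by blast
  qed
  then obtain n where n: "ipow J n \<subseteq> U" using pow_sub_of_elem_pow[OF J Ui] by blast
  have "z \<in> T" if "z \<in> D" "z \<in> T <+> ipow J n" for z
    using that U n sum_least[OF Ui, of T "ipow J n"] by blast
  then show ?thesis using that[of n] by blast
qed

text \<open>Artin--Rees modulo \<open>B\<close>, without control of how \<open>n\<close> depends on
  \<open>N\<close>. It is \<open>max_ideal_trick\<close> for \<open>T = B + J^N C\<close> and
  \<open>D = B + C\<close>, because \<open>y^N\<close> maps \<open>D\<close> into
  \<open>T\<close>.\<close>

lemma weak_artin_rees:
  assumes B: "ideal B R" and C: "ideal C R" and J: "ideal J R"
  obtains n where "\<And>z. z \<in> B <+> C \<Longrightarrow> z \<in> B <+> ipow J n \<Longrightarrow> z \<in> B <+> ipow J N \<cdot> C"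
proof -
  note Ji = ipow_ideal[OF J]
  note T = add_ideals[OF B prod_ideal[OF Ji[of N] C]]
  have "y [^] N \<otimes> d \<in> B <+> ipow J N \<cdot> C" if yJ: "y \<in> J" and d: "d \<in> B <+> C" for y d
  proof -
    obtain b c where bc: "b \<in> B" "c \<in> C" "d = b \<oplus> c" using d by (auto simp: mem_sum)
    have y: "y \<in> carrier R" using yJ ideal_carr[OF J] by blast
    have "y [^] N \<otimes> d = y [^] N \<otimes> b \<oplus> y [^] N \<otimes> c"
      using bc y ideal_carr[OF B] ideal_carr[OF C] by (simp add: r_distr)
    moreover have "y [^] N \<otimes> b \<in> B" using ideal_lmult[OF B bc(1)] y by simp
    moreover have "y [^] N \<otimes> c \<in> ipow J N \<cdot> C"
      using bc pow_in_ipow[OF J yJ] by (auto intro: ideal_prod.prod)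
    ultimately show ?thesis by (auto simp: mem_sum)
  qed
  then obtain n where n: "\<And>z. z \<in> B <+> C \<Longrightarrow> z \<in> (B <+> ipow J N \<cdot> C) <+> ipow J n \<Longrightarrow> z \<in> B <+> ipow J N \<cdot> C"
    using max_ideal_trick[OF T add_ideals[OF B C] J, of N] by metis
  have "B <+> ipow J n \<subseteq> (B <+> ipow J N \<cdot> C) <+> ipow J n"
    by (intro sum_mono sum_ub1 B prod_ideal Ji C order_refl)
  then show ?thesis using that[of n] n by blast
qed

lemma nakayama_loc_step:
  assumes q: "primeideal q R" and N: "ideal N R" and K: "ideal K R" and x: "x \<in> N"
    and "N \<subseteq> sat q (K <+> PIdl x)" and z: "z \<in> q \<cdot> N"
  shows "\<exists>s\<in>carrier R - q. \<exists>c\<in>q. \<exists>k\<in>K. s \<otimes> z = k \<oplus> c \<otimes> x"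
  using z
proof induct
  case (prod c n)
  have xc: "x \<in> carrier R" using x ideal_carr[OF N] by blast
  have "n \<in> sat q (K <+> PIdl x)" using prod assms(5) by blast
  then obtain s k r where s: "n \<in> carrier R" "s \<in> carrier R" "s \<notin> q" "k \<in> K" "r \<in> carrier R" "s \<otimes> n = k \<oplus> r \<otimes> x"
    by (auto simp: sat_def mem_sum_PIdl)
  have c: "c \<in> carrier R" "k \<in> carrier R" using prod s ideal_carr[OF primeideal_ideal[OF q]] ideal_carr[OF K] by auto
  have "s \<otimes> (c \<otimes> n) = c \<otimes> (s \<otimes> n)" using c s(1,2) by algebra
  also have "\<dots> = c \<otimes> k \<oplus> (c \<otimes> r) \<otimes> x" unfolding s(6) using c s(5) xc by algebra
  finally have "s \<otimes> (c \<otimes> n) = c \<otimes> k \<oplus> (c \<otimes> r) \<otimes> x" .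
  moreover have "c \<otimes> k \<in> K" "c \<otimes> r \<in> q"
    using c s prod ideal_lmult[OF K] ideal_rmult[OF primeideal_ideal[OF q]] by auto
  ultimately show ?case using s by blast
next
  case (sum z1 z2)
  have xc: "x \<in> carrier R" using x ideal_carr[OF N] by blast
  note qi = primeideal_ideal[OF q]
  obtain s c k where 1: "s \<in> carrier R" "s \<notin> q" "c \<in> q" "k \<in> K" "s \<otimes> z1 = k \<oplus> c \<otimes> x" using sum by blast
  obtain t d l where 2: "t \<in> carrier R" "t \<notin> q" "d \<in> q" "l \<in> K" "t \<otimes> z2 = l \<oplus> d \<otimes> x" using sum by blast
  have c: "c \<in> carrier R" "k \<in> carrier R" "d \<in> carrier R" "l \<in> carrier R" "z1 \<in> carrier R" "z2 \<in> carrier R"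
    using 1 2 sum ideal_carr[OF qi] ideal_carr[OF K] ideal_carr[OF prod_ideal[OF qi N]] by auto
  have "s \<otimes> t \<otimes> (z1 \<oplus> z2) = t \<otimes> (s \<otimes> z1) \<oplus> s \<otimes> (t \<otimes> z2)" using c 1(1) 2(1) by algebra
  also have "\<dots> = (t \<otimes> k \<oplus> s \<otimes> l) \<oplus> (t \<otimes> c \<oplus> s \<otimes> d) \<otimes> x" unfolding 1(5) 2(5) using c 1(1) 2(1) xc by algebra
  finally have "s \<otimes> t \<otimes> (z1 \<oplus> z2) = (t \<otimes> k \<oplus> s \<otimes> l) \<oplus> (t \<otimes> c \<oplus> s \<otimes> d) \<otimes> x" .
  moreover have "t \<otimes> k \<oplus> s \<otimes> l \<in> K" "t \<otimes> c \<oplus> s \<otimes> d \<in> q"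
    using 1 2 by (auto intro!: ideal_add[OF K] ideal_lmult[OF K] ideal_add[OF qi] ideal_lmult[OF qi])
  moreover have "s \<otimes> t \<in> carrier R - q" using 1 2 prime_mult_iff[OF q] by auto
  ultimately show ?case by blast
qed

lemma nakayama_loc:
  assumes q: "primeideal q R" and N: "ideal N R" and I: "ideal I R"
    and sub: "N \<subseteq> sat q (I <+> q \<cdot> N)"
  shows "N \<subseteq> sat q I"
proof -
  note qi = primeideal_ideal[OF q]
  note sati = sat_ideal[OF q]
  obtain A where A: "A \<subseteq> carrier R" "finite A" "N = Idl A" using finetely_gen[OF N] by blast
  have AN: "A \<subseteq> N" using A genideal_self by blast
  have *: "N \<subseteq> sat q (I <+> Idl B) \<Longrightarrow> N \<subseteq> sat q I" if "finite B" "B \<subseteq> A" for B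
    using that
  proof (induct B)
    case empty
    have "Idl {} \<subseteq> I" using genideal_minimal[OF I, of "{}"] by simp
    then have "I <+> Idl {} \<subseteq> I" by (rule sum_least[OF I order_refl])
    then show ?case using empty sat_mono[of "I <+> Idl {}" I q] by blast
  next
    case (insert x B)
    let ?K = "I <+> Idl B"
    have Bc: "B \<subseteq> carrier R" "x \<in> carrier R" "x \<in> N" using insert A AN by auto
    have Bi: "ideal (Idl B) R" by (rule genideal_ideal[OF Bc(1)])
    have K: "ideal ?K R" by (rule add_ideals[OF I Bi])
    have Kx: "ideal (?K <+> PIdl x) R" by (rule PIdl_sum_ideal[OF K Bc(2)])
    have "I <+> Idl (insert x B) \<subseteq> ?K <+> PIdl x"
    proof (rule sum_least[OF Kx])
      show "I \<subseteq> ?K <+> PIdl x" using sum_ub1[OF I Bi] PIdl_sum_sub[OF K Bc(2)] by blast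
      show "Idl (insert x B) \<subseteq> ?K <+> PIdl x"
        using sum_ub2[OF I Bi] PIdl_sum_sub[OF K Bc(2)] PIdl_sum_mem[OF K Bc(2)] genideal_self[OF Bc(1)]
        by (intro genideal_minimal[OF Kx]) blast
    qed
    then have NKx: "N \<subseteq> sat q (?K <+> PIdl x)" using insert sat_mono by blast
    have "x \<in> sat q (I <+> q \<cdot> N)" using sub Bc by blast
    then obtain s i z where s: "s \<in> carrier R" "s \<notin> q" "i \<in> I" "z \<in> q \<cdot> N" "s \<otimes> x = i \<oplus> z"
      by (auto simp: sat_def mem_sum)
    obtain t c k where t: "t \<in> carrier R" "t \<notin> q" "c \<in> q" "k \<in> ?K" "t \<otimes> z = k \<oplus> c \<otimes> x"
      using nakayama_loc_step[OF q N K Bc(3) NKx s(4)] by blast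
    have car: "i \<in> carrier R" "z \<in> carrier R" "c \<in> carrier R" "k \<in> carrier R"
      using s t ideal_carr[OF I] ideal_carr[OF prod_ideal[OF qi N]] ideal_carr[OF qi] ideal_carr[OF K] by auto
    \<comment> \<open>The coefficient \<open>t s - c\<close> lies outside \<open>q\<close>, because
      \<open>t s\<close> is outside and \<open>c\<close> is inside. It acts as a unit and puts
      \<open>x\<close> into the span of the remaining generators.\<close>
    have "(t \<otimes> s \<ominus> c) \<otimes> x = t \<otimes> (s \<otimes> x) \<ominus> c \<otimes> x" using car s(1) t(1) Bc(2) by algebra
    also have "\<dots> = t \<otimes> i \<oplus> t \<otimes> z \<ominus> c \<otimes> x" unfolding s(5) using car t(1) by algebra
    also have "\<dots> = t \<otimes> i \<oplus> k" unfolding t(5) using car t(1) Bc(2) by algebra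
    also have "\<dots> \<in> ?K" using ideal_lmult[OF I s(3) t(1)] sum_ub1[OF I Bi] t(4) by (intro ideal_add[OF K]) auto
    finally have "(t \<otimes> s \<ominus> c) \<otimes> x \<in> ?K" .
    moreover have "t \<otimes> s \<ominus> c \<notin> q"
    proof
      assume "t \<otimes> s \<ominus> c \<in> q"
      then have "t \<otimes> s \<in> q" using ideal_cancel_minus[OF qi] t s by auto
      then show False using prime_mult_iff[OF q] s t by blast
    qed
    ultimately have "x \<in> sat q ?K" using s t car Bc by (auto simp: sat_def intro!: bexI[of _ "t \<otimes> s \<ominus> c"])
    then have "?K <+> PIdl x \<subseteq> sat q ?K" using PIdl_sum_least[OF sati[OF K] sat_ext[OF q K]] by blast
    then have "N \<subseteq> sat q ?K" using NKx sat_least[OF q, of "?K <+> PIdl x" ?K] by blast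
    then show ?case using insert by blast
  qed
  have "N \<subseteq> I <+> Idl A" using sum_ub2[OF I N] A by simp
  also have "\<dots> \<subseteq> sat q (I <+> Idl A)" using sat_ext[OF q add_ideals[OF I N]] A by simp
  finally show ?thesis using *[OF A(2) order_refl] by blast
qed

text \<open>Let \<open>D\<close> be the intersection of the saturated ideals. The trick with
  \<open>N = 1\<close>, for the saturation of \<open>I + q D\<close>, shows that \<open>D\<close>
  lies in that saturation, and Nakayama's lemma removes \<open>q D\<close>.\<close>

lemma krull_loc:
  assumes q: "primeideal q R" and I: "ideal I R"
    and z: "\<And>n. z \<in> sat q (I <+> ipow q n)"
  shows "z \<in> sat q I"
proof -
  note qi = primeideal_ideal[OF q]
  define D where "D = (\<Inter>n. sat q (I <+> ipow q n))"
  have D: "ideal D R" unfolding D_def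
    using i_Intersect[of "range (\<lambda>n. sat q (I <+> ipow q n))"] sat_ideal[OF q] add_ideals[OF I ipow_ideal[OF qi]] by auto
  have qD: "ideal (q \<cdot> D) R" by (rule prod_ideal[OF qi D])
  note IqD = add_ideals[OF I qD]
  let ?T = "sat q (I <+> q \<cdot> D)"
  have T: "ideal ?T R" by (rule sat_ideal[OF q IqD])
  have "y [^] (1::nat) \<otimes> d \<in> ?T" if "y \<in> q" "d \<in> D" for y d
    using that ideal_carr[OF qi] ideal_prod.prod[of y q d D R] sum_ub2[OF I qD] sat_ext[OF q IqD] by auto
  then obtain n where n: "\<And>z. z \<in> D \<Longrightarrow> z \<in> ?T <+> ipow q n \<Longrightarrow> z \<in> ?T"
    using max_ideal_trick[OF T D qi, of 1] by metis
  have "D \<subseteq> ?T"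
  proof
    fix z assume zD: "z \<in> D"
    then have "z \<in> sat q (I <+> ipow q n)" by (auto simp: D_def)
    then obtain s where s: "z \<in> carrier R" "s \<in> carrier R" "s \<notin> q" "s \<otimes> z \<in> I <+> ipow q n" by (auto simp: sat_def)
    have "I <+> ipow q n \<subseteq> ?T <+> ipow q n"
      using sum_ub1[OF I qD] sat_ext[OF q IqD] by (intro sum_mono) auto
    then have "s \<otimes> z \<in> ?T" using n[OF ideal_lmult[OF D zD s(2)]] s(4) by blast
    then show "z \<in> ?T" using sat_closed[OF q s(2,3,1)] by blast
  qed
  then have "D \<subseteq> sat q I" by (rule nakayama_loc[OF q D I])
  then show ?thesis using z by (auto simp: D_def)
qed

end

section \<open>Minimal primes and the principal ideal theorem\<close>

context cring
begin

text \<open>Let \<open>M\<close> be minimal in \<open>F\<close>. Every other member of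
  \<open>F\<close> has an element outside \<open>M\<close>, and a product of these with an element
  of \<open>I\<close> gives \<open>y\<close> in \<open>I\<close> that lies in all the others but not
  in \<open>M\<close>. If \<open>x\<close> in \<open>I\<close> avoids the others, then
  \<open>x\<close> or \<open>x + y\<close> avoids all of \<open>F\<close>.\<close>

lemma prime_avoidance:
  assumes "finite F" "\<And>P. P \<in> F \<Longrightarrow> primeideal P R" "ideal I R" "\<And>P. P \<in> F \<Longrightarrow> \<not> I \<subseteq> P"
  shows "\<exists>x\<in>I. \<forall>P\<in>F. x \<notin> P"
  using assms(1,2,4)
proof (induct F rule: finite_psubset_induct)
  case (psubset F)
  show ?case
  proof (cases "F = {}")
    case True
    then show ?thesis using ideal_zero[OF assms(3)] by auto
  next
    case False
    obtain M where M: "M \<in> F" "\<And>P. P \<in> F \<Longrightarrow> P \<subseteq> M \<Longrightarrow> M = P"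
      using finite_has_minimal[OF psubset(1) False] by auto
    have Mp: "primeideal M R" using psubset(3) M(1) by simp
    have G: "\<exists>y\<in>I. y \<notin> M \<and> (\<forall>P\<in>G. y \<in> P)"
      if "finite G" "\<And>P. P \<in> G \<Longrightarrow> primeideal P R \<and> \<not> P \<subseteq> M" for G
      using that
    proof (induct G)
      case empty
      then show ?case using psubset(4)[OF M(1)] by auto
    next
      case (insert P G)
      then obtain y where y: "y \<in> I" "y \<notin> M" "\<forall>P\<in>G. y \<in> P" by auto
      have P: "primeideal P R" using insert by simp
      obtain z where z: "z \<in> P" "z \<notin> M" using insert(4)[of P] by auto
      have zc: "z \<in> carrier R" "y \<in> carrier R"
        using z y ideal_carr[OF primeideal_ideal[OF P]] ideal_carr[OF assms(3)] by auto
      have "z \<otimes> y \<in> I" "z \<otimes> y \<notin> M" "z \<otimes> y \<in> P"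
        using y z zc prime_mult_iff[OF Mp zc] ideal_lmult[OF assms(3)] ideal_rmult[OF primeideal_ideal[OF P]] by auto
      moreover have "z \<otimes> y \<in> P'" if "P' \<in> G" for P'
        using ideal_lmult[OF primeideal_ideal, of P' y z] insert(4)[of P'] y(3) that zc by auto
      ultimately show ?case by (intro bexI[of _ "z \<otimes> y"]) auto
    qed
    have "F - {M} \<subset> F" using M(1) by auto
    then obtain x where x: "x \<in> I" "\<forall>P\<in>F - {M}. x \<notin> P"
      using psubset(2)[of "F - {M}"] psubset(3,4) by auto
    obtain y where y: "y \<in> I" "y \<notin> M" "\<forall>P\<in>F - {M}. y \<in> P"
      using G[of "F - {M}"] psubset(1,3) M(2) by auto
    have c: "x \<in> carrier R" "y \<in> carrier R" using x y ideal_carr[OF assms(3)] by auto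
    show ?thesis
    proof (cases "x \<in> M")
      case False then show ?thesis using x by auto
    next
      case True
      have "x \<oplus> y \<notin> M"
        using ideal_cancel_add[OF primeideal_ideal[OF Mp] _ True, of y] c y by auto
      moreover have "x \<oplus> y \<notin> P" if "P \<in> F - {M}" for P
      proof
        assume "x \<oplus> y \<in> P"
        then have "y \<oplus> x \<in> P" using c by (simp add: a_comm)
        then have "x \<in> P" using ideal_cancel_add[OF primeideal_ideal, of P y x] psubset(3)[of P] that y c by auto
        then show False using x that by auto
      qed
      ultimately show ?thesis using ideal_add[OF assms(3) x(1) y(1)] by auto
    qed
  qed
qed

definition min_over :: "'a set \<Rightarrow> 'a set \<Rightarrow> bool" where
  "min_over q I \<longleftrightarrow> primeideal q R \<and> I \<subseteq> q \<and> (\<forall>Q. primeideal Q R \<and> I \<subseteq> Q \<and> Q \<subseteq> q \<longrightarrow> Q = q)"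

end

context noetherian_cring
begin

lemma exists_min_over:
  assumes "primeideal q R" "ideal I R" "I \<subseteq> q"
  obtains P where "P \<subseteq> q" "min_over P I"
proof -
  obtain F where F: "finite F" "\<And>P. P \<in> F \<Longrightarrow> primeideal P R \<and> I \<subseteq> P"
    "\<And>Q. primeideal Q R \<Longrightarrow> I \<subseteq> Q \<Longrightarrow> \<exists>P\<in>F. P \<subseteq> Q"
    by (rule primes_above_finite[OF assms(2)]) (rule that)
  have "{P\<in>F. P \<subseteq> q} \<noteq> {}" using F(3)[OF assms(1,3)] by auto
  then obtain P where P: "P \<in> F" "P \<subseteq> q" "\<And>P'. P' \<in> F \<Longrightarrow> P' \<subseteq> q \<Longrightarrow> P' \<subseteq> P \<Longrightarrow> P = P'"
    using finite_has_minimal[of "{P\<in>F. P \<subseteq> q}"] F(1) by auto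
  have "Q = P" if Q: "primeideal Q R" "I \<subseteq> Q" "Q \<subseteq> P" for Q
  proof -
    obtain P' where "P' \<in> F" "P' \<subseteq> Q" using F(3)[OF Q(1,2)] by auto
    then have "P = P'" using P(2) P(3)[of P'] Q(3) by simp
    then show ?thesis using \<open>P' \<subseteq> Q\<close> Q(3) by simp
  qed
  then have "min_over P I" using F(2)[OF P(1)] by (simp add: min_over_def)
  then show ?thesis using that P(2) by simp
qed

text \<open>Otherwise the products \<open>s a^n\<close> with \<open>s\<close> outside
  \<open>q\<close> form a multiplicative set that misses \<open>I\<close>. A prime over
  \<open>I\<close> avoiding this set lies inside \<open>q\<close> and does not contain
  \<open>a\<close>, against minimality.\<close>

lemma min_over_pow:
  assumes q: "min_over q I" and I: "ideal I R" and a: "a \<in> q"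
  shows "\<exists>s\<in>carrier R - q. \<exists>n::nat. s \<otimes> a [^] n \<in> I"
proof (rule ccontr)
  assume n: "\<not> ?thesis"
  have qp: "primeideal q R" and Iq: "I \<subseteq> q" using q by (auto simp: min_over_def)
  have ac: "a \<in> carrier R" using a ideal_carr[OF primeideal_ideal[OF qp]] by simp
  let ?S = "{s \<otimes> a [^] n | s n. s \<in> carrier R - q \<and> n \<in> (UNIV :: nat set)}"
  have 1: "\<one> \<in> carrier R - q" using prime_one[OF qp] by simp
  obtain Q where Q: "primeideal Q R" "I \<subseteq> Q" "Q \<inter> ?S = {}"
  proof (rule exists_prime_avoiding[OF I, of ?S])
    show "?S \<subseteq> carrier R" using ac by auto
    have "\<one> = \<one> \<otimes> a [^] (0::nat)" by simp
    then show "\<one> \<in> ?S" using 1 by blast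
    show "I \<inter> ?S = {}" using n by auto
    fix u v assume "u \<in> ?S" "v \<in> ?S"
    then obtain s n t m where st: "s \<in> carrier R - q" "u = s \<otimes> a [^] (n::nat)" "t \<in> carrier R - q" "v = t \<otimes> a [^] (m::nat)"
      by auto
    have "u \<otimes> v = (s \<otimes> t) \<otimes> a [^] (n + m)" using st ac by (simp add: nat_pow_mult[symmetric] m_ac)
    moreover have "s \<otimes> t \<in> carrier R - q" using st prime_mult_iff[OF qp, of s t] by simp
    ultimately show "u \<otimes> v \<in> ?S" by blast
  qed
  have "Q \<subseteq> q"
  proof
    fix b assume b: "b \<in> Q"
    show "b \<in> q"
    proof (rule ccontr)
      assume "b \<notin> q"
      moreover have bc: "b \<in> carrier R" using b ideal_carr[OF primeideal_ideal[OF Q(1)]] by simp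
      moreover have "b = b \<otimes> a [^] (0::nat)" using bc by simp
      ultimately have "b \<in> ?S" by blast
      then show False using b Q(3) by auto
    qed
  qed
  then have "Q = q" using q Q by (simp add: min_over_def)
  moreover have "a = \<one> \<otimes> a [^] (1::nat)" using ac by simp
  then have "a \<in> ?S" using 1 by blast
  ultimately show False using a Q(3) by auto
qed

lemma min_over_ipow:
  assumes q: "min_over q I" and I: "ideal I R"
  shows "\<exists>n. ipow q n \<subseteq> sat q I"
proof -
  have qp: "primeideal q R" using q by (auto simp: min_over_def)
  have "\<exists>e::nat. y [^] e \<in> sat q I" if y: "y \<in> q" for y
    using min_over_pow[OF q I y] ideal_carr[OF primeideal_ideal[OF qp] y] by (auto simp: sat_def)
  then show ?thesis using pow_sub_of_elem_pow[OF primeideal_ideal[OF qp] sat_ideal[OF qp I]] by simp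
qed

text \<open>An element of \<open>J\<close> without a power in \<open>I\<close> would be avoided by
  some prime over \<open>I\<close>.\<close>

lemma ipow_sub_of_primes:
  assumes I: "ideal I R" and J: "ideal J R" and sub: "\<And>Q. primeideal Q R \<Longrightarrow> I \<subseteq> Q \<Longrightarrow> J \<subseteq> Q"
  shows "\<exists>n. ipow J n \<subseteq> I"
proof (rule pow_sub_of_elem_pow[OF J I], rule ccontr)
  fix y assume y: "y \<in> J" and n: "\<not> (\<exists>e::nat. y [^] e \<in> I)"
  have yc: "y \<in> carrier R" using y ideal_carr[OF J] by simp
  let ?S = "range (\<lambda>n::nat. y [^] n)"
  obtain Q where Q: "primeideal Q R" "I \<subseteq> Q" "Q \<inter> ?S = {}"
  proof (rule exists_prime_avoiding[OF I, of ?S])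
    show "?S \<subseteq> carrier R" using yc by auto
    have "\<one> = y [^] (0::nat)" by simp
    then show "\<one> \<in> ?S" by blast
    show "I \<inter> ?S = {}" using n by auto
    fix u v assume "u \<in> ?S" "v \<in> ?S"
    then show "u \<otimes> v \<in> ?S" using yc by (auto simp: nat_pow_mult)
  qed
  have "y = y [^] (1::nat)" using yc by simp
  then have "y \<in> ?S" by blast
  then show False using sub[OF Q(1,2)] y Q(3) by auto
qed

text \<open>The local ring at \<open>q\<close> modulo \<open>q^c\<close> is Artinian. Instead of
  counting lengths, let \<open>M\<close> be maximal among the saturated ideals below a chain that
  never becomes stationary, and adjoin to the whole chain an element \<open>x\<close> of the socle
  modulo \<open>M\<close>. The new chain lies over a larger ideal, so it is stationary, and this
  passes back to the old chain.\<close>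

lemma dcc_loc:
  assumes q: "primeideal q R"
    and J: "\<And>n. ideal (J n) R" "\<And>n. J (Suc n) \<subseteq> J n" "\<And>n. sat q (J n) \<subseteq> J n" "\<And>n. ipow q c \<subseteq> J n"
  shows "\<exists>n. \<forall>m\<ge>n. J m = J (n::nat)"
proof (rule ccontr)
  assume nst: "\<not> ?thesis"
  note qi = primeideal_ideal[OF q]
  define chain where "chain I J \<longleftrightarrow> (\<forall>n. ideal (J n) R \<and> J (Suc n) \<subseteq> J n \<and> sat q (J n) \<subseteq> J n \<and> I \<subseteq> J n) \<and>
      \<not> (\<exists>n. \<forall>m\<ge>n. J m = J (n::nat))" for I and J :: "nat \<Rightarrow> 'a set"
  define C where "C = {I. ideal I R \<and> sat q I \<subseteq> I \<and> ipow q c \<subseteq> I \<and> (\<exists>J. chain I J)}"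
  let ?I0 = "sat q (ipow q c)"
  have satsat: "sat q (sat q I) \<subseteq> sat q I" for I using sat_least[OF q, of "sat q I" I] by simp
  have "?I0 \<subseteq> J n" for n using sat_mono[OF J(4), of q n] J(3)[of n] by simp
  then have "chain ?I0 J" unfolding chain_def using J nst by simp
  then have "?I0 \<in> C" unfolding C_def
    using sat_ideal[OF q ipow_ideal[OF qi]] sat_ext[OF q ipow_ideal[OF qi]] satsat by auto
  then have "C \<noteq> {}" by auto
  then obtain M where MC: "M \<in> C" and max: "\<And>I. I \<in> C \<Longrightarrow> M \<subseteq> I \<Longrightarrow> I = M"
    by (rule noeth_max) (auto simp: C_def)
  obtain L where M: "ideal M R" "sat q M \<subseteq> M" "ipow q c \<subseteq> M" and ch: "chain M L"
    using MC by (auto simp: C_def)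
  have L: "\<And>n. ideal (L n) R" "\<And>n. L (Suc n) \<subseteq> L n" "\<And>n. sat q (L n) \<subseteq> L n" "\<And>n. M \<subseteq> L n"
    and Ln: "\<not> (\<exists>n. \<forall>m\<ge>n. L m = L n)" using ch by (auto simp: chain_def)
  have Lmono: "L m \<subseteq> L n" if "n \<le> m" for n m using lift_Suc_antimono_le[of L, OF L(2) that] .
  have Mne: "M \<noteq> carrier R"
  proof
    assume "M = carrier R"
    then have "L n = carrier R" for n using L(4)[of n] ideal_sub[OF L(1)[of n]] by auto
    then show False using Ln by auto
  qed
  \<comment> \<open>The last power of \<open>q\<close> that is not inside \<open>M\<close> supplies
    \<open>x\<close> outside \<open>M\<close> with \<open>q x\<close> inside
    \<open>M\<close>.\<close>
  define e where "e = (LEAST e. ipow q e \<subseteq> M)"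
  have e: "ipow q e \<subseteq> M" unfolding e_def using M(3) by (rule LeastI)
  have "e \<noteq> 0" using e Mne ideal_sub[OF M(1)] by (auto simp: ipow_0)
  then obtain d where d: "e = Suc d" by (cases e) auto
  have "\<not> ipow q d \<subseteq> M" using not_less_Least[of d "\<lambda>e. ipow q e \<subseteq> M"] d e_def by auto
  then obtain x where x: "x \<in> ipow q d" "x \<notin> M" by auto
  have xc: "x \<in> carrier R" using x ideal_carr[OF ipow_ideal[OF qi]] by auto
  have soc: "a \<otimes> x \<in> M" if "a \<in> q" for a
  proof -
    have "x \<otimes> a \<in> ipow q e" using x that by (auto simp: d ipow_Suc intro: ideal_prod.prod)
    then show ?thesis using e xc ideal_carr[OF qi that] by (auto simp: m_comm)
  qed
  have Mx: "ideal (M <+> PIdl x) R" by (rule PIdl_sum_ideal[OF M(1) xc])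
  have Lx: "ideal (L n <+> PIdl x) R" for n by (rule PIdl_sum_ideal[OF L(1) xc])
  define M' where "M' = sat q (M <+> PIdl x)"
  define L' where "L' n = sat q (L n <+> PIdl x)" for n
  have MM': "M \<subseteq> M'" using PIdl_sum_sub[OF M(1) xc] sat_ext[OF q Mx] by (simp add: M'_def)
  have "x \<in> M'" using PIdl_sum_mem[OF M(1) xc] sat_ext[OF q Mx] by (auto simp: M'_def)
  then have M'n: "M' \<notin> C" using max[of M'] MM' x by auto
  have "\<exists>n. \<forall>m\<ge>n. L' m = L' n"
  proof (rule ccontr)
    assume "\<not> ?thesis"
    moreover have "ideal (L' n) R" "sat q (L' n) \<subseteq> L' n" for n
      unfolding L'_def by (rule sat_ideal[OF q Lx], rule satsat)
    moreover have "L' (Suc n) \<subseteq> L' n" "M' \<subseteq> L' n" for n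
      unfolding L'_def M'_def by (intro sat_mono sum_mono L(2) L(4) order_refl)+
    ultimately have "chain M' L'" unfolding chain_def by auto
    then have "M' \<in> C" unfolding C_def using sat_ideal[OF q Mx] satsat M(3) MM' by (auto simp: M'_def)
    then show False using M'n by simp
  qed
  then obtain n0 where n0: "\<And>m. m \<ge> n0 \<Longrightarrow> L' m = L' n0" by auto
  show False
  proof (cases "\<forall>n. x \<in> L n")
    case True
    have "L' n = L n" for n
    proof
      have "L n <+> PIdl x \<subseteq> L n" using PIdl_sum_least[OF L(1) order_refl] True by simp
      then show "L' n \<subseteq> L n" using sat_mono[of _ "L n" q] L(3)[of n] unfolding L'_def by (meson order_trans)
      show "L n \<subseteq> L' n" using PIdl_sum_sub[OF L(1) xc] sat_ext[OF q Lx] unfolding L'_def by (meson order_trans)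
    qed
    then have "L m = L n0" if "m \<ge> n0" for m using n0[OF that] by simp
    then have "\<forall>m\<ge>n0. L m = L n0" by blast
    then have "\<exists>n. \<forall>m\<ge>n. L m = L n" by (rule exI)
    with Ln show False by (rule notE)
  next
    case False
    then obtain n1 where n1: "x \<notin> L n1" by auto
    let ?n = "max n0 n1"
    have xn: "x \<notin> L ?n" using n1 Lmono[of n1 ?n] by auto
    have "L m = L ?n" if m: "m \<ge> ?n" for m
    proof
      show "L m \<subseteq> L ?n" by (rule Lmono[OF m])
      show "L ?n \<subseteq> L m"
      proof
        fix z assume z: "z \<in> L ?n"
        have zc: "z \<in> carrier R" using z ideal_carr[OF L(1)] by auto
        have "L' ?n = L' m" using n0[of ?n] n0[of m] m by simp
        moreover have "z \<in> L' ?n" using z PIdl_sum_sub[OF L(1) xc, of ?n] sat_ext[OF q Lx, of ?n] by (auto simp: L'_def)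
        ultimately have "z \<in> L' m" by simp
        then obtain s j r where s: "s \<in> carrier R" "s \<notin> q" "j \<in> L m" "r \<in> carrier R" "s \<otimes> z = j \<oplus> r \<otimes> x"
          by (auto simp: L'_def sat_def mem_sum_PIdl)
        have jc: "j \<in> carrier R" using s ideal_carr[OF L(1)] by auto
        \<comment> \<open>If \<open>r\<close> were outside \<open>q\<close>, then \<open>x\<close>
          would lie in the saturated ideal \<open>L ?n\<close>, contrary to the choice of
          \<open>?n\<close>. So \<open>r\<close> is in \<open>q\<close>, and \<open>r x\<close>
          already lies in \<open>M\<close>.\<close>
        have "r \<in> q"
        proof (rule ccontr)
          assume r: "r \<notin> q"
          have "j \<oplus> r \<otimes> x \<in> L ?n" using ideal_lmult[OF L(1) z s(1)] s(5) by simp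
          then have "r \<otimes> x \<in> L ?n" using ideal_cancel_add[OF L(1)] Lmono[OF m] s(3,4) xc by auto
          then have "r \<otimes> x \<in> sat q (L ?n)" using sat_ext[OF q L(1)] by auto
          then show False using sat_closed[OF q s(4) r xc] L(3)[of ?n] xn by auto
        qed
        then have "s \<otimes> z \<in> L m" unfolding s(5) using soc[of r] L(4)[of m] by (intro ideal_add[OF L(1) s(3)]) auto
        then have "z \<in> sat q (L m)" using s(1,2) zc unfolding sat_def by blast
        then show "z \<in> L m" using L(3) by auto
      qed
    qed
    then have "\<exists>n. \<forall>m\<ge>n. L m = L n" by blast
    with Ln show False by (rule notE)
  qed
qed

text \<open>The principal ideal theorem in \<open>R/K\<close>, by Krull's argument.
  \<open>S n\<close> is the \<open>n\<close>-th symbolic power of \<open>Q\<close> modulo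
  \<open>K\<close>. The ideals \<open>S n + (x)\<close>, localized at \<open>q\<close>, become
  stationary because \<open>q\<close> is locally nilpotent modulo \<open>K + (x)\<close>. Two uses
  of Nakayama's lemma then make a power of \<open>Q\<close> vanish locally, which forces
  \<open>Q\<close> into \<open>K\<close>.\<close>

theorem krull_height_one:
  assumes K: "primeideal K R" and Q: "primeideal Q R" and KQ: "K \<subset> Q" and Qq: "Q \<subset> q"
    and x: "x \<in> carrier R" and min: "min_over q (K <+> PIdl x)"
  shows False
proof -
  have q: "primeideal q R" and subq: "K <+> PIdl x \<subseteq> q" using min by (auto simp: min_over_def)
  note Ki = primeideal_ideal[OF K] and Qi = primeideal_ideal[OF Q] and qi = primeideal_ideal[OF q]
  note Kx = PIdl_sum_ideal[OF Ki x]
  have xq: "x \<in> q" using subq PIdl_sum_mem[OF Ki x] by auto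
  have xQ: "x \<notin> Q"
  proof
    assume "x \<in> Q"
    then have "K <+> PIdl x \<subseteq> Q" using PIdl_sum_least[OF Qi] KQ by simp
    then show False using min Q Qq by (auto simp: min_over_def)
  qed
  obtain c where c: "ipow q c \<subseteq> sat q (K <+> PIdl x)" using min_over_ipow[OF min Kx] by auto
  define S where "S n = sat Q (K <+> ipow Q n)" for n
  define J where "J n = sat q (S n <+> PIdl x)" for n
  note KQn = add_ideals[OF Ki ipow_ideal[OF Qi]]
  have Si: "ideal (S n) R" for n unfolding S_def by (rule sat_ideal[OF Q KQn])
  have Sx: "ideal (S n <+> PIdl x) R" for n by (rule PIdl_sum_ideal[OF Si x])
  have Sdec: "S (Suc n) \<subseteq> S n" for n
    unfolding S_def by (intro sat_mono sum_mono ipow_antimono[OF Qi]) auto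
  have KS: "K \<subseteq> S n" for n
    using sum_ub1[OF Ki ipow_ideal[OF Qi], of n] sat_ext[OF Q KQn, of n] unfolding S_def by (rule order_trans)
  have "\<exists>n. \<forall>m\<ge>n. J m = J n"
  proof (rule dcc_loc[OF q])
    fix n
    show "ideal (J n) R" unfolding J_def by (rule sat_ideal[OF q Sx])
    show "J (Suc n) \<subseteq> J n" unfolding J_def by (intro sat_mono sum_mono Sdec) auto
    show "sat q (J n) \<subseteq> J n" unfolding J_def by (rule sat_least[OF q]) simp
    show "ipow q c \<subseteq> J n" using c sat_mono[OF sum_mono[OF KS[of n] order_refl], of q "PIdl x"] unfolding J_def by (rule order_trans)
  qed
  then obtain n where n: "\<And>m. m \<ge> n \<Longrightarrow> J m = J n" by auto
  \<comment> \<open>Since \<open>x\<close> is outside \<open>Q\<close> and \<open>S n\<close> is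
    saturated at \<open>Q\<close>, a multiple \<open>r x\<close> in \<open>S n\<close> has
    \<open>r\<close> in \<open>S n\<close>. Hence \<open>r x\<close> lies in \<open>q S n\<close>,
    and Nakayama's lemma at \<open>q\<close> applies.\<close>
  have "S n \<subseteq> sat q (S (Suc n) <+> q \<cdot> S n)"
  proof
    fix a assume a: "a \<in> S n"
    have ac: "a \<in> carrier R" using a ideal_carr[OF Si] by auto
    have "a \<in> J n" using a PIdl_sum_sub[OF Si x, of n] sat_ext[OF q Sx, of n] by (auto simp: J_def)
    then have "a \<in> J (Suc n)" using n[of "Suc n"] by simp
    then obtain s b r where s: "s \<in> carrier R" "s \<notin> q" "b \<in> S (Suc n)" "r \<in> carrier R" "s \<otimes> a = b \<oplus> r \<otimes> x"
      by (auto simp: J_def sat_def mem_sum_PIdl)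
    have bS: "b \<in> S n" using s Sdec by auto
    have "b \<oplus> r \<otimes> x \<in> S n" using ideal_lmult[OF Si a s(1)] s(5) by simp
    then have "r \<otimes> x \<in> S n" using ideal_cancel_add[OF Si _ bS] s(4) x by simp
    then have "x \<otimes> r \<in> sat Q (K <+> ipow Q n)" using s(4) x by (simp add: m_comm S_def)
    then have "r \<in> S n" unfolding S_def using sat_closed[OF Q x xQ s(4)] by simp
    then have "x \<otimes> r \<in> q \<cdot> S n" using xq by (auto intro: ideal_prod.prod)
    then have "s \<otimes> a \<in> S (Suc n) <+> q \<cdot> S n" using s x by (auto simp: mem_sum m_comm)
    then show "a \<in> sat q (S (Suc n) <+> q \<cdot> S n)" using s(1,2) ac unfolding sat_def by blast
  qed
  then have "S n \<subseteq> sat q (S (Suc n))" by (rule nakayama_loc[OF q Si Si])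
  moreover have "sat q (S (Suc n)) \<subseteq> S (Suc n)"
  proof
    fix a assume "a \<in> sat q (S (Suc n))"
    then obtain s where s: "a \<in> carrier R" "s \<in> carrier R" "s \<notin> q" "s \<otimes> a \<in> S (Suc n)" by (auto simp: sat_def)
    then show "a \<in> S (Suc n)" using sat_closed[OF Q s(2) _ s(1)] Qq unfolding S_def by auto
  qed
  \<comment> \<open>\<open>S (Suc n)\<close> is saturated at \<open>Q\<close>, hence at the larger
    prime \<open>q\<close>. The second use of Nakayama's lemma is at \<open>Q\<close>, for the ideal
    \<open>Q^n\<close>.\<close>
  ultimately have "S n \<subseteq> sat Q (K <+> Q \<cdot> ipow Q n)"
    by (simp add: S_def ipow_Suc2[OF Qi])
  moreover have "ipow Q n \<subseteq> S n"
    using sum_ub2[OF Ki ipow_ideal[OF Qi], of n] sat_ext[OF Q KQn, of n] unfolding S_def by (rule order_trans)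
  ultimately have "ipow Q n \<subseteq> sat Q K" by (intro nakayama_loc[OF Q ipow_ideal[OF Qi] Ki]) simp
  moreover have "sat Q K \<subseteq> K" using prime_mult_iff[OF K] KQ by (auto simp: sat_def)
  ultimately have "Q \<subseteq> K" using prime_ipow[OF K Qi, of n] by simp
  then show False using KQ by simp
qed

text \<open>Supplies elements \<open>w\<close> such that the primes minimal over
  \<open>K + (w)\<close> avoid a given \<open>t\<close>. If such a prime \<open>q'\<close> contained
  \<open>t\<close>, it would contain one of the finitely many primes \<open>P\<close> chosen over
  \<open>K + (t)\<close>; as \<open>w\<close> is outside \<open>P\<close>, this places
  \<open>P\<close> strictly between \<open>K\<close> and \<open>q'\<close>, against the principal
  ideal theorem. In the same way \<open>Q\<close> rules out \<open>q' = q\<close>.\<close>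

lemma finite_bad_primes:
  assumes K: "primeideal K R" and Q: "primeideal Q R" and q: "primeideal q R" and KQ: "K \<subset> Q" and Qq: "Q \<subset> q"
    and t: "t \<in> carrier R" "t \<notin> K"
  obtains F where "finite F" "\<And>P. P \<in> F \<Longrightarrow> primeideal P R \<and> P \<subset> q"
    "\<And>w q'. w \<in> q \<Longrightarrow> (\<And>P. P \<in> F \<Longrightarrow> w \<notin> P) \<Longrightarrow> q' \<subseteq> q \<Longrightarrow> min_over q' (K <+> PIdl w) \<Longrightarrow>
        t \<notin> q' \<and> q' \<subset> q \<and> K \<subset> q'"
proof -
  note Ki = primeideal_ideal[OF K]
  obtain F where F: "finite F" "\<And>P. P \<in> F \<Longrightarrow> primeideal P R \<and> K <+> PIdl t \<subseteq> P"
    "\<And>Q. primeideal Q R \<Longrightarrow> K <+> PIdl t \<subseteq> Q \<Longrightarrow> \<exists>P\<in>F. P \<subseteq> Q"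
    by (rule primes_above_finite[OF PIdl_sum_ideal[OF Ki t(1)]]) (rule that)
  show ?thesis
  proof (rule that[of "insert K {P \<in> F. P \<subset> q}"])
    show "finite (insert K {P \<in> F. P \<subset> q})" using F(1) by simp
    show "primeideal P R \<and> P \<subset> q" if "P \<in> insert K {P \<in> F. P \<subset> q}" for P
      using that F(2)[of P] K KQ Qq by auto
    fix w q' assume w: "w \<in> q" "\<And>P. P \<in> insert K {P \<in> F. P \<subset> q} \<Longrightarrow> w \<notin> P" and q': "q' \<subseteq> q" "min_over q' (K <+> PIdl w)"
    have wc: "w \<in> carrier R" using w(1) ideal_carr[OF primeideal_ideal[OF q]] by auto
    have q'p: "primeideal q' R" and sub: "K <+> PIdl w \<subseteq> q'" using q'(2) by (auto simp: min_over_def)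
    have "q' \<noteq> q" using krull_height_one[OF K Q KQ Qq wc] q'(2) by auto
    then have 1: "q' \<subset> q" using q' by auto
    have Kq': "K \<subseteq> q'" "w \<in> q'" using sub PIdl_sum_sub[OF Ki wc] PIdl_sum_mem[OF Ki wc] by auto
    then have 2: "K \<subset> q'" using w(2)[of K] by auto
    have "t \<notin> q'"
    proof
      assume "t \<in> q'"
      then have "K <+> PIdl t \<subseteq> q'" using PIdl_sum_least[OF primeideal_ideal[OF q'p] Kq'(1)] by simp
      then obtain P where P: "P \<in> F" "P \<subseteq> q'" using F(3)[OF q'p] by auto
      then have "P \<noteq> q'" using w(2)[of P] 1 Kq'(2) by auto
      have Pp: "primeideal P R" "K <+> PIdl t \<subseteq> P" using F(2)[OF P(1)] by auto
      then have "K \<subset> P" using PIdl_sum_sub[OF Ki t(1)] PIdl_sum_mem[OF Ki t(1)] t(2) by auto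
      then show False using krull_height_one[OF K Pp(1) _ _ wc q'(2)] P(2) \<open>P \<noteq> q'\<close> by auto
    qed
    then show "t \<notin> q' \<and> q' \<subset> q \<and> K \<subset> q'" using 1 2 by simp
  qed
qed

end

section \<open>Local rings and their completions\<close>

locale noeth_local = noetherian_cring +
  fixes m
  assumes maximal: "maximalideal m R" and unique_maximal: "maximalideal M R \<Longrightarrow> M = m"
begin

lemma m_ideal: "ideal m R"
  using maximal by (rule maximalideal.axioms(1))

lemma m_prime: "primeideal m R"
  using maximalideal_prime[OF maximal] .

lemma ideal_sub_m:
  assumes "ideal I R" "\<one> \<notin> I" shows "I \<subseteq> m"
proof -
  let ?C = "{J. ideal J R \<and> I \<subseteq> J \<and> \<one> \<notin> J}"
  have "?C \<noteq> {}" using assms by auto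
  then obtain M where M: "M \<in> ?C" and max: "\<And>J. J \<in> ?C \<Longrightarrow> M \<subseteq> J \<Longrightarrow> J = M"
    by (rule noeth_max) auto
  have "maximalideal M R"
  proof (rule maximalidealI)
    show "ideal M R" using M by simp
    show "carrier R \<noteq> M" using M by auto
    fix J assume J: "ideal J R" "M \<subseteq> J" "J \<subseteq> carrier R"
    show "J = M \<or> J = carrier R"
    proof (cases "\<one> \<in> J")
      case True then show ?thesis using ideal.one_imp_carrier[OF J(1)] by simp
    next
      case False then show ?thesis using max[of J] J M by auto
    qed
  qed
  then show ?thesis using unique_maximal[of M] M by auto
qed

lemma unit_of_notin_m:
  assumes "s \<in> carrier R" "s \<notin> m" shows "\<exists>t\<in>carrier R. t \<otimes> s = \<one>"
proof -
  have "\<one> \<in> PIdl s"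
    using ideal_sub_m[OF cgenideal_ideal[OF assms(1)]] cgenideal_self[OF assms(1)] assms(2) by auto
  then show ?thesis by (auto simp: mem_PIdl)
qed

text \<open>Elements outside \<open>m\<close> are units, so saturation at \<open>m\<close> changes
  nothing, and the local theorems specialize to statements about ideals of \<open>R\<close>.\<close>

lemma sat_m: "ideal I R \<Longrightarrow> sat m I = I"
proof
  assume I: "ideal I R"
  show "I \<subseteq> sat m I" by (rule sat_ext[OF m_prime I])
  show "sat m I \<subseteq> I"
  proof
    fix a assume "a \<in> sat m I"
    then obtain s where s: "a \<in> carrier R" "s \<in> carrier R" "s \<notin> m" "s \<otimes> a \<in> I" by (auto simp: sat_def)
    obtain t where t: "t \<in> carrier R" "t \<otimes> s = \<one>" using unit_of_notin_m s by auto
    have "a = t \<otimes> (s \<otimes> a)" using s t by (simp add: m_assoc[symmetric])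
    then show "a \<in> I" using ideal_lmult[OF I s(4) t(1)] by simp
  qed
qed

lemma prime_sub_m: "primeideal P R \<Longrightarrow> P \<subseteq> m"
  using ideal_sub_m[OF primeideal_ideal prime_one] .

lemma krull_local: "ideal I R \<Longrightarrow> (\<And>n. z \<in> I <+> ipow m n) \<Longrightarrow> z \<in> I"
  using krull_loc[OF m_prime, of I z] sat_m[of I] sat_m[OF add_ideals[OF _ ipow_ideal[OF m_ideal]], of I] by simp

lemma nakayama_local: "ideal N R \<Longrightarrow> ideal I R \<Longrightarrow> N \<subseteq> I <+> m \<cdot> N \<Longrightarrow> N \<subseteq> I"
  using nakayama_loc[OF m_prime, of N I] sat_m[of I] sat_m[OF add_ideals[OF _ prod_ideal[OF m_ideal]], of I N] by simp

end

context cring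
begin

section \<open>Linear combinations of finitely many generators\<close>

lemma add_minus_cancel:
  assumes "a \<in> carrier R" "b \<in> carrier R" "c \<in> carrier R"
  shows "(a \<oplus> b) \<ominus> (b \<oplus> c) = a \<ominus> c"
  using assms by algebra

lemma add_minus_self:
  assumes "a \<in> carrier R" "b \<in> carrier R" shows "b \<oplus> (a \<ominus> b) = a"
  using assms by algebra

lemma lincomb_ideal:
  assumes "finite A" "g \<in> A \<rightarrow> carrier R" "ideal J R"
  shows "ideal {\<Oplus>a\<in>A. c a \<otimes> g a | c. c \<in> A \<rightarrow> J} R" (is "ideal ?L R")
proof (rule ideal_crit)
  note car = ideal_carr[OF assms(3)]
  have cc: "c \<in> A \<rightarrow> J \<Longrightarrow> (\<lambda>a. c a \<otimes> g a) \<in> A \<rightarrow> carrier R" for c using assms(2) car by (auto simp: Pi_iff)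
  show "?L \<subseteq> carrier R" using finsum_closed cc by auto
  have "(\<Oplus>a\<in>A. \<zero> \<otimes> g a) = (\<Oplus>a\<in>A. \<zero>)" using assms(2) by (intro finsum_cong') (auto simp: Pi_iff)
  then have "\<zero> = (\<Oplus>a\<in>A. (\<lambda>a. \<zero>) a \<otimes> g a)" by simp
  moreover have "(\<lambda>a. \<zero>) \<in> A \<rightarrow> J" using ideal_zero[OF assms(3)] by auto
  ultimately show "\<zero> \<in> ?L" by (intro CollectI exI[of _ "\<lambda>a. \<zero>"] conjI) auto
  fix u assume "u \<in> ?L"
  then obtain c where c: "c \<in> A \<rightarrow> J" "u = (\<Oplus>a\<in>A. c a \<otimes> g a)" by auto
  { fix v assume "v \<in> ?L"
    then obtain d where d: "d \<in> A \<rightarrow> J" "v = (\<Oplus>a\<in>A. d a \<otimes> g a)" by auto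
    have "u \<oplus> v = (\<Oplus>a\<in>A. c a \<otimes> g a \<oplus> d a \<otimes> g a)"
      using c d finsum_addf[OF cc[OF c(1)] cc[OF d(1)]] by simp
    also have "\<dots> = (\<Oplus>a\<in>A. (c a \<oplus> d a) \<otimes> g a)"
      using c d car assms(2) by (intro finsum_cong') (auto simp: Pi_iff l_distr)
    finally have "u \<oplus> v = (\<Oplus>a\<in>A. (\<lambda>a. c a \<oplus> d a) a \<otimes> g a)" .
    moreover have "(\<lambda>a. c a \<oplus> d a) \<in> A \<rightarrow> J" using c d ideal_add[OF assms(3)] by (auto simp: Pi_iff)
    ultimately show "u \<oplus> v \<in> ?L" by (intro CollectI exI[of _ "\<lambda>a. c a \<oplus> d a"] conjI) }
  { fix r assume r: "r \<in> carrier R"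
    have "r \<otimes> u = (\<Oplus>a\<in>A. r \<otimes> (c a \<otimes> g a))" using finsum_rdistr[OF assms(1) r cc[OF c(1)]] c by simp
    also have "\<dots> = (\<Oplus>a\<in>A. (r \<otimes> c a) \<otimes> g a)"
      using c car assms(2) r by (intro finsum_cong') (auto simp: Pi_iff m_assoc)
    finally have "r \<otimes> u = (\<Oplus>a\<in>A. (\<lambda>a. r \<otimes> c a) a \<otimes> g a)" .
    moreover have "(\<lambda>a. r \<otimes> c a) \<in> A \<rightarrow> J" using c r ideal_lmult[OF assms(3)] by (auto simp: Pi_iff)
    ultimately show "r \<otimes> u \<in> ?L" by (intro CollectI exI[of _ "\<lambda>a. r \<otimes> c a"] conjI) }
qed

lemma lincomb_single:
  assumes "finite A" "A \<subseteq> carrier R" "ideal J R" "j \<in> J" "b \<in> A"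
  shows "j \<otimes> b = (\<Oplus>a\<in>A. (if a = b then j else \<zero>) \<otimes> a)"
proof -
  have "(\<Oplus>a\<in>A. (if a = b then j else \<zero>) \<otimes> a) = (\<Oplus>a\<in>A. (if b = a then j \<otimes> a else \<zero>))"
    using assms(2,4,5) ideal_carr[OF assms(3)] by (intro finsum_cong') (auto simp: Pi_iff subset_eq)
  also have "\<dots> = j \<otimes> b"
    using finsum_singleton[OF assms(5,1), of "\<lambda>a. j \<otimes> a"] assms(2,4) ideal_carr[OF assms(3)] by (auto simp: subset_eq)
  finally show ?thesis by simp
qed

text \<open>That the coefficients lie in \<open>J\<close> is the point: for \<open>J\<close> a power
  of \<open>m\<close>, series of such combinations converge in the completion.\<close>

lemma prod_Idl_lincomb:
  assumes A: "finite A" "A \<subseteq> carrier R" and J: "ideal J R" and z: "z \<in> J \<cdot> (Idl A)"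
  obtains c where "c \<in> A \<rightarrow> J" "z = (\<Oplus>a\<in>A. c a \<otimes> a)"
proof -
  let ?L = "{\<Oplus>a\<in>A. c a \<otimes> a | c. c \<in> A \<rightarrow> J}"
  have L: "ideal ?L R" using lincomb_ideal[of A "\<lambda>a. a" J] A J by auto
  have b: "j \<otimes> b \<in> ?L" if jb: "j \<in> J" "b \<in> Idl A" for j b
  proof -
    let ?B = "{b \<in> carrier R. j \<otimes> b \<in> ?L}"
    have jc: "j \<in> carrier R" using jb ideal_carr[OF J] by simp
    have "ideal ?B R"
    proof (rule ideal_crit)
      show "?B \<subseteq> carrier R" by auto
      show "\<zero> \<in> ?B" using ideal_zero[OF L] jc by simp
      fix a assume a: "a \<in> ?B"
      { fix b assume "b \<in> ?B" then show "a \<oplus> b \<in> ?B" using a jc ideal_add[OF L, of "j \<otimes> a" "j \<otimes> b"] by (simp add: r_distr) }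
      { fix r assume "r \<in> carrier R" then show "r \<otimes> a \<in> ?B"
          using a jc ideal_lmult[OF L, of "j \<otimes> a" r] by (simp add: m_lcomm) }
    qed
    moreover have "A \<subseteq> ?B"
    proof
      fix b assume bA: "b \<in> A"
      have "(\<lambda>a. if a = b then j else \<zero>) \<in> A \<rightarrow> J" using jb ideal_zero[OF J] by auto
      then have "j \<otimes> b \<in> ?L" using lincomb_single[OF A J jb(1) bA]
        by (intro CollectI exI[of _ "\<lambda>a. if a = b then j else \<zero>"] conjI)
      then show "b \<in> ?B" using bA A(2) by auto
    qed
    ultimately have "Idl A \<subseteq> ?B" by (rule genideal_minimal)
    then show ?thesis using jb(2) by auto
  qed
  have "J \<cdot> (Idl A) \<subseteq> ?L" by (rule prod_least[OF L b])
  then show ?thesis using z that by auto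
qed

lemma Idl_lincomb:
  assumes A: "finite A" "A \<subseteq> carrier R" and z: "z \<in> Idl A"
  obtains c where "c \<in> A \<rightarrow> carrier R" "z = (\<Oplus>a\<in>A. c a \<otimes> a)"
proof -
  have "Idl A = carrier R \<cdot> (Idl A)"
    using ideal_prod_one[OF genideal_ideal[OF A(2)]] ideal_prod_commute[OF genideal_ideal[OF A(2)] oneideal] by simp
  then show ?thesis using prod_Idl_lincomb[OF A oneideal] z that by metis
qed

lemma lincomb_in_ideal:
  assumes "ideal I R" "\<And>a. a \<in> A \<Longrightarrow> f a \<in> I" shows "(\<Oplus>a\<in>A. f a) \<in> I"
  using assms(2)
proof (induct A rule: infinite_finite_induct)
  case (infinite A) then show ?case using ideal_zero[OF assms(1)] by (simp add: finsum_infinite)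
next
  case empty then show ?case using ideal_zero[OF assms(1)] by simp
next
  case (insert x A)
  then show ?case using ideal_add[OF assms(1)] ideal_carr[OF assms(1)] by (subst finsum_insert) (auto simp: Pi_iff)
qed

end

text \<open>\<open>S\<close> is the completion of \<open>R\<close>, and \<open>F n\<close> is the kernel of its projection to \<open>R/m\<^sup>n\<close>.\<close>

locale completion_pair = R: noeth_local R m + S: cring S for R (structure) and m and S (structure) +
  fixes h and F :: "nat \<Rightarrow> 'c set"
  assumes h_hom: "h \<in> ring_hom R S"
    and F_ideal: "ideal (F n) S"
    and F_0: "F 0 = carrier S"
    and F_Suc: "F (Suc n) \<subseteq> F n"
    and F_mult: "a \<in> F i \<Longrightarrow> b \<in> F j \<Longrightarrow> a \<otimes>\<^bsub>S\<^esub> b \<in> F (i + j)"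
    and F_sep: "z \<in> carrier S \<Longrightarrow> (\<And>n. z \<in> F n) \<Longrightarrow> z = \<zero>\<^bsub>S\<^esub>"
    and dense: "s \<in> carrier S \<Longrightarrow> \<exists>r\<in>carrier R. s \<ominus>\<^bsub>S\<^esub> h r \<in> F n"
    and F_R: "r \<in> carrier R \<Longrightarrow> h r \<in> F n \<longleftrightarrow> r \<in> R.ipow m n"
    and complete: "(\<And>n. u n \<in> carrier S) \<Longrightarrow> (\<And>n. u (Suc n) \<ominus>\<^bsub>S\<^esub> u n \<in> F n) \<Longrightarrow>
      \<exists>t\<in>carrier S. \<forall>n. t \<ominus>\<^bsub>S\<^esub> u n \<in> F n"
begin

lemma h_closed: "r \<in> carrier R \<Longrightarrow> h r \<in> carrier S"
  using ring_hom_closed[OF h_hom] .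

lemma h_mult: "a \<in> carrier R \<Longrightarrow> b \<in> carrier R \<Longrightarrow> h (a \<otimes> b) = h a \<otimes>\<^bsub>S\<^esub> h b"
  using ring_hom_mult[OF h_hom] .

lemma h_add: "a \<in> carrier R \<Longrightarrow> b \<in> carrier R \<Longrightarrow> h (a \<oplus> b) = h a \<oplus>\<^bsub>S\<^esub> h b"
  using ring_hom_add[OF h_hom] .

lemma h_one: "h \<one> = \<one>\<^bsub>S\<^esub>"
  using ring_hom_one[OF h_hom] .

sublocale hom: ring_hom_cring R S h
  by unfold_locales (rule h_hom)

lemma h_minus: "a \<in> carrier R \<Longrightarrow> b \<in> carrier R \<Longrightarrow> h (a \<ominus> b) = h a \<ominus>\<^bsub>S\<^esub> h b"
  by (simp add: a_minus_def)

lemma h_lincomb: "finite A \<Longrightarrow> f \<in> A \<rightarrow> carrier R \<Longrightarrow> h (\<Oplus>a\<in>A. f a) = (\<Oplus>\<^bsub>S\<^esub>a\<in>A. h (f a))"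
  by (simp add: hom.hom_finsum comp_def)

lemma F_antimono: "i \<le> j \<Longrightarrow> F j \<subseteq> F i"
  using lift_Suc_antimono_le[of F, OF F_Suc] .

lemma F_carr: "z \<in> F n \<Longrightarrow> z \<in> carrier S"
  by (rule S.ideal_carr[OF F_ideal])

lemma F_pow: "a \<in> F 1 \<Longrightarrow> a [^]\<^bsub>S\<^esub> n \<in> F n"
proof (induct n)
  case 0 then show ?case by (simp add: F_0)
next
  case (Suc n) then show ?case using F_mult[of "a [^]\<^bsub>S\<^esub> n" n a 1] by simp
qed

text \<open>Successive approximation with fixed generators: the \<open>n\<close>-th error is a
  combination with coefficients in \<open>F n\<close>, up to the next error, so the coefficients
  form convergent series. This gives both \<open>F n = m^n S\<close> and the Noetherian property of
  \<open>S\<close>.\<close>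

lemma complete_span:
  assumes A: "finite A" "g \<in> A \<rightarrow> carrier S"
    and BF: "\<And>n. B n \<subseteq> F n"
    and step: "\<And>n b. b \<in> B n \<Longrightarrow>
        \<exists>c b'. c \<in> A \<rightarrow> F n \<and> b' \<in> B (Suc n) \<and> b = (\<Oplus>\<^bsub>S\<^esub>a\<in>A. c a \<otimes>\<^bsub>S\<^esub> g a) \<oplus>\<^bsub>S\<^esub> b'"
    and b: "b \<in> B 0"
  shows "\<exists>C\<in>A \<rightarrow> carrier S. b = (\<Oplus>\<^bsub>S\<^esub>a\<in>A. C a \<otimes>\<^bsub>S\<^esub> g a)"
proof -
  \<comment> \<open>A state is a pair: the coefficients accumulated so far, and the remaining error
    in \<open>B n\<close>.\<close>
  have "\<exists>st. \<forall>n. (snd (st n) \<in> B n \<and> fst (st n) \<in> A \<rightarrow> carrier S \<and>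
        b = (\<Oplus>\<^bsub>S\<^esub>a\<in>A. fst (st n) a \<otimes>\<^bsub>S\<^esub> g a) \<oplus>\<^bsub>S\<^esub> snd (st n)) \<and>
        (\<forall>a\<in>A. fst (st (Suc n)) a \<ominus>\<^bsub>S\<^esub> fst (st n) a \<in> F n)"
  proof (rule dependent_nat_choice)
    have "b \<in> carrier S" using b BF F_carr by blast
    moreover have "(\<Oplus>\<^bsub>S\<^esub>a\<in>A. \<zero>\<^bsub>S\<^esub> \<otimes>\<^bsub>S\<^esub> g a) = (\<Oplus>\<^bsub>S\<^esub>a\<in>A. \<zero>\<^bsub>S\<^esub>)"
      using A(2) by (intro S.finsum_cong') (auto simp: Pi_iff)
    ultimately show "\<exists>x. snd x \<in> B 0 \<and> fst x \<in> A \<rightarrow> carrier S \<and>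
        b = (\<Oplus>\<^bsub>S\<^esub>a\<in>A. fst x a \<otimes>\<^bsub>S\<^esub> g a) \<oplus>\<^bsub>S\<^esub> snd x"
      using b by (intro exI[of _ "(\<lambda>a. \<zero>\<^bsub>S\<^esub>, b)"]) simp
  next
    fix x n assume x: "snd x \<in> B n \<and> fst x \<in> A \<rightarrow> carrier S \<and> b = (\<Oplus>\<^bsub>S\<^esub>a\<in>A. fst x a \<otimes>\<^bsub>S\<^esub> g a) \<oplus>\<^bsub>S\<^esub> snd x"
    obtain c b' where c: "c \<in> A \<rightarrow> F n" "b' \<in> B (Suc n)" "snd x = (\<Oplus>\<^bsub>S\<^esub>a\<in>A. c a \<otimes>\<^bsub>S\<^esub> g a) \<oplus>\<^bsub>S\<^esub> b'"
      using step[of "snd x" n] x by auto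
    have cc: "c \<in> A \<rightarrow> carrier S" using c(1) F_carr by (auto simp: Pi_iff)
    have b'c: "b' \<in> carrier S" using c(2) BF[of "Suc n"] F_carr by auto
    have P: "(\<lambda>a. d a \<otimes>\<^bsub>S\<^esub> g a) \<in> A \<rightarrow> carrier S" if "d \<in> A \<rightarrow> carrier S" for d
      using that A(2) by (auto simp: Pi_iff)
    have "(\<Oplus>\<^bsub>S\<^esub>a\<in>A. (fst x a \<oplus>\<^bsub>S\<^esub> c a) \<otimes>\<^bsub>S\<^esub> g a) = (\<Oplus>\<^bsub>S\<^esub>a\<in>A. fst x a \<otimes>\<^bsub>S\<^esub> g a \<oplus>\<^bsub>S\<^esub> c a \<otimes>\<^bsub>S\<^esub> g a)"
      using x cc A(2) by (intro S.finsum_cong') (auto simp: Pi_iff S.l_distr)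
    also have "\<dots> = (\<Oplus>\<^bsub>S\<^esub>a\<in>A. fst x a \<otimes>\<^bsub>S\<^esub> g a) \<oplus>\<^bsub>S\<^esub> (\<Oplus>\<^bsub>S\<^esub>a\<in>A. c a \<otimes>\<^bsub>S\<^esub> g a)"
      using S.finsum_addf[OF P P] x cc by simp
    finally have "b = (\<Oplus>\<^bsub>S\<^esub>a\<in>A. (fst x a \<oplus>\<^bsub>S\<^esub> c a) \<otimes>\<^bsub>S\<^esub> g a) \<oplus>\<^bsub>S\<^esub> b'"
      using x c(3) b'c S.finsum_closed[OF P] cc by (simp add: S.a_assoc)
    moreover have "(\<lambda>a. fst x a \<oplus>\<^bsub>S\<^esub> c a) \<in> A \<rightarrow> carrier S" using x cc by (auto simp: Pi_iff)
    moreover have "(fst x a \<oplus>\<^bsub>S\<^esub> c a) \<ominus>\<^bsub>S\<^esub> fst x a \<in> F n" if "a \<in> A" for a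
    proof -
      have ac: "fst x a \<in> carrier S" "c a \<in> carrier S" using that x cc by (auto simp: Pi_iff)
      then have "(fst x a \<oplus>\<^bsub>S\<^esub> c a) \<ominus>\<^bsub>S\<^esub> fst x a = c a" by algebra
      then show ?thesis using c(1) that by (simp add: Pi_iff)
    qed
    ultimately show "\<exists>y. (snd y \<in> B (Suc n) \<and> fst y \<in> A \<rightarrow> carrier S \<and>
        b = (\<Oplus>\<^bsub>S\<^esub>a\<in>A. fst y a \<otimes>\<^bsub>S\<^esub> g a) \<oplus>\<^bsub>S\<^esub> snd y) \<and> (\<forall>a\<in>A. fst y a \<ominus>\<^bsub>S\<^esub> fst x a \<in> F n)"
      using c(2) by (intro exI[of _ "(\<lambda>a. fst x a \<oplus>\<^bsub>S\<^esub> c a, b')"]) simp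
  qed
  then obtain st where st: "\<And>n. snd (st n) \<in> B n" "\<And>n. fst (st n) \<in> A \<rightarrow> carrier S"
        "\<And>n. b = (\<Oplus>\<^bsub>S\<^esub>a\<in>A. fst (st n) a \<otimes>\<^bsub>S\<^esub> g a) \<oplus>\<^bsub>S\<^esub> snd (st n)"
        "\<And>n a. a \<in> A \<Longrightarrow> fst (st (Suc n)) a \<ominus>\<^bsub>S\<^esub> fst (st n) a \<in> F n"
    by auto
  have "\<exists>t. t \<in> carrier S \<and> (\<forall>n. t \<ominus>\<^bsub>S\<^esub> fst (st n) a \<in> F n)" if "a \<in> A" for a
    using complete[of "\<lambda>n. fst (st n) a"] st(2,4) that by (auto simp: Pi_iff)
  then obtain C where C: "\<And>a. a \<in> A \<Longrightarrow> C a \<in> carrier S" "\<And>a n. a \<in> A \<Longrightarrow> C a \<ominus>\<^bsub>S\<^esub> fst (st n) a \<in> F n"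
    by metis
  have CP: "(\<lambda>a. C a \<otimes>\<^bsub>S\<^esub> g a) \<in> A \<rightarrow> carrier S" using C(1) A(2) by (auto simp: Pi_iff)
  have bc: "b \<in> carrier S" using b BF F_carr by blast
  let ?C = "\<Oplus>\<^bsub>S\<^esub>a\<in>A. C a \<otimes>\<^bsub>S\<^esub> g a"
  have Cc: "?C \<in> carrier S" by (rule S.finsum_closed[OF CP])
  \<comment> \<open>For every \<open>n\<close>, the tails of the coefficients and the error both lie
    in \<open>F n\<close>; by separatedness the limit represents \<open>b\<close> exactly.\<close>
  have "?C \<ominus>\<^bsub>S\<^esub> b \<in> F n" for n
  proof -
    let ?p = "fst (st n)"
    have pP: "(\<lambda>a. ?p a \<otimes>\<^bsub>S\<^esub> g a) \<in> A \<rightarrow> carrier S" using st(2)[of n] A(2) by (auto simp: Pi_iff)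
    have dP: "(\<lambda>a. (C a \<ominus>\<^bsub>S\<^esub> ?p a) \<otimes>\<^bsub>S\<^esub> g a) \<in> A \<rightarrow> carrier S" using C(1) st(2)[of n] A(2) by (auto simp: Pi_iff)
    have "?C = (\<Oplus>\<^bsub>S\<^esub>a\<in>A. (C a \<ominus>\<^bsub>S\<^esub> ?p a) \<otimes>\<^bsub>S\<^esub> g a \<oplus>\<^bsub>S\<^esub> ?p a \<otimes>\<^bsub>S\<^esub> g a)"
    proof (rule S.finsum_cong'[OF refl])
      fix a assume "a \<in> A"
      then have "C a \<in> carrier S" "?p a \<in> carrier S" "g a \<in> carrier S" using C(1) st(2)[of n] A(2) by (auto simp: Pi_iff)
      then show "C a \<otimes>\<^bsub>S\<^esub> g a = (C a \<ominus>\<^bsub>S\<^esub> ?p a) \<otimes>\<^bsub>S\<^esub> g a \<oplus>\<^bsub>S\<^esub> ?p a \<otimes>\<^bsub>S\<^esub> g a" by algebra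
    next
      show "(\<lambda>a. (C a \<ominus>\<^bsub>S\<^esub> ?p a) \<otimes>\<^bsub>S\<^esub> g a \<oplus>\<^bsub>S\<^esub> ?p a \<otimes>\<^bsub>S\<^esub> g a) \<in> A \<rightarrow> carrier S" using dP pP by (auto simp: Pi_iff)
    qed
    also have "\<dots> = (\<Oplus>\<^bsub>S\<^esub>a\<in>A. (C a \<ominus>\<^bsub>S\<^esub> ?p a) \<otimes>\<^bsub>S\<^esub> g a) \<oplus>\<^bsub>S\<^esub> (\<Oplus>\<^bsub>S\<^esub>a\<in>A. ?p a \<otimes>\<^bsub>S\<^esub> g a)"
      by (rule S.finsum_addf[OF dP pP])
    finally have 1: "?C = (\<Oplus>\<^bsub>S\<^esub>a\<in>A. (C a \<ominus>\<^bsub>S\<^esub> ?p a) \<otimes>\<^bsub>S\<^esub> g a) \<oplus>\<^bsub>S\<^esub> (\<Oplus>\<^bsub>S\<^esub>a\<in>A. ?p a \<otimes>\<^bsub>S\<^esub> g a)" (is "_ = ?D \<oplus>\<^bsub>S\<^esub> ?E") .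
    have D: "?D \<in> F n"
      using C(2) A(2) by (intro S.lincomb_in_ideal[OF F_ideal] S.ideal_rmult[OF F_ideal]) (auto simp: Pi_iff)
    have Ec: "?E \<in> carrier S" by (rule S.finsum_closed[OF pP])
    have sB: "snd (st n) \<in> F n" using st(1) BF by blast
    have "?C \<ominus>\<^bsub>S\<^esub> b = (?D \<oplus>\<^bsub>S\<^esub> ?E) \<ominus>\<^bsub>S\<^esub> (?E \<oplus>\<^bsub>S\<^esub> snd (st n))" using 1 st(3)[of n] by simp
    also have "\<dots> = ?D \<ominus>\<^bsub>S\<^esub> snd (st n)" by (rule S.add_minus_cancel[OF F_carr[OF D] Ec F_carr[OF sB]])
    also have "\<dots> \<in> F n" by (rule S.ideal_minus[OF F_ideal D sB])
    finally show ?thesis .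
  qed
  then have "?C \<ominus>\<^bsub>S\<^esub> b = \<zero>\<^bsub>S\<^esub>" using F_sep Cc bc by auto
  then have "b = ?C" using Cc bc by (simp add: S.r_right_minus_eq)
  then show ?thesis using C(1) by auto
qed

definition ext :: "'a set \<Rightarrow> 'c set" where "ext I = Idl\<^bsub>S\<^esub> (h ` I)"

lemma ext_ideal: "I \<subseteq> carrier R \<Longrightarrow> ideal (ext I) S"
  unfolding ext_def by (rule S.genideal_ideal) (auto simp: h_closed)

lemma ext_self: "I \<subseteq> carrier R \<Longrightarrow> i \<in> I \<Longrightarrow> h i \<in> ext I"
  unfolding ext_def using S.genideal_self[of "h ` I"] h_closed by auto

lemma ext_least: "ideal K S \<Longrightarrow> (\<And>i. i \<in> I \<Longrightarrow> h i \<in> K) \<Longrightarrow> ext I \<subseteq> K"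
  unfolding ext_def by (rule S.genideal_minimal) auto

lemma ext_mono: "J \<subseteq> carrier R \<Longrightarrow> I \<subseteq> J \<Longrightarrow> ext I \<subseteq> ext J"
  by (rule ext_least[OF ext_ideal]) (auto intro: ext_self)

text \<open>A priori \<open>F n\<close> is only the closure of the extension of \<open>m^n\<close>.
  Since \<open>m^n\<close> has finitely many generators, the approximations converge coefficient by
  coefficient over these generators.\<close>

lemma F_eq_ext: "F n = ext (R.ipow m n)"
proof
  note mi = R.ipow_ideal[OF R.m_ideal]
  show "ext (R.ipow m n) \<subseteq> F n"
    using F_R R.ideal_carr[OF mi] by (intro ext_least[OF F_ideal]) auto
  obtain A where A: "A \<subseteq> carrier R" "finite A" "R.ipow m n = Idl A" using R.finetely_gen[OF mi, of n] by auto
  have hA: "h \<in> A \<rightarrow> carrier S" using A(1) h_closed by auto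
  have AI: "A \<subseteq> R.ipow m n" using A R.genideal_self by auto
  show "F n \<subseteq> ext (R.ipow m n)"
  proof
    fix b assume b: "b \<in> F n"
    have "\<exists>C\<in>A \<rightarrow> carrier S. b = (\<Oplus>\<^bsub>S\<^esub>a\<in>A. C a \<otimes>\<^bsub>S\<^esub> h a)"
    proof (rule complete_span[OF A(2) hA, of "\<lambda>i. F (n + i)"])
      show "F (n + i) \<subseteq> F i" for i by (rule F_antimono) simp
      show "b \<in> F (n + 0)" using b by simp
      fix i b assume b: "b \<in> F (n + i)"
      have bc: "b \<in> carrier S" by (rule F_carr[OF b])
      obtain r where r: "r \<in> carrier R" "b \<ominus>\<^bsub>S\<^esub> h r \<in> F (n + Suc i)" using dense[OF bc] by auto
      have hr: "h r \<in> carrier S" using h_closed r by simp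
      have "h r \<ominus>\<^bsub>S\<^esub> b \<in> F (n + i)"
        using S.ideal_minus_swap[OF F_ideal r(2) bc hr] F_antimono[of "n + i" "n + Suc i"] by auto
      then have "h r \<in> F (n + i)" using S.ideal_cancel_minus[OF F_ideal _ b hr] by simp
      \<comment> \<open>As \<open>m^(i+n) = m^i m^n\<close>, the coefficients over the generators of
        \<open>m^n\<close> can be taken in \<open>m^i\<close>.\<close>
      then have "r \<in> R.ipow m (i + n)" using F_R[OF r(1)] by (simp add: add.commute)
      then have "r \<in> R.ipow m i \<cdot> (Idl A)" using R.ipow_add[OF R.m_ideal, of i n] A(3) by simp
      then obtain c where c: "c \<in> A \<rightarrow> R.ipow m i" "r = (\<Oplus>a\<in>A. c a \<otimes> a)"
        by (rule R.prod_Idl_lincomb[OF A(2,1) mi])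
      have cc: "c \<in> A \<rightarrow> carrier R" using c(1) R.ideal_carr[OF mi] by (auto simp: Pi_iff)
      have "h r = (\<Oplus>\<^bsub>S\<^esub>a\<in>A. h (c a \<otimes> a))" unfolding c(2) using cc A by (intro h_lincomb) (auto simp: Pi_iff)
      also have "\<dots> = (\<Oplus>\<^bsub>S\<^esub>a\<in>A. h (c a) \<otimes>\<^bsub>S\<^esub> h a)"
        using cc A(1) h_closed by (intro S.finsum_cong') (auto simp: Pi_iff h_mult subset_eq)
      finally have "b = (\<Oplus>\<^bsub>S\<^esub>a\<in>A. h (c a) \<otimes>\<^bsub>S\<^esub> h a) \<oplus>\<^bsub>S\<^esub> (b \<ominus>\<^bsub>S\<^esub> h r)"
        using S.add_minus_self[OF bc hr] by simp
      moreover have "(\<lambda>a. h (c a)) \<in> A \<rightarrow> F i" using c(1) cc F_R by (auto simp: Pi_iff)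
      ultimately show "\<exists>c b'. c \<in> A \<rightarrow> F i \<and> b' \<in> F (n + Suc i) \<and> b = (\<Oplus>\<^bsub>S\<^esub>a\<in>A. c a \<otimes>\<^bsub>S\<^esub> h a) \<oplus>\<^bsub>S\<^esub> b'"
        using r(2) by blast
    qed
    then obtain C where C: "C \<in> A \<rightarrow> carrier S" "b = (\<Oplus>\<^bsub>S\<^esub>a\<in>A. C a \<otimes>\<^bsub>S\<^esub> h a)" by auto
    have E: "ideal (ext (R.ipow m n)) S" by (rule ext_ideal[OF R.ideal_sub[OF mi]])
    show "b \<in> ext (R.ipow m n)" unfolding C(2)
    proof (rule S.lincomb_in_ideal[OF E])
      fix a assume a: "a \<in> A"
      have "h a \<in> ext (R.ipow m n)" using ext_self[OF R.ideal_sub[OF mi]] AI a by auto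
      then show "C a \<otimes>\<^bsub>S\<^esub> h a \<in> ext (R.ipow m n)" using S.ideal_lmult[OF E] C(1) a by (auto simp: Pi_iff)
    qed
  qed
qed

lemma geometric_inverse:
  assumes v: "v \<in> F 1" shows "\<exists>y\<in>carrier S. y \<otimes>\<^bsub>S\<^esub> (\<one>\<^bsub>S\<^esub> \<ominus>\<^bsub>S\<^esub> v) = \<one>\<^bsub>S\<^esub>"
proof -
  have vc: "v \<in> carrier S" by (rule F_carr[OF v])
  \<comment> \<open>\<open>y n\<close> is the sum of the powers of \<open>v\<close> below
    \<open>n\<close>, so that \<open>y n (1 - v) = 1 - v^n\<close>.\<close>
  define y where "y = rec_nat \<zero>\<^bsub>S\<^esub> (\<lambda>n a. a \<oplus>\<^bsub>S\<^esub> v [^]\<^bsub>S\<^esub> n)"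
  have y0: "y 0 = \<zero>\<^bsub>S\<^esub>" and yS: "y (Suc n) = y n \<oplus>\<^bsub>S\<^esub> v [^]\<^bsub>S\<^esub> n" for n by (auto simp: y_def)
  have yc: "y n \<in> carrier S" for n by (induct n) (auto simp: y0 yS vc)
  have yd: "y (Suc n) \<ominus>\<^bsub>S\<^esub> y n \<in> F n" for n
  proof -
    have vn: "v [^]\<^bsub>S\<^esub> n \<in> carrier S" using vc by simp
    have "y (Suc n) \<ominus>\<^bsub>S\<^esub> y n = v [^]\<^bsub>S\<^esub> n" unfolding yS using yc[of n] vn by algebra
    then show ?thesis using F_pow[OF v] by simp
  qed
  have ye: "y n \<otimes>\<^bsub>S\<^esub> (\<one>\<^bsub>S\<^esub> \<ominus>\<^bsub>S\<^esub> v) \<ominus>\<^bsub>S\<^esub> \<one>\<^bsub>S\<^esub> \<in> F n" for n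
  proof -
    have "y n \<otimes>\<^bsub>S\<^esub> (\<one>\<^bsub>S\<^esub> \<ominus>\<^bsub>S\<^esub> v) = \<one>\<^bsub>S\<^esub> \<ominus>\<^bsub>S\<^esub> v [^]\<^bsub>S\<^esub> n"
    proof (induct n)
      case 0 then show ?case using vc by (simp add: y0 S.minus_eq S.r_neg)
    next
      case (Suc n)
      have vn: "v [^]\<^bsub>S\<^esub> n \<in> carrier S" using vc by simp
      have "y (Suc n) \<otimes>\<^bsub>S\<^esub> (\<one>\<^bsub>S\<^esub> \<ominus>\<^bsub>S\<^esub> v) = y n \<otimes>\<^bsub>S\<^esub> (\<one>\<^bsub>S\<^esub> \<ominus>\<^bsub>S\<^esub> v) \<oplus>\<^bsub>S\<^esub> (v [^]\<^bsub>S\<^esub> n \<ominus>\<^bsub>S\<^esub> v [^]\<^bsub>S\<^esub> n \<otimes>\<^bsub>S\<^esub> v)"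
        unfolding yS using yc[of n] vn vc by algebra
      also have "\<dots> = \<one>\<^bsub>S\<^esub> \<ominus>\<^bsub>S\<^esub> v [^]\<^bsub>S\<^esub> n \<otimes>\<^bsub>S\<^esub> v" unfolding Suc using vn vc by algebra
      finally show ?case by simp
    qed
    moreover have "(\<one>\<^bsub>S\<^esub> \<ominus>\<^bsub>S\<^esub> v [^]\<^bsub>S\<^esub> n) \<ominus>\<^bsub>S\<^esub> \<one>\<^bsub>S\<^esub> = \<ominus>\<^bsub>S\<^esub> (v [^]\<^bsub>S\<^esub> n)"
    proof -
      have vn: "v [^]\<^bsub>S\<^esub> n \<in> carrier S" using vc by simp
      then show ?thesis by algebra
    qed
    ultimately show ?thesis using S.ideal_neg[OF F_ideal F_pow[OF v]] by simp
  qed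
  obtain t where t: "t \<in> carrier S" "\<And>n. t \<ominus>\<^bsub>S\<^esub> y n \<in> F n" using complete[of y, OF yc yd] by auto
  have vm: "\<one>\<^bsub>S\<^esub> \<ominus>\<^bsub>S\<^esub> v \<in> carrier S" using vc by simp
  have "t \<otimes>\<^bsub>S\<^esub> (\<one>\<^bsub>S\<^esub> \<ominus>\<^bsub>S\<^esub> v) \<ominus>\<^bsub>S\<^esub> \<one>\<^bsub>S\<^esub> \<in> F n" for n
  proof -
    have "t \<otimes>\<^bsub>S\<^esub> (\<one>\<^bsub>S\<^esub> \<ominus>\<^bsub>S\<^esub> v) \<ominus>\<^bsub>S\<^esub> \<one>\<^bsub>S\<^esub> = (t \<ominus>\<^bsub>S\<^esub> y n) \<otimes>\<^bsub>S\<^esub> (\<one>\<^bsub>S\<^esub> \<ominus>\<^bsub>S\<^esub> v) \<oplus>\<^bsub>S\<^esub> (y n \<otimes>\<^bsub>S\<^esub> (\<one>\<^bsub>S\<^esub> \<ominus>\<^bsub>S\<^esub> v) \<ominus>\<^bsub>S\<^esub> \<one>\<^bsub>S\<^esub>)"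
      using t(1) yc[of n] vc by algebra
    also have "\<dots> \<in> F n" by (rule S.ideal_add[OF F_ideal S.ideal_rmult[OF F_ideal t(2) vm] ye])
    finally show ?thesis .
  qed
  then have "t \<otimes>\<^bsub>S\<^esub> (\<one>\<^bsub>S\<^esub> \<ominus>\<^bsub>S\<^esub> v) \<ominus>\<^bsub>S\<^esub> \<one>\<^bsub>S\<^esub> = \<zero>\<^bsub>S\<^esub>" using F_sep t(1) vm by simp
  then have "t \<otimes>\<^bsub>S\<^esub> (\<one>\<^bsub>S\<^esub> \<ominus>\<^bsub>S\<^esub> v) = \<one>\<^bsub>S\<^esub>" using t(1) vm by (simp add: S.r_right_minus_eq)
  then show ?thesis using t(1) by auto
qed

lemma unit_of_notin_F1:
  assumes s: "s \<in> carrier S" "s \<notin> F 1" shows "\<exists>t\<in>carrier S. t \<otimes>\<^bsub>S\<^esub> s = \<one>\<^bsub>S\<^esub>"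
proof -
  obtain r where r: "r \<in> carrier R" "s \<ominus>\<^bsub>S\<^esub> h r \<in> F 1" using dense[OF s(1)] by auto
  have "h r \<notin> F 1" using S.ideal_cancel_minus[OF F_ideal r(2) _ s(1)] s(2) by auto
  then have "r \<notin> m" using F_R[OF r(1), of 1] R.ipow_1[OF R.m_ideal] by simp
  then obtain r' where r': "r' \<in> carrier R" "r' \<otimes> r = \<one>" using R.unit_of_notin_m r(1) by auto
  have hc: "h r \<in> carrier S" "h r' \<in> carrier S" using r r' h_closed by auto
  have hh: "h r' \<otimes>\<^bsub>S\<^esub> h r = \<one>\<^bsub>S\<^esub>" using r r' h_mult h_one by metis
  \<comment> \<open>Here \<open>h r'\<close> inverts \<open>h r\<close>. The product
    \<open>h r' s\<close> has the form \<open>1 - v\<close> with \<open>v\<close> in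
    \<open>F 1\<close>, and a geometric series inverts it.\<close>
  define v where "v = \<ominus>\<^bsub>S\<^esub> (h r' \<otimes>\<^bsub>S\<^esub> (s \<ominus>\<^bsub>S\<^esub> h r))"
  have v: "v \<in> F 1" unfolding v_def by (intro S.ideal_neg[OF F_ideal] S.ideal_lmult[OF F_ideal r(2) hc(2)])
  have "\<one>\<^bsub>S\<^esub> \<ominus>\<^bsub>S\<^esub> v = \<one>\<^bsub>S\<^esub> \<oplus>\<^bsub>S\<^esub> h r' \<otimes>\<^bsub>S\<^esub> s \<ominus>\<^bsub>S\<^esub> h r' \<otimes>\<^bsub>S\<^esub> h r"
    unfolding v_def using hc s(1) by algebra
  also have "\<dots> = h r' \<otimes>\<^bsub>S\<^esub> s" unfolding hh using hc s(1) by algebra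
  finally have e: "\<one>\<^bsub>S\<^esub> \<ominus>\<^bsub>S\<^esub> v = h r' \<otimes>\<^bsub>S\<^esub> s" .
  obtain y where y: "y \<in> carrier S" "y \<otimes>\<^bsub>S\<^esub> (\<one>\<^bsub>S\<^esub> \<ominus>\<^bsub>S\<^esub> v) = \<one>\<^bsub>S\<^esub>" using geometric_inverse[OF v] by auto
  then have "(y \<otimes>\<^bsub>S\<^esub> h r') \<otimes>\<^bsub>S\<^esub> s = \<one>\<^bsub>S\<^esub>" unfolding e using hc s(1) by (simp add: S.m_assoc)
  then show ?thesis using y(1) hc by blast
qed

end

context cring
begin

definition colon :: "'a set \<Rightarrow> 'a set \<Rightarrow> 'a set" where
  "colon I J = {r \<in> carrier R. \<forall>y\<in>J. r \<otimes> y \<in> I}"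

lemma colon_ideal:
  assumes I: "ideal I R" and J: "J \<subseteq> carrier R" shows "ideal (colon I J) R"
proof (rule ideal_crit)
  show "colon I J \<subseteq> carrier R" by (auto simp: colon_def)
  show "\<zero> \<in> colon I J" using ideal_zero[OF I] J by (auto simp: colon_def subset_eq)
  fix a assume a: "a \<in> colon I J"
  { fix b assume b: "b \<in> colon I J"
    show "a \<oplus> b \<in> colon I J"
    proof -
      have "(a \<oplus> b) \<otimes> y \<in> I" if "y \<in> J" for y
        using a b that J ideal_add[OF I, of "a \<otimes> y" "b \<otimes> y"] by (auto simp: colon_def l_distr subset_eq)
      then show ?thesis using a b by (simp add: colon_def)
    qed }
  { fix r assume r: "r \<in> carrier R"
    show "r \<otimes> a \<in> colon I J"
    proof -
      have "r \<otimes> a \<otimes> y \<in> I" if "y \<in> J" for y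
        using a that J r ideal_lmult[OF I, of "a \<otimes> y" r] by (auto simp: colon_def m_assoc subset_eq)
      then show ?thesis using a r by (simp add: colon_def)
    qed }
qed

lemma colon_mono1: "I \<subseteq> I' \<Longrightarrow> colon I J \<subseteq> colon I' J"
  by (auto simp: colon_def)

lemma prod_PIdl:
  assumes J: "ideal J R" and y: "y \<in> carrier R" and z: "z \<in> J \<cdot> (PIdl y)"
  shows "\<exists>j\<in>J. z = j \<otimes> y"
  using z
proof induct
  case (prod i j)
  then obtain r where r: "r \<in> carrier R" "j = r \<otimes> y" by (auto simp: mem_PIdl)
  have "i \<otimes> r \<in> J" "i \<in> carrier R" using prod r ideal_rmult[OF J] ideal_carr[OF J] by auto
  then show ?case using r y by (intro bexI[of _ "i \<otimes> r"]) (auto simp: m_assoc)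
next
  case (sum a b)
  then obtain i j where ij: "i \<in> J" "a = i \<otimes> y" "j \<in> J" "b = j \<otimes> y" by auto
  then have "a \<oplus> b = (i \<oplus> j) \<otimes> y" using y ideal_carr[OF J] by (simp add: l_distr)
  then show ?case using ij ideal_add[OF J] by (intro bexI[of _ "i \<oplus> j"]) auto
qed

text \<open>A step of Cohen's argument. Generators of \<open>P + (a)\<close> split as
  \<open>p + r a\<close>; what the parts \<open>p\<close> miss in an element of \<open>P\<close> is
  a multiple \<open>s a\<close> that lies in \<open>P\<close>, that is, \<open>s\<close> is in the
  colon ideal.\<close>

lemma fg_of_fg_sum:
  assumes P: "ideal P R" and a: "a \<in> carrier R" and A: "A \<subseteq> carrier R" "finite A" "P <+> PIdl a = Idl A"
  shows "\<exists>B\<subseteq>P. finite B \<and> P \<subseteq> Idl B <+> colon P {a} \<cdot> (PIdl a)"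
proof -
  have "\<exists>p\<in>P. \<exists>r\<in>carrier R. x = p \<oplus> r \<otimes> a" if "x \<in> A" for x
    using that genideal_self[OF A(1)] A(3) by (auto simp: mem_sum_PIdl[symmetric])
  then obtain p r where pr: "\<And>x. x \<in> A \<Longrightarrow> p x \<in> P" "\<And>x. x \<in> A \<Longrightarrow> r x \<in> carrier R" "\<And>x. x \<in> A \<Longrightarrow> x = p x \<oplus> r x \<otimes> a"
    by metis
  have Pc: "ideal (colon P {a}) R" using colon_ideal[OF P] a by simp
  let ?B = "p ` A"
  have B: "?B \<subseteq> P" "?B \<subseteq> carrier R" using pr(1) ideal_sub[OF P] by auto
  note Bi = genideal_ideal[OF B(2)] and ai = cgenideal_ideal[OF a]
  note BK = add_ideals[OF Bi ai]
  have "Idl A \<subseteq> Idl ?B <+> PIdl a"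
  proof (rule genideal_minimal[OF BK], rule subsetI)
    fix x assume x: "x \<in> A"
    have "p x \<in> Idl ?B" using genideal_self[OF B(2)] x by auto
    then show "x \<in> Idl ?B <+> PIdl a" using pr(2,3)[OF x] by (auto simp: mem_sum_PIdl)
  qed
  moreover have "P \<subseteq> Idl A" using PIdl_sum_sub[OF P a] A(3) by simp
  ultimately have sub: "P \<subseteq> Idl ?B <+> PIdl a" by simp
  have "P \<subseteq> Idl ?B <+> colon P {a} \<cdot> (PIdl a)"
  proof
    fix z assume z: "z \<in> P"
    then have "z \<in> Idl ?B <+> PIdl a" using sub by auto
    then obtain b s where b: "b \<in> Idl ?B" "s \<in> carrier R" "z = b \<oplus> s \<otimes> a" by (auto simp: mem_sum_PIdl)
    have "b \<in> P" using b(1) genideal_minimal[OF P B(1)] by auto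
    then have "s \<otimes> a \<in> P" using ideal_cancel_add[OF P, of b "s \<otimes> a"] z b(2,3) a by simp
    then have "s \<in> colon P {a}" using b(2) by (simp add: colon_def)
    then have "s \<otimes> a \<in> colon P {a} \<cdot> (PIdl a)" using cgenideal_self[OF a] by (rule ideal_prod.prod)
    then show "z \<in> Idl ?B <+> colon P {a} \<cdot> (PIdl a)" using b by (auto simp: mem_sum)
  qed
  then show ?thesis using B(1) A(2) by (intro exI[of _ ?B]) auto
qed

end

context noetherian_cring
begin

text \<open>Weak Artin--Rees for \<open>(y)\<close>, divided by \<open>y\<close>; the ambiguity of
  the division is the colon ideal. Together with the next lemma it is the input for flatness of the
  completion.\<close>

lemma weak_artin_rees_colon:
  assumes I: "ideal I R" and y: "y \<in> carrier R" and J: "ideal J R"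
  obtains n where "\<And>r. r \<in> carrier R \<Longrightarrow> r \<otimes> y \<in> I <+> ipow J n \<Longrightarrow> r \<in> colon I {y} <+> ipow J N"
proof -
  note Ji = ipow_ideal[OF J]
  obtain n where n: "\<And>z. z \<in> I <+> PIdl y \<Longrightarrow> z \<in> I <+> ipow J n \<Longrightarrow> z \<in> I <+> ipow J N \<cdot> (PIdl y)"
    by (rule weak_artin_rees[OF I cgenideal_ideal[OF y] J]) (rule that)
  show ?thesis
  proof (rule that[of n])
    fix r assume r: "r \<in> carrier R" "r \<otimes> y \<in> I <+> ipow J n"
    have "r \<otimes> y \<in> PIdl y" unfolding mem_PIdl using r(1) by blast
    then have "r \<otimes> y \<in> I <+> PIdl y" using sum_ub2[OF I cgenideal_ideal[OF y]] by auto
    then have "r \<otimes> y \<in> I <+> ipow J N \<cdot> (PIdl y)" using n r(2) by simp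
    then obtain i z where iz: "i \<in> I" "z \<in> ipow J N \<cdot> (PIdl y)" "r \<otimes> y = i \<oplus> z"
      by (auto simp: mem_sum)
    obtain j where j: "j \<in> ipow J N" "z = j \<otimes> y" using prod_PIdl[OF Ji y iz(2)] by auto
    have c: "i \<in> carrier R" "j \<in> carrier R" using iz j ideal_carr[OF I] ideal_carr[OF Ji] by auto
    have "(r \<ominus> j) \<otimes> y = r \<otimes> y \<ominus> j \<otimes> y" using r(1) c y by algebra
    also have "\<dots> = i" unfolding iz(3) j(2) using c y by algebra
    finally have "r \<ominus> j \<in> colon I {y}" using iz(1) r(1) c by (simp add: colon_def)
    moreover have "r = (r \<ominus> j) \<oplus> j" using r(1) c by algebra
    ultimately show "r \<in> colon I {y} <+> ipow J N" unfolding mem_sum using j(1) by blast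
  qed
qed

text \<open>By weak Artin--Rees \<open>a\<close> is an element of \<open>B\<close> plus an element
  of \<open>J^N A\<close>. Subtracting the latter leaves an element of both ideals.\<close>

lemma weak_artin_rees_inter:
  assumes A: "ideal A R" and B: "ideal B R" and J: "ideal J R"
  obtains n where "\<And>a b. a \<in> A \<Longrightarrow> b \<in> B \<Longrightarrow> a \<ominus> b \<in> ipow J n \<Longrightarrow> \<exists>c\<in>A \<inter> B. a \<ominus> c \<in> ipow J N"
proof -
  note Ji = ipow_ideal[OF J]
  obtain n where n: "\<And>z. z \<in> B <+> A \<Longrightarrow> z \<in> B <+> ipow J n \<Longrightarrow> z \<in> B <+> ipow J N \<cdot> A"
    by (rule weak_artin_rees[OF B A J]) (rule that)
  show ?thesis
  proof (rule that[of n])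
    fix a b assume ab: "a \<in> A" "b \<in> B" "a \<ominus> b \<in> ipow J n"
    have c: "a \<in> carrier R" "b \<in> carrier R" using ab ideal_carr[OF A] ideal_carr[OF B] by auto
    have "a \<in> B <+> A" using ab(1) sum_ub2[OF B A] by auto
    moreover have "a = b \<oplus> (a \<ominus> b)" using c by algebra
    then have "a \<in> B <+> ipow J n" unfolding mem_sum using ab by blast
    ultimately have "a \<in> B <+> ipow J N \<cdot> A" by (rule n)
    then obtain d j where dj: "d \<in> B" "j \<in> ipow J N \<cdot> A" "a = d \<oplus> j" by (auto simp: mem_sum)
    have jA: "j \<in> A" "j \<in> ipow J N" using dj(2) prod_sub1[OF Ji A] prod_sub2[OF Ji A] by auto
    have dc: "d \<in> carrier R" "j \<in> carrier R" using dj(1) jA ideal_carr[OF B] ideal_carr[OF A] by auto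
    have "d = a \<ominus> j" "a \<ominus> d = j" unfolding dj(3) using dc by algebra+
    then have "d \<in> A \<inter> B" "a \<ominus> d \<in> ipow J N" using ideal_minus[OF A ab(1) jA(1)] dj(1) jA(2) by auto
    then show "\<exists>c\<in>A \<inter> B. a \<ominus> c \<in> ipow J N" by auto
  qed
qed

end

context completion_pair
begin

text \<open>Let \<open>P\<close> be maximal among the ideals that are not finitely generated. If
  some \<open>a\<close> in \<open>F 1\<close> is outside \<open>P\<close>, then
  \<open>P = (B) + (P : a) a\<close> with \<open>B\<close> finite. If the colon ideal is larger than
  \<open>P\<close>, it is finitely generated, and so is \<open>P\<close>. If it equals
  \<open>P\<close>, iteration gives convergent series in powers of \<open>a\<close>, and
  \<open>B\<close> generates \<open>P\<close>. So \<open>P\<close> contains \<open>F 1\<close> and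
  hence equals it; but \<open>F 1 = m S\<close> is finitely generated.\<close>

lemma S_noetherian: "noetherian_ring S"
proof (rule ccontr)
  assume nn: "\<not> noetherian_ring S"
  define fg where "fg I \<longleftrightarrow> (\<exists>A\<subseteq>carrier S. finite A \<and> I = Idl\<^bsub>S\<^esub> A)" for I
  have "\<exists>I. ideal I S \<and> \<not> fg I" using nn S.noetherian_ringI unfolding fg_def by metis
  then have ne: "{I. ideal I S \<and> \<not> fg I} \<noteq> {}" by auto
  have "\<exists>P\<in>{I. ideal I S \<and> \<not> fg I}. \<forall>I\<in>{I. ideal I S \<and> \<not> fg I}. P \<subseteq> I \<longrightarrow> I = P"
  proof (rule subset_Zorn_nonempty[OF ne])
    fix C assume C: "C \<noteq> {}" "subset.chain {I. ideal I S \<and> \<not> fg I} C"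
    have C': "subset.chain {I. ideal I S} C" using C(2) by (auto simp: pred_on.chain_def)
    have U: "ideal (\<Union>C) S" using S.chain_Union_is_ideal[OF C'] C(1) by simp
    have "\<not> fg (\<Union>C)"
    proof
      assume "fg (\<Union>C)"
      then obtain A where A: "A \<subseteq> carrier S" "finite A" "\<Union>C = Idl\<^bsub>S\<^esub> A" by (auto simp: fg_def)
      have "\<exists>I\<in>C. B \<subseteq> I" if "finite B" "B \<subseteq> \<Union>C" for B
        using that
      proof (induct B)
        case empty then show ?case using C(1) by auto
      next
        case (insert x B)
        then obtain I I' where "I \<in> C" "B \<subseteq> I" "I' \<in> C" "x \<in> I'" by auto
        moreover have "I \<subseteq> I' \<or> I' \<subseteq> I" using calculation C(2) by (auto simp: subset_chain_def)
        ultimately show ?case by auto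
      qed
      then have "\<exists>I\<in>C. A \<subseteq> I" using A S.genideal_self[OF A(1)] by simp
      then obtain I where I: "I \<in> C" "A \<subseteq> I" by auto
      have Ii: "ideal I S" "\<not> fg I" using I(1) C(2) by (auto simp: pred_on.chain_def)
      have "I = Idl\<^bsub>S\<^esub> A" using S.genideal_minimal[OF Ii(1) I(2)] A(3) I(1) by auto
      then show False using Ii(2) A by (auto simp: fg_def)
    qed
    then show "\<Union>C \<in> {I. ideal I S \<and> \<not> fg I}" using U by simp
  qed
  then obtain P where P: "ideal P S" "\<not> fg P" and max: "\<And>I. ideal I S \<Longrightarrow> \<not> fg I \<Longrightarrow> P \<subseteq> I \<Longrightarrow> I = P" by auto
  have one: "\<one>\<^bsub>S\<^esub> \<notin> P"
  proof
    assume "\<one>\<^bsub>S\<^esub> \<in> P"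
    then have "P = carrier S" using ideal.one_imp_carrier[OF P(1)] by simp
    then have "P = Idl\<^bsub>S\<^esub> {\<one>\<^bsub>S\<^esub>}" using S.genideal_one by simp
    then have "fg P" unfolding fg_def by (intro exI[of _ "{\<one>\<^bsub>S\<^esub>}"]) auto
    then show False using P(2) by simp
  qed
  have "a \<in> P" if a: "a \<in> F 1" for a
  proof (rule ccontr)
    assume aP: "a \<notin> P"
    have ac: "a \<in> carrier S" by (rule F_carr[OF a])
    note Pa = S.PIdl_sum_ideal[OF P(1) ac]
    have "fg (P <+>\<^bsub>S\<^esub> PIdl\<^bsub>S\<^esub> a)"
      using max[OF Pa _ S.PIdl_sum_sub[OF P(1) ac]] S.PIdl_sum_mem[OF P(1) ac] aP by auto
    then obtain A where A: "A \<subseteq> carrier S" "finite A" "P <+>\<^bsub>S\<^esub> PIdl\<^bsub>S\<^esub> a = Idl\<^bsub>S\<^esub> A" by (auto simp: fg_def)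
    obtain B where B: "B \<subseteq> P" "finite B" "P \<subseteq> Idl\<^bsub>S\<^esub> B <+>\<^bsub>S\<^esub> S.colon P {a} \<cdot>\<^bsub>S\<^esub> (PIdl\<^bsub>S\<^esub> a)"
      using S.fg_of_fg_sum[OF P(1) ac A] by auto
    have Bc: "B \<subseteq> carrier S" using B(1) S.ideal_sub[OF P(1)] by simp
    have Ci: "ideal (S.colon P {a}) S" using S.colon_ideal[OF P(1)] ac by simp
    have PC: "P \<subseteq> S.colon P {a}" using S.ideal_rmult[OF P(1)] S.ideal_carr[OF P(1)] ac by (auto simp: S.colon_def)
    have dec: "\<exists>b\<in>Idl\<^bsub>S\<^esub> B. \<exists>c\<in>S.colon P {a}. p = b \<oplus>\<^bsub>S\<^esub> c \<otimes>\<^bsub>S\<^esub> a" if "p \<in> P" for p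
    proof -
      have "p \<in> Idl\<^bsub>S\<^esub> B <+>\<^bsub>S\<^esub> S.colon P {a} \<cdot>\<^bsub>S\<^esub> (PIdl\<^bsub>S\<^esub> a)" using B(3) that by auto
      then obtain b z where "b \<in> Idl\<^bsub>S\<^esub> B" "z \<in> S.colon P {a} \<cdot>\<^bsub>S\<^esub> (PIdl\<^bsub>S\<^esub> a)" "p = b \<oplus>\<^bsub>S\<^esub> z"
        by (auto simp: S.mem_sum)
      then show ?thesis using S.prod_PIdl[OF Ci ac, of z] by auto
    qed
    show False
    proof (cases "S.colon P {a} = P")
      case True
      \<comment> \<open>The successive errors are \<open>a^n x\<close> with \<open>x\<close> in
        \<open>P\<close>; they tend to zero because \<open>a\<close> is in
        \<open>F 1\<close>.\<close>
      have "\<exists>C\<in>B \<rightarrow> carrier S. p = (\<Oplus>\<^bsub>S\<^esub>b\<in>B. C b \<otimes>\<^bsub>S\<^esub> b)" if p: "p \<in> P" for p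
      proof (rule complete_span[OF B(2), of "\<lambda>b. b" "\<lambda>n. {a [^]\<^bsub>S\<^esub> n \<otimes>\<^bsub>S\<^esub> x | x. x \<in> P}"])
        show "(\<lambda>b. b) \<in> B \<rightarrow> carrier S" using Bc by auto
        show "{a [^]\<^bsub>S\<^esub> n \<otimes>\<^bsub>S\<^esub> x | x. x \<in> P} \<subseteq> F n" for n
          using S.ideal_rmult[OF F_ideal F_pow[OF a]] S.ideal_carr[OF P(1)] by auto
        have "p = a [^]\<^bsub>S\<^esub> (0::nat) \<otimes>\<^bsub>S\<^esub> p" using S.ideal_carr[OF P(1) p] by simp
        then show "p \<in> {a [^]\<^bsub>S\<^esub> (0::nat) \<otimes>\<^bsub>S\<^esub> x | x. x \<in> P}" using p by blast
        fix n :: nat and b assume "b \<in> {a [^]\<^bsub>S\<^esub> n \<otimes>\<^bsub>S\<^esub> x | x. x \<in> P}"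
        then obtain x where x: "x \<in> P" "b = a [^]\<^bsub>S\<^esub> n \<otimes>\<^bsub>S\<^esub> x" by auto
        obtain y z where yz: "y \<in> Idl\<^bsub>S\<^esub> B" "z \<in> P" "x = y \<oplus>\<^bsub>S\<^esub> z \<otimes>\<^bsub>S\<^esub> a" using dec[OF x(1)] True by auto
        obtain c where c: "c \<in> B \<rightarrow> carrier S" "y = (\<Oplus>\<^bsub>S\<^esub>b\<in>B. c b \<otimes>\<^bsub>S\<^esub> b)"
          by (rule S.Idl_lincomb[OF B(2) Bc yz(1)])
        have an: "a [^]\<^bsub>S\<^esub> n \<in> carrier S" using ac by simp
        have zc: "z \<in> carrier S" by (rule S.ideal_carr[OF P(1) yz(2)])
        have cb: "(\<lambda>b. c b \<otimes>\<^bsub>S\<^esub> b) \<in> B \<rightarrow> carrier S" using c(1) Bc by (auto simp: Pi_iff)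
        have yc: "y \<in> carrier S" unfolding c(2) by (rule S.finsum_closed[OF cb])
        have "a [^]\<^bsub>S\<^esub> n \<otimes>\<^bsub>S\<^esub> y = (\<Oplus>\<^bsub>S\<^esub>b\<in>B. a [^]\<^bsub>S\<^esub> n \<otimes>\<^bsub>S\<^esub> (c b \<otimes>\<^bsub>S\<^esub> b))"
          unfolding c(2) by (rule S.finsum_rdistr[OF B(2) an cb])
        also have "\<dots> = (\<Oplus>\<^bsub>S\<^esub>b\<in>B. (a [^]\<^bsub>S\<^esub> n \<otimes>\<^bsub>S\<^esub> c b) \<otimes>\<^bsub>S\<^esub> b)"
          using c(1) Bc an by (intro S.finsum_cong') (auto simp: Pi_iff S.m_assoc subset_eq)
        finally have "b = (\<Oplus>\<^bsub>S\<^esub>b\<in>B. (a [^]\<^bsub>S\<^esub> n \<otimes>\<^bsub>S\<^esub> c b) \<otimes>\<^bsub>S\<^esub> b) \<oplus>\<^bsub>S\<^esub> a [^]\<^bsub>S\<^esub> Suc n \<otimes>\<^bsub>S\<^esub> z"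
          unfolding x(2) yz(3) using an yc zc ac by (simp add: S.r_distr S.m_ac)
        moreover have "(\<lambda>b. a [^]\<^bsub>S\<^esub> n \<otimes>\<^bsub>S\<^esub> c b) \<in> B \<rightarrow> F n"
          using c(1) S.ideal_rmult[OF F_ideal F_pow[OF a]] by (auto simp: Pi_iff)
        moreover have "a [^]\<^bsub>S\<^esub> Suc n \<otimes>\<^bsub>S\<^esub> z \<in> {a [^]\<^bsub>S\<^esub> Suc n \<otimes>\<^bsub>S\<^esub> x | x. x \<in> P}" using yz(2) by blast
        ultimately show "\<exists>c b'. c \<in> B \<rightarrow> F n \<and> b' \<in> {a [^]\<^bsub>S\<^esub> Suc n \<otimes>\<^bsub>S\<^esub> x | x. x \<in> P} \<and>
            b = (\<Oplus>\<^bsub>S\<^esub>b\<in>B. c b \<otimes>\<^bsub>S\<^esub> b) \<oplus>\<^bsub>S\<^esub> b'"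
          by (intro exI[of _ "\<lambda>b. a [^]\<^bsub>S\<^esub> n \<otimes>\<^bsub>S\<^esub> c b"] exI[of _ "a [^]\<^bsub>S\<^esub> Suc n \<otimes>\<^bsub>S\<^esub> z"] conjI)
      qed
      note * = this
      have "P = Idl\<^bsub>S\<^esub> B"
      proof
        show "Idl\<^bsub>S\<^esub> B \<subseteq> P" by (rule S.genideal_minimal[OF P(1) B(1)])
        note Bi = S.genideal_ideal[OF Bc]
        show "P \<subseteq> Idl\<^bsub>S\<^esub> B"
        proof
          fix p assume "p \<in> P"
          then obtain C where C: "C \<in> B \<rightarrow> carrier S" "p = (\<Oplus>\<^bsub>S\<^esub>b\<in>B. C b \<otimes>\<^bsub>S\<^esub> b)" using * by auto
          show "p \<in> Idl\<^bsub>S\<^esub> B" unfolding C(2)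
            using C(1) S.genideal_self[OF Bc] by (intro S.lincomb_in_ideal[OF Bi] S.ideal_lmult[OF Bi]) (auto simp: Pi_iff)
        qed
      qed
      then show False using P(2) B(2) Bc by (auto simp: fg_def)
    next
      case False
      then have "fg (S.colon P {a})" using max[OF Ci _ PC] by auto
      then obtain D where D: "D \<subseteq> carrier S" "finite D" "S.colon P {a} = Idl\<^bsub>S\<^esub> D" by (auto simp: fg_def)
      let ?E = "B \<union> (\<lambda>d. d \<otimes>\<^bsub>S\<^esub> a) ` D"
      have DC: "D \<subseteq> S.colon P {a}" using S.genideal_self[OF D(1)] D(3) by simp
      have EP: "?E \<subseteq> P" using B(1) DC by (auto simp: S.colon_def)
      then have Ec: "?E \<subseteq> carrier S" using S.ideal_sub[OF P(1)] by auto
      note Ei = S.genideal_ideal[OF Ec]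
      have "P \<subseteq> Idl\<^bsub>S\<^esub> ?E"
      proof
        fix p assume "p \<in> P"
        from dec[OF this] obtain y z
          where yz: "y \<in> Idl\<^bsub>S\<^esub> B" "z \<in> S.colon P {a}" "p = y \<oplus>\<^bsub>S\<^esub> z \<otimes>\<^bsub>S\<^esub> a" by auto
        have "Idl\<^bsub>S\<^esub> B \<subseteq> Idl\<^bsub>S\<^esub> ?E" using S.genideal_self[OF Ec] by (intro S.genideal_minimal[OF Ei]) auto
        moreover have "Idl\<^bsub>S\<^esub> D \<subseteq> S.colon (Idl\<^bsub>S\<^esub> ?E) {a}"
        proof (rule S.genideal_minimal)
          show "ideal (S.colon (Idl\<^bsub>S\<^esub> ?E) {a}) S" using S.colon_ideal[OF Ei] ac by simp
          show "D \<subseteq> S.colon (Idl\<^bsub>S\<^esub> ?E) {a}" using S.genideal_self[OF Ec] D(1) by (auto simp: S.colon_def)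
        qed
        ultimately show "p \<in> Idl\<^bsub>S\<^esub> ?E" unfolding yz(3) using yz(1,2) D(3)
          by (intro S.ideal_add[OF Ei]) (auto simp: S.colon_def)
      qed
      then have "P = Idl\<^bsub>S\<^esub> ?E" using S.genideal_minimal[OF P(1) EP] by simp
      then show False using P(2) Ec B(2) D(2) unfolding fg_def by blast
    qed
  qed
  then have FP: "F 1 \<subseteq> P" by auto
  have "P \<subseteq> F 1"
  proof
    fix s assume s: "s \<in> P"
    show "s \<in> F 1"
    proof (rule ccontr)
      assume "s \<notin> F 1"
      then obtain t where t: "t \<in> carrier S" "t \<otimes>\<^bsub>S\<^esub> s = \<one>\<^bsub>S\<^esub>" using unit_of_notin_F1 S.ideal_carr[OF P(1) s] by auto
      then show False using S.ideal_lmult[OF P(1) s t(1)] one by simp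
    qed
  qed
  then have PF: "P = ext m" using FP F_eq_ext[of 1] R.ipow_1[OF R.m_ideal] by simp
  obtain A where A: "A \<subseteq> carrier R" "finite A" "m = Idl A" using R.finetely_gen[OF R.m_ideal] by auto
  have hA: "h ` A \<subseteq> carrier S" using A(1) h_closed by auto
  note hAi = S.genideal_ideal[OF hA]
  have "ideal {r \<in> carrier R. h r \<in> Idl\<^bsub>S\<^esub> (h ` A)} R"
  proof (rule R.ideal_crit)
    show "\<zero> \<in> {r \<in> carrier R. h r \<in> Idl\<^bsub>S\<^esub> (h ` A)}" using S.ideal_zero[OF hAi] by simp
  qed (use S.ideal_add[OF hAi] S.ideal_lmult[OF hAi] h_closed in \<open>auto simp: h_add h_mult\<close>)
  moreover have "A \<subseteq> {r \<in> carrier R. h r \<in> Idl\<^bsub>S\<^esub> (h ` A)}" using A(1) S.genideal_self[OF hA] by auto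
  ultimately have mA: "m \<subseteq> {r \<in> carrier R. h r \<in> Idl\<^bsub>S\<^esub> (h ` A)}" using R.genideal_minimal A(3) by metis
  have "ext m \<subseteq> Idl\<^bsub>S\<^esub> (h ` A)" using mA by (intro ext_least[OF hAi]) auto
  moreover have "Idl\<^bsub>S\<^esub> (h ` A) \<subseteq> ext m"
    using ext_self[OF R.ideal_sub[OF R.m_ideal]] R.genideal_self[OF A(1)] A(3)
    by (intro S.genideal_minimal ext_ideal R.ideal_sub[OF R.m_ideal]) auto
  ultimately have "fg P" unfolding fg_def PF using hA A(2) by (intro exI[of _ "h ` A"]) auto
  then show False using P(2) by simp
qed

lemma S_noeth_local: "noeth_local S (F 1)"
proof -
  interpret S': noetherian_ring S by (rule S_noetherian)
  have one: "\<one>\<^bsub>S\<^esub> \<notin> F 1"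
    using F_R[OF R.one_closed, of 1] h_one R.ipow_1[OF R.m_ideal] R.prime_one[OF R.m_prime] by simp
  have full: "J = carrier S" if J: "ideal J S" "\<not> J \<subseteq> F 1" for J
  proof -
    obtain s where s: "s \<in> J" "s \<notin> F 1" using J(2) by auto
    then obtain t where t: "t \<in> carrier S" "t \<otimes>\<^bsub>S\<^esub> s = \<one>\<^bsub>S\<^esub>" using unit_of_notin_F1 S.ideal_carr[OF J(1)] by blast
    then have "\<one>\<^bsub>S\<^esub> \<in> J" using S.ideal_lmult[OF J(1) s(1) t(1)] by simp
    then show ?thesis using ideal.one_imp_carrier[OF J(1)] by simp
  qed
  have mx: "maximalideal (F 1) S"
  proof (rule maximalidealI[OF F_ideal])
    show "carrier S \<noteq> F 1" using one by auto
  qed (use full in auto)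
  have un: "M = F 1" if M: "maximalideal M S" for M
  proof -
    interpret M: maximalideal M S by (rule M)
    have "M \<subseteq> F 1" using full[OF M.is_ideal] M.I_notcarr by auto
    then show "M = F 1" using M.I_maximal[OF F_ideal, of 1] S.ideal_sub[OF F_ideal, of 1] one by auto
  qed
  show ?thesis
    by (intro noeth_local.intro noetherian_cring.intro noeth_local_axioms.intro S.cring_axioms S_noetherian mx un)
qed

sublocale S: noeth_local S "F 1"
  by (rule S_noeth_local)

end

section \<open>Flatness of the completion\<close>

context completion_pair
begin

text \<open>Identifies the filtration with the powers of the maximal ideal of \<open>S\<close>, so
  that Krull's intersection theorem in \<open>S\<close> makes every ideal closed.\<close>

lemma F_ipow: "F n = S.ipow (F 1) n"
proof
  show "S.ipow (F 1) n \<subseteq> F n"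
  proof (induct n)
    case 0 then show ?case by (simp add: F_0 S.ipow_0)
  next
    case (Suc n)
    have "S.ipow (F 1) (Suc n) \<subseteq> F (Suc n)" unfolding S.ipow_Suc
      using F_mult[of _ n _ 1] Suc by (intro S.prod_least[OF F_ideal]) auto
    then show ?case .
  qed
  note mi = R.ipow_ideal[OF R.m_ideal]
  have "h r \<in> S.ipow (F 1) n" if "r \<in> R.ipow m n" for r
    using that
  proof (induct n arbitrary: r)
    case 0 then show ?case by (simp add: R.ipow_0 S.ipow_0 h_closed)
  next
    case (Suc n)
    have "r \<in> R.ipow m n \<cdot> m" using Suc(2) by (simp add: R.ipow_Suc)
    then show ?case
    proof induct
      case (prod i j)
      have "h j \<in> F 1" using prod(2) F_R[of j 1] R.ideal_carr[OF R.m_ideal] R.ipow_1[OF R.m_ideal] by simp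
      then have "h i \<otimes>\<^bsub>S\<^esub> h j \<in> S.ipow (F 1) (Suc n)"
        unfolding S.ipow_Suc using Suc(1)[OF prod(1)] by (rule ideal_prod.prod[rotated])
      then show ?case using prod R.ideal_carr[OF mi] R.ideal_carr[OF R.m_ideal] by (simp add: h_mult)
    next
      case (sum a b)
      have "a \<in> carrier R" "b \<in> carrier R" using sum R.ideal_carr[OF R.prod_ideal[OF mi R.m_ideal]] by auto
      then show ?case using S.ideal_add[OF S.ipow_ideal[OF F_ideal] sum(2,4)] by (simp add: h_add)
    qed
  qed
  then show "F n \<subseteq> S.ipow (F 1) n"
    unfolding F_eq_ext[of n] by (intro ext_least S.ipow_ideal[OF F_ideal])
qed

lemma closed_ideal:
  assumes "ideal I S" "\<And>n. z \<in> I <+>\<^bsub>S\<^esub> F n" shows "z \<in> I"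
  by (rule S.krull_local[OF assms(1), unfolded F_ipow[symmetric], OF assms(2)])

lemma F_R_minus: "a \<in> carrier R \<Longrightarrow> b \<in> carrier R \<Longrightarrow> h a \<ominus>\<^bsub>S\<^esub> h b \<in> F n \<longleftrightarrow> a \<ominus> b \<in> R.ipow m n"
  using F_R[of "a \<ominus> b" n] h_minus[of a b] by simp

lemma mem_sumI: "ideal I S \<Longrightarrow> ideal J S \<Longrightarrow> z \<in> carrier S \<Longrightarrow> i \<in> I \<Longrightarrow> z \<ominus>\<^bsub>S\<^esub> i \<in> J \<Longrightarrow> z \<in> I <+>\<^bsub>S\<^esub> J"
proof -
  assume a: "ideal I S" "ideal J S" "z \<in> carrier S" "i \<in> I" "z \<ominus>\<^bsub>S\<^esub> i \<in> J"
  have "z = i \<oplus>\<^bsub>S\<^esub> (z \<ominus>\<^bsub>S\<^esub> i)" using S.add_minus_self[of z i] a S.ideal_carr[OF a(1)] by simp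
  then show ?thesis unfolding S.mem_sum using a by blast
qed

text \<open>Replacing the coefficients from \<open>S\<close> by nearby elements of \<open>R\<close>
  moves an element of \<open>I S\<close> into the image of \<open>I\<close>, at the cost of an error
  in the extension of \<open>m^n I\<close>.\<close>

lemma ext_approx:
  assumes I: "ideal I R" and z: "z \<in> ext I"
  shows "\<exists>i\<in>I. z \<ominus>\<^bsub>S\<^esub> h i \<in> ext (R.ipow m n \<cdot> I)"
proof -
  note mi = R.ipow_ideal[OF R.m_ideal, of n]
  note mI = R.prod_ideal[OF mi I]
  have E: "ideal (ext (R.ipow m n \<cdot> I)) S" (is "ideal ?E S") by (rule ext_ideal[OF R.ideal_sub[OF mI]])
  let ?K = "{z \<in> carrier S. \<exists>i\<in>I. z \<ominus>\<^bsub>S\<^esub> h i \<in> ?E}"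
  have K: "ideal ?K S"
  proof (rule S.ideal_crit)
    show "?K \<subseteq> carrier S" by auto
    have "\<zero>\<^bsub>S\<^esub> \<ominus>\<^bsub>S\<^esub> h \<zero> \<in> ?E" using S.ideal_zero[OF E] by (simp add: S.minus_eq)
    then show "\<zero>\<^bsub>S\<^esub> \<in> ?K" using R.ideal_zero[OF I] by blast
    fix a assume "a \<in> ?K"
    then obtain i where i: "a \<in> carrier S" "i \<in> I" "a \<ominus>\<^bsub>S\<^esub> h i \<in> ?E" by auto
    have ic: "i \<in> carrier R" "h i \<in> carrier S" using R.ideal_carr[OF I i(2)] h_closed by auto
    { fix b assume "b \<in> ?K"
      then obtain j where j: "b \<in> carrier S" "j \<in> I" "b \<ominus>\<^bsub>S\<^esub> h j \<in> ?E" by auto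
      have jc: "j \<in> carrier R" "h j \<in> carrier S" using R.ideal_carr[OF I j(2)] h_closed by auto
      have "(a \<oplus>\<^bsub>S\<^esub> b) \<ominus>\<^bsub>S\<^esub> (h i \<oplus>\<^bsub>S\<^esub> h j) = (a \<ominus>\<^bsub>S\<^esub> h i) \<oplus>\<^bsub>S\<^esub> (b \<ominus>\<^bsub>S\<^esub> h j)"
        using i(1) j(1) ic(2) jc(2) by algebra
      then have "(a \<oplus>\<^bsub>S\<^esub> b) \<ominus>\<^bsub>S\<^esub> h (i \<oplus> j) \<in> ?E" using S.ideal_add[OF E i(3) j(3)] ic jc by (simp add: h_add)
      then show "a \<oplus>\<^bsub>S\<^esub> b \<in> ?K" using i j R.ideal_add[OF I] by auto }
    { fix s assume s: "s \<in> carrier S"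
      obtain r where r: "r \<in> carrier R" "s \<ominus>\<^bsub>S\<^esub> h r \<in> F n" using dense[OF s] by auto
      have hr: "h r \<in> carrier S" using r h_closed by simp
      have 1: "u \<otimes>\<^bsub>S\<^esub> h i \<in> ?E" if u: "u \<in> F n" for u
      proof -
        have "ext (R.ipow m n) \<subseteq> {u \<in> carrier S. u \<otimes>\<^bsub>S\<^esub> h i \<in> ?E}"
        proof (rule ext_least)
          show "ideal {u \<in> carrier S. u \<otimes>\<^bsub>S\<^esub> h i \<in> ?E} S"
            using S.colon_ideal[OF E, of "{h i}"] ic by (simp add: S.colon_def)
          fix x assume x: "x \<in> R.ipow m n"
          have xc: "x \<in> carrier R" using R.ideal_carr[OF mi x] .
          have "h (x \<otimes> i) \<in> ?E" using ext_self[OF R.ideal_sub[OF mI] ideal_prod.prod[OF x i(2)]] .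
          then show "h x \<in> {u \<in> carrier S. u \<otimes>\<^bsub>S\<^esub> h i \<in> ?E}" using xc ic h_closed by (simp add: h_mult)
        qed
        then show ?thesis using u F_eq_ext[of n] by auto
      qed
      have "s \<otimes>\<^bsub>S\<^esub> a \<ominus>\<^bsub>S\<^esub> h r \<otimes>\<^bsub>S\<^esub> h i = s \<otimes>\<^bsub>S\<^esub> (a \<ominus>\<^bsub>S\<^esub> h i) \<oplus>\<^bsub>S\<^esub> (s \<ominus>\<^bsub>S\<^esub> h r) \<otimes>\<^bsub>S\<^esub> h i"
        using s hr ic(2) i(1) by algebra
      then have "s \<otimes>\<^bsub>S\<^esub> a \<ominus>\<^bsub>S\<^esub> h (r \<otimes> i) \<in> ?E"
        using S.ideal_add[OF E S.ideal_lmult[OF E i(3) s] 1[OF r(2)]] ic r by (simp add: h_mult)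
      then show "s \<otimes>\<^bsub>S\<^esub> a \<in> ?K" using s i R.ideal_lmult[OF I i(2) r(1)] by auto }
  qed
  have "ext I \<subseteq> ?K"
  proof (rule ext_least[OF K])
    fix i assume i: "i \<in> I"
    have "h i \<in> carrier S" using R.ideal_carr[OF I i] h_closed by simp
    then have eq: "h i \<ominus>\<^bsub>S\<^esub> h i = \<zero>\<^bsub>S\<^esub>" by (simp add: S.minus_eq S.r_neg)
    have "h i \<ominus>\<^bsub>S\<^esub> h i \<in> ?E" unfolding eq by (rule S.ideal_zero[OF E])
    then show "h i \<in> ?K" using i \<open>h i \<in> carrier S\<close> by blast
  qed
  then show ?thesis using z by auto
qed

lemma ext_ipow_prod_sub: "ideal I R \<Longrightarrow> ext (R.ipow m n \<cdot> I) \<subseteq> F n"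
  unfolding F_eq_ext[of n]
  by (intro ext_mono R.ideal_sub R.ipow_ideal R.m_ideal R.prod_sub1)

text \<open>By approximation \<open>r\<close> is within \<open>m^n\<close> of \<open>I\<close> for
  every \<open>n\<close>, and Krull's intersection theorem in \<open>R\<close> applies.\<close>

lemma ext_contract:
  assumes I: "ideal I R" and r: "r \<in> carrier R" and hr: "h r \<in> ext I"
  shows "r \<in> I"
proof (rule R.krull_local[OF I])
  fix n
  obtain i where i: "i \<in> I" "h r \<ominus>\<^bsub>S\<^esub> h i \<in> ext (R.ipow m n \<cdot> I)" using ext_approx[OF I hr] by blast
  have ic: "i \<in> carrier R" by (rule R.ideal_carr[OF I i(1)])
  have "h r \<ominus>\<^bsub>S\<^esub> h i \<in> F n" using i(2) ext_ipow_prod_sub[OF I] by auto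
  then have "r \<ominus> i \<in> R.ipow m n" using F_R_minus[OF r ic] by simp
  moreover have "r = i \<oplus> (r \<ominus> i)" using r ic by algebra
  ultimately show "r \<in> I <+> R.ipow m n" unfolding R.mem_sum using i(1) by blast
qed

text \<open>The substance of flatness, for one element: \<open>s\<close> is approximated by some
  \<open>r\<close> in \<open>R\<close>, Artin--Rees in \<open>R\<close> places \<open>r\<close> near
  the colon ideal, and ideals of \<open>S\<close> are closed.\<close>

lemma ext_colon1:
  assumes I: "ideal I R" and y: "y \<in> carrier R" and s: "s \<in> carrier S" and sy: "s \<otimes>\<^bsub>S\<^esub> h y \<in> ext I"
  shows "s \<in> ext (R.colon I {y})"
proof -
  have C: "ideal (R.colon I {y}) R" using R.colon_ideal[OF I] y by simp
  note Ci = ext_ideal[OF R.ideal_sub[OF C]] and Ii = ext_ideal[OF R.ideal_sub[OF I]]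
  show ?thesis
  proof (rule closed_ideal[OF Ci])
    fix N
    obtain n where n: "\<And>r. r \<in> carrier R \<Longrightarrow> r \<otimes> y \<in> I <+> R.ipow m n \<Longrightarrow> r \<in> R.colon I {y} <+> R.ipow m N"
      by (rule R.weak_artin_rees_colon[OF I y R.m_ideal]) (rule that)
    obtain r where r: "r \<in> carrier R" "s \<ominus>\<^bsub>S\<^esub> h r \<in> F (max n N)" using dense[OF s] by auto
    have hc: "h r \<in> carrier S" "h y \<in> carrier S" using r y h_closed by auto
    have r2: "s \<ominus>\<^bsub>S\<^esub> h r \<in> F n" "s \<ominus>\<^bsub>S\<^esub> h r \<in> F N" using r(2) F_antimono[of n "max n N"] F_antimono[of N "max n N"] by auto
    obtain i where i: "i \<in> I" "s \<otimes>\<^bsub>S\<^esub> h y \<ominus>\<^bsub>S\<^esub> h i \<in> F n"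
      using ext_approx[OF I sy, of n] ext_ipow_prod_sub[OF I, of n] by auto
    have ic: "i \<in> carrier R" "h i \<in> carrier S" using R.ideal_carr[OF I i(1)] h_closed by auto
    have "h r \<otimes>\<^bsub>S\<^esub> h y \<ominus>\<^bsub>S\<^esub> h i = (s \<otimes>\<^bsub>S\<^esub> h y \<ominus>\<^bsub>S\<^esub> h i) \<ominus>\<^bsub>S\<^esub> (s \<ominus>\<^bsub>S\<^esub> h r) \<otimes>\<^bsub>S\<^esub> h y"
      using hc ic(2) s by algebra
    also have "\<dots> \<in> F n" by (rule S.ideal_minus[OF F_ideal i(2) S.ideal_rmult[OF F_ideal r2(1) hc(2)]])
    finally have "r \<otimes> y \<ominus> i \<in> R.ipow m n" using F_R_minus[of "r \<otimes> y" i n] r(1) y ic(1) by (simp add: h_mult)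
    moreover have "r \<otimes> y = i \<oplus> (r \<otimes> y \<ominus> i)" using R.add_minus_self[of "r \<otimes> y" i] r(1) y ic by simp
    ultimately have "r \<otimes> y \<in> I <+> R.ipow m n" unfolding R.mem_sum using i(1) by blast
    then obtain c j where cj: "c \<in> R.colon I {y}" "j \<in> R.ipow m N" "r = c \<oplus> j" using n[OF r(1)] by (auto simp: R.mem_sum)
    have cc: "c \<in> carrier R" "j \<in> carrier R" "h c \<in> carrier S" "h j \<in> carrier S"
      using cj R.ideal_carr[OF C] R.ideal_carr[OF R.ipow_ideal[OF R.m_ideal]] h_closed by auto
    have "s \<ominus>\<^bsub>S\<^esub> h c = (s \<ominus>\<^bsub>S\<^esub> (h c \<oplus>\<^bsub>S\<^esub> h j)) \<oplus>\<^bsub>S\<^esub> h j" using s cc(3,4) by algebra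
    also have "\<dots> = (s \<ominus>\<^bsub>S\<^esub> h r) \<oplus>\<^bsub>S\<^esub> h j" using cj(3) cc by (simp add: h_add)
    also have "\<dots> \<in> F N" using r2(2) cj(2) F_R[OF cc(2)] by (intro S.ideal_add[OF F_ideal]) auto
    finally show "s \<in> ext (R.colon I {y}) <+>\<^bsub>S\<^esub> F N"
      by (rule mem_sumI[OF Ci F_ideal s ext_self[OF R.ideal_sub[OF C] cj(1)]])
  qed
qed

lemma ext_inter:
  assumes A: "ideal A R" and B: "ideal B R" and s: "s \<in> ext A" "s \<in> ext B"
  shows "s \<in> ext (A \<inter> B)"
proof -
  have C: "ideal (A \<inter> B) R" by (rule R.i_intersect[OF A B])
  note Ci = ext_ideal[OF R.ideal_sub[OF C]]
  have sc: "s \<in> carrier S" using S.ideal_carr[OF ext_ideal[OF R.ideal_sub[OF A]] s(1)] .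
  show ?thesis
  proof (rule closed_ideal[OF Ci])
    fix N
    obtain n where n: "\<And>a b. a \<in> A \<Longrightarrow> b \<in> B \<Longrightarrow> a \<ominus> b \<in> R.ipow m n \<Longrightarrow> \<exists>c\<in>A \<inter> B. a \<ominus> c \<in> R.ipow m N"
      by (rule R.weak_artin_rees_inter[OF A B R.m_ideal]) (rule that)
    let ?k = "max n N"
    obtain a b where ab: "a \<in> A" "s \<ominus>\<^bsub>S\<^esub> h a \<in> F ?k" "b \<in> B" "s \<ominus>\<^bsub>S\<^esub> h b \<in> F ?k"
      using ext_approx[OF A s(1), of ?k] ext_approx[OF B s(2), of ?k]
        ext_ipow_prod_sub[OF A, of ?k] ext_ipow_prod_sub[OF B, of ?k] by auto
    have c: "a \<in> carrier R" "b \<in> carrier R" "h a \<in> carrier S" "h b \<in> carrier S"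
      using ab R.ideal_carr[OF A] R.ideal_carr[OF B] h_closed by auto
    have "h a \<ominus>\<^bsub>S\<^esub> h b = (s \<ominus>\<^bsub>S\<^esub> h b) \<ominus>\<^bsub>S\<^esub> (s \<ominus>\<^bsub>S\<^esub> h a)" using c(3,4) sc by algebra
    also have "\<dots> \<in> F ?k" by (rule S.ideal_minus[OF F_ideal ab(4,2)])
    finally have "h a \<ominus>\<^bsub>S\<^esub> h b \<in> F n" using F_antimono[of n ?k] by auto
    then have "a \<ominus> b \<in> R.ipow m n" using F_R_minus[OF c(1,2)] by simp
    then obtain d where d: "d \<in> A \<inter> B" "a \<ominus> d \<in> R.ipow m N" using n ab by blast
    have dc: "d \<in> carrier R" "h d \<in> carrier S" using d R.ideal_carr[OF A] h_closed by auto
    have "s \<ominus>\<^bsub>S\<^esub> h d = (s \<ominus>\<^bsub>S\<^esub> h a) \<oplus>\<^bsub>S\<^esub> (h a \<ominus>\<^bsub>S\<^esub> h d)" using sc c(3) dc(2) by algebra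
    also have "\<dots> \<in> F N"
      using ab(2) F_antimono[of N ?k] d(2) F_R_minus[OF c(1) dc(1), of N]
      by (intro S.ideal_add[OF F_ideal]) auto
    finally show "s \<in> ext (A \<inter> B) <+>\<^bsub>S\<^esub> F N"
      by (rule mem_sumI[OF Ci F_ideal sc ext_self[OF R.ideal_sub[OF C] d(1)]])
  qed
qed

text \<open>Adding a generator \<open>x\<close> to \<open>J\<close> intersects the colon ideal with
  \<open>(I : x)\<close>, so \<open>ext_colon1\<close> and \<open>ext_inter\<close> combine along
  generators.\<close>

lemma ext_colon:
  assumes I: "ideal I R" and J: "ideal J R" and s: "s \<in> carrier S"
    and sJ: "\<And>y. y \<in> J \<Longrightarrow> s \<otimes>\<^bsub>S\<^esub> h y \<in> ext I"
  shows "s \<in> ext (R.colon I J)"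
  using J
proof (induct rule: R.noeth_ideal_induct)
  case zero
  have "R.colon I {\<zero>} = carrier R" using R.ideal_zero[OF I] by (auto simp: R.colon_def)
  moreover have "s \<otimes>\<^bsub>S\<^esub> h \<one> \<in> ext (carrier R)"
    using S.ideal_lmult[OF ext_ideal[OF order_refl] ext_self[OF order_refl R.one_closed] s] .
  ultimately show ?case using s by (simp add: h_one)
next
  case (step K x)
  have x: "x \<in> carrier R" using step R.ideal_carr[OF J] by auto
  have "s \<in> ext (R.colon I {x})" using ext_colon1[OF I x s] sJ step by simp
  then have "s \<in> ext (R.colon I K \<inter> R.colon I {x})"
    using step(3) R.colon_ideal[OF I R.ideal_sub[OF step(1)]] R.colon_ideal[OF I, of "{x}"] x by (intro ext_inter) auto
  moreover have "R.colon I K \<inter> R.colon I {x} \<subseteq> R.colon I (K <+> PIdl x)"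
  proof
    fix r assume r: "r \<in> R.colon I K \<inter> R.colon I {x}"
    then have rc: "r \<in> carrier R" by (simp add: R.colon_def)
    have "r \<otimes> z \<in> I" if z: "z \<in> K <+> PIdl x" for z
    proof -
      obtain k t where k: "k \<in> K" "t \<in> carrier R" "z = k \<oplus> t \<otimes> x" using z by (auto simp: R.mem_sum_PIdl)
      have kc: "k \<in> carrier R" using R.ideal_carr[OF step(1) k(1)] .
      have "r \<otimes> z = r \<otimes> k \<oplus> t \<otimes> (r \<otimes> x)" unfolding k(3) using rc kc k(2) x by algebra
      also have "\<dots> \<in> I"
        using r k by (intro R.ideal_add[OF I] R.ideal_lmult[OF I, of "r \<otimes> x" t]) (auto simp: R.colon_def)
      finally show ?thesis .
    qed
    then show "r \<in> R.colon I (K <+> PIdl x)" using rc by (simp add: R.colon_def)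
  qed
  moreover have "ideal (R.colon I (K <+> PIdl x)) R"
    using R.ideal_sub[OF R.PIdl_sum_ideal[OF step(1) x]] by (rule R.colon_ideal[OF I])
  ultimately show ?case using ext_mono R.ideal_sub by blast
qed

definition contract :: "'c set \<Rightarrow> 'a set" where "contract P = {r \<in> carrier R. h r \<in> P}"

lemma contract_prime:
  assumes P: "primeideal P S" shows "primeideal (contract P) R"
proof (rule R.primeideal_crit)
  note Pi = S.primeideal_ideal[OF P]
  show "ideal (contract P) R"
  proof (rule R.ideal_crit)
    show "\<zero> \<in> contract P" using S.ideal_zero[OF Pi] by (simp add: contract_def)
  qed (use S.ideal_add[OF Pi] S.ideal_lmult[OF Pi] h_closed in \<open>auto simp: contract_def h_add h_mult\<close>)
  show "\<one> \<notin> contract P" using S.prime_one[OF P] by (simp add: contract_def)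
  show "a \<in> contract P \<or> b \<in> contract P" if "a \<in> carrier R" "b \<in> carrier R" "a \<otimes> b \<in> contract P" for a b
    using that S.prime_mult_iff[OF P, of "h a" "h b"] h_closed by (auto simp: contract_def h_mult)
qed

lemma contract_F1: "contract (F 1) = m"
  using F_R[of _ 1] R.ipow_1[OF R.m_ideal] R.ideal_carr[OF R.m_ideal] by (auto simp: contract_def)

lemma ext_sub_iff: "I \<subseteq> carrier R \<Longrightarrow> ideal P S \<Longrightarrow> ext I \<subseteq> P \<longleftrightarrow> I \<subseteq> contract P"
  using ext_self[of I] ext_least[of P I] by (auto simp: contract_def)

text \<open>Going-down for the flat map \<open>h\<close>, in the form used later. If a prime
  \<open>q\<close> over \<open>I\<close> were strictly inside \<open>contract Q\<close>, some
  \<open>y\<close> in the difference would satisfy \<open>s (h y)^n \<in> q S\<close> with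
  \<open>s\<close> outside \<open>Q\<close>. Flatness gives \<open>s \<in> (q : y^n) S\<close>, and
  \<open>(q : y^n) = q\<close> because \<open>y\<close> is outside \<open>q\<close>; so
  \<open>s\<close> lies in \<open>Q\<close> after all.\<close>

lemma going_down:
  assumes I: "ideal I R" and Q: "S.min_over Q (ext I)" shows "R.min_over (contract Q) I"
proof -
  have Qp: "primeideal Q S" and IQ: "ext I \<subseteq> Q" using Q by (auto simp: S.min_over_def)
  note Ii = ext_ideal[OF R.ideal_sub[OF I]]
  have "I \<subseteq> contract Q" using ext_sub_iff[OF R.ideal_sub[OF I] S.primeideal_ideal[OF Qp]] IQ by simp
  moreover have "q = contract Q" if q: "primeideal q R" "I \<subseteq> q" "q \<subseteq> contract Q" for q
  proof (rule ccontr)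
    assume "q \<noteq> contract Q"
    then obtain y where y: "y \<in> contract Q" "y \<notin> q" using q(3) by auto
    have yc: "y \<in> carrier R" "h y \<in> Q" using y(1) by (auto simp: contract_def)
    note qi = R.primeideal_ideal[OF q(1)]
    obtain s n where s: "s \<in> carrier S" "s \<notin> Q" "s \<otimes>\<^bsub>S\<^esub> h y [^]\<^bsub>S\<^esub> (n::nat) \<in> ext I"
      using S.min_over_pow[OF Q Ii yc(2)] by auto
    have yn: "y [^] n \<in> carrier R" using yc by simp
    have "h (y [^] n) = h y [^]\<^bsub>S\<^esub> n" using yc(1) by (simp add: hom.hom_pow)
    then have "s \<otimes>\<^bsub>S\<^esub> h (y [^] n) \<in> ext q" using s(3) ext_mono[OF R.ideal_sub[OF qi] q(2)] by auto
    then have "s \<in> ext (R.colon q {y [^] n})" by (rule ext_colon1[OF qi yn s(1)])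
    moreover have "R.colon q {y [^] n} \<subseteq> contract Q"
      using R.prime_mult_iff[OF q(1) _ yn] R.prime_pow[OF q(1) yc(1), of n] y(2) q(3) by (auto simp: R.colon_def)
    then have "ext (R.colon q {y [^] n}) \<subseteq> Q"
      using ext_sub_iff[OF _ S.primeideal_ideal[OF Qp], of "R.colon q {y [^] n}"] by (auto simp: R.colon_def)
    ultimately show False using s(2) by auto
  qed
  ultimately show ?thesis using contract_prime[OF Qp] by (simp add: R.min_over_def)
qed

text \<open>If no \<open>J n\<close> lies in the open ideal \<open>T\<close>, stationarity modulo
  each \<open>F M\<close> yields a Cauchy sequence through deeper and deeper \<open>J n\<close> that
  starts outside \<open>T\<close>. Its limit lies in every \<open>J n\<close>, hence in
  \<open>T\<close>, but differs from the first term by an element of \<open>F N\<close>.\<close>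

lemma chevalley:
  assumes J: "\<And>n. ideal (J n) S" "\<And>n. J (Suc n) \<subseteq> J n" and T: "ideal T S" "F N \<subseteq> T"
    and int: "\<And>z. (\<And>n. z \<in> J n) \<Longrightarrow> z \<in> T"
  shows "\<exists>n. \<forall>k\<ge>n. J k \<subseteq> T"
proof -
  have Jm: "J k \<subseteq> J n" if "n \<le> k" for n k using lift_Suc_antimono_le[of J, OF J(2) that] .
  have JF: "ideal (J n <+>\<^bsub>S\<^esub> F k) S" for n k by (rule S.add_ideals[OF J(1) F_ideal])
  have "\<exists>n. \<forall>k\<ge>n. J k <+>\<^bsub>S\<^esub> F M = J n <+>\<^bsub>S\<^esub> F M" for M
  proof (rule S.dcc_loc[OF S.m_prime])
    show "ideal (J n <+>\<^bsub>S\<^esub> F M) S" for n by (rule JF)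
    show "J (Suc n) <+>\<^bsub>S\<^esub> F M \<subseteq> J n <+>\<^bsub>S\<^esub> F M" for n by (rule S.sum_mono[OF J(2) order_refl])
    show "S.sat (F 1) (J n <+>\<^bsub>S\<^esub> F M) \<subseteq> J n <+>\<^bsub>S\<^esub> F M" for n using S.sat_m[OF JF] by simp
    show "S.ipow (F 1) M \<subseteq> J n <+>\<^bsub>S\<^esub> F M" for n
      unfolding F_ipow[symmetric] by (rule S.sum_ub2[OF J(1) F_ideal])
  qed
  then obtain v0 where v0: "\<And>M k. k \<ge> v0 M \<Longrightarrow> J k <+>\<^bsub>S\<^esub> F M = J (v0 M) <+>\<^bsub>S\<^esub> F M" by metis
  \<comment> \<open>Partial sums make the indices monotone in \<open>M\<close>, and from
    \<open>v M\<close> on the ideals \<open>J k + F M\<close> are still constant.\<close>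
  define v where "v M = (\<Sum>i\<le>M. v0 i)" for M
  have vge: "v0 M \<le> v M" for M unfolding v_def by (rule member_le_sum) auto
  have vmono: "v M \<le> v (Suc M)" for M by (simp add: v_def)
  have stab: "J k <+>\<^bsub>S\<^esub> F M = J (v M) <+>\<^bsub>S\<^esub> F M" if "k \<ge> v M" for k M
    using v0[of M k] v0[of M "v M"] vge[of M] that by simp
  have "\<exists>n. J n \<subseteq> T"
  proof (rule ccontr)
    assume no: "\<not> (\<exists>n. J n \<subseteq> T)"
    have "\<exists>w. \<forall>i. (w i \<in> J (v (N + i)) \<and> (i = 0 \<longrightarrow> w i \<notin> T)) \<and> w (Suc i) \<ominus>\<^bsub>S\<^esub> w i \<in> F (N + i)"
    proof (rule dependent_nat_choice)
      show "\<exists>x. x \<in> J (v (N + 0)) \<and> ((0::nat) = 0 \<longrightarrow> x \<notin> T)" using no by auto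
      fix x i assume x: "x \<in> J (v (N + i)) \<and> (i = 0 \<longrightarrow> x \<notin> T)"
      have xc: "x \<in> carrier S" using x S.ideal_carr[OF J(1)] by auto
      have "x \<in> J (v (N + i)) <+>\<^bsub>S\<^esub> F (N + i)" using x S.sum_ub1[OF J(1) F_ideal] by auto
      also have "\<dots> = J (v (N + Suc i)) <+>\<^bsub>S\<^esub> F (N + i)" using stab[of "N + i" "v (N + Suc i)"] vmono[of "N + i"] by simp
      finally obtain y f where yf: "y \<in> J (v (N + Suc i))" "f \<in> F (N + i)" "x = y \<oplus>\<^bsub>S\<^esub> f" by (auto simp: S.mem_sum)
      have c: "y \<in> carrier S" "f \<in> carrier S" using yf S.ideal_carr[OF J(1)] F_carr by auto
      have "y \<ominus>\<^bsub>S\<^esub> x = \<ominus>\<^bsub>S\<^esub> f" unfolding yf(3) using c by algebra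
      then have "y \<ominus>\<^bsub>S\<^esub> x \<in> F (N + i)" using S.ideal_neg[OF F_ideal yf(2)] by simp
      then show "\<exists>y. (y \<in> J (v (N + Suc i)) \<and> (Suc i = 0 \<longrightarrow> y \<notin> T)) \<and> y \<ominus>\<^bsub>S\<^esub> x \<in> F (N + i)" using yf(1) by auto
    qed
    then obtain w where w: "\<And>i. w i \<in> J (v (N + i))" "w 0 \<notin> T" "\<And>i. w (Suc i) \<ominus>\<^bsub>S\<^esub> w i \<in> F (N + i)" by auto
    have wc: "w i \<in> carrier S" for i using w(1) S.ideal_carr[OF J(1)] by auto
    \<comment> \<open>Truncated subtraction keeps the sequence constant up to index
      \<open>N\<close>, which compensates the shift by \<open>N\<close> in the increments of
      \<open>w\<close>.\<close>
    have "w (Suc n - N) \<ominus>\<^bsub>S\<^esub> w (n - N) \<in> F n" for n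
    proof (cases "n \<ge> N")
      case True then show ?thesis using w(3)[of "n - N"] by (simp add: Suc_diff_le)
    next
      case False
      have "w 0 \<ominus>\<^bsub>S\<^esub> w 0 = \<zero>\<^bsub>S\<^esub>" using wc by (simp add: S.minus_eq S.r_neg)
      then show ?thesis using False S.ideal_zero[OF F_ideal] by simp
    qed
    then obtain t where t: "t \<in> carrier S" "\<And>n. t \<ominus>\<^bsub>S\<^esub> w (n - N) \<in> F n"
      using complete[of "\<lambda>n. w (n - N)"] wc by auto
    have "t \<in> J n" for n
    proof (rule closed_ideal[OF J(1)])
      fix M
      have "t \<in> J (v (N + M)) <+>\<^bsub>S\<^esub> F (N + M)"
        using mem_sumI[OF J(1) F_ideal t(1) w(1), of M "N + M"] t(2)[of "N + M"] by simp
      then have "t \<in> J (max n (v (N + M))) <+>\<^bsub>S\<^esub> F (N + M)" using stab[of "N + M" "max n (v (N + M))"] by simp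
      moreover have "J (max n (v (N + M))) <+>\<^bsub>S\<^esub> F (N + M) \<subseteq> J n <+>\<^bsub>S\<^esub> F M"
        by (intro S.sum_mono Jm F_antimono) auto
      ultimately show "t \<in> J n <+>\<^bsub>S\<^esub> F M" by auto
    qed
    then have tN: "t \<in> T" by (rule int)
    have "w 0 \<ominus>\<^bsub>S\<^esub> t \<in> F N" using S.ideal_minus_swap[OF F_ideal, of t "w 0" N] t(2)[of N] t(1) wc by simp
    then have "w 0 \<in> T" using S.ideal_cancel_minus[OF T(1) _ tN wc] T(2) by auto
    then show False using w(2) by simp
  qed
  then obtain n where "J n \<subseteq> T" by auto
  then have "\<forall>k\<ge>n. J k \<subseteq> T" using Jm by blast
  then show ?thesis by blast
qed

end

section \<open>Parameters with small colon ideals\<close>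

context cring
begin

text \<open>Recursion on the last index fits the choice of one parameter after another. The
  parameters are \<open>a 0, ..., a (j - 1)\<close>.\<close>

primrec aprod :: "(nat \<Rightarrow> 'a) \<Rightarrow> nat \<Rightarrow> 'a" where
  "aprod a 0 = \<one>"
| "aprod a (Suc j) = aprod a j \<otimes> a j"

primrec sqid :: "(nat \<Rightarrow> 'a) \<Rightarrow> nat \<Rightarrow> 'a set" where
  "sqid a 0 = {\<zero>}"
| "sqid a (Suc j) = sqid a j <+> PIdl (a j \<otimes> a j)"

lemma aprod_closed: "(\<And>l. l < j \<Longrightarrow> a l \<in> carrier R) \<Longrightarrow> aprod a j \<in> carrier R"
  by (induct j) auto

lemma sqid_ideal: "(\<And>l. l < j \<Longrightarrow> a l \<in> carrier R) \<Longrightarrow> ideal (sqid a j) R"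
  by (induct j) (auto intro!: PIdl_sum_ideal zeroideal)

lemma aprod_cong: "(\<And>l. l < j \<Longrightarrow> a l = b l) \<Longrightarrow> aprod a j = aprod b j"
  by (induct j) auto

lemma sqid_cong: "(\<And>l. l < j \<Longrightarrow> a l = b l) \<Longrightarrow> sqid a j = sqid b j"
  by (induct j) auto

text \<open>Otherwise a product of elements outside \<open>P\<close>, one from each
  \<open>J\<close>, lies in the intersection but not in \<open>P\<close>. Writing the intersection
  inside the carrier makes it the whole ring for the empty family.\<close>

lemma prime_finite_inter:
  assumes P: "primeideal P R" and "finite FF" "\<And>J. J \<in> FF \<Longrightarrow> ideal J R"
    and "{z \<in> carrier R. \<forall>J\<in>FF. z \<in> J} \<subseteq> P"
  shows "\<exists>J\<in>FF. J \<subseteq> P"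
proof (rule ccontr)
  assume n: "\<not> ?thesis"
  have "\<exists>z\<in>carrier R. z \<notin> P \<and> (\<forall>J\<in>Y. z \<in> J)" if "finite Y" "Y \<subseteq> FF" for Y
    using that
  proof (induct Y)
    case empty then show ?case using prime_one[OF P] by auto
  next
    case (insert J Y)
    then obtain z where z: "z \<in> carrier R" "z \<notin> P" "\<forall>J\<in>Y. z \<in> J" by auto
    have J: "ideal J R" "J \<in> FF" using insert assms(3) by auto
    obtain w where w: "w \<in> J" "w \<notin> P" using n J(2) by auto
    have wc: "w \<in> carrier R" using ideal_carr[OF J(1) w(1)] .
    have "z \<otimes> w \<in> J'" if "J' \<in> Y" for J'
      using ideal_rmult[OF assms(3), of J' z w] z(3) that insert(4) wc by auto
    moreover have "z \<otimes> w \<in> J" by (rule ideal_lmult[OF J(1) w(1) z(1)])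
    moreover have "z \<otimes> w \<notin> P" using prime_mult_iff[OF P z(1) wc] z w by simp
    ultimately show ?case using z(1) wc by (intro bexI[of _ "z \<otimes> w"]) auto
  qed
  from this[OF assms(2) order_refl] show False using assms(4) by auto
qed

text \<open>Only a lower bound: the coheight of \<open>P\<close> is at least \<open>n\<close>.\<close>

definition coht :: "'a set \<Rightarrow> nat \<Rightarrow> bool" where
  "coht P n \<longleftrightarrow> (\<exists>c. prime_chain R c n \<and> c 0 = P)"

lemma coht_less:
  assumes "primeideal P R" "P \<subset> Q" "coht Q n" shows "coht P (Suc n)"
proof -
  obtain c where c: "prime_chain R c n" "c 0 = Q" using assms(3) by (auto simp: coht_def)
  have "prime_chain R (case_nat P c) (Suc n)"
    using c assms(1,2) by (auto simp: prime_chain_def split: nat.split)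
  then show ?thesis unfolding coht_def by (intro exI[of _ "case_nat P c"]) simp
qed

lemma coht_mono:
  assumes "primeideal P R" "P \<subseteq> Q" "coht Q n" shows "coht P n"
proof -
  obtain c where c: "prime_chain R c n" "c 0 = Q" using assms(3) by (auto simp: coht_def)
  have "prime_chain R (c(0 := P)) n"
    using c assms(1,2) by (auto simp: prime_chain_def)
  then show ?thesis unfolding coht_def by (intro exI[of _ "c(0 := P)"]) simp
qed

lemma coht_chain:
  assumes "prime_chain R c n" "i \<le> n" shows "coht (c i) (n - i)"
  using assms unfolding coht_def by (intro exI[of _ "\<lambda>l. c (i + l)"]) (auto simp: prime_chain_def)

lemma coht_chain_up:
  assumes c: "prime_chain R c n" and "i \<le> n" and "coht (c i) l" shows "coht (c 0) (i + l)"
  using assms(2,3)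
proof (induct i arbitrary: l)
  case (Suc i)
  then have "coht (c i) (Suc l)" using coht_less[of "c i" "c (Suc i)" l] c by (auto simp: prime_chain_def)
  then have "coht (c 0) (i + Suc l)" using Suc(1)[of "Suc l"] Suc(2) by simp
  then show ?case by simp
qed simp

end

text \<open>A prime \<open>q\<close> maximal among those over \<open>P\<close> with coheight at
  least \<open>k\<close> has coheight exactly \<open>k\<close>, since the second term of a longer
  chain would be a larger such prime. The terms of a chain of length \<open>k\<close> from
  \<open>q\<close> then also have exact coheights; this keeps the chains over different minimal
  primes apart.\<close>

lemma (in noetherian_cring) exact_chain:
  assumes P: "primeideal P R" and k: "coht P k"
  shows "\<exists>c. prime_chain R c k \<and> P \<subseteq> c 0 \<and> (\<forall>i\<le>k. \<not> coht (c i) (Suc (k - i)))"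
proof -
  let ?C = "{Q. primeideal Q R \<and> P \<subseteq> Q \<and> coht Q k}"
  have "?C \<noteq> {}" using assms by auto
  then obtain q where q: "q \<in> ?C" and max: "\<And>Q. Q \<in> ?C \<Longrightarrow> q \<subseteq> Q \<Longrightarrow> Q = q"
    by (rule noeth_max) (auto intro: primeideal_ideal)
  have nq: "\<not> coht q (Suc k)"
  proof
    assume "coht q (Suc k)"
    then obtain d where d: "prime_chain R d (Suc k)" "d 0 = q" by (auto simp: coht_def)
    have "coht (d 1) k" using coht_chain[OF d(1), of 1] by simp
    moreover have "primeideal (d 1) R" "q \<subset> d 1" using d by (auto simp: prime_chain_def)
    ultimately show False using max[of "d 1"] q by auto
  qed
  obtain c where c: "prime_chain R c k" "c 0 = q" using q by (auto simp: coht_def)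
  have "\<not> coht (c i) (Suc (k - i))" if "i \<le> k" for i
    using coht_chain_up[OF c(1) that, of "Suc (k - i)"] that nq c(2) by auto
  then show ?thesis using c q by auto
qed

context completion_pair
begin

text \<open>
  Each \<open>a j\<close> is a high power of \<open>x j\<close>. As the exponent grows, the localized colon conditions at level
  \<open>j + 1\<close> intersect, by Krull, in the conditions at level \<open>j\<close>; Chevalley's theorem turns this into one exponent.
\<close>

lemma bounded_colon_chains:
  assumes I: "finite I"
    and q: "\<And>i j. i \<in> I \<Longrightarrow> j \<le> k \<Longrightarrow> primeideal (q i j) S" "\<And>i j. i \<in> I \<Longrightarrow> j < k \<Longrightarrow> q i j \<subseteq> q i (Suc j)"
    and x: "\<And>j. j < k \<Longrightarrow> x j \<in> carrier S" "\<And>i j. i \<in> I \<Longrightarrow> j < k \<Longrightarrow> x j \<in> q i (Suc j)"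
       "\<And>i j. i \<in> I \<Longrightarrow> j < k \<Longrightarrow> x j \<notin> q i j"
    and T: "\<And>i. i \<in> I \<Longrightarrow> ideal (T i) S" "\<And>i. i \<in> I \<Longrightarrow> F N \<subseteq> T i"
       "\<And>i. i \<in> I \<Longrightarrow> S.sat (q i 0) {\<zero>\<^bsub>S\<^esub>} \<subseteq> T i"
    and "j \<le> k"
  shows "\<exists>a. (\<forall>l. a l \<in> carrier S) \<and>
    (\<forall>i\<in>I. \<forall>w\<in>carrier S. w \<otimes>\<^bsub>S\<^esub> S.aprod a j \<in> S.sat (q i j) (S.sqid a j) \<longrightarrow> w \<in> T i)"
  using \<open>j \<le> k\<close>
proof (induct j)
  case 0
  have "(\<forall>i\<in>I. \<forall>w\<in>carrier S. w \<otimes>\<^bsub>S\<^esub> S.aprod (\<lambda>_. \<zero>\<^bsub>S\<^esub>) 0 \<in> S.sat (q i 0) (S.sqid (\<lambda>_. \<zero>\<^bsub>S\<^esub>) 0) \<longrightarrow> w \<in> T i)"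
    using T(3) by auto
  then show ?case by (intro exI[of _ "\<lambda>_. \<zero>\<^bsub>S\<^esub>"]) auto
next
  case (Suc j)
  then have jk: "j < k" by simp
  obtain a where a: "\<And>l. a l \<in> carrier S"
    and IH: "\<And>i w. i \<in> I \<Longrightarrow> w \<in> carrier S \<Longrightarrow> w \<otimes>\<^bsub>S\<^esub> S.aprod a j \<in> S.sat (q i j) (S.sqid a j) \<Longrightarrow> w \<in> T i"
    using Suc by auto
  define A where "A = S.aprod a j"
  define Q where "Q = S.sqid a j"
  define y where "y = x j"
  have Ac: "A \<in> carrier S" unfolding A_def by (rule S.aprod_closed[OF a])
  have Qi: "ideal Q S" unfolding Q_def by (rule S.sqid_ideal[OF a])
  have yc: "y \<in> carrier S" unfolding y_def by (rule x(1)[OF jk])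
  \<comment> \<open>The union of the colon ideals of \<open>Q\<close> by the powers of
    \<open>y\<close>. It absorbs the factor \<open>y^n\<close> that is cancelled at the end.\<close>
  define Qy where "Qy = {z \<in> carrier S. \<exists>t::nat. y [^]\<^bsub>S\<^esub> t \<otimes>\<^bsub>S\<^esub> z \<in> Q}"
  have Qyi: "ideal Qy S"
  proof (rule S.ideal_crit)
    show "Qy \<subseteq> carrier S" by (auto simp: Qy_def)
    show "\<zero>\<^bsub>S\<^esub> \<in> Qy" using S.ideal_zero[OF Qi] yc by (auto simp: Qy_def)
    fix u assume "u \<in> Qy"
    then obtain s :: nat where s: "u \<in> carrier S" "y [^]\<^bsub>S\<^esub> s \<otimes>\<^bsub>S\<^esub> u \<in> Q" by (auto simp: Qy_def)
    { fix v assume "v \<in> Qy"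
      then obtain t :: nat where t: "v \<in> carrier S" "y [^]\<^bsub>S\<^esub> t \<otimes>\<^bsub>S\<^esub> v \<in> Q" by (auto simp: Qy_def)
      have "y [^]\<^bsub>S\<^esub> (s + t) \<otimes>\<^bsub>S\<^esub> (u \<oplus>\<^bsub>S\<^esub> v) = y [^]\<^bsub>S\<^esub> t \<otimes>\<^bsub>S\<^esub> (y [^]\<^bsub>S\<^esub> s \<otimes>\<^bsub>S\<^esub> u) \<oplus>\<^bsub>S\<^esub> y [^]\<^bsub>S\<^esub> s \<otimes>\<^bsub>S\<^esub> (y [^]\<^bsub>S\<^esub> t \<otimes>\<^bsub>S\<^esub> v)"
        using s(1) t(1) yc by (simp add: S.nat_pow_mult[symmetric] S.r_distr S.m_ac)
      also have "\<dots> \<in> Q"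
        using S.ideal_lmult[OF Qi s(2), of "y [^]\<^bsub>S\<^esub> t"] S.ideal_lmult[OF Qi t(2), of "y [^]\<^bsub>S\<^esub> s"] yc
        by (intro S.ideal_add[OF Qi]) auto
      finally have "y [^]\<^bsub>S\<^esub> (s + t) \<otimes>\<^bsub>S\<^esub> (u \<oplus>\<^bsub>S\<^esub> v) \<in> Q" .
      then show "u \<oplus>\<^bsub>S\<^esub> v \<in> Qy" using s(1) t(1) unfolding Qy_def by blast }
    { fix r assume r: "r \<in> carrier S"
      have "y [^]\<^bsub>S\<^esub> s \<otimes>\<^bsub>S\<^esub> (r \<otimes>\<^bsub>S\<^esub> u) = r \<otimes>\<^bsub>S\<^esub> (y [^]\<^bsub>S\<^esub> s \<otimes>\<^bsub>S\<^esub> u)" using s(1) r yc by (simp add: S.m_ac)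
      then have "y [^]\<^bsub>S\<^esub> s \<otimes>\<^bsub>S\<^esub> (r \<otimes>\<^bsub>S\<^esub> u) \<in> Q" using S.ideal_lmult[OF Qi s(2) r] by simp
      then show "r \<otimes>\<^bsub>S\<^esub> u \<in> Qy" using s(1) r unfolding Qy_def by blast }
  qed
  define G where "G n = Qy <+>\<^bsub>S\<^esub> PIdl\<^bsub>S\<^esub> (y [^]\<^bsub>S\<^esub> n)" for n :: nat
  have Gi: "ideal (G n) S" for n unfolding G_def using S.PIdl_sum_ideal[OF Qyi] yc by simp
  have Gdec: "G (Suc n) \<subseteq> G n" for n
  proof -
    have "y \<otimes>\<^bsub>S\<^esub> y [^]\<^bsub>S\<^esub> n \<in> G n"
      using S.ideal_lmult[OF Gi _ yc] S.PIdl_sum_mem[OF Qyi, of "y [^]\<^bsub>S\<^esub> n"] yc by (simp add: G_def)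
    then have "y [^]\<^bsub>S\<^esub> Suc n \<in> G n" using yc by (simp add: S.m_comm)
    then show ?thesis unfolding G_def[of "Suc n"]
      using S.PIdl_sum_sub[OF Qyi, of "y [^]\<^bsub>S\<^esub> n"] yc by (intro S.PIdl_sum_least[OF Gi]) (auto simp: G_def)
  qed
  have "\<exists>n. \<forall>l\<ge>n. S.colon (S.sat (q i (Suc j)) (G l)) {A} \<subseteq> T i" if i: "i \<in> I" for i
  proof (rule chevalley)
    have qp: "primeideal (q i (Suc j)) S" and qp0: "primeideal (q i j) S" using q(1)[OF i] jk by auto
    note qi = S.primeideal_ideal[OF qp]
    show "ideal (S.colon (S.sat (q i (Suc j)) (G n)) {A}) S" for n
      using S.colon_ideal[OF S.sat_ideal[OF qp Gi]] Ac by simp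
    show "S.colon (S.sat (q i (Suc j)) (G (Suc n))) {A} \<subseteq> S.colon (S.sat (q i (Suc j)) (G n)) {A}" for n
      by (intro S.colon_mono1 S.sat_mono Gdec)
    show "ideal (T i) S" "F N \<subseteq> T i" using T i by auto
    fix w assume w: "\<And>n. w \<in> S.colon (S.sat (q i (Suc j)) (G n)) {A}"
    then have wc: "w \<in> carrier S" by (simp add: S.colon_def)
    \<comment> \<open>Since \<open>y\<close> lies in \<open>q i (Suc j)\<close>, Krull's theorem at
      this prime removes the powers of \<open>y\<close> and leaves \<open>Qy\<close>. At the smaller
      prime \<open>q i j\<close> the element \<open>y\<close> becomes a unit, so the induction
      hypothesis applies.\<close>
    have "w \<otimes>\<^bsub>S\<^esub> A \<in> S.sat (q i (Suc j)) Qy"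
    proof (rule S.krull_loc[OF qp Qyi])
      fix n
      have "y [^]\<^bsub>S\<^esub> n \<in> S.ipow (q i (Suc j)) n" using S.pow_in_ipow[OF qi] x(2)[OF i jk] by (simp add: y_def)
      then have "G n \<subseteq> Qy <+>\<^bsub>S\<^esub> S.ipow (q i (Suc j)) n" unfolding G_def
        by (intro S.sum_mono order_refl S.PIdl_least[OF S.ipow_ideal[OF qi]])
      then show "w \<otimes>\<^bsub>S\<^esub> A \<in> S.sat (q i (Suc j)) (Qy <+>\<^bsub>S\<^esub> S.ipow (q i (Suc j)) n)"
        using w[of n] S.sat_mono[of "G n" "Qy <+>\<^bsub>S\<^esub> S.ipow (q i (Suc j)) n" "q i (Suc j)"] by (auto simp: S.colon_def)
    qed
    then obtain s where s: "s \<in> carrier S" "s \<notin> q i (Suc j)" "s \<otimes>\<^bsub>S\<^esub> (w \<otimes>\<^bsub>S\<^esub> A) \<in> Qy" by (auto simp: S.sat_def)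
    then obtain t :: nat where t: "y [^]\<^bsub>S\<^esub> t \<otimes>\<^bsub>S\<^esub> (s \<otimes>\<^bsub>S\<^esub> (w \<otimes>\<^bsub>S\<^esub> A)) \<in> Q" by (auto simp: Qy_def)
    have yt: "y [^]\<^bsub>S\<^esub> t \<in> carrier S" using yc by simp
    have "y [^]\<^bsub>S\<^esub> t \<notin> q i j" using S.prime_pow[OF qp0 yc] x(3)[OF i jk] by (auto simp: y_def)
    moreover have "s \<notin> q i j" using s(2) q(2)[OF i jk] by auto
    ultimately have "y [^]\<^bsub>S\<^esub> t \<otimes>\<^bsub>S\<^esub> s \<notin> q i j" using S.prime_mult_iff[OF qp0 yt s(1)] by simp
    moreover have "(y [^]\<^bsub>S\<^esub> t \<otimes>\<^bsub>S\<^esub> s) \<otimes>\<^bsub>S\<^esub> (w \<otimes>\<^bsub>S\<^esub> A) \<in> Q" using t yt s(1) wc Ac by (simp add: S.m_assoc)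
    moreover have "y [^]\<^bsub>S\<^esub> t \<otimes>\<^bsub>S\<^esub> s \<in> carrier S" "w \<otimes>\<^bsub>S\<^esub> A \<in> carrier S" using yt s(1) wc Ac by auto
    ultimately have "w \<otimes>\<^bsub>S\<^esub> A \<in> S.sat (q i j) Q" unfolding S.sat_def by blast
    then show "w \<in> T i" using IH[OF i wc] by (simp add: A_def Q_def)
  qed
  then obtain n0 where n0: "\<And>i l. i \<in> I \<Longrightarrow> l \<ge> n0 i \<Longrightarrow> S.colon (S.sat (q i (Suc j)) (G l)) {A} \<subseteq> T i"
    by metis
  define n where "n = (\<Sum>i\<in>I. n0 i)"
  have n: "S.colon (S.sat (q i (Suc j)) (G n)) {A} \<subseteq> T i" if "i \<in> I" for i
    using n0[OF that] member_le_sum[of i I n0] I that by (simp add: n_def)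
  define b where "b = a(j := y [^]\<^bsub>S\<^esub> n)"
  have bA: "S.aprod b (Suc j) = A \<otimes>\<^bsub>S\<^esub> y [^]\<^bsub>S\<^esub> n" using S.aprod_cong[of j b a] by (simp add: b_def A_def)
  have bQ: "S.sqid b (Suc j) = Q <+>\<^bsub>S\<^esub> PIdl\<^bsub>S\<^esub> (y [^]\<^bsub>S\<^esub> n \<otimes>\<^bsub>S\<^esub> y [^]\<^bsub>S\<^esub> n)" using S.sqid_cong[of j b a] by (simp add: b_def Q_def)
  have "w \<in> T i" if i: "i \<in> I" and w: "w \<in> carrier S"
    and wb: "w \<otimes>\<^bsub>S\<^esub> S.aprod b (Suc j) \<in> S.sat (q i (Suc j)) (S.sqid b (Suc j))" for i w
  proof -
    let ?y = "y [^]\<^bsub>S\<^esub> n"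
    have yn: "?y \<in> carrier S" using yc by simp
    obtain s c r where s: "s \<in> carrier S" "s \<notin> q i (Suc j)" "c \<in> Q" "r \<in> carrier S"
       "s \<otimes>\<^bsub>S\<^esub> (w \<otimes>\<^bsub>S\<^esub> (A \<otimes>\<^bsub>S\<^esub> ?y)) = c \<oplus>\<^bsub>S\<^esub> r \<otimes>\<^bsub>S\<^esub> (?y \<otimes>\<^bsub>S\<^esub> ?y)"
      using wb unfolding bA bQ by (auto simp: S.sat_def S.mem_sum_PIdl)
    have cc: "c \<in> carrier S" using S.ideal_carr[OF Qi s(3)] .
    \<comment> \<open>Cancelling one factor \<open>y^n\<close> from the relation leaves
      \<open>?z\<close> in \<open>Qy\<close>, so the generator \<open>(y^n)^2\<close> counts only as
      \<open>y^n\<close> in \<open>G n\<close>.\<close>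
    let ?z = "s \<otimes>\<^bsub>S\<^esub> (w \<otimes>\<^bsub>S\<^esub> A) \<ominus>\<^bsub>S\<^esub> r \<otimes>\<^bsub>S\<^esub> ?y"
    have "?y \<otimes>\<^bsub>S\<^esub> ?z = s \<otimes>\<^bsub>S\<^esub> (w \<otimes>\<^bsub>S\<^esub> (A \<otimes>\<^bsub>S\<^esub> ?y)) \<ominus>\<^bsub>S\<^esub> r \<otimes>\<^bsub>S\<^esub> (?y \<otimes>\<^bsub>S\<^esub> ?y)"
      using s(1,4) w Ac yn by algebra
    also have "\<dots> = c" unfolding s(5) using cc s(4) yn by algebra
    finally have "?y \<otimes>\<^bsub>S\<^esub> ?z \<in> Q" using s(3) by simp
    moreover have zc: "?z \<in> carrier S" using s w Ac yn by simp
    ultimately have zQ: "?z \<in> Qy" unfolding Qy_def by blast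
    have "s \<otimes>\<^bsub>S\<^esub> (w \<otimes>\<^bsub>S\<^esub> A) = ?z \<oplus>\<^bsub>S\<^esub> r \<otimes>\<^bsub>S\<^esub> ?y" using s(1,4) w Ac yn by algebra
    then have "s \<otimes>\<^bsub>S\<^esub> (w \<otimes>\<^bsub>S\<^esub> A) \<in> G n" unfolding G_def S.mem_sum_PIdl using zQ s(4) by blast
    then have "w \<otimes>\<^bsub>S\<^esub> A \<in> S.sat (q i (Suc j)) (G n)" using s(1,2) w Ac unfolding S.sat_def by blast
    then have "w \<in> S.colon (S.sat (q i (Suc j)) (G n)) {A}" using w by (simp add: S.colon_def)
    then show "w \<in> T i" using n[OF i] by auto
  qed
  moreover have "b l \<in> carrier S" for l using a yc by (simp add: b_def)
  ultimately show ?case by blast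
qed

text \<open>Each minimal prime \<open>P\<close> gets an exact chain above it, and one element
  \<open>x j\<close> serves all chains at level \<open>j\<close>. The targets \<open>P + F M\<close>
  come from Chevalley's theorem: in a reduced ring the minimal primes intersect in zero, so for some
  \<open>M\<close> the intersection of the \<open>P + F M\<close> lies in
  \<open>F N\<close>.\<close>

lemma small_colon_S:
  assumes red: "reduced_ring S" and coht: "\<And>P. S.min_over P {\<zero>\<^bsub>S\<^esub>} \<Longrightarrow> S.coht P k"
  shows "\<exists>a. (\<forall>l. a l \<in> carrier S) \<and> (\<forall>w\<in>carrier S. w \<otimes>\<^bsub>S\<^esub> S.aprod a k \<in> S.sqid a k \<longrightarrow> w \<in> F N)"
proof -
  define FF where "FF = {P. S.min_over P {\<zero>\<^bsub>S\<^esub>}}"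
  obtain Y where Y: "finite Y" "\<And>P. P \<in> Y \<Longrightarrow> primeideal P S \<and> {\<zero>\<^bsub>S\<^esub>} \<subseteq> P"
    "\<And>Q. primeideal Q S \<Longrightarrow> {\<zero>\<^bsub>S\<^esub>} \<subseteq> Q \<Longrightarrow> \<exists>P\<in>Y. P \<subseteq> Q"
    by (rule S.primes_above_finite[OF S.zeroideal]) (rule that)
  have Xp: "primeideal P S" if "P \<in> FF" for P using that by (simp add: FF_def S.min_over_def)
  note Xi = S.primeideal_ideal[OF Xp]
  have "FF \<subseteq> Y"
  proof
    fix P assume P: "P \<in> FF"
    then obtain P' where "P' \<in> Y" "P' \<subseteq> P" using Y(3)[of P] by (auto simp: FF_def S.min_over_def)
    moreover have "P' = P" using P Y(2)[of P'] calculation by (auto simp: FF_def S.min_over_def)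
    ultimately show "P \<in> Y" by simp
  qed
  then have FF: "finite FF" using Y(1) finite_subset by auto
  have zero: "z = \<zero>\<^bsub>S\<^esub>" if z: "z \<in> carrier S" "\<And>P. P \<in> FF \<Longrightarrow> z \<in> P" for z
  proof -
    have "PIdl\<^bsub>S\<^esub> z \<subseteq> Q" if Q: "primeideal Q S" "{\<zero>\<^bsub>S\<^esub>} \<subseteq> Q" for Q
    proof -
      obtain P where "P \<subseteq> Q" "S.min_over P {\<zero>\<^bsub>S\<^esub>}" by (rule S.exists_min_over[OF Q(1) S.zeroideal Q(2)]) (rule that)
      then show ?thesis using z(2)[of P] S.PIdl_least[OF S.primeideal_ideal[OF Q(1)], of z] by (auto simp: FF_def)
    qed
    then obtain n where "S.ipow (PIdl\<^bsub>S\<^esub> z) n \<subseteq> {\<zero>\<^bsub>S\<^esub>}"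
      using S.ipow_sub_of_primes[OF S.zeroideal S.cgenideal_ideal[OF z(1)]] by auto
    then have "z [^]\<^bsub>S\<^esub> n = \<zero>\<^bsub>S\<^esub>" using S.pow_in_ipow[OF S.cgenideal_ideal[OF z(1)] S.cgenideal_self[OF z(1)], of n] by auto
    then show ?thesis using red z(1) unfolding reduced_ring_def by blast
  qed
  have PF: "ideal (P <+>\<^bsub>S\<^esub> F n) S" if "P \<in> FF" for P n using S.add_ideals[OF Xi[OF that] F_ideal] .
  define J where "J n = {z \<in> carrier S. \<forall>P\<in>FF. z \<in> P <+>\<^bsub>S\<^esub> F n}" for n
  have "\<exists>n. \<forall>l\<ge>n. J l \<subseteq> F N"
  proof (rule chevalley)
    show "ideal (J n) S" for n unfolding J_def
      by (rule S.ideal_crit) (use S.ideal_zero[OF PF] S.ideal_add[OF PF] S.ideal_lmult[OF PF] in auto)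
    show "J (Suc n) \<subseteq> J n" for n unfolding J_def using S.sum_mono[OF order_refl F_Suc] by blast
    show "ideal (F N) S" "F N \<subseteq> F N" using F_ideal by auto
    fix z assume z: "\<And>n. z \<in> J n"
    have zc: "z \<in> carrier S" using z by (simp add: J_def)
    have "z \<in> P" if "P \<in> FF" for P using closed_ideal[OF Xi[OF that], of z] z that by (auto simp: J_def)
    then have "z = \<zero>\<^bsub>S\<^esub>" by (rule zero[OF zc])
    then show "z \<in> F N" using S.ideal_zero[OF F_ideal] by simp
  qed
  then obtain M where M: "J M \<subseteq> F N" by auto
  have "\<exists>c. prime_chain S c k \<and> P \<subseteq> c 0 \<and> (\<forall>i\<le>k. \<not> S.coht (c i) (Suc (k - i)))" if "P \<in> FF" for P
    using S.exact_chain[OF Xp[OF that] coht] that by (simp add: FF_def)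
  then obtain q where q: "\<And>P. P \<in> FF \<Longrightarrow> prime_chain S (q P) k" "\<And>P. P \<in> FF \<Longrightarrow> P \<subseteq> q P 0"
    "\<And>P i. P \<in> FF \<Longrightarrow> i \<le> k \<Longrightarrow> \<not> S.coht (q P i) (Suc (k - i))" by metis
  have qp: "primeideal (q P i) S" if "P \<in> FF" "i \<le> k" for P i using q(1)[OF that(1)] that(2) by (simp add: prime_chain_def)
  have "\<exists>x. x \<in> carrier S \<and> (\<forall>P\<in>FF. x \<in> q P (Suc j) \<and> x \<notin> q P j)" if j: "j < k" for j
  proof -
    let ?I = "{z \<in> carrier S. \<forall>J\<in>(\<lambda>P. q P (Suc j)) ` FF. z \<in> J}"
    have qi: "ideal (q P (Suc j)) S" if "P \<in> FF" for P using S.primeideal_ideal[OF qp[OF that]] j by simp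
    have Ii: "ideal ?I S"
      by (rule S.ideal_crit) (use S.ideal_zero[OF qi] S.ideal_add[OF qi] S.ideal_lmult[OF qi] in auto)
    \<comment> \<open>Every prime inside \<open>q P' j\<close> has coheight at least
      \<open>k - j\<close>, whereas by exactness \<open>q P (Suc j)\<close> has a smaller one. So no
      \<open>q P (Suc j)\<close> lies in \<open>q P' j\<close>, and neither does their
      intersection.\<close>
    have "\<not> ?I \<subseteq> q P' j" if P': "P' \<in> FF" for P'
    proof
      assume sub: "?I \<subseteq> q P' j"
      have "\<exists>J\<in>(\<lambda>P. q P (Suc j)) ` FF. J \<subseteq> q P' j"
        by (rule S.prime_finite_inter[OF _ _ _ sub]) (use qp[OF P'] FF qi j in auto)
      then obtain P where P: "P \<in> FF" "q P (Suc j) \<subseteq> q P' j" by auto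
      have "S.coht (q P' j) (k - j)" using S.coht_chain[OF q(1)[OF P']] j by simp
      then have "S.coht (q P (Suc j)) (k - j)" using S.coht_mono[OF qp[OF P(1)] P(2)] j by simp
      moreover have "k - j = Suc (k - Suc j)" using j by simp
      ultimately show False using q(3)[OF P(1), of "Suc j"] j by simp
    qed
    then have "\<exists>x\<in>?I. \<forall>P\<in>(\<lambda>P. q P j) ` FF. x \<notin> P"
      using FF qp j by (intro S.prime_avoidance[OF _ _ Ii]) auto
    then show ?thesis by auto
  qed
  then obtain x where x: "\<And>j. j < k \<Longrightarrow> x j \<in> carrier S" "\<And>j P. j < k \<Longrightarrow> P \<in> FF \<Longrightarrow> x j \<in> q P (Suc j) \<and> x j \<notin> q P j"
    by metis
  have "\<exists>a. (\<forall>l. a l \<in> carrier S) \<and>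
    (\<forall>P\<in>FF. \<forall>w\<in>carrier S. w \<otimes>\<^bsub>S\<^esub> S.aprod a k \<in> S.sat (q P k) (S.sqid a k) \<longrightarrow> w \<in> P <+>\<^bsub>S\<^esub> F M)"
  proof (rule bounded_colon_chains[OF FF, where x = x and k = k])
    show "primeideal (q P j) S" if "P \<in> FF" "j \<le> k" for P j using qp that by simp
    show "q P j \<subseteq> q P (Suc j)" if "P \<in> FF" "j < k" for P j using q(1)[OF that(1)] that(2) by (auto simp: prime_chain_def)
    show "x j \<in> carrier S" if "j < k" for j using x(1) that .
    show "x j \<in> q P (Suc j)" "x j \<notin> q P j" if "P \<in> FF" "j < k" for P j using x(2) that by auto
    show "ideal (P <+>\<^bsub>S\<^esub> F M) S" if "P \<in> FF" for P using PF that .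
    show "F M \<subseteq> P <+>\<^bsub>S\<^esub> F M" if "P \<in> FF" for P using S.sum_ub2[OF Xi[OF that] F_ideal] .
    show "k \<le> k" by simp
    \<comment> \<open>\<open>P\<close> is prime and lies in \<open>q P 0\<close>, so it contains
      everything that becomes zero in the local ring at \<open>q P 0\<close>.\<close>
    show "S.sat (q P 0) {\<zero>\<^bsub>S\<^esub>} \<subseteq> P <+>\<^bsub>S\<^esub> F M" if P: "P \<in> FF" for P
    proof
      fix w assume "w \<in> S.sat (q P 0) {\<zero>\<^bsub>S\<^esub>}"
      then obtain s where s: "w \<in> carrier S" "s \<in> carrier S" "s \<notin> q P 0" "s \<otimes>\<^bsub>S\<^esub> w = \<zero>\<^bsub>S\<^esub>" by (auto simp: S.sat_def)
      then have "w \<in> P" using S.prime_mult_iff[OF Xp[OF P] s(2,1)] q(2)[OF P] S.ideal_zero[OF Xi[OF P]] by auto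
      then show "w \<in> P <+>\<^bsub>S\<^esub> F M" using S.sum_ub1[OF Xi[OF P] F_ideal] by auto
    qed
  qed
  then obtain a where a: "\<And>l. a l \<in> carrier S"
    "\<And>P w. P \<in> FF \<Longrightarrow> w \<in> carrier S \<Longrightarrow> w \<otimes>\<^bsub>S\<^esub> S.aprod a k \<in> S.sat (q P k) (S.sqid a k) \<Longrightarrow> w \<in> P <+>\<^bsub>S\<^esub> F M"
    by blast
  have "w \<in> F N" if w: "w \<in> carrier S" "w \<otimes>\<^bsub>S\<^esub> S.aprod a k \<in> S.sqid a k" for w
  proof -
    have "w \<in> P <+>\<^bsub>S\<^esub> F M" if P: "P \<in> FF" for P
      using a(2)[OF P w(1)] S.sat_ext[OF qp[OF P order_refl] S.sqid_ideal[of k a, OF a(1)]] w(2) by auto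
    then show ?thesis using M w(1) by (auto simp: J_def)
  qed
  then show ?thesis using a(1) by blast
qed

text \<open>The condition on the parameters is open: by Chevalley's theorem it survives when
  \<open>sqid b k\<close> is enlarged by some \<open>F M\<close>, so parameters in \<open>R\<close>
  that agree with \<open>b\<close> modulo \<open>F M\<close> inherit it.\<close>

lemma small_colon_R:
  assumes red: "reduced_ring S" and coht: "\<And>P. S.min_over P {\<zero>\<^bsub>S\<^esub>} \<Longrightarrow> S.coht P k"
  shows "\<exists>a. (\<forall>l. a l \<in> carrier R) \<and> (\<forall>w\<in>carrier R. w \<otimes> R.aprod a k \<in> R.sqid a k \<longrightarrow> w \<in> R.ipow m N)"
proof -
  obtain b where b: "\<And>l. b l \<in> carrier S"
    and bw: "\<And>w. w \<in> carrier S \<Longrightarrow> w \<otimes>\<^bsub>S\<^esub> S.aprod b k \<in> S.sqid b k \<Longrightarrow> w \<in> F N"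
    using small_colon_S[OF assms] by blast
  have Qi: "ideal (S.sqid b j) S" for j by (rule S.sqid_ideal[OF b])
  have QF: "ideal (S.sqid b j <+>\<^bsub>S\<^esub> F l) S" for j l by (rule S.add_ideals[OF Qi F_ideal])
  have bc: "S.aprod b j \<in> carrier S" for j by (rule S.aprod_closed[OF b])
  have "\<exists>n. \<forall>l\<ge>n. S.colon (S.sqid b k <+>\<^bsub>S\<^esub> F l) {S.aprod b k} \<subseteq> F N"
  proof (rule chevalley)
    show "ideal (S.colon (S.sqid b k <+>\<^bsub>S\<^esub> F n) {S.aprod b k}) S" for n using S.colon_ideal[OF QF] bc by simp
    show "S.colon (S.sqid b k <+>\<^bsub>S\<^esub> F (Suc n)) {S.aprod b k} \<subseteq> S.colon (S.sqid b k <+>\<^bsub>S\<^esub> F n) {S.aprod b k}" for n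
      by (intro S.colon_mono1 S.sum_mono F_Suc order_refl)
    show "ideal (F N) S" "F N \<subseteq> F N" using F_ideal by auto
    fix z assume z: "\<And>n. z \<in> S.colon (S.sqid b k <+>\<^bsub>S\<^esub> F n) {S.aprod b k}"
    then have "z \<otimes>\<^bsub>S\<^esub> S.aprod b k \<in> S.sqid b k" using closed_ideal[OF Qi] by (simp add: S.colon_def)
    then show "z \<in> F N" using bw z by (simp add: S.colon_def)
  qed
  then obtain M where M: "S.colon (S.sqid b k <+>\<^bsub>S\<^esub> F M) {S.aprod b k} \<subseteq> F N" by auto
  obtain a where a: "\<And>l. a l \<in> carrier R" "\<And>l. b l \<ominus>\<^bsub>S\<^esub> h (a l) \<in> F M" using dense[OF b, of _ M] by metis
  have ha: "h (a l) \<in> carrier S" for l using h_closed[OF a(1)] .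
  have ac: "R.aprod a j \<in> carrier R" "h (R.aprod a j) \<in> carrier S" for j
    using R.aprod_closed[of j a, OF a(1)] h_closed by auto
  have 1: "S.aprod b j \<ominus>\<^bsub>S\<^esub> h (R.aprod a j) \<in> F M" for j
  proof (induct j)
    case 0 then show ?case using S.ideal_zero[OF F_ideal] by (simp add: S.minus_eq S.r_neg)
  next
    case (Suc j)
    have "S.aprod b j \<otimes>\<^bsub>S\<^esub> b j \<ominus>\<^bsub>S\<^esub> h (R.aprod a j) \<otimes>\<^bsub>S\<^esub> h (a j) =
       (S.aprod b j \<ominus>\<^bsub>S\<^esub> h (R.aprod a j)) \<otimes>\<^bsub>S\<^esub> b j \<oplus>\<^bsub>S\<^esub> h (R.aprod a j) \<otimes>\<^bsub>S\<^esub> (b j \<ominus>\<^bsub>S\<^esub> h (a j))"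
      using bc[of j] b[of j] ac(2)[of j] ha[of j] by algebra
    also have "\<dots> \<in> F M"
      by (intro S.ideal_add[OF F_ideal] S.ideal_rmult[OF F_ideal Suc b] S.ideal_lmult[OF F_ideal a(2) ac(2)])
    finally show ?case using ac(1) a(1) by (simp add: h_mult)
  qed
  have 2: "h r \<in> S.sqid b j <+>\<^bsub>S\<^esub> F M" if "r \<in> R.sqid a j" for r j
    using that
  proof (induct j arbitrary: r)
    case 0 then show ?case using S.ideal_zero[OF QF[of 0 M]] by simp
  next
    case (Suc j)
    obtain c t where c: "c \<in> R.sqid a j" "t \<in> carrier R" "r = c \<oplus> t \<otimes> (a j \<otimes> a j)"
      using Suc(2) by (auto simp: R.mem_sum_PIdl)
    have cc: "c \<in> carrier R" using R.ideal_carr[OF R.sqid_ideal[OF a(1)] c(1)] .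
    have tc: "h t \<in> carrier S" using h_closed c(2) .
    let ?I = "S.sqid b (Suc j) <+>\<^bsub>S\<^esub> F M"
    have I: "ideal ?I S" by (rule QF)
    have bb: "b j \<otimes>\<^bsub>S\<^esub> b j \<in> carrier S" using b by simp
    have "h c \<in> S.sqid b j <+>\<^bsub>S\<^esub> F M" by (rule Suc(1)[OF c(1)])
    moreover have "S.sqid b j <+>\<^bsub>S\<^esub> F M \<subseteq> ?I" using S.PIdl_sum_sub[OF Qi bb, of j] by (intro S.sum_mono) auto
    ultimately have h1: "h c \<in> ?I" by auto
    have "b j \<otimes>\<^bsub>S\<^esub> b j \<in> S.sqid b (Suc j)" using S.PIdl_sum_mem[OF Qi bb, of j] by simp
    then have h2: "b j \<otimes>\<^bsub>S\<^esub> b j \<in> ?I" using S.sum_ub1[OF Qi F_ideal] by blast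
    have h3: "b j \<ominus>\<^bsub>S\<^esub> h (a j) \<in> ?I" using a(2) S.sum_ub2[OF Qi F_ideal] by blast
    \<comment> \<open>The identity \<open>(h a)^2 = b^2 - (b + h a)(b - h a)\<close> keeps the
      squares of the approximations in the enlarged ideal.\<close>
    have "h c \<oplus>\<^bsub>S\<^esub> h t \<otimes>\<^bsub>S\<^esub> (h (a j) \<otimes>\<^bsub>S\<^esub> h (a j)) = h c \<oplus>\<^bsub>S\<^esub> (h t \<otimes>\<^bsub>S\<^esub> (b j \<otimes>\<^bsub>S\<^esub> b j) \<ominus>\<^bsub>S\<^esub>
        (h t \<otimes>\<^bsub>S\<^esub> (b j \<oplus>\<^bsub>S\<^esub> h (a j))) \<otimes>\<^bsub>S\<^esub> (b j \<ominus>\<^bsub>S\<^esub> h (a j)))"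
      using h_closed[OF cc] tc b[of j] ha[of j] by algebra
    also have "\<dots> \<in> ?I"
      using h1 h2 h3 tc b[of j] ha[of j]
      by (intro S.ideal_add[OF I] S.ideal_minus[OF I] S.ideal_lmult[OF I h2] S.ideal_lmult[OF I h3]) auto
    finally show ?case unfolding c(3) using cc c(2) a(1) by (simp add: h_add h_mult)
  qed
  have "w \<in> R.ipow m N" if w: "w \<in> carrier R" "w \<otimes> R.aprod a k \<in> R.sqid a k" for w
  proof -
    have wc: "h w \<in> carrier S" using h_closed w(1) .
    let ?I = "S.sqid b k <+>\<^bsub>S\<^esub> F M"
    have e: "h w \<otimes>\<^bsub>S\<^esub> S.aprod b k = h w \<otimes>\<^bsub>S\<^esub> h (R.aprod a k) \<oplus>\<^bsub>S\<^esub> h w \<otimes>\<^bsub>S\<^esub> (S.aprod b k \<ominus>\<^bsub>S\<^esub> h (R.aprod a k))"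
      using wc bc[of k] ac(2)[of k] by algebra
    have "h w \<otimes>\<^bsub>S\<^esub> h (R.aprod a k) \<in> ?I" using 2[OF w(2)] w(1) ac(1) by (simp add: h_mult)
    moreover have "h w \<otimes>\<^bsub>S\<^esub> (S.aprod b k \<ominus>\<^bsub>S\<^esub> h (R.aprod a k)) \<in> ?I"
      using S.ideal_lmult[OF F_ideal 1 wc] S.sum_ub2[OF Qi F_ideal] by blast
    ultimately have "h w \<otimes>\<^bsub>S\<^esub> S.aprod b k \<in> ?I" unfolding e by (rule S.ideal_add[OF QF])
    then have "h w \<in> F N" using M wc by (auto simp: S.colon_def)
    then show ?thesis using F_R[OF w(1)] by simp
  qed
  then show ?thesis using a(1) by blast
qed

end

section \<open>Polarization\<close>

locale cring_with_UP = cring + UPr: cring "UP R"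
begin

abbreviation UPR where "UPR \<equiv> UP R"
abbreviation "cf \<equiv> up_ring.coeff (UP R)"
abbreviation "mn \<equiv> up_ring.monom (UP R)"

lemma UP_ring_R: "UP_ring R"
  by unfold_locales

lemmas UP_coeff_closed [simp] = UP.coeff_closed[of _ R]
lemmas UP_coeff_add [simp] = UP_ring.coeff_add[OF UP_ring_R]
lemmas UP_coeff_zero [simp] = UP_ring.coeff_zero[OF UP_ring_R]
lemmas UP_coeff_monom [simp] = UP_ring.coeff_monom[OF UP_ring_R]
lemmas UP_coeff_mult = UP_ring.coeff_mult[OF UP_ring_R]
lemmas UP_monom_closed [simp] = UP_ring.monom_closed[OF UP_ring_R]
lemmas UP_deg_aboveD = UP_ring.deg_aboveD[OF UP_ring_R]

lemma ideals_carrier: "I \<in> carrier (ideals_set R) \<longleftrightarrow> ideal I R"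
  by (simp add: ideals_set_def)

lemma ideals_mult: "I \<otimes>\<^bsub>ideals_set R\<^esub> J = I \<cdot> J"
  by (simp add: ideals_set_def)

lemma ideals_add: "I \<oplus>\<^bsub>ideals_set R\<^esub> J = I <+> J"
  by (simp add: ideals_set_def)

sublocale ISet: comm_monoid "ideals_set R"
  by (rule ideals_set_is_comm_monoid)

sublocale ISem: semiring "ideals_set R"
  by (rule ideals_set_is_semiring)

section \<open>Content ideals and polynomials assembled from blocks\<close>

lemma content_ideal_ideal: "f \<in> carrier UPR \<Longrightarrow> ideal (content_ideal R f) R"
  unfolding content_ideal_def by (rule genideal_ideal) (auto simp: UP_coeff_closed)

lemma coeff_in_content: "f \<in> carrier UPR \<Longrightarrow> cf f n \<in> content_ideal R f"
proof -
  assume "f \<in> carrier UPR"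
  then have "{cf f n | n. True} \<subseteq> carrier R" by auto
  from genideal_self[OF this] show ?thesis unfolding content_ideal_def by auto
qed

lemma content_least:
  "ideal I R \<Longrightarrow> (\<And>n. cf f n \<in> I) \<Longrightarrow> content_ideal R f \<subseteq> I"
  unfolding content_ideal_def by (rule genideal_minimal) auto

lemma content_mult_sub:
  assumes "f \<in> carrier UPR" "g \<in> carrier UPR"
  shows "content_ideal R (f \<otimes>\<^bsub>UPR\<^esub> g) \<subseteq> content_ideal R f \<cdot> content_ideal R g"
proof (rule content_least)
  show "ideal (content_ideal R f \<cdot> content_ideal R g) R" (is "ideal ?I R")
    using assms by (intro prod_ideal content_ideal_ideal)
  then show "cf (f \<otimes>\<^bsub>UPR\<^esub> g) n \<in> ?I" for n
    using assms by (auto simp: UP_coeff_mult intro!: lincomb_in_ideal ideal_prod.prod coeff_in_content)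
qed

lemma coeff_monom_mult:
  assumes a: "a \<in> carrier R" and p: "p \<in> carrier UPR"
  shows "cf (mn a d \<otimes>\<^bsub>UPR\<^esub> p) n = (if n < d then \<zero> else a \<otimes> cf p (n - d))"
proof -
  have "cf (mn a d \<otimes>\<^bsub>UPR\<^esub> p) n = (\<Oplus>i\<in>{..n}. cf (mn a d) i \<otimes> cf p (n - i))"
    using assms by (simp add: UP_coeff_mult)
  also have "\<dots> = (\<Oplus>i\<in>{..n}. if d = i then a \<otimes> cf p (n - i) else \<zero>)"
    using assms by (intro finsum_cong') (auto simp: UP_coeff_closed)
  also have "\<dots> = (if n < d then \<zero> else a \<otimes> cf p (n - d))"
  proof (cases "n < d")
    case True
    have "(\<Oplus>i\<in>{..n}. if d = i then a \<otimes> cf p (n - i) else \<zero>) = (\<Oplus>i\<in>{..n}. \<zero>)"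
      using True by (intro finsum_cong') auto
    then show ?thesis using True by simp
  next
    case False
    then show ?thesis
      using finsum_singleton[of d "{..n}" "\<lambda>i. a \<otimes> cf p (n - i)"] assms by (simp add: UP_coeff_closed Pi_def)
  qed
  finally show ?thesis .
qed

text \<open>The polynomial \<open>\<Sum> a_l X^(l E) p_l\<close>. When every \<open>p_l\<close> has
  degree below \<open>E\<close>, the blocks do not overlap, and each \<open>a_l c\<close> with
  \<open>c\<close> a coefficient of \<open>p_l\<close> is a coefficient of the whole.\<close>

primrec spread :: "(nat \<Rightarrow> 'a) \<Rightarrow> (nat \<Rightarrow> nat \<Rightarrow> 'a) \<Rightarrow> nat \<Rightarrow> nat \<Rightarrow> nat \<Rightarrow> 'a" where
  "spread a p E 0 = \<zero>\<^bsub>UPR\<^esub>"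
| "spread a p E (Suc j) = spread a p E j \<oplus>\<^bsub>UPR\<^esub> mn (a j) (j * E) \<otimes>\<^bsub>UPR\<^esub> p j"

lemma spread_closed:
  assumes "\<And>j. a j \<in> carrier R" "\<And>j. p j \<in> carrier UPR" shows "spread a p E j \<in> carrier UPR"
  by (induct j) (use assms in auto)

lemma spread_mult:
  assumes "\<And>j. a j \<in> carrier R" "\<And>j. p j \<in> carrier UPR" "g \<in> carrier UPR"
  shows "spread a p E j \<otimes>\<^bsub>UPR\<^esub> g = spread a (\<lambda>j. p j \<otimes>\<^bsub>UPR\<^esub> g) E j"
  by (induct j) (use assms spread_closed[of a p E] in \<open>auto simp: UPr.l_distr UPr.m_assoc\<close>)

lemma spread_coeff_zero:
  assumes "\<And>j. a j \<in> carrier R" "\<And>j. p j \<in> carrier UPR" "\<And>j n. n \<ge> E \<Longrightarrow> cf (p j) n = \<zero>"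
  shows "n \<ge> k * E \<Longrightarrow> cf (spread a p E k) n = \<zero>"
proof (induct k)
  case (Suc k)
  then have "n - k * E \<ge> E" "n \<ge> k * E" "\<not> n < k * E" by auto
  then show ?case using Suc assms spread_closed[of a p E] by (simp add: coeff_monom_mult)
qed (simp)

lemma spread_coeff:
  assumes "\<And>j. a j \<in> carrier R" "\<And>j. p j \<in> carrier UPR" "\<And>j n. n \<ge> E \<Longrightarrow> cf (p j) n = \<zero>"
  shows "j < k \<Longrightarrow> n < E \<Longrightarrow> cf (spread a p E k) (j * E + n) = a j \<otimes> cf (p j) n"
proof (induct k)
  case (Suc k)
  have c: "a i \<otimes> cf (p i) n \<in> carrier R" for i using assms by (simp add: UP_coeff_closed)
  show ?case
  proof (cases "j = k")
    case True
    then show ?thesis using spread_coeff_zero[OF assms, of E k] assms c spread_closed[of a p E]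
      by (simp add: coeff_monom_mult)
  next
    case False
    then have jk: "j < k" using Suc by simp
    then have "Suc j * E \<le> k * E" by (intro mult_le_mono1) simp
    then have "j * E + n < k * E" using Suc(3) by simp
    then show ?thesis using Suc(1)[OF jk Suc(3)] assms c spread_closed[of a p E]
      by (simp add: coeff_monom_mult)
  qed
qed simp

text \<open>Blocks may overlap here: besides \<open>p j\<close> itself, the lemma is applied to the
  products of \<open>p j\<close> with \<open>g\<close>, whose degrees can exceed \<open>E\<close>.
  Only an upper bound for the coefficients is wanted.\<close>

lemma spread_coeff_in:
  assumes "\<And>j. a j \<in> carrier R" "\<And>j. p j \<in> carrier UPR" "ideal I R"
    and "\<And>j c. j < k \<Longrightarrow> c \<in> content_ideal R (p j) \<Longrightarrow> a j \<otimes> c \<in> I"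
  shows "cf (spread a p E k) n \<in> I"
  using assms(4)
proof (induct k)
  case 0 then show ?case using ideal_zero[OF assms(3)] by simp
next
  case (Suc k)
  have "cf (mn (a k) (k * E) \<otimes>\<^bsub>UPR\<^esub> p k) n \<in> I"
    using Suc(2)[of k "cf (p k) (n - k * E)"] coeff_in_content[OF assms(2)] ideal_zero[OF assms(3)]
    by (simp add: coeff_monom_mult[OF assms(1,2)])
  then show ?case
    using ideal_add[OF assms(3) Suc(1)] Suc(2) assms(1,2) spread_closed[of a p E] by simp
qed

section \<open>Finite sums and products of ideals\<close>

lemma ideals_finsum_ideal:
  assumes "finite A" "\<And>i. i \<in> A \<Longrightarrow> ideal (I i) R"
  shows "ideal (\<Oplus>\<^bsub>ideals_set R\<^esub> i\<in>A. I i) R"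
  using ISem.finsum_closed[of I A] assms by (auto simp: ideals_carrier Pi_iff)

lemma ideals_finprod_ideal:
  assumes "finite A" "\<And>i. i \<in> A \<Longrightarrow> ideal (I i) R"
  shows "ideal (\<Otimes>\<^bsub>ideals_set R\<^esub> i\<in>A. I i) R"
  using ISet.finprod_closed[of I A] assms by (auto simp: ideals_carrier Pi_iff)

lemma ideals_finsum_insert:
  assumes "finite A" "x \<notin> A" "\<And>i. i \<in> insert x A \<Longrightarrow> ideal (I i) R"
  shows "(\<Oplus>\<^bsub>ideals_set R\<^esub> i\<in>insert x A. I i) = I x <+> (\<Oplus>\<^bsub>ideals_set R\<^esub> i\<in>A. I i)"
  using ISem.finsum_insert[of A x I] assms by (simp add: ideals_carrier ideals_add Pi_iff)

lemma ideals_finprod_insert: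
  assumes "finite A" "x \<notin> A" "\<And>i. i \<in> insert x A \<Longrightarrow> ideal (I i) R"
  shows "(\<Otimes>\<^bsub>ideals_set R\<^esub> i\<in>insert x A. I i) = I x \<cdot> (\<Otimes>\<^bsub>ideals_set R\<^esub> i\<in>A. I i)"
  using ISet.finprod_insert[of A x I] assms by (simp add: ideals_carrier ideals_mult Pi_iff)

lemma ideals_finsum_ub:
  assumes "finite A" "\<And>i. i \<in> A \<Longrightarrow> ideal (I i) R" "x \<in> A"
  shows "I x \<subseteq> (\<Oplus>\<^bsub>ideals_set R\<^esub> i\<in>A. I i)"
proof -
  have A: "A = insert x (A - {x})" using assms(3) by auto
  have "(\<Oplus>\<^bsub>ideals_set R\<^esub> i\<in>A. I i) = I x <+> (\<Oplus>\<^bsub>ideals_set R\<^esub> i\<in>A - {x}. I i)"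
    by (subst A, rule ideals_finsum_insert) (use assms in auto)
  then show ?thesis using sum_ub1[of "I x"] ideals_finsum_ideal[of "A - {x}" I] assms by auto
qed

lemma ideals_finsum_least:
  assumes "finite A" "\<And>i. i \<in> A \<Longrightarrow> ideal (I i) R" "ideal K R" "\<And>i. i \<in> A \<Longrightarrow> I i \<subseteq> K"
  shows "(\<Oplus>\<^bsub>ideals_set R\<^esub> i\<in>A. I i) \<subseteq> K"
  using assms(1,2,4)
proof (induct A)
  case empty
  have "\<zero>\<^bsub>ideals_set R\<^esub> = {\<zero>}" by (simp add: ideals_set_def)
  then show ?case using ideal_zero[OF assms(3)] by simp
next
  case (insert x A)
  have "I x <+> (\<Oplus>\<^bsub>ideals_set R\<^esub> i\<in>A. I i) \<subseteq> K" using insert by (intro sum_least[OF assms(3)]) auto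
  then show ?case using ideals_finsum_insert[OF insert(1,2), of I] insert(4) by simp
qed

lemma sq_in_sqid: "(\<And>l. l < k \<Longrightarrow> a l \<in> carrier R) \<Longrightarrow> l < k \<Longrightarrow> a l \<otimes> a l \<in> sqid a k"
proof (induct k)
  case (Suc k)
  have i: "ideal (sqid a k) R" using sqid_ideal[of k a] Suc(2) by simp
  have ak: "a k \<otimes> a k \<in> carrier R" using Suc(2) by simp
  show ?case
    using Suc PIdl_sum_sub[OF i ak] PIdl_sum_mem[OF i ak] by (cases "l = k") auto
qed simp

lemma aprod_finprod:
  assumes "\<And>l. a l \<in> carrier R" shows "aprod a k = (\<Otimes>i\<in>{1..k}. a (i - 1))"
proof (induct k)
  case (Suc k)
  have "{1..Suc k} = insert (Suc k) {1..k}" by auto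
  then have "(\<Otimes>i\<in>{1..Suc k}. a (i - 1)) = a k \<otimes> (\<Otimes>i\<in>{1..k}. a (i - 1))"
    using assms finprod_insert[of "{1..k}" "Suc k" "\<lambda>i. a (i - 1)"] by (simp add: Pi_iff)
  then show ?case using Suc assms aprod_closed[of k a] m_comm by simp
qed simp

lemma Idl_prod_least:
  assumes K: "ideal K R" and Y: "Y \<subseteq> carrier R" and J: "J \<subseteq> carrier R" "\<And>x j. x \<in> Y \<Longrightarrow> j \<in> J \<Longrightarrow> x \<otimes> j \<in> K"
  shows "(Idl Y) \<cdot> J \<subseteq> K"
proof (rule prod_least[OF K])
  fix i j assume ij: "i \<in> Idl Y" "j \<in> J"
  have "Idl Y \<subseteq> colon K {j}"
    using ij J Y by (intro genideal_minimal colon_ideal[OF K]) (auto simp: colon_def)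
  then show "i \<otimes> j \<in> K" using ij by (auto simp: colon_def)
qed

text \<open>The parameters \<open>a\<close> act as indeterminates: modulo their squares, the part of the identity that is
  linear in each of them is the polarized one.\<close>

lemma polarization_step:
  assumes k: "0 < k" and f: "\<And>i. f i \<in> carrier UPR" and g: "g \<in> carrier UPR" and dm: "dm_identity R g k"
    and a: "\<And>l. a l \<in> carrier R"
    and z: "z \<in> (\<Otimes>\<^bsub>ideals_set R\<^esub> j \<in> {1..k}. content_ideal R (f j)) \<cdot> content_ideal R g"
  shows "\<exists>l\<in>(\<Oplus>\<^bsub>ideals_set R\<^esub> i \<in> {1..k}. content_ideal R (f i \<otimes>\<^bsub>UP R\<^esub> g)
           \<cdot> (\<Otimes>\<^bsub>ideals_set R\<^esub> j \<in> {1..k} - {i}. content_ideal R (f j))).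
      (z \<ominus> l) \<otimes> aprod a k \<in> sqid a k"
proof -
  define C where "C i = content_ideal R (f i)" for i
  define D where "D i = content_ideal R (f i \<otimes>\<^bsub>UP R\<^esub> g)" for i
  define J where "J = content_ideal R g"
  \<comment> \<open>Shift between the parameters, indexed from \<open>0\<close>, and the
    polynomials, indexed from \<open>1\<close>.\<close>
  define b where "b i = a (i - 1)" for i
  define PT where "PT T = (\<Otimes>\<^bsub>ideals_set R\<^esub> j \<in> T. C j)" for T
  define aT where "aT T = (\<Otimes>j\<in>T. b j)" for T :: "nat set"
  define L where "L = (\<Oplus>\<^bsub>ideals_set R\<^esub> i \<in> {1..k}. D i \<cdot> PT ({1..k} - {i}))"
  define SQ where "SQ = sqid a k"
  define A where "A = aprod a k"
  have Ci: "ideal (C i) R" for i unfolding C_def by (rule content_ideal_ideal[OF f])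
  have Di: "ideal (D i) R" for i unfolding D_def using f g by (intro content_ideal_ideal) simp
  have Ji: "ideal J R" unfolding J_def by (rule content_ideal_ideal[OF g])
  have bc: "b i \<in> carrier R" for i using a by (simp add: b_def)
  have Pi: "ideal (PT T) R" if "finite T" for T unfolding PT_def using that Ci by (rule ideals_finprod_ideal)
  have aTc: "aT T \<in> carrier R" for T unfolding aT_def using bc by (intro finprod_closed) auto
  have Pins: "PT (insert i T) = C i \<cdot> PT T" if "finite T" "i \<notin> T" for i T
    unfolding PT_def using that Ci by (intro ideals_finprod_insert) auto
  have ains: "aT (insert i T) = b i \<otimes> aT T" if "finite T" "i \<notin> T" for i T
    unfolding aT_def using that bc by (intro finprod_insert) auto
  have DPi: "ideal (D i \<cdot> PT ({1..k} - {i})) R" for i by (intro prod_ideal Di Pi) simp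
  have Li: "ideal L R" unfolding L_def by (intro ideals_finsum_ideal DPi) simp
  have SQi: "ideal SQ R" unfolding SQ_def using a by (intro sqid_ideal) auto
  have Ak: "A = aT {1..k}" unfolding A_def aT_def b_def by (rule aprod_finprod[OF a])
  have Ac: "A \<in> carrier R" unfolding Ak by (rule aTc)
  have bb: "b i \<otimes> b i \<in> SQ" if "i \<in> {1..k}" for i
    unfolding SQ_def b_def using that a by (intro sq_in_sqid) auto
  \<comment> \<open>A parameter that occurs twice produces an element of \<open>SQ\<close>.\<close>
  have bT: "b i \<otimes> aT T \<in> SQ" if T: "finite T" "T \<subseteq> {1..k}" "i \<in> T" for i T
  proof -
    have "T = insert i (T - {i})" using T(3) by auto
    then have "aT T = b i \<otimes> aT (T - {i})" using ains[of "T - {i}" i] T(1) by simp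
    then have "b i \<otimes> aT T = aT (T - {i}) \<otimes> (b i \<otimes> b i)" using bc[of i] aTc[of "T - {i}"] by (simp add: m_ac)
    then show ?thesis using ideal_lmult[OF SQi bb aTc] T(2,3) by auto
  qed
  \<comment> \<open>Larger than every degree, so that the blocks in \<open>ff\<close> are
    disjoint.\<close>
  define E where "E = Suc (Max ((\<lambda>i. deg R (f i)) ` {1..k}))"
  define p where "p j = (if j < k then f (Suc j) else \<zero>\<^bsub>UPR\<^esub>)" for j
  have pc: "p j \<in> carrier UPR" for j using f by (simp add: p_def)
  have pE: "cf (p j) n = \<zero>" if "n \<ge> E" for j n
  proof (cases "j < k")
    case True
    then have "deg R (f (Suc j)) \<le> Max ((\<lambda>i. deg R (f i)) ` {1..k})" by (intro Max_ge) auto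
    then have "deg R (f (Suc j)) < n" using that by (simp add: E_def)
    then show ?thesis using True UP_deg_aboveD[OF _ f] by (simp add: p_def)
  qed (simp add: p_def)
  define ff where "ff = spread a p E k"
  define V where "V = content_ideal R ff"
  have ffc: "ff \<in> carrier UPR" unfolding ff_def by (rule spread_closed[OF a pc])
  have Vi: "ideal V R" unfolding V_def by (rule content_ideal_ideal[OF ffc])
  have aV: "b i \<otimes> c \<in> V" if i: "i \<in> {1..k}" and c: "c \<in> C i" for i c
  proof -
    have "C i \<subseteq> {c \<in> carrier R. b i \<otimes> c \<in> V}" unfolding C_def
    proof (rule content_least)
      show "ideal {c \<in> carrier R. b i \<otimes> c \<in> V} R"
        using colon_ideal[OF Vi, of "{b i}"] bc by (simp add: colon_def m_comm cong: conj_cong)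
      fix n
      have "b i \<otimes> cf (f i) n \<in> V"
      proof (cases "n < E")
        case True
        have "cf ff ((i - 1) * E + n) = a (i - 1) \<otimes> cf (p (i - 1)) n"
          unfolding ff_def using i True by (intro spread_coeff[OF a pc pE]) auto
        moreover have "p (i - 1) = f i" using i by (cases i) (auto simp: p_def)
        ultimately show ?thesis using coeff_in_content[OF ffc, of "(i - 1) * E + n"] by (simp add: V_def b_def)
      next
        case False
        then have "cf (f i) n = \<zero>" using pE[of n "i - 1"] i by (cases i) (auto simp: p_def)
        then show ?thesis using bc ideal_zero[OF Vi] by simp
      qed
      then show "cf (f i) n \<in> {c \<in> carrier R. b i \<otimes> c \<in> V}" using UP_coeff_closed[OF f] by simp
    qed
    then show ?thesis using c by auto
  qed
  \<comment> \<open>Each factor \<open>C i\<close> is carried into \<open>V\<close> by its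
    parameter, so the product over \<open>T\<close> is carried by \<open>aT T\<close> into the power
    of \<open>V\<close> with exponent \<open>card T\<close>.\<close>
  have TV: "PT T \<subseteq> colon (ipow V (card T)) {aT T}" if "finite T" "T \<subseteq> {1..k}" for T
    using that
  proof (induct T)
    case empty
    then show ?case using ideal_sub[OF Pi] aTc by (auto simp: ipow_0 colon_def)
  next
    case (insert i T)
    have IH: "PT T \<subseteq> colon (ipow V (card T)) {aT T}" using insert by simp
    have K: "ideal (colon (ipow V (card (insert i T))) {aT (insert i T)}) R"
      using colon_ideal[OF ipow_ideal[OF Vi]] aTc by simp
    show ?case unfolding Pins[OF insert(1,2)]
    proof (rule prod_least[OF K])
      fix c q assume c: "c \<in> C i" and q: "q \<in> PT T"
      have cc: "c \<in> carrier R" "q \<in> carrier R" using ideal_carr[OF Ci c] ideal_carr[OF Pi[OF insert(1)] q] by auto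
      have "(c \<otimes> q) \<otimes> aT (insert i T) = (q \<otimes> aT T) \<otimes> (b i \<otimes> c)"
        unfolding ains[OF insert(1,2)] using cc bc[of i] aTc[of T] by (simp add: m_ac)
      moreover have "(q \<otimes> aT T) \<otimes> (b i \<otimes> c) \<in> ipow V (Suc (card T))"
        unfolding ipow_Suc using IH q aV[OF _ c] insert(4) by (intro ideal_prod.prod) (auto simp: colon_def)
      ultimately show "c \<otimes> q \<in> colon (ipow V (card (insert i T))) {aT (insert i T)}"
        using cc insert(1,2) by (simp add: colon_def)
    qed
  qed
  have zA: "z \<otimes> A \<in> ipow V k \<cdot> J"
  proof -
    have K: "ideal (colon (ipow V k \<cdot> J) {A}) R" using colon_ideal[OF prod_ideal[OF ipow_ideal[OF Vi] Ji]] Ac by simp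
    have "PT {1..k} \<cdot> J \<subseteq> colon (ipow V k \<cdot> J) {A}"
    proof (rule prod_least[OF K])
      fix q j assume q: "q \<in> PT {1..k}" and j: "j \<in> J"
      have cc: "q \<in> carrier R" "j \<in> carrier R" using ideal_carr[OF Pi q] ideal_carr[OF Ji j] by auto
      have "q \<otimes> A \<in> ipow V k" using TV[of "{1..k}"] q by (auto simp: colon_def Ak)
      then have "(q \<otimes> A) \<otimes> j \<in> ipow V k \<cdot> J" using j by (rule ideal_prod.prod)
      moreover have "(q \<otimes> j) \<otimes> A = (q \<otimes> A) \<otimes> j" using cc Ac by (simp add: m_ac)
      ultimately show "q \<otimes> j \<in> colon (ipow V k \<cdot> J) {A}" using cc by (simp add: colon_def)
    qed
    then show ?thesis using z by (auto simp: colon_def PT_def C_def J_def)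
  qed
  \<comment> \<open>The given identity of order \<open>k\<close> enters here, for the single
    polynomial \<open>ff\<close>.\<close>
  have "content_ideal R (ff \<otimes>\<^bsub>UPR\<^esub> g) \<cdot> ipow V (k - 1) = ipow V k \<cdot> J"
    using dm ffc unfolding dm_identity_def ideals_mult ipow_def V_def J_def by blast
  moreover define W where "W = content_ideal R (ff \<otimes>\<^bsub>UPR\<^esub> g)"
  ultimately have zW: "z \<otimes> A \<in> W \<cdot> ipow V (k - 1)" using zA by simp
  have Wi: "ideal W R" unfolding W_def using ffc g by (intro content_ideal_ideal) simp
  \<comment> \<open>Modulo the squares, only products with \<open>n\<close> distinct parameters
    survive in the \<open>n\<close>-th power of \<open>V\<close>.\<close>
  define G where "G n = {q \<otimes> aT T | q T. T \<subseteq> {1..k} \<and> card T = n \<and> q \<in> PT T} \<union> SQ" for n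
  have Gc: "G n \<subseteq> carrier R" for n
  proof -
    have "q \<otimes> aT T \<in> carrier R" if "T \<subseteq> {1..k}" "q \<in> PT T" for q T
      using ideal_carr[OF Pi that(2)] finite_subset[OF that(1)] aTc by simp
    then show ?thesis unfolding G_def using ideal_sub[OF SQi] by blast
  qed
  have Gi: "ideal (Idl (G n)) R" for n by (rule genideal_ideal[OF Gc])
  have GSQ: "SQ \<subseteq> Idl (G n)" for n using genideal_self[OF Gc[of n]] by (auto simp: G_def)
  have VG: "ipow V n \<subseteq> Idl (G n)" for n
  proof (induct n)
    case 0
    have "\<one>\<^bsub>ideals_set R\<^esub> = carrier R" by (simp add: ideals_set_def)
    then have "PT {} = carrier R" by (simp add: PT_def)
    moreover have "aT {} = \<one>" by (simp add: aT_def)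
    moreover have "\<one> = \<one> \<otimes> \<one>" by simp
    ultimately have "\<one> \<in> G 0" unfolding G_def by (intro UnI1 CollectI exI[of _ \<one>] exI[of _ "{}"]) auto
    then have "\<one> \<in> Idl (G 0)" using genideal_self[OF Gc[of 0]] by auto
    then show ?case using ideal.one_imp_carrier[OF Gi] by (simp add: ipow_0)
  next
    case (Suc n)
    have VS: "V \<subseteq> {v \<in> carrier R. \<forall>x\<in>G n. x \<otimes> v \<in> Idl (G (Suc n))}" (is "V \<subseteq> ?K")
      unfolding V_def
    proof (rule content_least)
      show K: "ideal ?K R"
        using colon_ideal[OF Gi[of "Suc n"] Gc[of n]] Gc[of n] by (simp add: colon_def m_comm subset_eq cong: conj_cong ball_cong)
      show "cf ff l \<in> ?K" for l unfolding ff_def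
      proof (rule spread_coeff_in[OF a pc K])
        fix j c assume j: "j < k" and "c \<in> content_ideal R (p j)"
        then have c: "c \<in> C (Suc j)" by (simp add: p_def C_def)
        have cc: "c \<in> carrier R" by (rule ideal_carr[OF Ci c])
        have "x \<otimes> (a j \<otimes> c) \<in> Idl (G (Suc n))" if x: "x \<in> G n" for x
        proof (cases "x \<in> SQ")
          case True
          then show ?thesis using ideal_rmult[OF SQi True, of "a j \<otimes> c"] a cc GSQ by auto
        next
          case False
          then obtain q T where qT: "T \<subseteq> {1..k}" "card T = n" "q \<in> PT T" "x = q \<otimes> aT T" using x by (auto simp: G_def)
          have fT: "finite T" using qT(1) finite_subset by auto
          have qc: "q \<in> carrier R" using ideal_carr[OF Pi[OF fT] qT(3)] .
          show ?thesis
          proof (cases "Suc j \<in> T")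
            case True
            have "x \<otimes> (a j \<otimes> c) = (q \<otimes> c) \<otimes> (b (Suc j) \<otimes> aT T)"
              unfolding qT(4) b_def using qc cc a aTc by (simp add: m_ac)
            then have "x \<otimes> (a j \<otimes> c) \<in> SQ" using ideal_lmult[OF SQi bT[OF fT qT(1) True], of "q \<otimes> c"] qc cc by simp
            then show ?thesis using GSQ by auto
          next
            case False
            have "x \<otimes> (a j \<otimes> c) = (c \<otimes> q) \<otimes> aT (insert (Suc j) T)"
              unfolding qT(4) ains[OF fT False] b_def using qc cc a aTc by (simp add: m_ac)
            moreover have "c \<otimes> q \<in> PT (insert (Suc j) T)" unfolding Pins[OF fT False] using c qT(3) by (rule ideal_prod.prod)
            moreover have "insert (Suc j) T \<subseteq> {1..k}" "card (insert (Suc j) T) = Suc n"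
              using qT(1,2) j fT False by auto
            ultimately have "x \<otimes> (a j \<otimes> c) \<in> G (Suc n)" unfolding G_def by blast
            then show ?thesis using genideal_self[OF Gc[of "Suc n"]] by auto
          qed
        qed
        then show "a j \<otimes> c \<in> ?K" using a cc by simp
      qed
    qed
    have "ipow V (Suc n) \<subseteq> (Idl (G n)) \<cdot> V" unfolding ipow_Suc using Suc by (intro prod_mono) auto
    also have "\<dots> \<subseteq> Idl (G (Suc n))"
      using VS ideal_sub[OF Vi] by (intro Idl_prod_least[OF Gi Gc]) auto
    finally show ?case .
  qed
  \<comment> \<open>The target: multiples of \<open>A\<close> with coefficients from the polarized
    left-hand side, up to squares.\<close>
  define LA where "LA = SQ <+> L \<cdot> (PIdl A)"
  have LAi: "ideal LA R" unfolding LA_def by (intro add_ideals SQi prod_ideal Li cgenideal_ideal Ac)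
  have LA1: "SQ \<subseteq> LA" unfolding LA_def by (intro sum_ub1 SQi prod_ideal Li cgenideal_ideal Ac)
  have LA2: "l \<otimes> A \<in> LA" if "l \<in> L" for l
  proof -
    have "l \<otimes> A \<in> L \<cdot> (PIdl A)" using that cgenideal_self[OF Ac] by (rule ideal_prod.prod)
    then show ?thesis unfolding LA_def using sum_ub2[OF SQi prod_ideal[OF Li cgenideal_ideal[OF Ac]]] by auto
  qed
  have WS: "W \<subseteq> {v \<in> carrier R. \<forall>x\<in>G (k - 1). x \<otimes> v \<in> LA}" (is "W \<subseteq> ?K")
    unfolding W_def
  proof (rule content_least)
    show K: "ideal ?K R"
      using colon_ideal[OF LAi Gc[of "k - 1"]] Gc[of "k - 1"] by (simp add: colon_def m_comm subset_eq cong: conj_cong ball_cong)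
    have pg: "p j \<otimes>\<^bsub>UPR\<^esub> g \<in> carrier UPR" for j using pc g by simp
    show "cf (ff \<otimes>\<^bsub>UPR\<^esub> g) l \<in> ?K" for l unfolding ff_def spread_mult[OF a pc g]
    proof (rule spread_coeff_in[OF a pg K])
      fix j d assume j: "j < k" and "d \<in> content_ideal R (p j \<otimes>\<^bsub>UPR\<^esub> g)"
      then have d: "d \<in> D (Suc j)" by (simp add: p_def D_def)
      have dc: "d \<in> carrier R" by (rule ideal_carr[OF Di d])
      have "x \<otimes> (a j \<otimes> d) \<in> LA" if x: "x \<in> G (k - 1)" for x
      proof (cases "x \<in> SQ")
        case True
        then show ?thesis using ideal_rmult[OF SQi True, of "a j \<otimes> d"] a dc LA1 by auto
      next
        case False
        then obtain q T where qT: "T \<subseteq> {1..k}" "card T = k - 1" "q \<in> PT T" "x = q \<otimes> aT T" using x by (auto simp: G_def)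
        have fT: "finite T" using qT(1) finite_subset by auto
        have qc: "q \<in> carrier R" using ideal_carr[OF Pi[OF fT] qT(3)] .
        show ?thesis
        proof (cases "Suc j \<in> T")
          case True
          have "x \<otimes> (a j \<otimes> d) = (q \<otimes> d) \<otimes> (b (Suc j) \<otimes> aT T)"
            unfolding qT(4) b_def using qc dc a aTc by (simp add: m_ac)
          then have "x \<otimes> (a j \<otimes> d) \<in> SQ" using ideal_lmult[OF SQi bT[OF fT qT(1) True], of "q \<otimes> d"] qc dc by simp
          then show ?thesis using LA1 by auto
        next
          case False
          have sub: "insert (Suc j) T \<subseteq> {1..k}" using qT(1) j by auto
          \<comment> \<open>\<open>T\<close> has \<open>k - 1\<close> elements and misses
            \<open>Suc j\<close>, so it is the complement of \<open>{Suc j}\<close>, and the term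
            belongs to one summand of the polarized sum.\<close>
          have "card (insert (Suc j) T) = card {1..k}" using qT(2) fT False k by simp
          then have ins: "insert (Suc j) T = {1..k}" using card_subset_eq[OF _ sub] by simp
          then have T: "T = {1..k} - {Suc j}" using False by auto
          have "x \<otimes> (a j \<otimes> d) = (d \<otimes> q) \<otimes> A"
            unfolding qT(4) Ak ins[symmetric] ains[OF fT False] b_def using qc dc a aTc by (simp add: m_ac)
          moreover have "d \<otimes> q \<in> D (Suc j) \<cdot> PT ({1..k} - {Suc j})" using d qT(3) unfolding T by (rule ideal_prod.prod)
          then have "d \<otimes> q \<in> L" unfolding L_def
            using ideals_finsum_ub[of "{1..k}" "\<lambda>i. D i \<cdot> PT ({1..k} - {i})" "Suc j"] DPi j by auto
          ultimately show ?thesis using LA2 by simp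
        qed
      qed
      then show "a j \<otimes> d \<in> ?K" using a dc by simp
    qed
  qed
  have "W \<cdot> ipow V (k - 1) = ipow V (k - 1) \<cdot> W" by (rule ideal_prod_commute[OF Wi ipow_ideal[OF Vi]])
  also have "\<dots> \<subseteq> (Idl (G (k - 1))) \<cdot> W" using VG by (intro prod_mono) auto
  also have "\<dots> \<subseteq> LA" using WS ideal_sub[OF Wi] by (intro Idl_prod_least[OF LAi Gc]) auto
  finally have "z \<otimes> A \<in> LA" using zW by auto
  then obtain s y where sy: "s \<in> SQ" "y \<in> L \<cdot> (PIdl A)" "z \<otimes> A = s \<oplus> y" by (auto simp: LA_def mem_sum)
  obtain l where l: "l \<in> L" "y = l \<otimes> A" using prod_PIdl[OF Li Ac sy(2)] by auto
  have zc: "z \<in> carrier R"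
    using z ideal_carr[OF prod_ideal[OF Pi Ji], of "{1..k}"] by (auto simp: PT_def C_def J_def)
  have c: "l \<in> carrier R" "s \<in> carrier R" using ideal_carr[OF Li l(1)] ideal_carr[OF SQi sy(1)] by auto
  have "(z \<ominus> l) \<otimes> A = z \<otimes> A \<ominus> l \<otimes> A" using zc c Ac by algebra
  also have "\<dots> = s" unfolding sy(3) l(2) using c Ac by algebra
  finally have "(z \<ominus> l) \<otimes> A \<in> SQ" using sy(1) by simp
  then show ?thesis using l(1) unfolding L_def D_def PT_def C_def A_def SQ_def by blast
qed

text \<open>With all polynomials equal to \<open>f\<close> the \<open>k\<close> summands coincide,
  and a nonempty sum of equal ideals is that ideal.\<close>

lemma polarized_imp_dm:
  assumes k: "0 < k" and g: "g \<in> carrier UPR" and pol: "polarized_dm_identity R g k"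
  shows "dm_identity R g k"
  unfolding dm_identity_def
proof
  fix f assume f: "f \<in> carrier UPR"
  have Ci: "ideal (content_ideal R f) R" by (rule content_ideal_ideal[OF f])
  have Di: "ideal (content_ideal R (f \<otimes>\<^bsub>UPR\<^esub> g)) R" using f g by (intro content_ideal_ideal) simp
  have P: "(\<Otimes>\<^bsub>ideals_set R\<^esub> j \<in> T. content_ideal R f) = content_ideal R f [^]\<^bsub>ideals_set R\<^esub> card T" for T :: "nat set"
    using ISet.finprod_const[of "content_ideal R f" T] Ci by (simp add: ideals_carrier)
  let ?t = "content_ideal R (f \<otimes>\<^bsub>UPR\<^esub> g) \<otimes>\<^bsub>ideals_set R\<^esub> content_ideal R f [^]\<^bsub>ideals_set R\<^esub> (k - 1)"
  have ti: "ideal ?t R" unfolding ideals_mult using prod_ideal[OF Di ipow_ideal[OF Ci]] by (simp add: ipow_def)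
  have "(\<Oplus>\<^bsub>ideals_set R\<^esub> i \<in> {1..k}. ?t) = ?t"
  proof
    show "(\<Oplus>\<^bsub>ideals_set R\<^esub> i \<in> {1..k}. ?t) \<subseteq> ?t" by (rule ideals_finsum_least) (use ti in auto)
    show "?t \<subseteq> (\<Oplus>\<^bsub>ideals_set R\<^esub> i \<in> {1..k}. ?t)"
      using ideals_finsum_ub[of "{1..k}" "\<lambda>_. ?t" 1] ti k by simp
  qed
  moreover have "(\<Oplus>\<^bsub>ideals_set R\<^esub> i \<in> {1..k}. content_ideal R (f \<otimes>\<^bsub>UPR\<^esub> g) \<otimes>\<^bsub>ideals_set R\<^esub>
      (\<Otimes>\<^bsub>ideals_set R\<^esub> j \<in> {1..k} - {i}. content_ideal R f)) = (\<Oplus>\<^bsub>ideals_set R\<^esub> i \<in> {1..k}. ?t)"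
    using ti by (intro ISem.finsum_cong') (auto simp: P ideals_carrier)
  ultimately show "?t = content_ideal R f [^]\<^bsub>ideals_set R\<^esub> k \<otimes>\<^bsub>ideals_set R\<^esub> content_ideal R g"
    using pol f unfolding polarized_dm_identity_def by (auto simp: P dest!: bspec[of _ _ "\<lambda>_. f"])
qed

end

locale noeth_local_with_UP = noeth_local + cring_with_UP
begin

text \<open>One inclusion is formal, because the content of a product lies in the product of the
  contents. For the other, the approximating element \<open>l\<close> may depend on
  \<open>N\<close>, but it always lies in the same ideal \<open>?L\<close>, so Krull's intersection
  theorem applies.\<close>

lemma polarized_of_small_colon:
  assumes k: "0 < k" and g: "g \<in> carrier UPR" and dm: "dm_identity R g k"
    and small: "\<And>N. \<exists>a. (\<forall>l. a l \<in> carrier R) \<and> (\<forall>w\<in>carrier R. w \<otimes> aprod a k \<in> sqid a k \<longrightarrow> w \<in> ipow m N)"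
  shows "polarized_dm_identity R g k"
  unfolding polarized_dm_identity_def ideals_mult
proof
  fix f0 assume "f0 \<in> {1..k} \<rightarrow> carrier UPR"
  \<comment> \<open>Extended by zero, because \<open>polarization_step\<close> asks for a polynomial
    at every index.\<close>
  define f where "f i = (if i \<in> {1..k} then f0 i else \<zero>\<^bsub>UPR\<^esub>)" for i
  have f: "f i \<in> carrier UPR" for i using \<open>f0 \<in> _\<close> by (auto simp: f_def)
  have Ci: "ideal (content_ideal R (f i)) R" for i by (rule content_ideal_ideal[OF f])
  have Di: "ideal (content_ideal R (f i \<otimes>\<^bsub>UPR\<^esub> g)) R" for i using f g by (intro content_ideal_ideal) simp
  have Ji: "ideal (content_ideal R g) R" by (rule content_ideal_ideal[OF g])
  let ?P = "\<lambda>T. \<Otimes>\<^bsub>ideals_set R\<^esub> j \<in> T. content_ideal R (f j)"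
  let ?t = "\<lambda>i. content_ideal R (f i \<otimes>\<^bsub>UP R\<^esub> g) \<cdot> ?P ({1..k} - {i})"
  let ?L = "\<Oplus>\<^bsub>ideals_set R\<^esub> i \<in> {1..k}. ?t i"
  have Pi: "ideal (?P T) R" if "finite T" for T using that Ci by (rule ideals_finprod_ideal)
  have ti: "ideal (?t i) R" for i by (intro prod_ideal Di Pi) simp
  have Li: "ideal ?L R" by (intro ideals_finsum_ideal ti) simp
  note PJ = prod_ideal[OF Pi Ji, of "{1..k}"]
  have "?L = ?P {1..k} \<cdot> content_ideal R g"
  proof
    show "?L \<subseteq> ?P {1..k} \<cdot> content_ideal R g"
    proof (rule ideals_finsum_least[OF _ ti])
      fix i assume i: "i \<in> {1..k}"
      have ins: "insert i ({1..k} - {i}) = {1..k}" using i by auto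
      have Pk: "?P {1..k} = content_ideal R (f i) \<cdot> ?P ({1..k} - {i})"
        using ideals_finprod_insert[of "{1..k} - {i}" i "\<lambda>j. content_ideal R (f j)"] Ci ins by simp
      have "?t i \<subseteq> (content_ideal R (f i) \<cdot> content_ideal R g) \<cdot> ?P ({1..k} - {i})"
        by (intro prod_mono content_mult_sub f g order_refl)
      also have "\<dots> = ?P {1..k} \<cdot> content_ideal R g" unfolding Pk
        using ideal_prod_assoc[OF Ci Ji Pi, of "{1..k} - {i}" i] ideal_prod_assoc[OF Ci Pi Ji, of "{1..k} - {i}" i]
          ideal_prod_commute[OF Ji Pi, of "{1..k} - {i}"] by simp
      finally show "?t i \<subseteq> ?P {1..k} \<cdot> content_ideal R g" .
    qed (use PJ in auto)
    show "?P {1..k} \<cdot> content_ideal R g \<subseteq> ?L"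
    proof
      fix z assume z: "z \<in> ?P {1..k} \<cdot> content_ideal R g"
      have zc: "z \<in> carrier R" using ideal_carr[OF PJ _ ] z by simp
      show "z \<in> ?L"
      proof (rule krull_local[OF Li])
        fix N
        obtain a where a: "\<And>l. a l \<in> carrier R" "\<And>w. w \<in> carrier R \<Longrightarrow> w \<otimes> aprod a k \<in> sqid a k \<Longrightarrow> w \<in> ipow m N"
          using small[of N] by blast
        from polarization_step[OF k f g dm a(1) z]
        obtain l where l: "l \<in> ?L" "(z \<ominus> l) \<otimes> aprod a k \<in> sqid a k" ..
        have lc: "l \<in> carrier R" using ideal_carr[OF Li l(1)] .
        have "z \<ominus> l \<in> ipow m N" using a(2)[of "z \<ominus> l"] l(2) zc lc by simp
        moreover have "z = l \<oplus> (z \<ominus> l)" using add_minus_self[OF zc lc] by simp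
        ultimately show "z \<in> ?L <+> ipow m N" unfolding mem_sum using l(1) by blast
      qed
    qed
  qed
  moreover have "?P T = (\<Otimes>\<^bsub>ideals_set R\<^esub> j \<in> T. content_ideal R (f0 j))" if "T \<subseteq> {1..k}" for T
    using Ci that \<open>f0 \<in> _\<close> by (intro ISet.finprod_cong') (auto simp: f_def ideals_carrier content_ideal_ideal Pi_iff)
  moreover have "?L = (\<Oplus>\<^bsub>ideals_set R\<^esub> i \<in> {1..k}. content_ideal R (f0 i \<otimes>\<^bsub>UP R\<^esub> g) \<cdot>
      (\<Otimes>\<^bsub>ideals_set R\<^esub> j \<in> {1..k} - {i}. content_ideal R (f0 j)))"
  proof (rule ISem.finsum_cong'[OF refl])
    fix i assume i: "i \<in> {1..k}"
    show "?t i = content_ideal R (f0 i \<otimes>\<^bsub>UP R\<^esub> g) \<cdot> (\<Otimes>\<^bsub>ideals_set R\<^esub> j \<in> {1..k} - {i}. content_ideal R (f0 j))"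
      using calculation(2)[of "{1..k} - {i}"] i by (simp add: f_def)
  next
    show "(\<lambda>i. content_ideal R (f0 i \<otimes>\<^bsub>UP R\<^esub> g) \<cdot> (\<Otimes>\<^bsub>ideals_set R\<^esub> j \<in> {1..k} - {i}. content_ideal R (f0 j)))
        \<in> {1..k} \<rightarrow> carrier (ideals_set R)"
    proof
      fix i assume i: "i \<in> {1..k}"
      show "content_ideal R (f0 i \<otimes>\<^bsub>UP R\<^esub> g) \<cdot> (\<Otimes>\<^bsub>ideals_set R\<^esub> j \<in> {1..k} - {i}. content_ideal R (f0 j)) \<in> carrier (ideals_set R)"
        using calculation(2)[of "{1..k} - {i}"] ti[of i] i by (simp add: f_def ideals_carrier)
    qed
  qed
  ultimately show "(\<Oplus>\<^bsub>ideals_set R\<^esub> i \<in> {1..k}. content_ideal R (f0 i \<otimes>\<^bsub>UP R\<^esub> g) \<cdot>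
      (\<Otimes>\<^bsub>ideals_set R\<^esub> j \<in> {1..k} - {i}. content_ideal R (f0 j))) =
      (\<Otimes>\<^bsub>ideals_set R\<^esub> j \<in> {1..k}. content_ideal R (f0 j)) \<cdot> content_ideal R g"
    by simp
qed

end

section \<open>The adic completion as an inverse limit\<close>

context noeth_local
begin

definition resid :: "nat \<Rightarrow> 'a \<Rightarrow> 'a set" where "resid n a = ipow m n +> a"

abbreviation "Qm n \<equiv> R Quot (ipow m n)"
abbreviation "Sm \<equiv> adic_completion R m"

lemma mi: "ideal (ipow m n) R"
  by (rule ipow_ideal[OF m_ideal])

lemma Qm_cring: "cring (Qm n)"
  by (rule ideal.quotient_is_cring[OF mi is_cring])

lemma resid_eq: "a \<in> carrier R \<Longrightarrow> b \<in> carrier R \<Longrightarrow> resid n a = resid n b \<longleftrightarrow> a \<ominus> b \<in> ipow m n"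
  unfolding resid_def using quotient_eq_iff_same_a_r_cos[OF mi] by blast

lemma Qm_carrier: "carrier (Qm n) = resid n ` carrier R"
  by (auto simp: FactRing_def A_RCOSETS_def' resid_def)

lemma Qm_mult: "a \<in> carrier R \<Longrightarrow> b \<in> carrier R \<Longrightarrow> resid n a \<otimes>\<^bsub>Qm n\<^esub> resid n b = resid n (a \<otimes> b)"
  using ring_hom_mult[OF ideal.rcos_ring_hom[OF mi]] by (simp add: resid_def)

lemma Qm_add: "a \<in> carrier R \<Longrightarrow> b \<in> carrier R \<Longrightarrow> resid n a \<oplus>\<^bsub>Qm n\<^esub> resid n b = resid n (a \<oplus> b)"
  using ring_hom_add[OF ideal.rcos_ring_hom[OF mi]] by (simp add: resid_def)

lemma Qm_one: "\<one>\<^bsub>Qm n\<^esub> = resid n \<one>"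
  using ring_hom_one[OF ideal.rcos_ring_hom[OF mi]] by (simp add: resid_def)

lemma Qm_zero: "\<zero>\<^bsub>Qm n\<^esub> = resid n \<zero>"
  using ring_hom_zero[OF ideal.rcos_ring_hom[OF mi] ring_axioms cring.axioms(1)[OF Qm_cring]] by (simp add: resid_def)

lemma resid_self: "a \<in> carrier R \<Longrightarrow> a \<in> resid n a"
  using ideal_zero[OF mi, of n] unfolding resid_def a_r_coset_def' by (auto intro!: bexI[of _ \<zero>])

lemma mem_resid: "b \<in> resid n a \<Longrightarrow> a \<in> carrier R \<Longrightarrow> b \<in> carrier R \<and> b \<ominus> a \<in> ipow m n"
proof -
  assume b: "b \<in> resid n a" and a: "a \<in> carrier R"
  then obtain i where i: "i \<in> ipow m n" "b = i \<oplus> a" by (auto simp: resid_def a_r_coset_def')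
  have ic: "i \<in> carrier R" using ideal_carr[OF mi i(1)] .
  have "b \<ominus> a = i" unfolding i(2) using ic a by algebra
  then show ?thesis using i a ic by simp
qed

text \<open>Turns the compatibility by inclusion in \<open>adic_completion\<close> into equality of
  residues: \<open>b\<close> lies in its own coset, and this determines the coset of
  \<open>m^n\<close> around it.\<close>

lemma resid_sub_iff:
  assumes "a \<in> carrier R" "b \<in> carrier R" shows "resid (Suc n) b \<subseteq> resid n a \<longleftrightarrow> resid n b = resid n a"
proof
  assume "resid (Suc n) b \<subseteq> resid n a"
  then have "b \<in> resid n a" using resid_self[OF assms(2)] by auto
  then show "resid n b = resid n a" using mem_resid assms resid_eq by auto
next
  assume e: "resid n b = resid n a"
  have "resid (Suc n) b \<subseteq> resid n b"
    unfolding resid_def a_r_coset_def' using ipow_antimono[OF m_ideal, of n "Suc n"] by auto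
  then show "resid (Suc n) b \<subseteq> resid n a" using e by simp
qed

lemma Sm_carrier_iff:
  "x \<in> carrier Sm \<longleftrightarrow> (\<exists>r. \<forall>n. r n \<in> carrier R \<and> x n = resid n (r n) \<and> resid n (r (Suc n)) = resid n (r n))"
proof
  assume "x \<in> carrier Sm"
  then have x: "\<And>n. x n \<in> resid n ` carrier R" "\<And>n. x (Suc n) \<subseteq> x n"
    by (auto simp: adic_completion_def Let_def ipow_def[symmetric] Qm_carrier)
  then have "\<forall>n. \<exists>a. a \<in> carrier R \<and> x n = resid n a" by blast
  then obtain r where "\<forall>n. r n \<in> carrier R \<and> x n = resid n (r n)" by (rule choice[THEN exE])
  then have r: "\<And>n. r n \<in> carrier R" "\<And>n. x n = resid n (r n)" by auto
  then have "resid n (r (Suc n)) = resid n (r n)" for n using x(2)[of n] resid_sub_iff by simp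
  then show "\<exists>r. \<forall>n. r n \<in> carrier R \<and> x n = resid n (r n) \<and> resid n (r (Suc n)) = resid n (r n)" using r by blast
next
  assume "\<exists>r. \<forall>n. r n \<in> carrier R \<and> x n = resid n (r n) \<and> resid n (r (Suc n)) = resid n (r n)"
  then obtain r where r: "\<And>n. r n \<in> carrier R" "\<And>n. x n = resid n (r n)" "\<And>n. resid n (r (Suc n)) = resid n (r n)" by blast
  then have "x (Suc n) \<subseteq> x n" for n using resid_sub_iff[of "r n" "r (Suc n)" n] by simp
  then show "x \<in> carrier Sm"
    using r by (auto simp: adic_completion_def Let_def ipow_def[symmetric] Qm_carrier)
qed

lemma Sm_rep:
  assumes "x \<in> carrier Sm"
  obtains r where "\<And>n. r n \<in> carrier R" "\<And>n. x n = resid n (r n)" "\<And>n. resid n (r (Suc n)) = resid n (r n)"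
proof -
  obtain r where "\<forall>n. r n \<in> carrier R \<and> x n = resid n (r n) \<and> resid n (r (Suc n)) = resid n (r n)"
    using assms unfolding Sm_carrier_iff ..
  then show thesis by (intro that[of r]) auto
qed

lemma Sm_mult: "x \<otimes>\<^bsub>Sm\<^esub> y = (\<lambda>n. x n \<otimes>\<^bsub>Qm n\<^esub> y n)"
  by (simp add: adic_completion_def Let_def ipow_def)

lemma Sm_add: "x \<oplus>\<^bsub>Sm\<^esub> y = (\<lambda>n. x n \<oplus>\<^bsub>Qm n\<^esub> y n)"
  by (simp add: adic_completion_def Let_def ipow_def)

lemma Sm_one: "\<one>\<^bsub>Sm\<^esub> = (\<lambda>n. \<one>\<^bsub>Qm n\<^esub>)"
  by (simp add: adic_completion_def Let_def ipow_def)

lemma Sm_zero: "\<zero>\<^bsub>Sm\<^esub> = (\<lambda>n. \<zero>\<^bsub>Qm n\<^esub>)"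
  by (simp add: adic_completion_def Let_def ipow_def)

lemma Sm_component: "x \<in> carrier Sm \<Longrightarrow> x n \<in> carrier (Qm n)"
  by (simp add: adic_completion_def Let_def ipow_def)

lemma const_in_Sm: "r \<in> carrier R \<Longrightarrow> (\<lambda>n. resid n r) \<in> carrier Sm"
  unfolding Sm_carrier_iff by (intro exI[of _ "\<lambda>_. r"]) simp

lemma resid_cong_op:
  assumes "a \<in> carrier R" "b \<in> carrier R" "c \<in> carrier R" "d \<in> carrier R" "resid n a = resid n c" "resid n b = resid n d"
  shows "resid n (a \<otimes> b) = resid n (c \<otimes> d)" "resid n (a \<oplus> b) = resid n (c \<oplus> d)" "resid n (\<ominus> a) = resid n (\<ominus> c)"
proof -
  have 1: "a \<ominus> c \<in> ipow m n" "b \<ominus> d \<in> ipow m n" using assms resid_eq by auto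
  show "resid n (a \<otimes> b) = resid n (c \<otimes> d)" "resid n (a \<oplus> b) = resid n (c \<oplus> d)"
    using assms Qm_mult[of a b n] Qm_mult[of c d n] Qm_add[of a b n] Qm_add[of c d n] by auto
  have "\<ominus> a \<ominus> \<ominus> c = \<ominus> (a \<ominus> c)" using assms(1,3) by algebra
  then show "resid n (\<ominus> a) = resid n (\<ominus> c)" using resid_eq[of "\<ominus> a" "\<ominus> c" n] assms(1,3) ideal_neg[OF mi 1(1)] by simp
qed

lemma Sm_closed:
  assumes "x \<in> carrier Sm" "y \<in> carrier Sm"
  shows "x \<otimes>\<^bsub>Sm\<^esub> y \<in> carrier Sm" "x \<oplus>\<^bsub>Sm\<^esub> y \<in> carrier Sm" "\<exists>z\<in>carrier Sm. z \<oplus>\<^bsub>Sm\<^esub> x = \<zero>\<^bsub>Sm\<^esub>"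
proof -
  obtain r where r: "\<And>n. r n \<in> carrier R" "\<And>n. x n = resid n (r n)" "\<And>n. resid n (r (Suc n)) = resid n (r n)"
    by (rule Sm_rep[OF assms(1)]) (rule that)
  obtain s where s: "\<And>n. s n \<in> carrier R" "\<And>n. y n = resid n (s n)" "\<And>n. resid n (s (Suc n)) = resid n (s n)"
    by (rule Sm_rep[OF assms(2)]) (rule that)
  show "x \<otimes>\<^bsub>Sm\<^esub> y \<in> carrier Sm" unfolding Sm_carrier_iff
    using r s by (intro exI[of _ "\<lambda>n. r n \<otimes> s n"]) (auto simp: Sm_mult Qm_mult intro!: resid_cong_op(1)[OF r(1) s(1) r(1) s(1) r(3) s(3)])
  show "x \<oplus>\<^bsub>Sm\<^esub> y \<in> carrier Sm" unfolding Sm_carrier_iff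
    using r s by (intro exI[of _ "\<lambda>n. r n \<oplus> s n"]) (auto simp: Sm_add Qm_add intro!: resid_cong_op(2)[OF r(1) s(1) r(1) s(1) r(3) s(3)])
  have "(\<lambda>n. resid n (\<ominus> (r n))) \<in> carrier Sm" unfolding Sm_carrier_iff
    using r by (intro exI[of _ "\<lambda>n. \<ominus> (r n)"]) (auto intro!: resid_cong_op(3)[OF r(1) r(1) r(1) r(1) r(3) r(3)])
  moreover have "(\<lambda>n. resid n (\<ominus> (r n))) \<oplus>\<^bsub>Sm\<^esub> x = \<zero>\<^bsub>Sm\<^esub>"
    using r by (simp add: Sm_add Sm_zero Qm_add Qm_zero l_neg)
  ultimately show "\<exists>z\<in>carrier Sm. z \<oplus>\<^bsub>Sm\<^esub> x = \<zero>\<^bsub>Sm\<^esub>" by blast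
qed

lemma Sm_cring: "cring Sm"
proof -
  interpret Q: cring "Qm n" for n by (rule Qm_cring)
  note c = Sm_component
  show ?thesis
  proof (rule cringI)
    show "abelian_group Sm"
    proof (rule abelian_groupI)
      show "\<zero>\<^bsub>Sm\<^esub> \<in> carrier Sm" using const_in_Sm[of \<zero>] by (simp add: Sm_zero Qm_zero)
    qed (use Sm_closed c in \<open>auto simp: Sm_add Sm_zero Q.a_ac\<close>)
    show "Group.comm_monoid Sm"
    proof (rule comm_monoidI)
      show "\<one>\<^bsub>Sm\<^esub> \<in> carrier Sm" using const_in_Sm[of \<one>] by (simp add: Sm_one Qm_one)
    qed (use Sm_closed c in \<open>auto simp: Sm_mult Sm_one Q.m_ac\<close>)
  qed (use c in \<open>auto simp: Sm_mult Sm_add Q.l_distr\<close>)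
qed

definition Fm :: "nat \<Rightarrow> (nat \<Rightarrow> 'a set) set" where
  "Fm n = {x \<in> carrier Sm. x n = resid n \<zero>}"

lemma Sm_proj: "ring_hom_cring Sm (Qm n) (\<lambda>x. x n)"
proof -
  interpret S: cring Sm by (rule Sm_cring)
  interpret Q: cring "Qm n" by (rule Qm_cring)
  show ?thesis
    by unfold_locales (auto simp: ring_hom_def Sm_mult Sm_add Sm_one Sm_component)
qed

lemma Fm_minus:
  assumes "x \<in> carrier Sm" "y \<in> carrier Sm" shows "x \<ominus>\<^bsub>Sm\<^esub> y \<in> Fm n \<longleftrightarrow> x n = y n"
proof -
  interpret P: ring_hom_cring Sm "Qm n" "\<lambda>x. x n" by (rule Sm_proj)
  have "(x \<ominus>\<^bsub>Sm\<^esub> y) n = x n \<ominus>\<^bsub>Qm n\<^esub> y n" using assms by (simp add: a_minus_def)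
  then show ?thesis
    using assms Sm_component by (simp add: Fm_def Qm_zero[symmetric] P.S.r_right_minus_eq)
qed

lemma Sm_rep_stable:
  assumes "\<And>n. r n \<in> carrier R" "\<And>n. resid n (r (Suc n)) = resid n (r n)"
  shows "resid i (r (i + d)) = resid i (r i)"
proof (induct d)
  case (Suc d)
  have "r (Suc (i + d)) \<ominus> r (i + d) \<in> ipow m (i + d)" using assms resid_eq[of "r (Suc (i + d))" "r (i + d)" "i + d"] by simp
  then have "r (Suc (i + d)) \<ominus> r (i + d) \<in> ipow m i" using ipow_antimono[OF m_ideal, of i "i + d"] by auto
  then have "resid i (r (Suc (i + d))) = resid i (r (i + d))" using resid_eq assms(1) by simp
  then show ?case using Suc by simp
qed simp

text \<open>The inverse limit satisfies the axioms from which all facts about the completion were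
  derived; \<open>Fm n\<close> is the kernel of the projection to component
  \<open>n\<close>.\<close>

lemma completion_pair_Sm: "completion_pair R m Sm (\<lambda>r n. resid n r) Fm"
proof -
  interpret S: cring Sm by (rule Sm_cring)
  show ?thesis
  proof (intro completion_pair.intro completion_pair_axioms.intro)
    show "noeth_local R m" by (rule noeth_local_axioms)
    show "cring Sm" by (rule Sm_cring)
    show "(\<lambda>r n. resid n r) \<in> ring_hom R Sm"
      by (auto simp: ring_hom_def const_in_Sm Sm_mult Sm_add Sm_one Qm_mult Qm_add Qm_one)
    show "ideal (Fm n) Sm" for n
    proof -
      interpret P: ring_hom_cring Sm "Qm n" "\<lambda>x. x n" by (rule Sm_proj)
      have "ideal (a_kernel Sm (Qm n) (\<lambda>x. x n)) Sm"
        by (rule P.ring.kernel_is_ideal)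
      moreover have "a_kernel Sm (Qm n) (\<lambda>x. x n) = Fm n" unfolding a_kernel_def' Fm_def Qm_zero ..
      ultimately show ?thesis by simp
    qed
    show "Fm 0 = carrier Sm"
    proof -
      have "x 0 = resid 0 \<zero>" if xS: "x \<in> carrier Sm" for x
      proof -
        obtain r where r: "\<And>n. r n \<in> carrier R" "\<And>n. x n = resid n (r n)" "\<And>n. resid n (r (Suc n)) = resid n (r n)" by (rule Sm_rep[OF xS]) (rule that)
        have "r 0 \<ominus> \<zero> \<in> ipow m 0" using r(1) by (simp add: ipow_0)
        then show ?thesis using r resid_eq[OF r(1) zero_closed] by simp
      qed
      then show ?thesis by (auto simp: Fm_def)
    qed
    show "Fm (Suc n) \<subseteq> Fm n" for n
    proof
      fix x assume x: "x \<in> Fm (Suc n)"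
      then have xS: "x \<in> carrier Sm" by (simp add: Fm_def)
      obtain r where r: "\<And>n. r n \<in> carrier R" "\<And>n. x n = resid n (r n)" "\<And>n. resid n (r (Suc n)) = resid n (r n)"
        by (rule Sm_rep[OF xS]) (rule that)
      have "resid (Suc n) (r (Suc n)) = resid (Suc n) \<zero>" using x r(2) by (simp add: Fm_def)
      then have "r (Suc n) \<ominus> \<zero> \<in> ipow m n" using resid_eq[of "r (Suc n)" \<zero> "Suc n"] r(1) ipow_antimono[OF m_ideal, of n "Suc n"] by auto
      then have "x n = resid n \<zero>" using resid_eq[of "r (Suc n)" \<zero> n] r by simp
      then show "x \<in> Fm n" using x by (simp add: Fm_def)
    qed
    show "a \<otimes>\<^bsub>Sm\<^esub> b \<in> Fm (i + j)" if a: "a \<in> Fm i" and b: "b \<in> Fm j" for a b i j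
    proof -
      have aS: "a \<in> carrier Sm" and bS: "b \<in> carrier Sm" using a b by (simp_all add: Fm_def)
      obtain r where r: "\<And>n. r n \<in> carrier R" "\<And>n. a n = resid n (r n)" "\<And>n. resid n (r (Suc n)) = resid n (r n)"
        by (rule Sm_rep[OF aS]) (rule that)
      obtain s where s: "\<And>n. s n \<in> carrier R" "\<And>n. b n = resid n (s n)" "\<And>n. resid n (s (Suc n)) = resid n (s n)"
        by (rule Sm_rep[OF bS]) (rule that)
      \<comment> \<open>Component \<open>i + j\<close> provides representatives of both factors at
        once: the one of \<open>a\<close> lies in \<open>m^i\<close>, the one of \<open>b\<close> in
        \<open>m^j\<close>.\<close>
      have "resid i (r (i + j)) = resid i \<zero>" using Sm_rep_stable[of r, OF r(1,3)] a r(2) by (simp add: Fm_def)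
      then have ri: "r (i + j) \<in> ipow m i" using resid_eq[of "r (i + j)" \<zero> i] r(1) by (simp add: a_minus_def)
      have "resid j (s (j + i)) = resid j \<zero>" using Sm_rep_stable[of s, OF s(1,3)] b s(2) by (simp add: Fm_def)
      then have sj: "s (i + j) \<in> ipow m j" using resid_eq[of "s (i + j)" \<zero> j] s(1) by (simp add: a_minus_def add.commute)
      have "r (i + j) \<otimes> s (i + j) \<in> ipow m (i + j)" unfolding ipow_add[OF m_ideal] using ri sj by (rule ideal_prod.prod)
      then have "resid (i + j) (r (i + j) \<otimes> s (i + j)) = resid (i + j) \<zero>"
        using resid_eq[of "r (i + j) \<otimes> s (i + j)" \<zero> "i + j"] r(1) s(1) by (simp add: a_minus_def)
      then have "(a \<otimes>\<^bsub>Sm\<^esub> b) (i + j) = resid (i + j) \<zero>" using r s by (simp add: Sm_mult Qm_mult)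
      then show ?thesis using a b Sm_closed(1) by (simp add: Fm_def)
    qed
    show "z = \<zero>\<^bsub>Sm\<^esub>" if "z \<in> carrier Sm" "\<And>n. z \<in> Fm n" for z
      using that(2) by (auto simp: Fm_def Sm_zero Qm_zero)
    show "\<exists>r\<in>carrier R. s \<ominus>\<^bsub>Sm\<^esub> (\<lambda>n. resid n r) \<in> Fm n" if s: "s \<in> carrier Sm" for s n
    proof -
      obtain r where r: "\<And>n. r n \<in> carrier R" "\<And>n. s n = resid n (r n)" "\<And>n. resid n (r (Suc n)) = resid n (r n)" by (rule Sm_rep[OF s]) (rule that)
      show ?thesis using Fm_minus[OF s const_in_Sm[OF r(1)[of n]], of n] r by (intro bexI[of _ "r n"]) auto
    qed
    show "((\<lambda>n. resid n r) \<in> Fm n) = (r \<in> ipow m n)" if "r \<in> carrier R" for r n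
      using that const_in_Sm[OF that] resid_eq[of r \<zero> n] by (simp add: Fm_def a_minus_def)
    show "\<exists>t\<in>carrier Sm. \<forall>n. t \<ominus>\<^bsub>Sm\<^esub> u n \<in> Fm n"
      if u: "\<And>n. u n \<in> carrier Sm" "\<And>n. u (Suc n) \<ominus>\<^bsub>Sm\<^esub> u n \<in> Fm n" for u
    proof -
      have e: "u (Suc n) n = u n n" for n using u(2)[of n] Fm_minus[OF u(1) u(1)] by simp
      \<comment> \<open>The diagonal is a compatible family because \<open>u (Suc n)\<close> and
        \<open>u n\<close> agree in component \<open>n\<close>.\<close>
      have "(\<lambda>n. u n n) \<in> carrier Sm"
        using u(1) e by (fastforce simp: adic_completion_def Let_def)
      then show ?thesis using Fm_minus[OF _ u(1)] by (intro bexI[of _ "\<lambda>n. u n n"]) auto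
    qed
  qed
qed

end

section \<open>Polynomial rings\<close>

lemma UP_carrier: "carrier (UP R) = up R"
  by (simp add: UP_def)

lemma UP_coeff_apply: "p \<in> up R \<Longrightarrow> up_ring.coeff (UP R) p n = p n"
  by (simp add: UP_def)

context cring_with_UP
begin

abbreviation "Cn a \<equiv> mn a 0"
abbreviation "Xn \<equiv> mn \<one> (Suc 0)"

lemma UP_eqI:
  assumes "p \<in> carrier UPR" "q \<in> carrier UPR" "\<And>n. cf p n = cf q n" shows "p = q"
  by (rule UP.up_eqI[OF assms(3,1,2)])

lemma Cn_hom: "ring_hom_cring R UPR (\<lambda>a. Cn a)"
proof (intro ring_hom_cring.intro ring_hom_cring_axioms.intro is_cring UPr.is_cring ring_hom_memI)
  fix a b assume a: "a \<in> carrier R" and b: "b \<in> carrier R"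
  show "Cn (a \<otimes> b) = Cn a \<otimes>\<^bsub>UPR\<^esub> Cn b"
    using a b by (intro UP_eqI) (auto simp: coeff_monom_mult)
  show "Cn (a \<oplus> b) = Cn a \<oplus>\<^bsub>UPR\<^esub> Cn b"
    using a b by (intro UP_eqI) auto
qed (use UP_ring.monom_one[OF UP_ring_R] in auto)

lemma coeff_C_mult: "a \<in> carrier R \<Longrightarrow> p \<in> carrier UPR \<Longrightarrow> cf (Cn a \<otimes>\<^bsub>UPR\<^esub> p) n = a \<otimes> cf p n"
  by (simp add: coeff_monom_mult)

lemma coeff_X_mult: "p \<in> carrier UPR \<Longrightarrow> cf (Xn \<otimes>\<^bsub>UPR\<^esub> p) n = (if n = 0 then \<zero> else cf p (n - 1))"
  by (simp add: coeff_monom_mult)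

lemma UP_split:
  assumes F: "F \<in> carrier UPR" and d: "\<And>i. i > d \<Longrightarrow> cf F i = \<zero>"
  obtains G where "G \<in> carrier UPR" "F = Cn (cf F 0) \<oplus>\<^bsub>UPR\<^esub> Xn \<otimes>\<^bsub>UPR\<^esub> G" "\<And>n. cf G n = cf F (Suc n)"
proof -
  define G where "G = (\<lambda>n. cf F (Suc n))"
  have G: "G \<in> up R"
  proof (rule mem_upI)
    show "G n \<in> carrier R" for n unfolding G_def using F by simp
    have "G i = \<zero>" if "d < i" for i unfolding G_def by (rule d) (use that in simp)
    then show "\<exists>n. bound \<zero> n G" by (intro exI[of _ d] bound.intro)
  qed
  then have Gc: "G \<in> carrier UPR" by (simp only: UP_carrier)
  have cG: "cf G n = cf F (Suc n)" for n using UP_coeff_apply[OF G, of n] by (simp only: G_def)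
  have "F = Cn (cf F 0) \<oplus>\<^bsub>UPR\<^esub> Xn \<otimes>\<^bsub>UPR\<^esub> G"
  proof (rule UP_eqI)
    show "cf F n = cf (Cn (cf F 0) \<oplus>\<^bsub>UPR\<^esub> Xn \<otimes>\<^bsub>UPR\<^esub> G) n" for n
      using F Gc by (cases n) (simp_all add: coeff_X_mult cG)
  qed (use F Gc in simp_all)
  then show ?thesis using that Gc cG by blast
qed

lemma UP_bound: "F \<in> carrier UPR \<Longrightarrow> \<exists>d. \<forall>i>d. cf F i = \<zero>"
  using UP_deg_aboveD by blast

text \<open>Induction along Horner's scheme; removing the constant term and dividing by
  \<open>X\<close> lowers the degree bound by one.\<close>

lemma UP_induct [consumes 1, case_names const step]:
  assumes F: "F \<in> carrier UPR"
    and const: "\<And>c. c \<in> carrier R \<Longrightarrow> P (Cn c)"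
    and step: "\<And>c G. c \<in> carrier R \<Longrightarrow> G \<in> carrier UPR \<Longrightarrow> P G \<Longrightarrow> P (Cn c \<oplus>\<^bsub>UPR\<^esub> Xn \<otimes>\<^bsub>UPR\<^esub> G)"
  shows "P F"
proof -
  have "F \<in> carrier UPR \<Longrightarrow> (\<forall>i>d. cf F i = \<zero>) \<Longrightarrow> P F" for d F
  proof (induct d arbitrary: F)
    case 0
    have "F = Cn (cf F 0)" using 0 by (intro UP_eqI) auto
    then show ?case using const[of "cf F 0"] 0 by simp
  next
    case (Suc d)
    obtain G where G: "G \<in> carrier UPR" "F = Cn (cf F 0) \<oplus>\<^bsub>UPR\<^esub> Xn \<otimes>\<^bsub>UPR\<^esub> G" "\<And>n. cf G n = cf F (Suc n)"
      by (rule UP_split[OF Suc(2), of "Suc d"]) (use Suc(3) in blast)+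
    have "P G" using Suc(1)[OF G(1)] G(3) Suc(3) by simp
    then have "P (Cn (cf F 0) \<oplus>\<^bsub>UPR\<^esub> Xn \<otimes>\<^bsub>UPR\<^esub> G)" using step[OF _ G(1), of "cf F 0"] Suc(2) by simp
    then show ?case using G(2) by simp
  qed
  then show ?thesis using F UP_bound by blast
qed

text \<open>The extended ideal \<open>I R[X]\<close>, described by coefficients.\<close>

definition upid :: "'a set \<Rightarrow> (nat \<Rightarrow> 'a) set" where
  "upid I = {F \<in> carrier UPR. \<forall>n. cf F n \<in> I}"

lemma upid_ideal:
  assumes I: "ideal I R" shows "ideal (upid I) UPR"
proof (rule UPr.ideal_crit)
  show "upid I \<subseteq> carrier UPR" by (auto simp: upid_def)
  show "\<zero>\<^bsub>UPR\<^esub> \<in> upid I" using ideal_zero[OF I] by (simp add: upid_def)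
  show "a \<oplus>\<^bsub>UPR\<^esub> b \<in> upid I" if "a \<in> upid I" "b \<in> upid I" for a b
    using that ideal_add[OF I] by (simp add: upid_def)
  show "r \<otimes>\<^bsub>UPR\<^esub> a \<in> upid I" if r: "r \<in> carrier UPR" and a: "a \<in> upid I" for r a
  proof -
    have "cf (r \<otimes>\<^bsub>UPR\<^esub> a) n \<in> I" for n
      using r a ideal_lmult[OF I] by (auto simp: upid_def UP_coeff_mult intro!: lincomb_in_ideal[OF I])
    then show ?thesis using r a by (simp add: upid_def)
  qed
qed

lemma C_in_upid: "ideal I R \<Longrightarrow> c \<in> carrier R \<Longrightarrow> Cn c \<in> upid I \<longleftrightarrow> c \<in> I"
  using ideal_zero[of I] by (auto simp: upid_def split: if_splits)

lemma upid_split_mem: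
  assumes I: "ideal I R" and "c \<in> carrier R" "G \<in> carrier UPR"
  shows "Cn c \<oplus>\<^bsub>UPR\<^esub> Xn \<otimes>\<^bsub>UPR\<^esub> G \<in> upid I \<longleftrightarrow> c \<in> I \<and> G \<in> upid I"
proof -
  have c0: "cf (Cn c \<oplus>\<^bsub>UPR\<^esub> Xn \<otimes>\<^bsub>UPR\<^esub> G) 0 = c" using assms(2,3) by (simp add: coeff_X_mult)
  have cS: "cf (Cn c \<oplus>\<^bsub>UPR\<^esub> Xn \<otimes>\<^bsub>UPR\<^esub> G) (Suc n) = cf G n" for n using assms(2,3) by (simp add: coeff_X_mult)
  have "(\<forall>n. cf (Cn c \<oplus>\<^bsub>UPR\<^esub> Xn \<otimes>\<^bsub>UPR\<^esub> G) n \<in> I) \<longleftrightarrow> c \<in> I \<and> (\<forall>n. cf G n \<in> I)"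
    using c0 cS by (metis not0_implies_Suc)
  then show ?thesis using assms(2,3) by (simp add: upid_def)
qed

lemma upid_least:
  assumes I: "ideal I R" and J: "ideal J UPR" and IJ: "\<And>c. c \<in> I \<Longrightarrow> Cn c \<in> J"
  shows "upid I \<subseteq> J"
proof
  fix F assume F: "F \<in> upid I"
  then have "F \<in> carrier UPR" by (simp add: upid_def)
  then show "F \<in> J" using F
  proof (induct rule: UP_induct)
    case (const c) then show ?case using C_in_upid[OF I] IJ by simp
  next
    case (step c G)
    then have "c \<in> I" "G \<in> J" using upid_split_mem[OF I] by auto
    then show ?case using IJ UPr.ideal_add[OF J] UPr.ideal_lmult[OF J] by simp
  qed
qed

lemma upid_mono: "I \<subseteq> J \<Longrightarrow> upid I \<subseteq> upid J"
  by (auto simp: upid_def)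

lemma upid_prime:
  assumes p: "primeideal p R" shows "primeideal (upid p) UPR"
proof -
  note pI = primeideal_ideal[OF p]
  have main: "G \<in> upid p" if "H \<in> carrier UPR" "G \<in> carrier UPR" "F \<in> carrier UPR" "H \<otimes>\<^bsub>UPR\<^esub> G \<in> upid p" "H \<notin> upid p" for F G H
  proof (rule ccontr)
    assume G: "G \<notin> upid p"
    \<comment> \<open>Gauss's argument with the lowest coefficients outside \<open>p\<close>: in
      degree \<open>i + j\<close> of the product all terms but one lie in \<open>p\<close>.\<close>
    define i where "i = (LEAST i. cf H i \<notin> p)"
    define j where "j = (LEAST j. cf G j \<notin> p)"
    have iE: "\<exists>i. cf H i \<notin> p" and jE: "\<exists>j. cf G j \<notin> p" using that G by (auto simp: upid_def)
    have i: "cf H i \<notin> p" unfolding i_def by (rule LeastI_ex[OF iE])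
    have i': "cf H n \<in> p" if "n < i" for n using not_less_Least[of n "\<lambda>i. cf H i \<notin> p"] that unfolding i_def by blast
    have j: "cf G j \<notin> p" unfolding j_def by (rule LeastI_ex[OF jE])
    have j': "cf G n \<in> p" if "n < j" for n using not_less_Least[of n "\<lambda>i. cf G i \<notin> p"] that unfolding j_def by blast
    have sp: "{..i + j} = insert i ({..i + j} - {i})" by auto
    have "cf (H \<otimes>\<^bsub>UPR\<^esub> G) (i + j) = (\<Oplus>l\<in>{..i + j}. cf H l \<otimes> cf G (i + j - l))"
      using that by (simp add: UP_coeff_mult)
    also have "\<dots> = (\<Oplus>l\<in>insert i ({..i + j} - {i}). cf H l \<otimes> cf G (i + j - l))" using sp by simp
    also have "\<dots> = cf H i \<otimes> cf G j \<oplus> (\<Oplus>l\<in>{..i + j} - {i}. cf H l \<otimes> cf G (i + j - l))"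
      using that(1,2) by (subst finsum_insert) (auto simp: Pi_iff)
    finally have e: "cf (H \<otimes>\<^bsub>UPR\<^esub> G) (i + j) = cf H i \<otimes> cf G j \<oplus> (\<Oplus>l\<in>{..i + j} - {i}. cf H l \<otimes> cf G (i + j - l))" .
    have "(\<Oplus>l\<in>{..i + j} - {i}. cf H l \<otimes> cf G (i + j - l)) \<in> p" (is "?s \<in> p")
    proof (rule lincomb_in_ideal[OF pI])
      fix l assume l: "l \<in> {..i + j} - {i}"
      then have "l < i \<or> i + j - l < j" by auto
      then show "cf H l \<otimes> cf G (i + j - l) \<in> p"
        using i' j' ideal_lmult[OF pI] ideal_rmult[OF pI] that(1,2) by auto
    qed
    moreover from this have "?s \<oplus> cf H i \<otimes> cf G j = cf (H \<otimes>\<^bsub>UPR\<^esub> G) (i + j)"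
      using e ideal_carr[OF pI] that(1,2) by (simp add: a_comm)
    moreover have "cf (H \<otimes>\<^bsub>UPR\<^esub> G) (i + j) \<in> p" using that(4) by (simp add: upid_def)
    ultimately have "cf H i \<otimes> cf G j \<in> p"
      using ideal_cancel_add[OF pI, of ?s "cf H i \<otimes> cf G j"] that(1,2) by simp
    then show False using prime_mult_iff[OF p, of "cf H i" "cf G j"] i j that(1,2) by simp
  qed
  show ?thesis
  proof (rule UPr.primeideal_crit[OF upid_ideal[OF pI]])
    show "\<one>\<^bsub>UPR\<^esub> \<notin> upid p"
      using C_in_upid[OF pI, of \<one>] prime_one[OF p] UP_ring.monom_one[OF UP_ring_R] by simp
    show "a \<in> upid p \<or> b \<in> upid p" if "a \<in> carrier UPR" "b \<in> carrier UPR" "a \<otimes>\<^bsub>UPR\<^esub> b \<in> upid p" for a b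
      using main[OF that(1,2,2,3)] by blast
  qed
qed

text \<open>The ideal \<open>(I, X)\<close>.\<close>

definition upX :: "'a set \<Rightarrow> (nat \<Rightarrow> 'a) set" where
  "upX I = {F \<in> carrier UPR. cf F 0 \<in> I}"

lemma coeff0_mult: "F \<in> carrier UPR \<Longrightarrow> G \<in> carrier UPR \<Longrightarrow> cf (F \<otimes>\<^bsub>UPR\<^esub> G) 0 = cf F 0 \<otimes> cf G 0"
  by (simp add: UP_coeff_mult)

lemma upX_prime:
  assumes p: "primeideal p R" shows "primeideal (upX p) UPR"
proof (rule UPr.primeideal_crit)
  note pI = primeideal_ideal[OF p]
  show "ideal (upX p) UPR"
    using ideal_zero[OF pI] ideal_add[OF pI] ideal_lmult[OF pI]
    by (intro UPr.ideal_crit) (auto simp: upX_def coeff0_mult)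
  show "\<one>\<^bsub>UPR\<^esub> \<notin> upX p" using prime_one[OF p] UP_ring.coeff_one[OF UP_ring_R, of 0] by (simp add: upX_def)
  show "a \<in> upX p \<or> b \<in> upX p" if "a \<in> carrier UPR" "b \<in> carrier UPR" "a \<otimes>\<^bsub>UPR\<^esub> b \<in> upX p" for a b
    using that prime_mult_iff[OF p, of "cf a 0" "cf b 0"] by (simp add: upX_def coeff0_mult)
qed

lemma upid_sub_upX: "upid I \<subseteq> upX I"
  by (auto simp: upid_def upX_def)

lemma X_notin_upid: "primeideal p R \<Longrightarrow> Xn \<notin> upid p"
  using prime_one[of p] by (auto simp: upid_def intro!: exI[of _ 1])

lemma X_in_upX: "ideal I R \<Longrightarrow> Xn \<in> upX I"
  using ideal_zero[of I] by (simp add: upX_def)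

section \<open>Leading coefficients and Hilbert's basis theorem\<close>

definition lead :: "(nat \<Rightarrow> 'a) set \<Rightarrow> nat \<Rightarrow> 'a set" where
  "lead J n = {c. \<exists>H\<in>J. (\<forall>i>n. cf H i = \<zero>) \<and> cf H n = c}"

lemma lead_ideal:
  assumes J: "ideal J UPR" shows "ideal (lead J n) R"
proof (rule ideal_crit)
  show "lead J n \<subseteq> carrier R" using UPr.ideal_carr[OF J] by (auto simp: lead_def)
  show "\<zero> \<in> lead J n" using UPr.ideal_zero[OF J] by (auto simp: lead_def intro!: bexI[of _ "\<zero>\<^bsub>UPR\<^esub>"])
  show "a \<oplus> b \<in> lead J n" if ab: "a \<in> lead J n" "b \<in> lead J n" for a b
  proof -
    obtain H K where H: "H \<in> J" "\<And>i. i > n \<Longrightarrow> cf H i = \<zero>" "cf H n = a" and K: "K \<in> J" "\<And>i. i > n \<Longrightarrow> cf K i = \<zero>" "cf K n = b"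
      using ab by (auto simp: lead_def)
    note c = UPr.ideal_carr[OF J H(1)] UPr.ideal_carr[OF J K(1)]
    show ?thesis unfolding lead_def
      using H(2,3) K(2,3) c UPr.ideal_add[OF J H(1) K(1)] by (auto intro!: bexI[of _ "H \<oplus>\<^bsub>UPR\<^esub> K"])
  qed
  show "r \<otimes> a \<in> lead J n" if r: "r \<in> carrier R" and a: "a \<in> lead J n" for r a
  proof -
    obtain H where H: "H \<in> J" "\<And>i. i > n \<Longrightarrow> cf H i = \<zero>" "cf H n = a" using a by (auto simp: lead_def)
    note c = UPr.ideal_carr[OF J H(1)]
    show ?thesis unfolding lead_def
      using H(2,3) c r UPr.ideal_lmult[OF J H(1), of "Cn r"] by (auto simp: coeff_C_mult intro!: bexI[of _ "Cn r \<otimes>\<^bsub>UPR\<^esub> H"])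
  qed
qed

lemma lead_Suc:
  assumes J: "ideal J UPR" shows "lead J n \<subseteq> lead J (Suc n)"
proof
  fix a assume "a \<in> lead J n"
  then obtain H where H: "H \<in> J" "\<And>i. i > n \<Longrightarrow> cf H i = \<zero>" "cf H n = a" by (auto simp: lead_def)
  note c = UPr.ideal_carr[OF J H(1)]
  show "a \<in> lead J (Suc n)" unfolding lead_def
    using H(2,3) c UPr.ideal_lmult[OF J H(1), of "Xn"] by (auto simp: coeff_X_mult intro!: bexI[of _ "Xn \<otimes>\<^bsub>UPR\<^esub> H"])
qed

text \<open>Division from the top: the leading coefficient of an element of \<open>J\<close> is
  cancelled by an element of \<open>K\<close>, and since \<open>K\<close> lies in \<open>J\<close>
  the difference stays in \<open>J\<close>.\<close>

lemma lead_cover: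
  assumes J: "ideal J UPR" and K: "ideal K UPR" and KJ: "K \<subseteq> J" and l: "\<And>n. lead J n \<subseteq> lead K n"
  shows "J \<subseteq> K"
proof -
  have "F \<in> J \<Longrightarrow> (\<forall>i\<ge>d. cf F i = \<zero>) \<Longrightarrow> F \<in> K" for d F
  proof (induct d arbitrary: F)
    case 0
    then have "F = \<zero>\<^bsub>UPR\<^esub>" using UPr.ideal_carr[OF J] by (intro UP_eqI) auto
    then show ?case using UPr.ideal_zero[OF K] by simp
  next
    case (Suc d)
    note Fc = UPr.ideal_carr[OF J Suc(2)]
    have "cf F d \<in> lead J d" using Suc(2,3) by (auto simp: lead_def intro!: bexI[of _ F])
    then have "cf F d \<in> lead K d" using l by blast
    then obtain H where H: "H \<in> K" "\<And>i. i > d \<Longrightarrow> cf H i = \<zero>" "cf H d = cf F d" by (auto simp: lead_def)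
    note Hc = UPr.ideal_carr[OF K H(1)]
    have HJ: "H \<in> J" using H(1) KJ by blast
    have "F \<ominus>\<^bsub>UPR\<^esub> H \<in> K"
    proof (rule Suc(1))
      show "F \<ominus>\<^bsub>UPR\<^esub> H \<in> J" by (rule UPr.ideal_minus[OF J Suc(2) HJ])
      show "\<forall>i\<ge>d. cf (F \<ominus>\<^bsub>UPR\<^esub> H) i = \<zero>"
      proof (intro allI impI)
        fix i assume i: "d \<le> i"
        show "cf (F \<ominus>\<^bsub>UPR\<^esub> H) i = \<zero>"
          using i Suc(3) H(2)[of i] H(3) Fc Hc UP_ring.coeff_minus[OF UP_ring_R Fc Hc, of i] r_neg[of "cf F d"] by (cases "i = d") (auto simp: a_minus_def)
      qed
    qed
    then show ?case using UPr.ideal_cancel_minus[OF K _ H(1) Fc] by blast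
  qed
  then show ?thesis using UP_bound UPr.ideal_carr[OF J] by (meson Suc_le_eq subsetI)
qed

end

locale noeth_cring_with_UP = noetherian_cring + cring_with_UP
begin

text \<open>The ideals \<open>lead J n\<close> increase and become stationary at some
  \<open>N\<close>, so generators for the finitely many \<open>n \<le> N\<close> suffice; beyond
  \<open>N\<close> they are multiplied by powers of \<open>X\<close>.\<close>

lemma hilbert_basis: "noetherian_cring UPR"
proof -
  have "\<exists>A\<subseteq>carrier UPR. finite A \<and> J = Idl\<^bsub>UPR\<^esub> A" if J: "ideal J UPR" for J
  proof -
    obtain N where N: "\<And>m. m \<ge> N \<Longrightarrow> lead J m = lead J N"
      by (rule noeth_acc[of "lead J"]) (use lead_ideal[OF J] lead_Suc[OF J] in blast)+
    have "\<exists>A. finite A \<and> A \<subseteq> J \<and> (\<forall>K. ideal K UPR \<and> A \<subseteq> K \<longrightarrow> lead J n \<subseteq> lead K n)" for n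
    proof -
      obtain G where G: "G \<subseteq> carrier R" "finite G" "lead J n = Idl G" using finetely_gen[OF lead_ideal[OF J]] by blast
      have GJ: "\<forall>g\<in>G. \<exists>H. H \<in> J \<and> (\<forall>i>n. cf H i = \<zero>) \<and> cf H n = g"
      proof
        fix g assume "g \<in> G"
        then have "g \<in> lead J n" using G genideal_self[OF G(1)] by auto
        then show "\<exists>H. H \<in> J \<and> (\<forall>i>n. cf H i = \<zero>) \<and> cf H n = g" by (auto simp: lead_def)
      qed
      obtain h where h: "\<forall>g\<in>G. h g \<in> J \<and> (\<forall>i>n. cf (h g) i = \<zero>) \<and> cf (h g) n = g" using bchoice[OF GJ] by auto
      have "lead J n \<subseteq> lead K n" if K: "ideal K UPR" "h ` G \<subseteq> K" for K
      proof -
        have "G \<subseteq> lead K n" using h K(2) by (auto simp: lead_def intro!: bexI[of _ "h _"])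
        then show ?thesis using G(3) genideal_minimal[OF lead_ideal[OF K(1)]] by blast
      qed
      then show ?thesis using G(2) h by (intro exI[of _ "h ` G"]) auto
    qed
    then have "\<forall>n. \<exists>A. finite A \<and> A \<subseteq> J \<and> (\<forall>K. ideal K UPR \<and> A \<subseteq> K \<longrightarrow> lead J n \<subseteq> lead K n)" by blast
    then obtain A where A: "\<forall>n. finite (A n) \<and> A n \<subseteq> J \<and> (\<forall>K. ideal K UPR \<and> A n \<subseteq> K \<longrightarrow> lead J n \<subseteq> lead K n)" 
      by (rule choice[THEN exE])
    let ?B = "\<Union>n\<le>N. A n"
    have BJ: "?B \<subseteq> J" using A by auto
    have Bc: "?B \<subseteq> carrier UPR" using BJ UPr.ideal_carr[OF J] by blast
    have Ki: "ideal (Idl\<^bsub>UPR\<^esub> ?B) UPR" by (rule UPr.genideal_ideal[OF Bc])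
    have KJ: "Idl\<^bsub>UPR\<^esub> ?B \<subseteq> J" by (rule UPr.genideal_minimal[OF J BJ])
    have 1: "lead J n \<subseteq> lead (Idl\<^bsub>UPR\<^esub> ?B) n" if "n \<le> N" for n
    proof -
      have "A n \<subseteq> ?B" using that by auto
      then have "A n \<subseteq> Idl\<^bsub>UPR\<^esub> ?B" using UPr.genideal_self[OF Bc] by blast
      then show ?thesis using A Ki by blast
    qed
    have 2: "lead (Idl\<^bsub>UPR\<^esub> ?B) N \<subseteq> lead (Idl\<^bsub>UPR\<^esub> ?B) (N + d)" for d
      using lead_Suc[OF Ki] by (induct d) auto
    have "lead J n \<subseteq> lead (Idl\<^bsub>UPR\<^esub> ?B) n" for n
    proof (cases "n \<le> N")
      case False
      then show ?thesis using N[of n] 1[of N] 2[of "n - N"] by simp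
    qed (rule 1)
    then have "J = Idl\<^bsub>UPR\<^esub> ?B" using lead_cover[OF J Ki KJ] KJ by blast
    then show ?thesis using Bc A by (intro exI[of _ ?B]) auto
  qed
  then show ?thesis by (intro noetherian_cring.intro UPr.is_cring noetherian_ring.intro UPr.ring_axioms noetherian_ring_axioms.intro) auto
qed

sublocale UPn: noetherian_cring UPR
  by (rule hilbert_basis)

end

context noeth_cring_with_UP
begin

sublocale Ch: ring_hom_cring R UPR "\<lambda>a. Cn a"
  by (rule Cn_hom)

section \<open>Kernels of evaluation at a fraction\<close>

definition lin :: "'a \<Rightarrow> 'a \<Rightarrow> nat \<Rightarrow> 'a" where
  "lin a b = Cn b \<otimes>\<^bsub>UPR\<^esub> Xn \<ominus>\<^bsub>UPR\<^esub> Cn a"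

text \<open>For \<open>b \<notin> p\<close>, \<open>slope p a b\<close> is the kernel of \<open>R[X] \<rightarrow> Frac (R/p)\<close>, \<open>X \<mapsto> a/b\<close>.\<close>

definition slope :: "'a set \<Rightarrow> 'a \<Rightarrow> 'a \<Rightarrow> (nat \<Rightarrow> 'a) set" where
  "slope p a b = {F \<in> carrier UPR. \<exists>n::nat. Cn (b [^] n) \<otimes>\<^bsub>UPR\<^esub> F \<in> upid p <+>\<^bsub>UPR\<^esub> PIdl\<^bsub>UPR\<^esub> (lin a b)}"

lemma lin_closed [simp]: "a \<in> carrier R \<Longrightarrow> b \<in> carrier R \<Longrightarrow> lin a b \<in> carrier UPR"
  by (simp add: lin_def)

lemma lin_mult_coeff:
  assumes "a \<in> carrier R" "b \<in> carrier R" "H \<in> carrier UPR"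
  shows "cf (H \<otimes>\<^bsub>UPR\<^esub> lin a b) n = b \<otimes> (if n = 0 then \<zero> else cf H (n - 1)) \<ominus> a \<otimes> cf H n"
proof -
  have X: "Xn \<in> carrier UPR" and Ca: "Cn a \<in> carrier UPR" and Cb: "Cn b \<in> carrier UPR" using assms by simp_all
  have "H \<otimes>\<^bsub>UPR\<^esub> lin a b = Cn b \<otimes>\<^bsub>UPR\<^esub> (Xn \<otimes>\<^bsub>UPR\<^esub> H) \<ominus>\<^bsub>UPR\<^esub> Cn a \<otimes>\<^bsub>UPR\<^esub> H"
    unfolding lin_def using X Ca Cb assms(3) by algebra
  moreover have "cf (Cn b \<otimes>\<^bsub>UPR\<^esub> (Xn \<otimes>\<^bsub>UPR\<^esub> H) \<ominus>\<^bsub>UPR\<^esub> Cn a \<otimes>\<^bsub>UPR\<^esub> H) n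
      = cf (Cn b \<otimes>\<^bsub>UPR\<^esub> (Xn \<otimes>\<^bsub>UPR\<^esub> H)) n \<ominus> cf (Cn a \<otimes>\<^bsub>UPR\<^esub> H) n"
    by (rule UP_ring.coeff_minus[OF UP_ring_R]) (use assms in simp_all)
  ultimately show ?thesis using assms by (simp add: coeff_C_mult coeff_X_mult)
qed

context
  fixes p a b assumes p: "primeideal p R" and ab: "a \<in> carrier R" "b \<in> carrier R" and bp: "b \<notin> p"
begin

private lemma pI: "ideal p R" by (rule primeideal_ideal[OF p])

text \<open>The ideal \<open>(p, b X - a)\<close>; \<open>slope p a b\<close> is its saturation by
  the powers of \<open>b\<close>.\<close>

abbreviation (input) "JJ \<equiv> upid p <+>\<^bsub>UPR\<^esub> PIdl\<^bsub>UPR\<^esub> (lin a b)"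

lemma JJ_ideal: "ideal JJ UPR"
  by (rule UPr.PIdl_sum_ideal[OF upid_ideal[OF pI]]) (use ab in simp)

lemma JJ_lin: "lin a b \<in> JJ"
  by (rule UPr.PIdl_sum_mem[OF upid_ideal[OF pI]]) (use ab in simp)

lemma JJ_upid: "upid p \<subseteq> JJ"
  by (rule UPr.PIdl_sum_sub[OF upid_ideal[OF pI]]) (use ab in simp)

text \<open>Comparing coefficients gives \<open>b H_n - a H_(n+1) \<in> p\<close>. The coefficients
  of \<open>H\<close> vanish in high degree, so by descent all of them lie in \<open>p\<close>, as
  \<open>b\<close> does not; the constant term then puts \<open>c\<close> into
  \<open>p\<close>.\<close>

lemma JJ_contract:
  assumes c: "c \<in> carrier R" "Cn c \<in> JJ" shows "c \<in> p"
proof -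
  obtain P H where PH: "P \<in> upid p" "H \<in> carrier UPR" "Cn c = P \<oplus>\<^bsub>UPR\<^esub> H \<otimes>\<^bsub>UPR\<^esub> lin a b"
    using c(2) unfolding UPr.mem_sum_PIdl by blast
  have Pc: "P \<in> carrier UPR" and Pp: "\<And>n. cf P n \<in> p" using PH(1) by (auto simp: upid_def)
  have e: "cf (Cn c) n = cf P n \<oplus> cf (H \<otimes>\<^bsub>UPR\<^esub> lin a b) n" for n
    unfolding PH(3) using Pc PH(2) ab by simp
  have s: "b \<otimes> cf H n \<ominus> a \<otimes> cf H (Suc n) \<in> p" for n
  proof -
    have "cf P (Suc n) \<oplus> (b \<otimes> cf H n \<ominus> a \<otimes> cf H (Suc n)) = \<zero>"
      using e[of "Suc n"] lin_mult_coeff[OF ab PH(2), of "Suc n"] c(1) by simp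
    then show ?thesis using ideal_cancel_add[OF pI _ Pp[of "Suc n"]] ideal_zero[OF pI] PH(2) ab by simp
  qed
  obtain d where d: "\<forall>i>d. cf H i = \<zero>" using UP_bound[OF PH(2)] by blast
  have "cf H (d + 1 - i) \<in> p" if "i \<le> d + 1" for i using that
  proof (induct i)
    case 0 then show ?case using d ideal_zero[OF pI] by simp
  next
    case (Suc i)
    let ?j = "d + 1 - Suc i"
    have j: "Suc ?j = d + 1 - i" using Suc by simp
    have "a \<otimes> cf H (Suc ?j) \<in> p" using Suc j ideal_lmult[OF pI] ab by simp
    then have "b \<otimes> cf H ?j \<in> p" using ideal_cancel_minus[OF pI s[of ?j]] ab PH(2) by simp
    then show ?case using prime_mult_iff[OF p ab(2)] bp PH(2) by simp
  qed
  from this[of "d + 1"] have H0: "cf H 0 \<in> p" by simp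
  have "c = cf P 0 \<oplus> (b \<otimes> \<zero> \<ominus> a \<otimes> cf H 0)"
    using e[of 0] lin_mult_coeff[OF ab PH(2), of 0] c(1) by simp
  also have "\<dots> = cf P 0 \<ominus> a \<otimes> cf H 0" using ab PH(2) by (simp add: a_minus_def)
  finally show ?thesis using ideal_minus[OF pI Pp ideal_lmult[OF pI H0 ab(1)]] by simp
qed

lemma pow_notin: "b [^] (n::nat) \<notin> p"
  using prime_pow[OF p ab(2)] bp by blast

lemma pow_cancel: "c \<in> carrier R \<Longrightarrow> b [^] (n::nat) \<otimes> c \<in> p \<Longrightarrow> c \<in> p"
  using prime_mult_iff[OF p] pow_notin ab by simp

text \<open>Evaluation at \<open>a/b\<close> with denominators cleared. The part of positive degree
  is kept in the form \<open>a u\<close> with \<open>u\<close> in \<open>(a, b)^D\<close>, because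
  for constant term \<open>1\<close> this becomes an equation of integral dependence.\<close>

lemma pseudo_division:
  assumes F: "F \<in> carrier UPR"
  shows "\<exists>D u. u \<in> ipow (PIdl a <+> PIdl b) D \<and> 
    Cn (b [^] Suc D) \<otimes>\<^bsub>UPR\<^esub> F \<ominus>\<^bsub>UPR\<^esub> Cn (b [^] Suc D \<otimes> cf F 0 \<oplus> a \<otimes> u) \<in> PIdl\<^bsub>UPR\<^esub> (lin a b)"
  using F
proof (induct rule: UP_induct)
  case (const c)
  have i: "ideal (PIdl\<^bsub>UPR\<^esub> (lin a b)) UPR" using ab by (intro UPr.cgenideal_ideal) simp
  have "Cn (b [^] Suc 0) \<otimes>\<^bsub>UPR\<^esub> Cn c = Cn (b [^] Suc 0 \<otimes> cf (Cn c) 0 \<oplus> a \<otimes> \<zero>)"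
    using const ab by simp
  then have "Cn (b [^] Suc 0) \<otimes>\<^bsub>UPR\<^esub> Cn c \<ominus>\<^bsub>UPR\<^esub> Cn (b [^] Suc 0 \<otimes> cf (Cn c) 0 \<oplus> a \<otimes> \<zero>) = \<zero>\<^bsub>UPR\<^esub>"
    using const ab by (simp add: UPr.r_right_minus_eq)
  then show ?case using UPr.ideal_zero[OF i] ab by (intro exI[of _ 0] exI[of _ \<zero>]) (simp add: ipow_0)
next
  case (step c G)
  have i: "ideal (PIdl\<^bsub>UPR\<^esub> (lin a b)) UPR" using ab by (intro UPr.cgenideal_ideal) simp
  have abI: "ideal (PIdl a <+> PIdl b) R" using ab by (intro add_ideals cgenideal_ideal)
  obtain D u where u: "u \<in> ipow (PIdl a <+> PIdl b) D"
    "Cn (b [^] Suc D) \<otimes>\<^bsub>UPR\<^esub> G \<ominus>\<^bsub>UPR\<^esub> Cn (b [^] Suc D \<otimes> cf G 0 \<oplus> a \<otimes> u) \<in> PIdl\<^bsub>UPR\<^esub> (lin a b)" using step by blast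
  have uc: "u \<in> carrier R" using ideal_carr[OF ipow_ideal[OF abI] u(1)] .
  define B where "B = b [^] Suc D"
  define v where "v = B \<otimes> cf G 0 \<oplus> a \<otimes> u"
  have Bc: "B \<in> carrier R" and vc: "v \<in> carrier R" unfolding v_def B_def using ab step uc by simp_all
  have c0: "cf (Cn c \<oplus>\<^bsub>UPR\<^esub> Xn \<otimes>\<^bsub>UPR\<^esub> G) 0 = c" using step by (simp add: coeff_X_mult)
  have aI: "a \<in> PIdl a <+> PIdl b" and bI: "b \<in> PIdl a <+> PIdl b"
    using sum_ub1[of "PIdl a" "PIdl b"] sum_ub2[of "PIdl a" "PIdl b"] ab cgenideal_ideal cgenideal_self by blast+
  have "B \<in> ipow (PIdl a <+> PIdl b) (Suc D)" unfolding B_def by (rule pow_in_ipow[OF abI bI])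
  moreover have "a \<otimes> u \<in> ipow (PIdl a <+> PIdl b) (Suc D)" unfolding ipow_Suc2[OF abI] using aI u(1) by (rule ideal_prod.prod)
  ultimately have vI: "v \<in> ipow (PIdl a <+> PIdl b) (Suc D)" unfolding v_def
    using ideal_add[OF ipow_ideal[OF abI]] ideal_rmult[OF ipow_ideal[OF abI]] step by simp
  have X: "Xn \<in> carrier UPR" and Cs: "Cn b \<in> carrier UPR" "Cn B \<in> carrier UPR" "Cn c \<in> carrier UPR" "Cn v \<in> carrier UPR" "Cn a \<in> carrier UPR"
    using ab Bc vc step by simp_all
  have 1: "Cn (b \<otimes> B) \<otimes>\<^bsub>UPR\<^esub> (Cn c \<oplus>\<^bsub>UPR\<^esub> Xn \<otimes>\<^bsub>UPR\<^esub> G) \<ominus>\<^bsub>UPR\<^esub> Cn ((b \<otimes> B) \<otimes> c \<oplus> a \<otimes> v)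
    = (Cn b \<otimes>\<^bsub>UPR\<^esub> Cn B) \<otimes>\<^bsub>UPR\<^esub> (Cn c \<oplus>\<^bsub>UPR\<^esub> Xn \<otimes>\<^bsub>UPR\<^esub> G) \<ominus>\<^bsub>UPR\<^esub> ((Cn b \<otimes>\<^bsub>UPR\<^esub> Cn B) \<otimes>\<^bsub>UPR\<^esub> Cn c \<oplus>\<^bsub>UPR\<^esub> Cn a \<otimes>\<^bsub>UPR\<^esub> Cn v)"
    using ab Bc step vc by simp
  also have "\<dots> = (Cn b \<otimes>\<^bsub>UPR\<^esub> Xn) \<otimes>\<^bsub>UPR\<^esub> (Cn B \<otimes>\<^bsub>UPR\<^esub> G \<ominus>\<^bsub>UPR\<^esub> Cn v) \<oplus>\<^bsub>UPR\<^esub> Cn v \<otimes>\<^bsub>UPR\<^esub> lin a b"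
    unfolding lin_def using X Cs step(2) by algebra
  also have "\<dots> \<in> PIdl\<^bsub>UPR\<^esub> (lin a b)"
  proof (rule UPr.ideal_add[OF i])
    show "(Cn b \<otimes>\<^bsub>UPR\<^esub> Xn) \<otimes>\<^bsub>UPR\<^esub> (Cn B \<otimes>\<^bsub>UPR\<^esub> G \<ominus>\<^bsub>UPR\<^esub> Cn v) \<in> PIdl\<^bsub>UPR\<^esub> (lin a b)"
      using u(2) unfolding v_def B_def by (intro UPr.ideal_lmult[OF i]) (use ab in simp_all)
    show "Cn v \<otimes>\<^bsub>UPR\<^esub> lin a b \<in> PIdl\<^bsub>UPR\<^esub> (lin a b)"
      using Cs(4) by (intro UPr.ideal_lmult[OF i] UPr.cgenideal_self) (use ab in simp_all)
  qed
  finally have "Cn (b \<otimes> B) \<otimes>\<^bsub>UPR\<^esub> (Cn c \<oplus>\<^bsub>UPR\<^esub> Xn \<otimes>\<^bsub>UPR\<^esub> G) \<ominus>\<^bsub>UPR\<^esub> Cn ((b \<otimes> B) \<otimes> c \<oplus> a \<otimes> v) \<in> PIdl\<^bsub>UPR\<^esub> (lin a b)" .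
  moreover have "b [^] Suc (Suc D) = b \<otimes> B" unfolding B_def using ab by (simp add: m_comm)
  ultimately show ?case using vI c0 by (intro exI[of _ "Suc D"] exI[of _ v]) simp
qed

text \<open>The residue \<open>r\<close> stands for \<open>b^D\<close> times the value of
  \<open>F\<close> at \<open>a/b\<close>. Membership in the kernel can thus be tested in
  \<open>R\<close>.\<close>

lemma slope_iff:
  assumes F: "F \<in> carrier UPR" and r: "r \<in> carrier R" and e: "Cn (b [^] (D::nat)) \<otimes>\<^bsub>UPR\<^esub> F \<ominus>\<^bsub>UPR\<^esub> Cn r \<in> JJ"
  shows "F \<in> slope p a b \<longleftrightarrow> r \<in> p"
proof
  have cl: "Cn (b [^] (n::nat)) \<in> carrier UPR" "Cn r \<in> carrier UPR" for n using ab r by simp_all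
  assume "F \<in> slope p a b"
  then have "\<exists>n::nat. Cn (b [^] n) \<otimes>\<^bsub>UPR\<^esub> F \<in> JJ" by (simp add: slope_def)
  then obtain n where n: "Cn (b [^] (n::nat)) \<otimes>\<^bsub>UPR\<^esub> F \<in> JJ" ..
  define A where "A = Cn (b [^] D)" define B where "B = Cn (b [^] n)"
  have AB: "A \<in> carrier UPR" "B \<in> carrier UPR" "Cn r \<in> carrier UPR" unfolding A_def B_def using ab r by simp_all
  have "Cn (b [^] n \<otimes> r) = B \<otimes>\<^bsub>UPR\<^esub> Cn r" unfolding B_def using ab r by simp
  also have "\<dots> = A \<otimes>\<^bsub>UPR\<^esub> (B \<otimes>\<^bsub>UPR\<^esub> F) \<ominus>\<^bsub>UPR\<^esub> B \<otimes>\<^bsub>UPR\<^esub> (A \<otimes>\<^bsub>UPR\<^esub> F \<ominus>\<^bsub>UPR\<^esub> Cn r)"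
    using AB F by algebra
  also have "\<dots> \<in> JJ" 
    using UPr.ideal_minus[OF JJ_ideal UPr.ideal_lmult[OF JJ_ideal n] UPr.ideal_lmult[OF JJ_ideal e]] AB unfolding A_def B_def by blast
  finally have "b [^] n \<otimes> r \<in> p" by (intro JJ_contract) (use ab r in simp_all)
  then show "r \<in> p" using pow_cancel r by blast
next
  assume "r \<in> p"
  then have "Cn r \<in> JJ" using JJ_upid C_in_upid[OF pI r] by blast
  then have "Cn (b [^] D) \<otimes>\<^bsub>UPR\<^esub> F \<in> JJ" using UPr.ideal_cancel_minus[OF JJ_ideal e] F ab by simp
  then show "F \<in> slope p a b" using F by (auto simp: slope_def)
qed

lemma residue:
  assumes F: "F \<in> carrier UPR"
  obtains D r where "r \<in> carrier R" "Cn (b [^] (D::nat)) \<otimes>\<^bsub>UPR\<^esub> F \<ominus>\<^bsub>UPR\<^esub> Cn r \<in> JJ"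
proof -
  have abI: "ideal (PIdl a <+> PIdl b) R" using ab by (intro add_ideals cgenideal_ideal)
  obtain D u where u: "u \<in> ipow (PIdl a <+> PIdl b) D"
    "Cn (b [^] Suc D) \<otimes>\<^bsub>UPR\<^esub> F \<ominus>\<^bsub>UPR\<^esub> Cn (b [^] Suc D \<otimes> cf F 0 \<oplus> a \<otimes> u) \<in> PIdl\<^bsub>UPR\<^esub> (lin a b)"
    using pseudo_division[OF F] by blast
  have "u \<in> carrier R" using ideal_carr[OF ipow_ideal[OF abI] u(1)] .
  moreover have "PIdl\<^bsub>UPR\<^esub> (lin a b) \<subseteq> JJ" by (rule UPr.PIdl_least[OF JJ_ideal JJ_lin])
  ultimately show ?thesis using u(2) ab F by (intro that[of "b [^] Suc D \<otimes> cf F 0 \<oplus> a \<otimes> u" "Suc D"]) auto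
qed

lemma JJ_sub_slope: "JJ \<subseteq> slope p a b"
proof
  fix F assume F: "F \<in> JJ"
  then have Fc: "F \<in> carrier UPR" using UPr.ideal_carr[OF JJ_ideal] by blast
  have "Cn (b [^] (0::nat)) \<otimes>\<^bsub>UPR\<^esub> F \<in> JJ" using F Fc by simp
  then show "F \<in> slope p a b" unfolding slope_def using Fc by blast
qed

text \<open>Residues are multiplicative like values, so primality is inherited from
  \<open>p\<close>.\<close>

lemma slope_prime: "primeideal (slope p a b) UPR"
proof (rule UPr.primeideal_crit)
  have red: "\<exists>D r. r \<in> carrier R \<and> Cn (b [^] (D::nat)) \<otimes>\<^bsub>UPR\<^esub> F \<ominus>\<^bsub>UPR\<^esub> Cn r \<in> JJ" if "F \<in> carrier UPR" for F
    by (rule residue[OF that]) (intro exI conjI)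
  have mult: "Cn (b [^] (D + E)) \<otimes>\<^bsub>UPR\<^esub> (F \<otimes>\<^bsub>UPR\<^esub> G) \<ominus>\<^bsub>UPR\<^esub> Cn (r \<otimes> s) \<in> JJ"
    if FG: "F \<in> carrier UPR" "G \<in> carrier UPR" "r \<in> carrier R" "s \<in> carrier R"
      and e: "Cn (b [^] (D::nat)) \<otimes>\<^bsub>UPR\<^esub> F \<ominus>\<^bsub>UPR\<^esub> Cn r \<in> JJ" "Cn (b [^] (E::nat)) \<otimes>\<^bsub>UPR\<^esub> G \<ominus>\<^bsub>UPR\<^esub> Cn s \<in> JJ" for F G D E r s
  proof -
    define A where "A = Cn (b [^] D)" define B where "B = Cn (b [^] E)"
    have AB: "A \<in> carrier UPR" "B \<in> carrier UPR" "Cn r \<in> carrier UPR" "Cn s \<in> carrier UPR" unfolding A_def B_def using ab FG by simp_all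
    have "Cn (b [^] (D + E)) \<otimes>\<^bsub>UPR\<^esub> (F \<otimes>\<^bsub>UPR\<^esub> G) \<ominus>\<^bsub>UPR\<^esub> Cn (r \<otimes> s) = (A \<otimes>\<^bsub>UPR\<^esub> B) \<otimes>\<^bsub>UPR\<^esub> (F \<otimes>\<^bsub>UPR\<^esub> G) \<ominus>\<^bsub>UPR\<^esub> Cn r \<otimes>\<^bsub>UPR\<^esub> Cn s"
      unfolding A_def B_def using ab FG by (simp add: nat_pow_mult[symmetric])
    also have "\<dots> = (B \<otimes>\<^bsub>UPR\<^esub> G) \<otimes>\<^bsub>UPR\<^esub> (A \<otimes>\<^bsub>UPR\<^esub> F \<ominus>\<^bsub>UPR\<^esub> Cn r) \<oplus>\<^bsub>UPR\<^esub> Cn r \<otimes>\<^bsub>UPR\<^esub> (B \<otimes>\<^bsub>UPR\<^esub> G \<ominus>\<^bsub>UPR\<^esub> Cn s)"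
      using AB FG(1,2) by algebra
    also have "\<dots> \<in> JJ" unfolding A_def B_def
      by (intro UPr.ideal_add[OF JJ_ideal] UPr.ideal_lmult[OF JJ_ideal] e) (use ab FG in simp_all)
    finally show ?thesis .
  qed
  show "ideal (slope p a b) UPR"
  proof (rule UPr.ideal_crit)
    show "slope p a b \<subseteq> carrier UPR" by (auto simp: slope_def)
    show "\<zero>\<^bsub>UPR\<^esub> \<in> slope p a b" using JJ_sub_slope UPr.ideal_zero[OF JJ_ideal] by blast
    show "F \<oplus>\<^bsub>UPR\<^esub> G \<in> slope p a b" if FG: "F \<in> slope p a b" "G \<in> slope p a b" for F G
    proof -
      obtain n k where nk: "Cn (b [^] (n::nat)) \<otimes>\<^bsub>UPR\<^esub> F \<in> JJ" "Cn (b [^] (k::nat)) \<otimes>\<^bsub>UPR\<^esub> G \<in> JJ" and c: "F \<in> carrier UPR" "G \<in> carrier UPR"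
        using FG unfolding slope_def by blast
      define A where "A = Cn (b [^] n)" define B where "B = Cn (b [^] k)"
      have AB: "A \<in> carrier UPR" "B \<in> carrier UPR" unfolding A_def B_def using ab by simp_all
      have "Cn (b [^] (n + k)) \<otimes>\<^bsub>UPR\<^esub> (F \<oplus>\<^bsub>UPR\<^esub> G) = (A \<otimes>\<^bsub>UPR\<^esub> B) \<otimes>\<^bsub>UPR\<^esub> (F \<oplus>\<^bsub>UPR\<^esub> G)"
        unfolding A_def B_def using ab by (simp add: nat_pow_mult[symmetric])
      also have "\<dots> = B \<otimes>\<^bsub>UPR\<^esub> (A \<otimes>\<^bsub>UPR\<^esub> F) \<oplus>\<^bsub>UPR\<^esub> A \<otimes>\<^bsub>UPR\<^esub> (B \<otimes>\<^bsub>UPR\<^esub> G)" using AB c by algebra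
      also have "\<dots> \<in> JJ"
        by (rule UPr.ideal_add[OF JJ_ideal UPr.ideal_lmult[OF JJ_ideal nk(1)[folded A_def] AB(2)] UPr.ideal_lmult[OF JJ_ideal nk(2)[folded B_def] AB(1)]])
      finally show ?thesis using c unfolding slope_def by blast
    qed
    show "F \<otimes>\<^bsub>UPR\<^esub> G \<in> slope p a b" if F: "F \<in> carrier UPR" and G: "G \<in> slope p a b" for F G
    proof -
      have Gc: "G \<in> carrier UPR" using G by (simp add: slope_def)
      obtain D r where r: "r \<in> carrier R" "Cn (b [^] (D::nat)) \<otimes>\<^bsub>UPR\<^esub> F \<ominus>\<^bsub>UPR\<^esub> Cn r \<in> JJ" using red[OF F] by blast
      obtain E s where s: "s \<in> carrier R" "Cn (b [^] (E::nat)) \<otimes>\<^bsub>UPR\<^esub> G \<ominus>\<^bsub>UPR\<^esub> Cn s \<in> JJ" using red[OF Gc] by blast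
      have "s \<in> p" using slope_iff[OF Gc s] G by blast
      then have "r \<otimes> s \<in> p" using ideal_lmult[OF pI _ r(1)] by blast
      then show ?thesis using slope_iff[OF UPr.m_closed[OF F Gc] m_closed[OF r(1) s(1)] mult[OF F Gc r(1) s(1) r(2) s(2)]] by blast
    qed
  qed
  have "Cn (b [^] (0::nat)) \<otimes>\<^bsub>UPR\<^esub> \<one>\<^bsub>UPR\<^esub> \<ominus>\<^bsub>UPR\<^esub> Cn \<one> \<in> JJ"
    using UPr.ideal_zero[OF JJ_ideal] by (simp add: UPr.minus_eq UPr.r_neg)
  then show "\<one>\<^bsub>UPR\<^esub> \<notin> slope p a b" using slope_iff[OF UPr.one_closed one_closed] prime_one[OF p] by blast
  show "F \<in> slope p a b \<or> G \<in> slope p a b" if F: "F \<in> carrier UPR" and Gc: "G \<in> carrier UPR" and FG: "F \<otimes>\<^bsub>UPR\<^esub> G \<in> slope p a b" for F G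
  proof -
    obtain D r where r: "r \<in> carrier R" "Cn (b [^] (D::nat)) \<otimes>\<^bsub>UPR\<^esub> F \<ominus>\<^bsub>UPR\<^esub> Cn r \<in> JJ" using red[OF F] by blast
    obtain E s where s: "s \<in> carrier R" "Cn (b [^] (E::nat)) \<otimes>\<^bsub>UPR\<^esub> G \<ominus>\<^bsub>UPR\<^esub> Cn s \<in> JJ" using red[OF Gc] by blast
    have "r \<otimes> s \<in> p"
      using slope_iff[OF UPr.m_closed[OF F Gc] m_closed[OF r(1) s(1)] mult[OF F Gc r(1) s(1) r(2) s(2)]] FG by blast
    then show ?thesis using slope_iff[OF Gc s] slope_iff[OF F r] prime_mult_iff[OF p r(1) s(1)] by blast
  qed
qed

lemma slope_contract: "c \<in> carrier R \<Longrightarrow> Cn c \<in> slope p a b \<longleftrightarrow> c \<in> p"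
proof -
  assume c: "c \<in> carrier R"
  have "Cn (b [^] (0::nat)) \<otimes>\<^bsub>UPR\<^esub> Cn c \<ominus>\<^bsub>UPR\<^esub> Cn c \<in> JJ"
    using UPr.ideal_zero[OF JJ_ideal] c by (simp add: UPr.minus_eq UPr.r_neg)
  then show ?thesis using slope_iff[of "Cn c" c 0] c by simp
qed

text \<open>A prime inside the slope ideal does not contain \<open>b\<close>, so over
  \<open>JJ\<close> it contains the saturation. Hence the principal ideal theorem applies: one
  linear polynomial over \<open>p[X]\<close> leaves no room in between.\<close>

lemma slope_min_over: "UPr.min_over (slope p a b) JJ"
  unfolding UPr.min_over_def
proof (intro conjI allI impI slope_prime JJ_sub_slope)
  fix Q assume Q: "primeideal Q UPR \<and> JJ \<subseteq> Q \<and> Q \<subseteq> slope p a b"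
  have bQ: "Cn b \<notin> Q" using Q slope_contract[OF ab(2)] bp by blast
  have "slope p a b \<subseteq> Q"
  proof
    fix F assume F: "F \<in> slope p a b"
    then obtain n where n: "F \<in> carrier UPR" "Cn (b [^] (n::nat)) \<otimes>\<^bsub>UPR\<^esub> F \<in> Q" using Q by (auto simp: slope_def)
    have "Cn (b [^] n) = Cn b [^]\<^bsub>UPR\<^esub> n" using ab by simp
    then have "Cn (b [^] n) \<notin> Q" using UPr.prime_pow[of Q "Cn b" n] Q bQ ab by auto
    then show "F \<in> Q" using UPr.prime_mult_iff[of Q "Cn (b [^] n)" F] Q n ab by simp
  qed
  then show "Q = slope p a b" using Q by blast
qed

lemma slope_height_one: "primeideal Q UPR \<Longrightarrow> upid p \<subset> Q \<Longrightarrow> Q \<subset> slope p a b \<Longrightarrow> False"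
  by (rule UPn.krull_height_one[OF upid_prime[OF p] _ _ _ lin_closed[OF ab] slope_min_over])

lemma lin_in_slope: "lin a b \<in> slope p a b"
  using JJ_sub_slope JJ_lin by blast

lemma upid_sub_slope: "upid p \<subseteq> slope p a b"
  using JJ_sub_slope JJ_upid by blast

text \<open>An element of the kernel with constant term \<open>1\<close> makes \<open>b\<close>
  integral over the ideal \<open>(a)\<close> modulo \<open>p\<close>.\<close>

lemma slope_unit_coeff:
  assumes F: "F \<in> slope p a b" "cf F 0 = \<one>"
  obtains D u where "u \<in> ipow (PIdl a <+> PIdl b) D" "b [^] Suc D \<oplus> a \<otimes> u \<in> p"
proof -
  have Fc: "F \<in> carrier UPR" using F(1) by (simp add: slope_def)
  have abI: "ideal (PIdl a <+> PIdl b) R" using ab by (intro add_ideals cgenideal_ideal)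
  obtain D u where u: "u \<in> ipow (PIdl a <+> PIdl b) D"
    "Cn (b [^] Suc D) \<otimes>\<^bsub>UPR\<^esub> F \<ominus>\<^bsub>UPR\<^esub> Cn (b [^] Suc D \<otimes> cf F 0 \<oplus> a \<otimes> u) \<in> PIdl\<^bsub>UPR\<^esub> (lin a b)"
    using pseudo_division[OF Fc] by blast
  have uc: "u \<in> carrier R" using ideal_carr[OF ipow_ideal[OF abI] u(1)] .
  have "PIdl\<^bsub>UPR\<^esub> (lin a b) \<subseteq> JJ" by (rule UPr.PIdl_least[OF JJ_ideal JJ_lin])
  then have "b [^] Suc D \<otimes> cf F 0 \<oplus> a \<otimes> u \<in> p"
    using slope_iff[OF Fc, of "b [^] Suc D \<otimes> cf F 0 \<oplus> a \<otimes> u" "Suc D"] u(2) F uc ab by auto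
  then have "b [^] Suc D \<oplus> a \<otimes> u \<in> p" unfolding F(2) using ab r_one[of "b [^] Suc D"] by simp
  then show ?thesis using that u(1) by blast
qed

text \<open>Up to a power of \<open>b\<close>, every polynomial is congruent to a constant modulo
  the slope ideal. So a prime over it that avoids \<open>b\<close> is determined by its
  constants.\<close>

lemma slope_maximal:
  assumes Q: "primeideal Q UPR" and KQ: "slope p a b \<subseteq> Q" and bQ: "Cn b \<notin> Q" and Qp: "\<And>c. c \<in> carrier R \<Longrightarrow> Cn c \<in> Q \<Longrightarrow> c \<in> p"
  shows "Q = slope p a b"
proof
  note QI = UPr.primeideal_ideal[OF Q]
  show "Q \<subseteq> slope p a b"
  proof
    fix F assume F: "F \<in> Q"
    then have Fc: "F \<in> carrier UPR" using UPr.ideal_carr[OF QI] by blast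
    obtain D r where r: "r \<in> carrier R" "Cn (b [^] (D::nat)) \<otimes>\<^bsub>UPR\<^esub> F \<ominus>\<^bsub>UPR\<^esub> Cn r \<in> JJ" by (rule residue[OF Fc]) (rule that)
    have "Cn (b [^] D) \<otimes>\<^bsub>UPR\<^esub> F \<ominus>\<^bsub>UPR\<^esub> Cn r \<in> Q" using r(2) JJ_sub_slope KQ by blast
    moreover have "Cn (b [^] D) \<otimes>\<^bsub>UPR\<^esub> F \<in> Q" using UPr.ideal_lmult[OF QI F] ab by simp
    ultimately have "Cn r \<in> Q" using UPr.ideal_minus_swap[OF QI] UPr.ideal_cancel_minus[OF QI, of "Cn r"] r(1) ab Fc by blast
    then have "r \<in> p" using Qp r(1) by blast
    then show "F \<in> slope p a b" using slope_iff[OF Fc r] by blast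
  qed
qed (rule KQ)

end
end

section \<open>Catenary polynomial rings over local domains\<close>

lemma catenaryD:
  assumes "catenary R" "primeideal p R" "primeideal q R" "p \<subseteq> q"
  obtains d where "\<And>P n. prime_chain R P n \<Longrightarrow> P 0 = p \<Longrightarrow> P n = q \<Longrightarrow> n \<le> d"
    "\<And>P n. saturated_prime_chain R P n \<Longrightarrow> P 0 = p \<Longrightarrow> P n = q \<Longrightarrow> n = d"
proof -
  obtain d where "\<forall>P n. prime_chain R P n \<and> P 0 = p \<and> P n = q \<longrightarrow> n \<le> d"
    "\<forall>P n. saturated_prime_chain R P n \<and> P 0 = p \<and> P n = q \<longrightarrow> n = d"
    using assms(1)[unfolded catenary_def, rule_format, of p q] assms(2-4) by auto
  then show thesis by (intro that[of d]) auto
qed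

context cring
begin

text \<open>Sharper than \<open>ipow_sum_sub\<close>: no factor is discarded, so the total degree
  \<open>a + b\<close> is kept inside powers of \<open>K\<close>. The degree count in
  \<open>rr_power\<close> depends on this.\<close>

lemma ipow_sum_sub_within:
  assumes I: "ideal I R" and J: "ideal J R" and K: "ideal K R" and IK: "I \<subseteq> K" and JK: "J \<subseteq> K"
  shows "ipow (I <+> J) (a + b) \<subseteq> ipow I a \<cdot> ipow K b <+> ipow J b \<cdot> ipow K a"
proof (induct "a + b" arbitrary: a b rule: less_induct)
  case less
  note IJ = add_ideals[OF I J]
  note pI = ipow_ideal[OF I] and pJ = ipow_ideal[OF J] and pK = ipow_ideal[OF K]
  have IJK: "I <+> J \<subseteq> K" by (rule sum_least[OF K IK JK])
  have one: "carrier R \<cdot> L = L" if L: "ideal L R" for L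
    using ideal_prod_one[OF L] ideal_prod_commute[OF L oneideal] by simp
  show ?case
  proof (cases "a = 0 \<or> b = 0")
    case True
    then show ?thesis
    proof
      assume a: "a = 0"
      have "ipow (I <+> J) b \<subseteq> carrier R \<cdot> ipow K b" unfolding one[OF pK] by (rule ipow_mono[OF IJK])
      also have "\<dots> \<subseteq> carrier R \<cdot> ipow K b <+> ipow J b \<cdot> carrier R"
        by (intro sum_ub1 prod_ideal oneideal pJ pK)
      finally show ?thesis using a by (simp add: ipow_0)
    next
      assume b: "b = 0"
      have "ipow (I <+> J) a \<subseteq> carrier R \<cdot> ipow K a" unfolding one[OF pK] by (rule ipow_mono[OF IJK])
      also have "\<dots> \<subseteq> ipow I a \<cdot> carrier R <+> carrier R \<cdot> ipow K a"
        by (intro sum_ub2 prod_ideal oneideal pI pK)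
      finally show ?thesis using b by (simp add: ipow_0)
    qed
  next
    case False
    then obtain a' b' where ab: "a = Suc a'" "b = Suc b'" by (meson not0_implies_Suc)
    let ?W = "ipow I a \<cdot> ipow K b <+> ipow J b \<cdot> ipow K a"
    have W1: "ideal (ipow I a \<cdot> ipow K b) R" and W2: "ideal (ipow J b \<cdot> ipow K a) R" by (intro prod_ideal pI pJ pK)+
    have W: "ideal ?W R" by (rule add_ideals[OF W1 W2])
    have low: "i \<otimes> z \<in> ipow L (Suc n) \<cdot> M" if L: "ideal L R" and M: "ideal M R" and i: "i \<in> L" and z: "z \<in> ipow L n \<cdot> M" for i z L M n
    proof -
      have "i \<otimes> z \<in> L \<cdot> (ipow L n \<cdot> M)" using i z by (rule ideal_prod.prod)
      then show ?thesis unfolding ipow_Suc2[OF L] ideal_prod_assoc[OF L ipow_ideal[OF L] M] .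
    qed
    have high: "i \<otimes> z \<in> L \<cdot> ipow K (Suc n)" if L: "ideal L R" and i: "i \<in> K" and z: "z \<in> L \<cdot> ipow K n" for i z L n
      using low[OF K L i, of z n] z unfolding ideal_prod_commute[OF L pK] by simp
    have 1: "ipow (I <+> J) (a' + b) \<subseteq> ipow I a' \<cdot> ipow K b <+> ipow J b \<cdot> ipow K a'"
      and 2: "ipow (I <+> J) (a + b') \<subseteq> ipow I a \<cdot> ipow K b' <+> ipow J b' \<cdot> ipow K a"
      using less[of a' b] less[of a b'] ab by simp_all
    have e: "a' + b = a + b'" "a + b = Suc (a' + b)" using ab by simp_all
    have "(I <+> J) \<cdot> ipow (I <+> J) (a' + b) \<subseteq> ?W"
    proof (rule prod_least[OF W])
      fix s z assume s: "s \<in> I <+> J" and z: "z \<in> ipow (I <+> J) (a' + b)"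
      obtain i j where ij: "i \<in> I" "j \<in> J" "s = i \<oplus> j" using s by (auto simp: mem_sum)
      note c = ideal_carr[OF I ij(1)] ideal_carr[OF J ij(2)] ideal_carr[OF ipow_ideal[OF IJ] z]
      have "z \<in> ipow I a' \<cdot> ipow K b <+> ipow J b \<cdot> ipow K a'" using 1 z by blast
      then obtain u v where uv: "u \<in> ipow I a' \<cdot> ipow K b" "v \<in> ipow J b \<cdot> ipow K a'" "z = u \<oplus> v" unfolding mem_sum by blast
      have "z \<in> ipow I a \<cdot> ipow K b' <+> ipow J b' \<cdot> ipow K a" using 2 z unfolding e(1) by blast
      then obtain u' v' where uv': "u' \<in> ipow I a \<cdot> ipow K b'" "v' \<in> ipow J b' \<cdot> ipow K a" "z = u' \<oplus> v'" unfolding mem_sum by blast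
      note c' = ideal_carr[OF prod_ideal[OF pI pK] uv(1)] ideal_carr[OF prod_ideal[OF pJ pK] uv(2)]
        ideal_carr[OF prod_ideal[OF pI pK] uv'(1)] ideal_carr[OF prod_ideal[OF pJ pK] uv'(2)]
      have "i \<otimes> u \<in> ipow I a \<cdot> ipow K b" unfolding ab(1) by (rule low[OF I pK ij(1) uv(1)])
      moreover have "i \<otimes> v \<in> ipow J b \<cdot> ipow K a" unfolding ab(1) by (rule high[OF pJ _ uv(2)]) (use ij IK in auto)
      moreover have "i \<otimes> z = i \<otimes> u \<oplus> i \<otimes> v" unfolding uv(3) using c c' by (simp add: r_distr)
      ultimately have iz: "i \<otimes> z \<in> ?W" unfolding mem_sum by blast
      have "j \<otimes> v' \<in> ipow J b \<cdot> ipow K a" unfolding ab(2) by (rule low[OF J pK ij(2) uv'(2)])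
      moreover have "j \<otimes> u' \<in> ipow I a \<cdot> ipow K b" unfolding ab(2) by (rule high[OF pI _ uv'(1)]) (use ij JK in auto)
      moreover have "j \<otimes> z = j \<otimes> u' \<oplus> j \<otimes> v'" unfolding uv'(3) using c c' by (simp add: r_distr)
      ultimately have jz: "j \<otimes> z \<in> ?W" unfolding mem_sum by blast
      have "s \<otimes> z = i \<otimes> z \<oplus> j \<otimes> z" unfolding ij(3) using c by (simp add: l_distr)
      then show "s \<otimes> z \<in> ?W" using ideal_add[OF W iz jz] by simp
    qed
    then show ?thesis unfolding e(2) ipow_Suc2[OF IJ] .
  qed
qed

end

sublocale noeth_local_with_UP \<subseteq> noeth_cring_with_UP ..

context noeth_local_with_UP
begin

lemma upX_unit:
  assumes K: "ideal K UPR" and n: "\<not> K \<subseteq> upX m"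
  obtains F where "F \<in> K" "cf F 0 = \<one>"
proof -
  obtain F where F: "F \<in> K" "F \<notin> upX m" using n by blast
  note Fc = UPr.ideal_carr[OF K F(1)]
  have "cf F 0 \<notin> m" using F(2) Fc by (simp add: upX_def)
  then obtain t where t: "t \<in> carrier R" "t \<otimes> cf F 0 = \<one>" using unit_of_notin_m[of "cf F 0"] Fc by auto
  have "Cn t \<otimes>\<^bsub>UPR\<^esub> F \<in> K" using UPr.ideal_lmult[OF K F(1)] t by simp
  moreover have "cf (Cn t \<otimes>\<^bsub>UPR\<^esub> F) 0 = \<one>" using coeff_C_mult[OF t(1) Fc] t by simp
  ultimately show ?thesis by (rule that)
qed

definition "upcon Q = {c \<in> carrier R. Cn c \<in> Q}"

lemma upcon_prime:
  assumes Q: "primeideal Q UPR" shows "primeideal (upcon Q) R"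
proof (rule primeideal_crit)
  note QI = UPr.primeideal_ideal[OF Q]
  show "ideal (upcon Q) R"
  proof (rule ideal_crit)
    show "\<zero> \<in> upcon Q" using UPr.ideal_zero[OF QI] by (simp add: upcon_def)
    show "a \<oplus> b \<in> upcon Q" if "a \<in> upcon Q" "b \<in> upcon Q" for a b
      using that UPr.ideal_add[OF QI] by (simp add: upcon_def)
    show "r \<otimes> a \<in> upcon Q" if "r \<in> carrier R" "a \<in> upcon Q" for r a
      using that UPr.ideal_lmult[OF QI, of "Cn a" "Cn r"] by (simp add: upcon_def)
  qed (auto simp: upcon_def)
  show "\<one> \<notin> upcon Q" using UPr.prime_one[OF Q] by (simp add: upcon_def)
  show "a \<in> upcon Q \<or> b \<in> upcon Q" if "a \<in> carrier R" "b \<in> carrier R" "a \<otimes> b \<in> upcon Q" for a b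
    using that UPr.prime_mult_iff[OF Q, of "Cn a" "Cn b"] by (simp add: upcon_def)
qed

context
  fixes p p1 assumes p: "primeideal p R" and p1: "primeideal p1 R" and pp1: "p \<subset> p1" and p1m: "p1 \<subset> m"
    and cat: "catenary UPR"
begin

text \<open>
  Otherwise \<open>p[X] \<subset> slope p a b \<subset> (m, X)\<close> would be saturated, although
  \<open>p[X] \<subset> p1[X] \<subset> m[X] \<subset> (m, X)\<close> is longer.
\<close>

lemma slope_gap:
  assumes ab: "a \<in> carrier R" "b \<in> carrier R" and bp: "b \<notin> p" and s: "slope p a b \<subset> upX m"
  obtains Q where "primeideal Q UPR" "slope p a b \<subset> Q" "Q \<subset> upX m"
proof -
  note pI = primeideal_ideal[OF p]
  let ?K = "slope p a b" and ?q = "upX m"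
  have K: "primeideal ?K UPR" by (rule slope_prime[OF p ab bp])
  have q: "primeideal ?q UPR" by (rule upX_prime[OF m_prime])
  \<comment> \<open>The coefficient of \<open>X\<close> is \<open>b\<close>, which is outside
    \<open>p\<close>; this makes \<open>p[X]\<close> strictly smaller than the slope ideal.\<close>
  have "cf (lin a b) 1 = b"
    using lin_mult_coeff[OF ab UPr.one_closed, of 1] UP_ring.coeff_one[OF UP_ring_R] ab by (simp add: a_minus_def)
  moreover have "cf F 1 \<in> p" if "F \<in> upid p" for F using that unfolding upid_def by blast
  ultimately have "lin a b \<notin> upid p" using bp by metis
  then have pK: "upid p \<subset> ?K" using lin_in_slope[OF p ab bp] upid_sub_slope[OF p ab bp] by blast
  show ?thesis
  proof (rule ccontr)
    assume n: "\<not> thesis"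
    have n': "\<not> (primeideal Q UPR \<and> ?K \<subset> Q \<and> Q \<subset> ?q)" for Q using n that[of Q] by blast
    have pq: "upid p \<subseteq> ?q" using pK s by blast
    obtain d where d: "\<And>P n. prime_chain UPR P n \<Longrightarrow> P 0 = upid p \<Longrightarrow> P n = ?q \<Longrightarrow> n \<le> d"
      "\<And>P n. saturated_prime_chain UPR P n \<Longrightarrow> P 0 = upid p \<Longrightarrow> P n = ?q \<Longrightarrow> n = d"
      by (rule catenaryD[OF cat upid_prime[OF p] q pq]) (rule that)
    let ?P = "\<lambda>i::nat. if i = 0 then upid p else if i = 1 then ?K else ?q"
    have "saturated_prime_chain UPR ?P 2"
      unfolding saturated_prime_chain_def prime_chain_def
    proof (intro conjI allI impI)
      fix i :: nat assume "i \<le> 2" then show "primeideal (?P i) UPR" using upid_prime[OF p] K q by simp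
    next
      fix i :: nat assume "i < 2"
      then have i: "i = 0 \<or> i = 1" by auto
      then show "?P i \<subset> ?P (Suc i)" using pK s by auto
      show "\<nexists>Q. primeideal Q UPR \<and> ?P i \<subset> Q \<and> Q \<subset> ?P (Suc i)"
        using i slope_height_one[OF p ab bp] n' by auto
    qed
    then have "2 = d" by (rule d(2)) simp_all
    let ?C = "\<lambda>i::nat. if i = 0 then upid p else if i = 1 then upid p1 else if i = 2 then upid m else ?q"
    have up: "upid I \<subset> upid J" if I: "ideal I R" and J: "ideal J R" and IJ: "I \<subset> J" for I J
    proof -
      obtain c where c: "c \<in> J" "c \<notin> I" using IJ by blast
      then have "Cn c \<in> upid J" "Cn c \<notin> upid I" using C_in_upid[OF I, of c] C_in_upid[OF J, of c] ideal_carr[OF J c(1)] by simp_all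
      then show ?thesis using upid_mono[of I J] IJ by blast
    qed
    have "upid m \<subset> ?q" using upid_sub_upX[of m] X_notin_upid[OF m_prime] X_in_upX[OF m_ideal] by blast
    moreover note up[OF pI primeideal_ideal[OF p1] pp1] up[OF primeideal_ideal[OF p1] m_ideal p1m]
    ultimately have "prime_chain UPR ?C 3"
      unfolding prime_chain_def using upid_prime[OF p] upid_prime[OF p1] upid_prime[OF m_prime] q
      by (auto simp: less_Suc_eq numeral_3_eq_3 numeral_2_eq_2)
    then have "3 \<le> d" by (rule d(1)) simp_all
    then show False using \<open>2 = d\<close> by simp
  qed
qed

context
  fixes x and c :: nat assumes x: "x \<in> carrier R" and xp: "x \<notin> p"
begin

text \<open>In the domain \<open>R/p\<close>, the fractions \<open>r/x\<close> with \<open>r\<close>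
  in \<open>rr\<close> are those that \<open>m^c\<close> multiplies back into \<open>R/p\<close>: a
  piece of the ideal transform of \<open>m\<close>.\<close>

abbreviation (input) "rr \<equiv> colon (p <+> PIdl x) (ipow m c)"

lemma rr_ideal: "ideal rr R"
  by (intro colon_ideal PIdl_sum_ideal primeideal_ideal[OF p] x ideal_sub ipow_ideal m_ideal)

lemma x_in_rr: "x \<in> rr"
proof -
  note I = PIdl_sum_ideal[OF primeideal_ideal[OF p] x]
  have "x \<otimes> y \<in> p <+> PIdl x" if "y \<in> ipow m c" for y
    using ideal_rmult[OF I PIdl_sum_mem[OF primeideal_ideal[OF p] x]] ideal_carr[OF ipow_ideal[OF m_ideal] that] by blast
  then show ?thesis using x by (simp add: colon_def)
qed

text \<open>
  If \<open>r\<close> were not integral in this sense, then \<open>slope p x r + (X)\<close> would be proper and contain \<open>m\<^sup>c\<close>, so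
  by the principal ideal theorem nothing could lie between \<open>slope p x r\<close> and \<open>(m, X)\<close>.
\<close>

lemma rr_integral:
  assumes r: "r \<in> rr"
  shows "\<exists>D u. u \<in> ipow (PIdl x <+> PIdl r) D \<and> r [^] Suc D \<oplus> x \<otimes> u \<in> p"
proof (cases "r \<in> p")
  case True
  note rc = ideal_carr[OF rr_ideal r]
  have "r [^] Suc 0 \<oplus> x \<otimes> \<zero> \<in> p" using True rc x by simp
  then show ?thesis by (intro exI[of _ 0] exI[of _ \<zero>]) (simp add: ipow_0)
next
  case rp: False
  note rc = ideal_carr[OF rr_ideal r]
  note xr = x rc rp
  note K = slope_prime[OF p xr]
  note KI = UPr.primeideal_ideal[OF K]
  show ?thesis
  proof (rule ccontr)
    assume n: "\<not> ?thesis"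
    have sub: "slope p x r \<subseteq> upX m"
    proof (rule ccontr)
      assume "\<not> slope p x r \<subseteq> upX m"
      then obtain F where F: "F \<in> slope p x r" "cf F 0 = \<one>" by (rule upX_unit[OF KI]) (rule that)
      obtain D u where "u \<in> ipow (PIdl x <+> PIdl r) D" "r [^] Suc D \<oplus> x \<otimes> u \<in> p" 
        by (rule slope_unit_coeff[OF p xr F]) (rule that)
      then show False using n by blast
    qed
    \<comment> \<open>Otherwise \<open>x = r X - (r X - x)\<close> would lie in the slope ideal,
      whose constants are those of \<open>p\<close>.\<close>
    have XK: "Xn \<notin> slope p x r"
    proof
      assume "Xn \<in> slope p x r"
      then have "Cn r \<otimes>\<^bsub>UPR\<^esub> Xn \<in> slope p x r" using UPr.ideal_lmult[OF KI] rc by simp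
      moreover have "Cn x = Cn r \<otimes>\<^bsub>UPR\<^esub> Xn \<ominus>\<^bsub>UPR\<^esub> lin x r"
      proof -
        have "Xn \<in> carrier UPR" "Cn r \<in> carrier UPR" "Cn x \<in> carrier UPR" using x rc by simp_all
        then show ?thesis unfolding lin_def by algebra
      qed
      ultimately have "Cn x \<in> slope p x r" using UPr.ideal_minus[OF KI _ lin_in_slope[OF p xr]] by simp
      then show False using slope_contract[OF p xr x] xp by blast
    qed
    have q: "primeideal (upX m) UPR" by (rule upX_prime[OF m_prime])
    have "slope p x r \<subset> upX m" using sub XK X_in_upX[OF m_ideal] by blast
    then obtain Q where Q: "primeideal Q UPR" "slope p x r \<subset> Q" "Q \<subset> upX m"
      by (rule slope_gap[OF xr]) (rule that)
    have Xc: "Xn \<in> carrier UPR" by simp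
    \<comment> \<open>For \<open>y\<close> in \<open>m^c\<close> a relation
      \<open>r y = w + s x\<close> with \<open>w\<close> in \<open>p\<close> makes \<open>y\<close>
      congruent to \<open>s X\<close> modulo the slope ideal. So a prime that contains this ideal
      and \<open>X\<close> contains \<open>m^c\<close>, hence \<open>m\<close>.\<close>
    have "UPr.min_over (upX m) (slope p x r <+>\<^bsub>UPR\<^esub> PIdl\<^bsub>UPR\<^esub> Xn)"
      unfolding UPr.min_over_def
    proof (intro conjI allI impI q)
      show "slope p x r <+>\<^bsub>UPR\<^esub> PIdl\<^bsub>UPR\<^esub> Xn \<subseteq> upX m"
        by (rule UPr.PIdl_sum_least[OF UPr.primeideal_ideal[OF q] sub X_in_upX[OF m_ideal]])
      fix Q' assume Q': "primeideal Q' UPR \<and> slope p x r <+>\<^bsub>UPR\<^esub> PIdl\<^bsub>UPR\<^esub> Xn \<subseteq> Q' \<and> Q' \<subseteq> upX m"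
      then have Qp: "primeideal Q' UPR" by blast
      note QI = UPr.primeideal_ideal[OF Qp]
      have KQ: "slope p x r \<subseteq> Q'" using Q' UPr.PIdl_sum_sub[OF KI Xc] by blast
      have XQ: "Xn \<in> Q'" using Q' UPr.PIdl_sum_mem[OF KI Xc] by blast
      have "ipow m c \<subseteq> upcon Q'"
      proof
        fix y assume y: "y \<in> ipow m c"
        note yc = ideal_carr[OF ipow_ideal[OF m_ideal] y]
        have "r \<otimes> y \<in> p <+> PIdl x" using r y by (simp add: colon_def)
        then obtain w s where ws: "w \<in> p" "s \<in> carrier R" "r \<otimes> y = w \<oplus> s \<otimes> x" unfolding mem_sum_PIdl by blast
        note wc = ideal_carr[OF primeideal_ideal[OF p] ws(1)]
        define G where "G = Cn y \<ominus>\<^bsub>UPR\<^esub> Cn s \<otimes>\<^bsub>UPR\<^esub> Xn"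
        have Gc: "G \<in> carrier UPR" unfolding G_def using yc ws by simp
        have "Cn r \<otimes>\<^bsub>UPR\<^esub> G = Cn (r \<otimes> y) \<ominus>\<^bsub>UPR\<^esub> Cn s \<otimes>\<^bsub>UPR\<^esub> (Cn r \<otimes>\<^bsub>UPR\<^esub> Xn)"
        proof -
          have "Xn \<in> carrier UPR" "Cn r \<in> carrier UPR" "Cn y \<in> carrier UPR" "Cn s \<in> carrier UPR" using yc rc ws by simp_all
          then have "Cn r \<otimes>\<^bsub>UPR\<^esub> G = Cn r \<otimes>\<^bsub>UPR\<^esub> Cn y \<ominus>\<^bsub>UPR\<^esub> Cn s \<otimes>\<^bsub>UPR\<^esub> (Cn r \<otimes>\<^bsub>UPR\<^esub> Xn)" unfolding G_def by algebra
          then show ?thesis using yc rc by simp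
        qed
        also have "\<dots> = (Cn w \<oplus>\<^bsub>UPR\<^esub> Cn s \<otimes>\<^bsub>UPR\<^esub> Cn x) \<ominus>\<^bsub>UPR\<^esub> Cn s \<otimes>\<^bsub>UPR\<^esub> (Cn r \<otimes>\<^bsub>UPR\<^esub> Xn)"
          unfolding ws(3) using wc ws(2) x by simp
        also have "\<dots> = Cn w \<ominus>\<^bsub>UPR\<^esub> Cn s \<otimes>\<^bsub>UPR\<^esub> lin x r"
        proof -
          have "Xn \<in> carrier UPR" "Cn r \<in> carrier UPR" "Cn w \<in> carrier UPR" "Cn s \<in> carrier UPR" "Cn x \<in> carrier UPR" using yc rc ws wc x by simp_all
          then show ?thesis unfolding lin_def by algebra
        qed
        also have "\<dots> \<in> slope p x r"
        proof (rule UPr.ideal_minus[OF KI])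
          show "Cn w \<in> slope p x r" using slope_contract[OF p xr wc] ws(1) by blast
          show "Cn s \<otimes>\<^bsub>UPR\<^esub> lin x r \<in> slope p x r" using UPr.ideal_lmult[OF KI lin_in_slope[OF p xr]] ws(2) by simp
        qed
        finally have "Cn r \<otimes>\<^bsub>UPR\<^esub> G \<in> slope p x r" .
        moreover have "Cn r \<notin> slope p x r" using slope_contract[OF p xr rc] rp by blast
        moreover have "Cn r \<in> carrier UPR" using rc by simp
        ultimately have "G \<in> slope p x r" using UPr.prime_mult_iff[OF K _ Gc] by blast
        then have GQ: "G \<in> Q'" using KQ by blast
        have "Cn s \<otimes>\<^bsub>UPR\<^esub> Xn \<in> Q'" using UPr.ideal_lmult[OF QI XQ] ws(2) by simp
        then have "Cn y \<in> Q'" using UPr.ideal_cancel_minus[OF QI GQ[unfolded G_def]] yc by simp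
        then show "y \<in> upcon Q'" using yc by (simp add: upcon_def)
      qed
      then have mQ: "m \<subseteq> upcon Q'" by (rule prime_ipow[OF upcon_prime[OF Qp] m_ideal])
      have "upX m \<subseteq> Q'"
      proof
        fix F assume F: "F \<in> upX m"
        then have Fc: "F \<in> carrier UPR" and F0: "cf F 0 \<in> m" by (auto simp: upX_def)
        obtain d where d: "\<forall>i>d. cf F i = \<zero>" using UP_bound[OF Fc] by blast
        obtain G where G: "G \<in> carrier UPR" "F = Cn (cf F 0) \<oplus>\<^bsub>UPR\<^esub> Xn \<otimes>\<^bsub>UPR\<^esub> G"
          by (rule UP_split[OF Fc, of d]) (use d in blast)+
        have "Cn (cf F 0) \<in> Q'" using mQ F0 by (auto simp: upcon_def)
        moreover have "Xn \<otimes>\<^bsub>UPR\<^esub> G \<in> Q'" by (rule UPr.ideal_rmult[OF QI XQ G(1)])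
        ultimately show "F \<in> Q'" using UPr.ideal_add[OF QI] G(2) by metis
      qed
      then show "Q' = upX m" using Q' by blast
    qed
    then show False by (rule UPn.krull_height_one[OF K Q(1) Q(2) Q(3) Xc])
  qed
qed

text \<open>Modulo \<open>p\<close> the ideal \<open>(x)\<close> is a reduction of
  \<open>rr\<close>: the elements of \<open>rr\<close> are integral over \<open>(x)\<close>, or
  rather over it with coefficients in \<open>rr\<close>, and finitely many such equations combine
  into one exponent \<open>D\<close>.\<close>

lemma rr_power:
  obtains D where "\<And>n. ipow rr (Suc (D + n)) \<subseteq> (PIdl x) \<cdot> ipow rr (D + n) <+> p"
proof -
  note pI = primeideal_ideal[OF p]
  note xI = cgenideal_ideal[OF x]
  note pr = ipow_ideal[OF rr_ideal]
  define T where "T D = (PIdl x) \<cdot> ipow rr D <+> p" for D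
  have Ti: "ideal (T D) R" for D unfolding T_def by (intro add_ideals prod_ideal xI pr pI)
  have T_mult: "T D \<cdot> ipow rr n \<subseteq> T (D + n)" for D n
  proof (rule prod_least[OF Ti])
    fix i j assume i: "i \<in> T D" and j: "j \<in> ipow rr n"
    obtain u v where uv: "u \<in> (PIdl x) \<cdot> ipow rr D" "v \<in> p" "i = u \<oplus> v" using i unfolding T_def mem_sum by blast
    note c = ideal_carr[OF prod_ideal[OF xI pr] uv(1)] ideal_carr[OF pI uv(2)] ideal_carr[OF pr j]
    have "u \<otimes> j \<in> ((PIdl x) \<cdot> ipow rr D) \<cdot> ipow rr n" using uv(1) j by (rule ideal_prod.prod)
    then have "u \<otimes> j \<in> (PIdl x) \<cdot> ipow rr (D + n)" unfolding ipow_add[OF rr_ideal] ideal_prod_assoc[OF xI pr pr] .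
    moreover have "v \<otimes> j \<in> p" using ideal_rmult[OF pI uv(2) c(3)] .
    moreover have "i \<otimes> j = u \<otimes> j \<oplus> v \<otimes> j" unfolding uv(3) using c by (simp add: l_distr)
    ultimately show "i \<otimes> j \<in> T (D + n)" unfolding T_def mem_sum by blast
  qed
  \<comment> \<open>The induction enlarges \<open>J\<close> only, while \<open>T\<close> keeps the
    full ideal \<open>rr\<close>; this is the reason for stating the claim through
    \<open>J = rr\<close>.\<close>
  have "\<exists>D. ipow J (Suc D) \<subseteq> T D" if J: "J = rr" for J
  proof -
    have "ideal J R" using J rr_ideal by simp
    then show ?thesis
    proof (induct rule: noeth_ideal_induct)
      case zero
      have "ipow {\<zero>} (Suc 0) \<subseteq> T 0" using ideal_zero[OF Ti[of 0]] ipow_1[OF zeroideal] by simp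
      then show ?case by blast
    next
      case (step I r)
      obtain e where e: "ipow I (Suc e) \<subseteq> T e" using step by blast
      have rR: "r \<in> rr" and IR: "I \<subseteq> rr" using step J by auto
      note rc = ideal_carr[OF rr_ideal rR]
      obtain D u where Du: "u \<in> ipow (PIdl x <+> PIdl r) D" "r [^] Suc D \<oplus> x \<otimes> u \<in> p" using rr_integral[OF rR] by blast
      have "PIdl x <+> PIdl r \<subseteq> rr" by (intro sum_least rr_ideal PIdl_least x_in_rr rR)
      then have uD: "u \<in> ipow rr D" using Du(1) ipow_mono by blast
      have rT: "r [^] Suc D \<in> T D"
      proof -
        have "x \<otimes> u \<in> (PIdl x) \<cdot> ipow rr D" using cgenideal_self[OF x] uD by (rule ideal_prod.prod)
        then have 1: "x \<otimes> u \<in> T D" unfolding T_def using sum_ub1[OF prod_ideal[OF xI pr] pI] by blast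
        have "r [^] Suc D \<oplus> x \<otimes> u \<in> T D" unfolding T_def using Du(2) sum_ub2[OF prod_ideal[OF xI pr] pI] by blast
        then have "x \<otimes> u \<oplus> r [^] Suc D \<in> T D" using ideal_carr[OF Ti 1] rc by (simp add: a_comm)
        from ideal_cancel_add[OF Ti this 1] show ?thesis using rc by simp
      qed
      have rI: "ipow (PIdl r) (Suc D) \<subseteq> T D" unfolding ipow_PIdl[OF rc] by (rule PIdl_least[OF Ti rT])
      \<comment> \<open>\<open>Suc e + Suc D\<close> is the successor of the new exponent
        \<open>e + Suc D\<close>. One factor \<open>x\<close> is extracted, and all other factors
        stay in \<open>rr\<close>.\<close>
      have "ipow (I <+> PIdl r) (Suc e + Suc D) \<subseteq> ipow I (Suc e) \<cdot> ipow rr (Suc D) <+> ipow (PIdl r) (Suc D) \<cdot> ipow rr (Suc e)"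
        by (rule ipow_sum_sub_within[OF step(1) cgenideal_ideal[OF rc] rr_ideal IR PIdl_least[OF rr_ideal rR]])
      also have "\<dots> \<subseteq> T (e + Suc D)"
      proof (rule sum_least[OF Ti])
        have "ipow I (Suc e) \<cdot> ipow rr (Suc D) \<subseteq> T e \<cdot> ipow rr (Suc D)" by (rule prod_mono[OF e subset_refl])
        then show "ipow I (Suc e) \<cdot> ipow rr (Suc D) \<subseteq> T (e + Suc D)" using T_mult by (rule subset_trans)
        have "ipow (PIdl r) (Suc D) \<cdot> ipow rr (Suc e) \<subseteq> T D \<cdot> ipow rr (Suc e)" by (rule prod_mono[OF rI subset_refl])
        also have "\<dots> \<subseteq> T (D + Suc e)" by (rule T_mult)
        finally show "ipow (PIdl r) (Suc D) \<cdot> ipow rr (Suc e) \<subseteq> T (e + Suc D)" by (simp add: add.commute)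
      qed
      finally show ?case by (intro exI[of _ "e + Suc D"]) simp
    qed
  qed
  then obtain D where D: "ipow rr (Suc D) \<subseteq> T D" by blast
  have "ipow rr (Suc (D + n)) \<subseteq> T (D + n)" for n
  proof -
    have "ipow rr (Suc (D + n)) = ipow rr (Suc D) \<cdot> ipow rr n" using ipow_add[OF rr_ideal, of "Suc D" n] by simp
    also have "\<dots> \<subseteq> T D \<cdot> ipow rr n" by (rule prod_mono[OF D subset_refl])
    also have "\<dots> \<subseteq> T (D + n)" by (rule T_mult)
    finally show ?thesis .
  qed
  then show ?thesis unfolding T_def by (rule that)
qed

lemma rr_power_iter:
  assumes D: "\<And>n. ipow rr (Suc (D + n)) \<subseteq> (PIdl x) \<cdot> ipow rr (D + n) <+> p"
  shows "z \<in> ipow rr (D + n) \<Longrightarrow> \<exists>w\<in>ipow rr D. z \<ominus> x [^] n \<otimes> w \<in> p"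
proof (induct n arbitrary: z)
  case 0
  then have "z \<ominus> x [^] (0::nat) \<otimes> z = \<zero>" using ideal_carr[OF ipow_ideal[OF rr_ideal]] by (simp add: a_minus_def r_neg)
  then have "z \<ominus> x [^] (0::nat) \<otimes> z \<in> p" using ideal_zero[OF primeideal_ideal[OF p]] by (simp only:)
  then show ?case using 0 by (intro bexI[of _ z]) simp_all
next
  case (Suc n)
  note pI = primeideal_ideal[OF p]
  note pr = ipow_ideal[OF rr_ideal]
  have "z \<in> (PIdl x) \<cdot> ipow rr (D + n) <+> p" using D[of n] Suc(2) by auto
  then obtain v e where ve: "v \<in> ipow rr (D + n) \<cdot> (PIdl x)" "e \<in> p" "z = v \<oplus> e"
    unfolding mem_sum ideal_prod_commute[OF cgenideal_ideal[OF x] pr] by blast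
  obtain y where y: "y \<in> ipow rr (D + n)" "v = y \<otimes> x" using prod_PIdl[OF pr x ve(1)] by blast
  obtain w where w: "w \<in> ipow rr D" "y \<ominus> x [^] n \<otimes> w \<in> p" using Suc(1)[OF y(1)] by blast
  note c = ideal_carr[OF pr y(1)] ideal_carr[OF pr w(1)] ideal_carr[OF pI ve(2)] nat_pow_closed[OF x, of n] x
  have "z \<ominus> x [^] Suc n \<otimes> w = (y \<ominus> x [^] n \<otimes> w) \<otimes> x \<oplus> e"
    unfolding ve(3) y(2) nat_pow_Suc using c by algebra
  also have "\<dots> \<in> p" by (rule ideal_add[OF pI ideal_rmult[OF pI w(2) x] ve(2)])
  finally show ?case using w(1) by blast
qed

end
end
end

section \<open>Chains of primes in the completion\<close>

context noetherian_cring
begin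

text \<open>Finite generation turns the multipliers of single elements into one common
  multiplier.\<close>

lemma sat_uniform:
  assumes q: "primeideal q R" and I: "ideal I R"
  shows "\<exists>s\<in>carrier R - q. \<forall>g\<in>sat q I. s \<otimes> g \<in> I"
proof -
  have "ideal (sat q I) R" by (rule sat_ideal[OF q I])
  then show ?thesis
  proof (induct rule: noeth_ideal_induct)
    case zero
    show ?case using prime_one[OF q] ideal_zero[OF I] by (intro bexI[of _ \<one>]) auto
  next
    case (step J x)
    obtain s where s: "s \<in> carrier R" "s \<notin> q" "\<forall>g\<in>J. s \<otimes> g \<in> I" using step(3) by blast
    obtain t where t: "x \<in> carrier R" "t \<in> carrier R" "t \<notin> q" "t \<otimes> x \<in> I" using step(4) by (auto simp: sat_def)
    have "(s \<otimes> t) \<otimes> g \<in> I" if g: "g \<in> J <+> PIdl x" for g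
    proof -
      obtain j r where jr: "j \<in> J" "r \<in> carrier R" "g = j \<oplus> r \<otimes> x" using g unfolding mem_sum_PIdl by blast
      note jc = ideal_carr[OF step(1) jr(1)]
      have "(s \<otimes> t) \<otimes> g = t \<otimes> (s \<otimes> j) \<oplus> (s \<otimes> r) \<otimes> (t \<otimes> x)" unfolding jr(3) using s(1) t(1,2) jr(2) jc by algebra
      then show ?thesis using ideal_add[OF I ideal_lmult[OF I _ t(2)] ideal_lmult[OF I t(4) m_closed[OF s(1) jr(2)]]] s(3) jr(1) by simp
    qed
    then show ?case using s t prime_mult_iff[OF q s(1) t(2)] by (intro bexI[of _ "s \<otimes> t"]) auto
  qed
qed

end

locale completion_pair_with_UP = completion_pair R m S h F + R: noeth_local_with_UP R m
  for R (structure) and m and S (structure) and h and F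
begin

lemma ext_prod:
  assumes L: "ideal L R" and z: "z \<in> m \<cdot> L" shows "h z \<in> F 1 \<cdot>\<^bsub>S\<^esub> ext L"
  using z
proof induct
  case (prod i j)
  have "h i \<in> F 1" using F_R[of i 1] R.ideal_carr[OF R.m_ideal] R.ipow_1[OF R.m_ideal] prod(1) by simp
  moreover have "h j \<in> ext L" by (rule ext_self[OF R.ideal_sub[OF L] prod(2)])
  moreover have "h (i \<otimes> j) = h i \<otimes>\<^bsub>S\<^esub> h j" using h_mult R.ideal_carr[OF R.m_ideal] R.ideal_carr[OF L] prod by blast
  ultimately show ?case by (simp add: ideal_prod.prod)
next
  note Li = ext_ideal[OF R.ideal_sub[OF L]]
  case (sum s1 s2)
  have "s1 \<in> carrier R" "s2 \<in> carrier R" using R.ideal_carr[OF R.prod_ideal[OF R.m_ideal L]] sum by blast+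
  then have "h (s1 \<oplus> s2) = h s1 \<oplus>\<^bsub>S\<^esub> h s2" by (rule h_add)
  then show ?case using S.ideal_add[OF S.prod_ideal[OF F_ideal Li] sum(2,4)] by simp
qed

lemma ext_prod_mult:
  assumes L: "ideal L R" and d: "d \<in> ext (m \<cdot> L)" and v: "v \<in> R.ipow L n"
  shows "d \<otimes>\<^bsub>S\<^esub> h v \<in> F 1 \<cdot>\<^bsub>S\<^esub> ext (R.ipow L (Suc n))"
proof -
  note pL = R.ipow_ideal[OF L]
  note vc = R.ideal_carr[OF pL v]
  note W = S.prod_ideal[OF F_ideal ext_ideal[OF R.ideal_sub[OF pL]], of 1 "Suc n"]
  have K: "ideal (S.colon (F 1 \<cdot>\<^bsub>S\<^esub> ext (R.ipow L (Suc n))) {h v}) S"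
    using h_closed[OF vc] by (intro S.colon_ideal W) simp
  have "ext (m \<cdot> L) \<subseteq> S.colon (F 1 \<cdot>\<^bsub>S\<^esub> ext (R.ipow L (Suc n))) {h v}"
  proof (rule ext_least[OF K])
    fix z assume z: "z \<in> m \<cdot> L"
    note zc = R.ideal_carr[OF R.prod_ideal[OF R.m_ideal L] z]
    have "z \<otimes> v \<in> (m \<cdot> L) \<cdot> R.ipow L n" using z v by (rule ideal_prod.prod)
    then have "z \<otimes> v \<in> m \<cdot> R.ipow L (Suc n)" 
      unfolding R.ipow_Suc2[OF L] R.ideal_prod_assoc[OF R.m_ideal L pL] .
    then have "h (z \<otimes> v) \<in> F 1 \<cdot>\<^bsub>S\<^esub> ext (R.ipow L (Suc n))" by (rule ext_prod[OF pL])
    then show "h z \<in> S.colon (F 1 \<cdot>\<^bsub>S\<^esub> ext (R.ipow L (Suc n))) {h v}"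
      using h_closed zc vc h_mult by (simp add: S.colon_def)
  qed
  then show ?thesis using d by (auto simp: S.colon_def)
qed

section \<open>One step of Ratliff's theorem, by contradiction\<close>

context
  fixes P p1
  assumes cat: "catenary (UP R)" and Pmin: "S.min_over P (ext (contract P))"
    and p1: "primeideal p1 R" and pp1: "contract P \<subset> p1" and p1m: "p1 \<subset> m"
    and gap: "\<And>Q. primeideal Q S \<Longrightarrow> P \<subset> Q \<Longrightarrow> Q \<subset> F 1 \<Longrightarrow> False"
begin

private abbreviation (input) "p \<equiv> contract P"
text \<open>The contraction of \<open>p S_P\<close>. Since \<open>P\<close> is minimal over
  \<open>p S\<close>, it is the \<open>P\<close>-primary component of \<open>p S\<close>.\<close>

private abbreviation (input) "G \<equiv> S.sat P (ext p)"

private lemma P: "primeideal P S"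
  using Pmin by (simp add: S.min_over_def)

private lemma p: "primeideal p R"
  by (rule contract_prime[OF P])

private lemmas PI = S.primeideal_ideal[OF P]
private lemmas pI = R.primeideal_ideal[OF p]
private lemmas pE = ext_ideal[OF R.ideal_sub[OF pI]]
private lemmas GI = S.sat_ideal[OF P pE]

private lemma extP: "ext p \<subseteq> P"
  using Pmin by (simp add: S.min_over_def)

private lemma GP: "G \<subseteq> P"
proof
  fix g assume "g \<in> G"
  then obtain s where s: "g \<in> carrier S" "s \<in> carrier S" "s \<notin> P" "s \<otimes>\<^bsub>S\<^esub> g \<in> ext p" unfolding S.sat_def by blast
  then have "s \<otimes>\<^bsub>S\<^esub> g \<in> P" using extP by blast
  then show "g \<in> P" using S.prime_mult_iff[OF P s(2,1)] s(3) by blast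
qed

text \<open>A prime over \<open>G + (u)\<close> contains \<open>P\<close>, whose elements are
  nilpotent modulo \<open>G\<close>, and it contains \<open>u\<close>. It is strictly above
  \<open>P\<close>, hence it is the maximal ideal.\<close>

private lemma big:
  assumes u: "u \<in> carrier S" "u \<notin> P"
  shows "\<exists>c. F c \<subseteq> G <+>\<^bsub>S\<^esub> PIdl\<^bsub>S\<^esub> u"
proof -
  have "\<exists>c. S.ipow (F 1) c \<subseteq> G <+>\<^bsub>S\<^esub> PIdl\<^bsub>S\<^esub> u"
  proof (rule S.ipow_sub_of_primes[OF S.PIdl_sum_ideal[OF GI u(1)] F_ideal])
    fix Q assume Q: "primeideal Q S" and GQ: "G <+>\<^bsub>S\<^esub> PIdl\<^bsub>S\<^esub> u \<subseteq> Q"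
    have uQ: "u \<in> Q" using GQ S.PIdl_sum_mem[OF GI u(1)] by blast
    have GQ': "G \<subseteq> Q" using GQ S.PIdl_sum_sub[OF GI u(1)] by blast
    have "P \<subseteq> Q"
    proof
      fix y assume y: "y \<in> P"
      note yc = S.ideal_carr[OF PI y]
      obtain s n where s: "s \<in> carrier S" "s \<notin> P" "s \<otimes>\<^bsub>S\<^esub> y [^]\<^bsub>S\<^esub> (n::nat) \<in> ext p"
        using S.min_over_pow[OF Pmin pE y] by blast
      have "y [^]\<^bsub>S\<^esub> n \<in> carrier S" using yc by simp
      then have "y [^]\<^bsub>S\<^esub> n \<in> G" using s unfolding S.sat_def by blast
      then show "y \<in> Q" using GQ' S.prime_pow[OF Q yc] by blast
    qed
    then have PQ: "P \<subset> Q" using uQ u(2) by blast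
    show "F 1 \<subseteq> Q"
    proof (rule ccontr)
      assume "\<not> F 1 \<subseteq> Q"
      then have "Q \<noteq> F 1" using subset_refl by metis
      then have "Q \<subset> F 1" using S.prime_sub_m[OF Q] by (simp add: psubset_eq)
      then show False by (rule gap[OF Q PQ])
    qed
  qed
  then obtain c where c: "S.ipow (F 1) c \<subseteq> G <+>\<^bsub>S\<^esub> PIdl\<^bsub>S\<^esub> u" ..
  from F_ipow[of c] c have "F c \<subseteq> G <+>\<^bsub>S\<^esub> PIdl\<^bsub>S\<^esub> u" by (rule ord_eq_le_trans)
  then show ?thesis ..
qed

text \<open>
  The element \<open>\<pi>\<close> of the localized fibre \<open>G\<close> is approximated by some \<open>a\<close> in \<open>R\<close>. A prime strictly between
  \<open>slope p a x\<close> and \<open>(m, X)\<close> that avoids \<open>x\<close> contracts to a prime \<open>p'\<close> modulo which \<open>x\<close> and \<open>a\<close>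
  nearly agree, and Nakayama's lemma in \<open>R[X]\<close> then forces \<open>x\<close> into that prime.
\<close>

lemma catenary_contradiction: False
proof -
  have m_not: "\<not> R.ipow m n \<subseteq> q" if "primeideal q R" "q \<subset> m" for q n
    using R.prime_ipow[OF that(1) R.m_ideal, of n] that(2) by blast
  have hF: "h y \<in> F n" if "y \<in> R.ipow m n" for y n
    using F_R[of y n] that R.ideal_carr[OF R.ipow_ideal[OF R.m_ideal] that] by blast
  have pm: "p \<subset> m" using pp1 p1m by blast
  \<comment> \<open>One multiplier outside \<open>P\<close> carries the whole primary component into
    \<open>p S\<close>.\<close>
  obtain \<sigma> where \<sigma>: "\<sigma> \<in> carrier S" "\<sigma> \<notin> P" "\<forall>g\<in>G. \<sigma> \<otimes>\<^bsub>S\<^esub> g \<in> ext p" using S.sat_uniform[OF P pE] by blast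
  obtain c0 where c0: "F c0 \<subseteq> G <+>\<^bsub>S\<^esub> PIdl\<^bsub>S\<^esub> \<sigma>" using big[OF \<sigma>(1,2)] by blast
  \<comment> \<open>The successor makes the exponent positive, so that \<open>x\<close> will lie in
    \<open>m\<close>.\<close>
  define c where "c = Suc c0"
  have c: "F c \<subseteq> G <+>\<^bsub>S\<^esub> PIdl\<^bsub>S\<^esub> \<sigma>" using c0 F_Suc[of c0] unfolding c_def by blast
  obtain x where x: "x \<in> R.ipow m c" "x \<notin> p" using m_not[OF p pm, of c] by blast
  have xc: "x \<in> carrier R" by (rule R.ideal_carr[OF R.ipow_ideal[OF R.m_ideal] x(1)])
  have xm: "x \<in> m" using x(1) R.ipow_sub[OF R.m_ideal, of c] unfolding c_def by blast
  \<comment> \<open>\<open>h x\<close> splits into \<open>\<pi>\<close> in \<open>G\<close> and a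
    multiple \<open>t\<close> of \<open>\<sigma>\<close>. Since \<open>\<sigma>\<close> carries
    \<open>G\<close> into \<open>p S\<close>, so does \<open>t\<close>.\<close>
  have "h x \<in> G <+>\<^bsub>S\<^esub> PIdl\<^bsub>S\<^esub> \<sigma>" using hF[OF x(1)] c by blast
  then obtain \<pi> w where \<pi>w: "\<pi> \<in> G" "w \<in> carrier S" "h x = \<pi> \<oplus>\<^bsub>S\<^esub> w \<otimes>\<^bsub>S\<^esub> \<sigma>" unfolding S.mem_sum_PIdl by blast
  define t where "t = w \<otimes>\<^bsub>S\<^esub> \<sigma>"
  have \<pi>c: "\<pi> \<in> carrier S" by (rule S.ideal_carr[OF GI \<pi>w(1)])
  have tc: "t \<in> carrier S" unfolding t_def using \<pi>w \<sigma> by simp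
  have hx: "h x = \<pi> \<oplus>\<^bsub>S\<^esub> t" unfolding t_def by (rule \<pi>w(3))
  have hxc: "h x \<in> carrier S" by (rule h_closed[OF xc])
  have tG: "t \<otimes>\<^bsub>S\<^esub> g \<in> ext p" if g: "g \<in> G" for g
  proof -
    have "t \<otimes>\<^bsub>S\<^esub> g = w \<otimes>\<^bsub>S\<^esub> (\<sigma> \<otimes>\<^bsub>S\<^esub> g)" unfolding t_def using S.ideal_carr[OF GI g] \<pi>w \<sigma> by (simp add: S.m_assoc)
    then show ?thesis using S.ideal_lmult[OF pE _ \<pi>w(2)] \<sigma>(3) g by simp
  qed
  let ?I = "p <+> PIdl x"
  let ?rr = "R.colon ?I (R.ipow m c)"
  have II: "ideal ?I R" by (rule R.PIdl_sum_ideal[OF pI xc])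
  have pIs: "p \<subseteq> ?I" by (rule R.PIdl_sum_sub[OF pI xc])
  note IE = ext_ideal[OF R.ideal_sub[OF II]]
  note rI = R.rr_ideal[OF p p1 pp1 p1m cat xc x(2), of c]
  note rE = ext_ideal[OF R.ideal_sub[OF rI]]
  note pr = R.ipow_ideal[OF rI]
  have mi: "ideal (R.ipow m n) R" for n by (rule R.ipow_ideal[OF R.m_ideal])
  \<comment> \<open>\<open>t\<close> carries \<open>m^c\<close> into \<open>(p, x) S\<close>: on the
    part in \<open>G\<close> it gives \<open>p S\<close>, and on the multiples of
    \<open>\<sigma>\<close> it is rewritten as \<open>h x - \<pi>\<close>. Flatness then places
    \<open>t\<close> in the extension of \<open>rr\<close>.\<close>
  have tr: "t \<in> ext ?rr"
  proof (rule ext_colon[OF II mi tc])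
    fix y assume y: "y \<in> R.ipow m c"
    have "h y \<in> G <+>\<^bsub>S\<^esub> PIdl\<^bsub>S\<^esub> \<sigma>" using hF[OF y] c by blast
    then obtain g s where gs: "g \<in> G" "s \<in> carrier S" "h y = g \<oplus>\<^bsub>S\<^esub> s \<otimes>\<^bsub>S\<^esub> \<sigma>" unfolding S.mem_sum_PIdl by blast
    note gc = S.ideal_carr[OF GI gs(1)]
    have te: "t = h x \<ominus>\<^bsub>S\<^esub> \<pi>" unfolding hx using \<pi>c tc by algebra
    have "t \<otimes>\<^bsub>S\<^esub> (s \<otimes>\<^bsub>S\<^esub> \<sigma>) = (s \<otimes>\<^bsub>S\<^esub> \<sigma>) \<otimes>\<^bsub>S\<^esub> h x \<ominus>\<^bsub>S\<^esub> s \<otimes>\<^bsub>S\<^esub> (\<sigma> \<otimes>\<^bsub>S\<^esub> \<pi>)"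
      unfolding te using hxc \<pi>c gs(2) \<sigma>(1) by algebra
    also have "\<dots> \<in> ext ?I"
    proof (rule S.ideal_minus[OF IE])
      show "(s \<otimes>\<^bsub>S\<^esub> \<sigma>) \<otimes>\<^bsub>S\<^esub> h x \<in> ext ?I"
        using gs(2) \<sigma>(1) by (intro S.ideal_lmult[OF IE] ext_self R.ideal_sub[OF II] R.PIdl_sum_mem[OF pI xc]) simp
      have "\<sigma> \<otimes>\<^bsub>S\<^esub> \<pi> \<in> ext ?I" using \<sigma>(3) \<pi>w(1) ext_mono[OF R.ideal_sub[OF II] pIs] by blast
      then show "s \<otimes>\<^bsub>S\<^esub> (\<sigma> \<otimes>\<^bsub>S\<^esub> \<pi>) \<in> ext ?I" by (rule S.ideal_lmult[OF IE _ gs(2)])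
    qed
    finally have 1: "t \<otimes>\<^bsub>S\<^esub> (s \<otimes>\<^bsub>S\<^esub> \<sigma>) \<in> ext ?I" .
    have 2: "t \<otimes>\<^bsub>S\<^esub> g \<in> ext ?I" using tG[OF gs(1)] ext_mono[OF R.ideal_sub[OF II] pIs] by blast
    have "t \<otimes>\<^bsub>S\<^esub> h y = t \<otimes>\<^bsub>S\<^esub> g \<oplus>\<^bsub>S\<^esub> t \<otimes>\<^bsub>S\<^esub> (s \<otimes>\<^bsub>S\<^esub> \<sigma>)" unfolding gs(3) using tc gc gs(2) \<sigma>(1) by (simp add: S.r_distr)
    then show "t \<otimes>\<^bsub>S\<^esub> h y \<in> ext ?I" using S.ideal_add[OF IE 2 1] by simp
  qed
  have x_rr: "x \<in> ?rr" by (rule R.x_in_rr[OF p p1 pp1 p1m cat xc x(2)])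
  have "\<pi> = h x \<ominus>\<^bsub>S\<^esub> t" unfolding hx using \<pi>c tc by algebra
  then have "\<pi> \<in> ext ?rr" using S.ideal_minus[OF rE ext_self[OF R.ideal_sub[OF rI] x_rr] tr] by simp
  \<comment> \<open>\<open>a\<close> is so close to \<open>\<pi>\<close> that the error
    \<open>\<delta>\<close> lies in the extension of \<open>m rr\<close>, where Nakayama's lemma can
    absorb it.\<close>
  then obtain a where a: "a \<in> ?rr" "\<pi> \<ominus>\<^bsub>S\<^esub> h a \<in> ext (R.ipow m 1 \<cdot> ?rr)" using ext_approx[OF rI, of \<pi> 1] by blast
  have m1: "R.ipow m 1 = m" using R.ipow_1[OF R.m_ideal] by simp
  have ac: "a \<in> carrier R" by (rule R.ideal_carr[OF rI a(1)])
  have hac: "h a \<in> carrier S" by (rule h_closed[OF ac])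
  define \<delta> where "\<delta> = \<pi> \<ominus>\<^bsub>S\<^esub> h a"
  have \<delta>: "\<delta> \<in> ext (m \<cdot> ?rr)" using a(2) unfolding \<delta>_def m1 .
  have \<delta>c: "\<delta> \<in> carrier S" unfolding \<delta>_def using \<pi>c hac by simp
  obtain D where D: "\<And>n. R.ipow ?rr (Suc (D + n)) \<subseteq> (PIdl x) \<cdot> R.ipow ?rr (D + n) <+> p"
    by (rule R.rr_power[OF p p1 pp1 p1m cat xc x(2), where c=c]) (rule that)
  let ?K = "R.slope p a x" and ?q = "R.upX m"
  note axp = ac xc x(2)
  note K = R.slope_prime[OF p axp]
  note KI = R.UPr.primeideal_ideal[OF K]
  note q = R.upX_prime[OF R.m_prime]
  note qI = R.UPr.primeideal_ideal[OF q]
  \<comment> \<open>An element with constant term \<open>1\<close> would give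
    \<open>x^(E+1) + a u\<close> in \<open>p\<close>. With \<open>a\<close> replaced by
    \<open>\<pi> - \<delta>\<close>, the extension of a power of \<open>rr\<close> lies in
    \<open>P\<close> up to the maximal ideal times itself; by Nakayama's lemma a power of
    \<open>x\<close> would lie in \<open>p\<close>.\<close>
  have Kq: "?K \<subseteq> ?q"
  proof (rule ccontr)
    assume "\<not> ?K \<subseteq> ?q"
    then obtain H where H: "H \<in> ?K" "R.cf H 0 = \<one>" by (rule R.upX_unit[OF KI]) (rule that)
    obtain E u where u: "u \<in> R.ipow (PIdl a <+> PIdl x) E" "x [^] Suc E \<oplus> a \<otimes> u \<in> p"
      by (rule R.slope_unit_coeff[OF p axp H]) (rule that)
    have "PIdl a <+> PIdl x \<subseteq> ?rr" by (intro R.sum_least rI R.PIdl_least a x_rr)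
    then have ur: "u \<in> R.ipow ?rr E" using u(1) R.ipow_mono by blast
    have uc: "u \<in> carrier R" by (rule R.ideal_carr[OF pr ur])
    let ?L = "R.ipow ?rr (Suc (E + D))"
    note LE = ext_ideal[OF R.ideal_sub[OF pr], of "Suc (E + D)"]
    let ?W = "P <+>\<^bsub>S\<^esub> F 1 \<cdot>\<^bsub>S\<^esub> ext ?L"
    have F1L: "ideal (F 1 \<cdot>\<^bsub>S\<^esub> ext ?L) S" by (rule S.prod_ideal[OF F_ideal LE])
    have W: "ideal ?W S" by (rule S.add_ideals[OF PI F1L])
    have hp: "h y \<in> P" if "y \<in> p" for y using that by (simp add: contract_def)
    have "ext ?L \<subseteq> ?W"
    proof (rule ext_least[OF W])
      fix z assume z: "z \<in> ?L"
      have zc: "z \<in> carrier R" by (rule R.ideal_carr[OF pr z])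
      have "Suc (E + D) = D + Suc E" by simp
      then have "z \<in> R.ipow ?rr (D + Suc E)" using z by (simp only:)
      then obtain v where v: "v \<in> R.ipow ?rr D" "z \<ominus> x [^] Suc E \<otimes> v \<in> p"
        using R.rr_power_iter[OF p p1 pp1 p1m cat xc x(2) D] by blast
      have vc: "v \<in> carrier R" by (rule R.ideal_carr[OF pr v(1)])
      define y1 where "y1 = z \<ominus> x [^] Suc E \<otimes> v"
      define y2 where "y2 = x [^] Suc E \<oplus> a \<otimes> u"
      have y12: "y1 \<in> p" "y2 \<in> p" unfolding y1_def y2_def by (rule v(2), rule u(2))
      have yc: "y1 \<in> carrier R" "y2 \<in> carrier R" using R.ideal_carr[OF pI] y12 by blast+
      have "z = y1 \<oplus> y2 \<otimes> v \<ominus> a \<otimes> (u \<otimes> v)"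
        unfolding y1_def y2_def using zc vc uc ac R.nat_pow_closed[OF xc, of "Suc E"] by algebra
      then have "h z = h y1 \<oplus>\<^bsub>S\<^esub> h y2 \<otimes>\<^bsub>S\<^esub> h v \<ominus>\<^bsub>S\<^esub> h a \<otimes>\<^bsub>S\<^esub> h (u \<otimes> v)"
        using yc vc ac uc by (simp add: h_add h_mult h_minus)
      also have "\<dots> = (h y1 \<oplus>\<^bsub>S\<^esub> h y2 \<otimes>\<^bsub>S\<^esub> h v \<ominus>\<^bsub>S\<^esub> \<pi> \<otimes>\<^bsub>S\<^esub> h (u \<otimes> v)) \<oplus>\<^bsub>S\<^esub> \<delta> \<otimes>\<^bsub>S\<^esub> h (u \<otimes> v)"
        unfolding \<delta>_def using h_closed[OF yc(1)] h_closed[OF yc(2)] h_closed[OF vc] hac \<pi>c h_closed[OF R.m_closed[OF uc vc]] by algebra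
      finally have e: "h z = (h y1 \<oplus>\<^bsub>S\<^esub> h y2 \<otimes>\<^bsub>S\<^esub> h v \<ominus>\<^bsub>S\<^esub> \<pi> \<otimes>\<^bsub>S\<^esub> h (u \<otimes> v)) \<oplus>\<^bsub>S\<^esub> \<delta> \<otimes>\<^bsub>S\<^esub> h (u \<otimes> v)" .
      have 1: "h y1 \<oplus>\<^bsub>S\<^esub> h y2 \<otimes>\<^bsub>S\<^esub> h v \<ominus>\<^bsub>S\<^esub> \<pi> \<otimes>\<^bsub>S\<^esub> h (u \<otimes> v) \<in> P"
        using GP \<pi>w(1) by (intro S.ideal_minus[OF PI] S.ideal_add[OF PI] S.ideal_rmult[OF PI] hp y12 h_closed vc R.m_closed uc) blast+
      have "u \<otimes> v \<in> R.ipow ?rr (E + D)" unfolding R.ipow_add[OF rI] using ur v(1) by (rule ideal_prod.prod)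
      then have 2: "\<delta> \<otimes>\<^bsub>S\<^esub> h (u \<otimes> v) \<in> F 1 \<cdot>\<^bsub>S\<^esub> ext ?L" by (rule ext_prod_mult[OF rI \<delta>])
      show "h z \<in> ?W" unfolding e S.mem_sum using 1 2 by blast
    qed
    then have "ext ?L \<subseteq> P" by (rule S.nakayama_local[OF LE PI])
    moreover have "h (x [^] Suc (E + D)) \<in> ext ?L" by (intro ext_self R.ideal_sub[OF pr] R.pow_in_ipow[OF rI x_rr])
    ultimately have "x [^] Suc (E + D) \<in> p" using R.nat_pow_closed[OF xc] unfolding contract_def by blast
    then show False using R.prime_pow[OF p xc] x(2) by blast
  qed
  have "?K \<noteq> ?q"
  proof
    assume e: "?K = ?q"
    have "m \<subseteq> p"
    proof
      fix y assume y: "y \<in> m"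
      have yc: "y \<in> carrier R" by (rule R.ideal_carr[OF R.m_ideal y])
      have "R.Cn y \<in> ?q" using y yc by (simp add: R.upX_def)
      then show "y \<in> p" using R.slope_contract[OF p axp yc] e by blast
    qed
    then show False using pm by blast
  qed
  then have "?K \<subset> ?q" using Kq by blast
  \<comment> \<open>This intermediate prime may contain \<open>x\<close>. By
    \<open>finite_bad_primes\<close> and prime avoidance it is traded for a prime \<open>q'\<close>
    that does not.\<close>
  then obtain Q where Q: "primeideal Q (UP R)" "?K \<subset> Q" "Q \<subset> ?q"
    by (rule R.slope_gap[OF p p1 pp1 p1m cat axp]) (rule that)
  have Cx: "R.Cn x \<in> carrier (UP R)" "R.Cn x \<notin> ?K" using xc x(2) R.slope_contract[OF p axp xc] by simp_all
  obtain BB where BB: "finite BB" "\<And>B. B \<in> BB \<Longrightarrow> primeideal B (UP R) \<and> B \<subset> ?q"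
    "\<And>w q'. w \<in> ?q \<Longrightarrow> (\<And>B. B \<in> BB \<Longrightarrow> w \<notin> B) \<Longrightarrow> q' \<subseteq> ?q \<Longrightarrow> R.UPr.min_over q' (?K <+>\<^bsub>UP R\<^esub> PIdl\<^bsub>UP R\<^esub> w) \<Longrightarrow>
        R.Cn x \<notin> q' \<and> q' \<subset> ?q \<and> ?K \<subset> q'"
  proof (rule R.UPn.finite_bad_primes[OF K Q(1) q Q(2,3) Cx])
    fix BB assume 1: "finite BB" and 2: "\<And>B. B \<in> BB \<Longrightarrow> primeideal B (UP R) \<and> B \<subset> ?q"
      and 3: "\<And>w q'. w \<in> ?q \<Longrightarrow> (\<And>B. B \<in> BB \<Longrightarrow> w \<notin> B) \<Longrightarrow> q' \<subseteq> ?q \<Longrightarrow> R.UPr.min_over q' (?K <+>\<^bsub>UP R\<^esub> PIdl\<^bsub>UP R\<^esub> w) \<Longrightarrow>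
        R.Cn x \<notin> q' \<and> q' \<subset> ?q \<and> ?K \<subset> q'"
    show thesis by (rule that[OF 1 2 3])
  qed
  have "\<exists>w\<in>?q. \<forall>B\<in>BB. w \<notin> B"
    by (rule R.UPr.prime_avoidance[OF BB(1) _ qI]) (use BB(2) in blast)+
  then obtain y0 where y0: "y0 \<in> ?q" "\<And>B. B \<in> BB \<Longrightarrow> y0 \<notin> B" by blast
  have y0c: "y0 \<in> carrier (UP R)" by (rule R.UPr.ideal_carr[OF qI y0(1)])
  obtain q' where q': "q' \<subseteq> ?q" "R.UPr.min_over q' (?K <+>\<^bsub>UP R\<^esub> PIdl\<^bsub>UP R\<^esub> y0)"
    by (rule R.UPn.exists_min_over[OF q R.UPr.PIdl_sum_ideal[OF KI y0c] R.UPr.PIdl_sum_least[OF qI Kq y0(1)]]) (rule that)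
  have xq: "R.Cn x \<notin> q'" and q'q: "q' \<subset> ?q" and Kq': "?K \<subset> q'" using BB(3)[OF y0 q'] by blast+
  have q'p: "primeideal q' (UP R)" using q'(2) by (simp add: R.UPr.min_over_def)
  note q'I = R.UPr.primeideal_ideal[OF q'p]
  let ?p' = "R.upcon q'"
  have p': "primeideal ?p' R" by (rule R.upcon_prime[OF q'p])
  note p'I = R.primeideal_ideal[OF p']
  have xp': "x \<notin> ?p'" using xq by (simp add: R.upcon_def)
  have pp': "p \<subseteq> ?p'"
  proof
    fix y assume y: "y \<in> p"
    have yc: "y \<in> carrier R" by (rule R.ideal_carr[OF pI y])
    then show "y \<in> ?p'" using R.slope_contract[OF p axp yc] y Kq' by (auto simp: R.upcon_def)
  qed
  have p'm: "?p' \<subset> m" using R.prime_sub_m[OF p'] xm xp' by blast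
  \<comment> \<open>By \<open>slope_maximal\<close>, contraction to \<open>p\<close> would force
    \<open>q'\<close> to be the slope ideal.\<close>
  have "?p' \<noteq> p"
  proof
    assume e: "?p' = p"
    have "q' = ?K"
      by (rule R.slope_maximal[OF p axp q'p _ xq]) (use Kq' e R.upcon_def in blast)+
    then show False using Kq' by blast
  qed
  then obtain y where y: "y \<in> ?p'" "y \<notin> p" using pp' by blast
  have yc: "y \<in> carrier R" by (rule R.ideal_carr[OF p'I y(1)])
  have hyc: "h y \<in> carrier S" by (rule h_closed[OF yc])
  have "h y \<notin> P" using y(2) yc by (simp add: contract_def)
  then obtain e where e: "F e \<subseteq> G <+>\<^bsub>S\<^esub> PIdl\<^bsub>S\<^esub> (h y)" using big[OF hyc] by blast
  note p'E = ext_ideal[OF R.ideal_sub[OF p'I]]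
  \<comment> \<open>An element \<open>y\<close> of \<open>?p'\<close> outside \<open>p\<close>
    generates together with \<open>G\<close> an ideal that contains some \<open>F e\<close>, and
    \<open>t\<close> carries both \<open>G\<close> and \<open>y\<close> into the extension of
    \<open>?p'\<close>. As \<open>?p'\<close> is strictly inside \<open>m\<close>, its colon ideal
    by \<open>m^e\<close> is \<open>?p'\<close> itself.\<close>
  have "t \<in> ext (R.colon ?p' (R.ipow m e))"
  proof (rule ext_colon[OF p'I mi tc])
    fix z assume z: "z \<in> R.ipow m e"
    have "h z \<in> G <+>\<^bsub>S\<^esub> PIdl\<^bsub>S\<^esub> (h y)" using hF[OF z] e by blast
    then obtain g s where gs: "g \<in> G" "s \<in> carrier S" "h z = g \<oplus>\<^bsub>S\<^esub> s \<otimes>\<^bsub>S\<^esub> h y" unfolding S.mem_sum_PIdl by blast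
    note gc = S.ideal_carr[OF GI gs(1)]
    have 1: "t \<otimes>\<^bsub>S\<^esub> g \<in> ext ?p'" using tG[OF gs(1)] ext_mono[OF R.ideal_sub[OF p'I] pp'] by blast
    have 2: "(t \<otimes>\<^bsub>S\<^esub> s) \<otimes>\<^bsub>S\<^esub> h y \<in> ext ?p'"
      by (intro S.ideal_lmult[OF p'E] ext_self[OF R.ideal_sub[OF p'I] y(1)] S.m_closed tc gs(2))
    have "t \<otimes>\<^bsub>S\<^esub> h z = t \<otimes>\<^bsub>S\<^esub> g \<oplus>\<^bsub>S\<^esub> (t \<otimes>\<^bsub>S\<^esub> s) \<otimes>\<^bsub>S\<^esub> h y" unfolding gs(3) using tc gc gs(2) hyc by algebra
    then show "t \<otimes>\<^bsub>S\<^esub> h z \<in> ext ?p'" using S.ideal_add[OF p'E 1 2] by simp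
  qed
  moreover have "R.colon ?p' (R.ipow m e) \<subseteq> ?p'"
  proof
    fix r assume r: "r \<in> R.colon ?p' (R.ipow m e)"
    obtain z where z: "z \<in> R.ipow m e" "z \<notin> ?p'" using m_not[OF p' p'm, of e] by blast
    have "r \<in> carrier R" "r \<otimes> z \<in> ?p'" using r z by (auto simp: R.colon_def)
    then show "r \<in> ?p'" using R.prime_mult_iff[OF p', of r z] z R.ideal_carr[OF mi z(1)] by blast
  qed
  ultimately have tp': "t \<in> ext ?p'" using ext_mono[OF R.ideal_sub[OF p'I]] by blast
  have mrI: "ideal (m \<cdot> ?rr) R" by (rule R.prod_ideal[OF R.m_ideal rI])
  have sI: "ideal (?p' <+> m \<cdot> ?rr) R" by (rule R.add_ideals[OF p'I mrI])
  note sE = ext_ideal[OF R.ideal_sub[OF sI]]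
  \<comment> \<open>Both parts of \<open>t + \<delta>\<close> lie in the extension of
    \<open>?p' + m rr\<close>; contraction turns this into a congruence between \<open>x\<close> and
    \<open>a\<close> in \<open>R\<close>.\<close>
  have "h (x \<ominus> a) = t \<oplus>\<^bsub>S\<^esub> \<delta>"
  proof -
    have "h (x \<ominus> a) = (\<pi> \<oplus>\<^bsub>S\<^esub> t) \<ominus>\<^bsub>S\<^esub> h a" using xc ac h_minus hx by simp
    also have "\<dots> = t \<oplus>\<^bsub>S\<^esub> \<delta>" unfolding \<delta>_def using \<pi>c tc hac by algebra
    finally show ?thesis .
  qed
  moreover have "t \<in> ext (?p' <+> m \<cdot> ?rr)" using tp' ext_mono[OF R.ideal_sub[OF sI] R.sum_ub1[OF p'I mrI]] by blast
  moreover have "\<delta> \<in> ext (?p' <+> m \<cdot> ?rr)" using \<delta> ext_mono[OF R.ideal_sub[OF sI] R.sum_ub2[OF p'I mrI]] by blast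
  ultimately have "h (x \<ominus> a) \<in> ext (?p' <+> m \<cdot> ?rr)" using S.ideal_add[OF sE] by simp
  then have "x \<ominus> a \<in> ?p' <+> m \<cdot> ?rr" using ext_contract[OF sI] xc ac by simp
  then obtain p2 d where pd: "p2 \<in> ?p'" "d \<in> m \<cdot> ?rr" "x \<ominus> a = p2 \<oplus> d" unfolding R.mem_sum by blast
  have pdc: "p2 \<in> carrier R" "d \<in> carrier R" using R.ideal_carr[OF p'I pd(1)] R.ideal_carr[OF mrI pd(2)] .
  \<comment> \<open>\<open>x rr^D\<close> absorbs \<open>rr^(D+1)\<close> modulo \<open>p\<close>,
    so that \<open>m rr^(D+1)\<close> counts as \<open>m\<close> times \<open>?M\<close>. Nakayama's
    lemma at \<open>(m, X)\<close> will be applied to the extension \<open>?N\<close>, modulo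
    \<open>q'\<close>.\<close>
  let ?M = "(PIdl x) \<cdot> R.ipow ?rr D"
  have xI: "ideal (PIdl x) R" by (rule R.cgenideal_ideal[OF xc])
  have MI: "ideal ?M R" by (rule R.prod_ideal[OF xI pr])
  let ?N = "R.upid ?M"
  have NI: "ideal ?N (UP R)" by (rule R.upid_ideal[OF MI])
  let ?W = "q' <+>\<^bsub>UP R\<^esub> ?q \<cdot>\<^bsub>UP R\<^esub> ?N"
  have qN: "ideal (?q \<cdot>\<^bsub>UP R\<^esub> ?N) (UP R)" by (rule R.UPr.prod_ideal[OF qI NI])
  have WI: "ideal ?W (UP R)" by (rule R.UPr.add_ideals[OF q'I qN])
  have W1: "q' \<subseteq> ?W" by (rule R.UPr.sum_ub1[OF q'I qN])
  have W2: "?q \<cdot>\<^bsub>UP R\<^esub> ?N \<subseteq> ?W" by (rule R.UPr.sum_ub2[OF q'I qN])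
  have cW: "ideal {z \<in> carrier R. R.Cn z \<in> ?W} R"
  proof (rule R.ideal_crit)
    show "\<zero> \<in> {z \<in> carrier R. R.Cn z \<in> ?W}" using R.UPr.ideal_zero[OF WI] by simp
    show "b \<oplus> c \<in> {z \<in> carrier R. R.Cn z \<in> ?W}" if "b \<in> {z \<in> carrier R. R.Cn z \<in> ?W}" "c \<in> {z \<in> carrier R. R.Cn z \<in> ?W}" for b c
      using that R.UPr.ideal_add[OF WI] by simp
    show "r \<otimes> b \<in> {z \<in> carrier R. R.Cn z \<in> ?W}" if "r \<in> carrier R" "b \<in> {z \<in> carrier R. R.Cn z \<in> ?W}" for r b
      using that R.UPr.ideal_lmult[OF WI, of "R.Cn b" "R.Cn r"] by simp
  qed auto
  have mW: "m \<cdot> R.ipow ?rr (Suc D) \<subseteq> {z \<in> carrier R. R.Cn z \<in> ?W}"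
  proof (rule R.prod_least[OF cW])
    fix i j assume i: "i \<in> m" and j: "j \<in> R.ipow ?rr (Suc D)"
    have "j \<in> ?M <+> p" using j D[of 0] by auto
    then obtain b b' where b: "b \<in> ?M" "b' \<in> p" "j = b \<oplus> b'" unfolding R.mem_sum by blast
    have ic: "i \<in> carrier R" by (rule R.ideal_carr[OF R.m_ideal i])
    have bc: "b \<in> carrier R" "b' \<in> carrier R" using R.ideal_carr[OF MI b(1)] R.ideal_carr[OF pI b(2)] .
    have "R.Cn i \<in> ?q" using i ic by (simp add: R.upX_def)
    moreover have "R.Cn b \<in> ?N" using R.C_in_upid[OF MI bc(1)] b(1) by blast
    ultimately have "R.Cn i \<otimes>\<^bsub>UP R\<^esub> R.Cn b \<in> ?q \<cdot>\<^bsub>UP R\<^esub> ?N" by (rule ideal_prod.prod)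
    then have 1: "R.Cn i \<otimes>\<^bsub>UP R\<^esub> R.Cn b \<in> ?W" using W2 by blast
    have "b' \<in> ?p'" using b(2) pp' by blast
    then have "R.Cn b' \<in> q'" by (simp add: R.upcon_def)
    then have "R.Cn b' \<in> ?W" using W1 by blast
    then have 2: "R.Cn i \<otimes>\<^bsub>UP R\<^esub> R.Cn b' \<in> ?W" by (rule R.UPr.ideal_lmult[OF WI _ R.UP_monom_closed[OF ic]])
    have "R.Cn (i \<otimes> j) = R.Cn i \<otimes>\<^bsub>UP R\<^esub> R.Cn b \<oplus>\<^bsub>UP R\<^esub> R.Cn i \<otimes>\<^bsub>UP R\<^esub> R.Cn b'"
      unfolding b(3) using ic bc by (simp add: R.r_distr)
    then show "i \<otimes> j \<in> {z \<in> carrier R. R.Cn z \<in> ?W}" using R.UPr.ideal_add[OF WI 1 2] ic bc b(3) by simp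
  qed
  have "?N \<subseteq> ?W"
  proof (rule R.upid_least[OF MI WI])
    fix z assume z: "z \<in> ?M"
    have zc: "z \<in> carrier R" by (rule R.ideal_carr[OF MI z])
    have "z \<in> R.ipow ?rr D \<cdot> (PIdl x)" using z R.ideal_prod_commute[OF xI pr] by blast
    then obtain v where v: "v \<in> R.ipow ?rr D" "z = v \<otimes> x" using R.prod_PIdl[OF pr xc] by blast
    have vc: "v \<in> carrier R" by (rule R.ideal_carr[OF pr v(1)])
    have Xc: "R.Xn \<in> carrier (UP R)" by simp
    have cc: "R.Cn a \<in> carrier (UP R)" "R.Cn x \<in> carrier (UP R)" "R.Cn v \<in> carrier (UP R)" "R.Cn p2 \<in> carrier (UP R)" "R.Cn d \<in> carrier (UP R)"
      using ac xc vc pdc by simp_all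
    \<comment> \<open>Of the three terms, \<open>a v\<close> equals \<open>X z\<close> modulo
      \<open>x X - a\<close>, \<open>p2 v\<close> has its constant in \<open>q'\<close>, and
      \<open>d v\<close> lies in \<open>m rr^(D+1)\<close>.\<close>
    have "z = a \<otimes> v \<oplus> p2 \<otimes> v \<oplus> d \<otimes> v"
    proof -
      have "z = (a \<oplus> (x \<ominus> a)) \<otimes> v" unfolding v(2) using vc xc ac by algebra
      also have "\<dots> = a \<otimes> v \<oplus> p2 \<otimes> v \<oplus> d \<otimes> v" unfolding pd(3) using vc ac pdc by algebra
      finally show ?thesis .
    qed
    then have "R.Cn z = R.Cn (a \<otimes> v) \<oplus>\<^bsub>UP R\<^esub> R.Cn (p2 \<otimes> v) \<oplus>\<^bsub>UP R\<^esub> R.Cn (d \<otimes> v)" using ac vc pdc by simp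
    moreover have "R.Cn (a \<otimes> v) \<in> ?W"
    proof -
      have "R.Cn (a \<otimes> v) = R.Cn a \<otimes>\<^bsub>UP R\<^esub> R.Cn v" using ac vc by simp
      also have "\<dots> = R.Xn \<otimes>\<^bsub>UP R\<^esub> (R.Cn v \<otimes>\<^bsub>UP R\<^esub> R.Cn x) \<ominus>\<^bsub>UP R\<^esub> R.lin a x \<otimes>\<^bsub>UP R\<^esub> R.Cn v"
        unfolding R.lin_def using cc Xc by algebra
      also have "\<dots> \<in> ?W"
      proof (rule R.UPr.ideal_minus[OF WI])
        have "R.Cn v \<otimes>\<^bsub>UP R\<^esub> R.Cn x = R.Cn z" unfolding v(2) using vc xc by simp
        also have "\<dots> \<in> ?N" using R.C_in_upid[OF MI zc] z by blast
        finally have "R.Cn v \<otimes>\<^bsub>UP R\<^esub> R.Cn x \<in> ?N" .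
        with R.X_in_upX[OF R.m_ideal] have "R.Xn \<otimes>\<^bsub>UP R\<^esub> (R.Cn v \<otimes>\<^bsub>UP R\<^esub> R.Cn x) \<in> ?q \<cdot>\<^bsub>UP R\<^esub> ?N" by (rule ideal_prod.prod)
        then show "R.Xn \<otimes>\<^bsub>UP R\<^esub> (R.Cn v \<otimes>\<^bsub>UP R\<^esub> R.Cn x) \<in> ?W" using W2 by blast
        have "R.lin a x \<in> ?W" using R.lin_in_slope[OF p axp] Kq' W1 by blast
        then show "R.lin a x \<otimes>\<^bsub>UP R\<^esub> R.Cn v \<in> ?W" by (rule R.UPr.ideal_rmult[OF WI _ cc(3)])
      qed
      finally show ?thesis .
    qed
    moreover have "R.Cn (p2 \<otimes> v) \<in> ?W"
    proof -
      have "p2 \<otimes> v \<in> ?p'" by (rule R.ideal_rmult[OF p'I pd(1) vc])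
      then have "R.Cn (p2 \<otimes> v) \<in> q'" by (simp add: R.upcon_def)
      then show ?thesis using W1 by blast
    qed
    moreover have "R.Cn (d \<otimes> v) \<in> ?W"
    proof -
      have "d \<otimes> v \<in> (m \<cdot> ?rr) \<cdot> R.ipow ?rr D" using pd(2) v(1) by (rule ideal_prod.prod)
      then have "d \<otimes> v \<in> m \<cdot> R.ipow ?rr (Suc D)" unfolding R.ipow_Suc2[OF rI] R.ideal_prod_assoc[OF R.m_ideal rI pr] .
      then show ?thesis using mW by blast
    qed
    ultimately show "R.Cn z \<in> ?W" using R.UPr.ideal_add[OF WI] by simp
  qed
  then have "?N \<subseteq> R.UPr.sat ?q ?W" using R.UPr.sat_ext[OF q WI] by blast
  then have Ns: "?N \<subseteq> R.UPr.sat ?q q'" by (rule R.UPn.nakayama_loc[OF q NI q'I])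
  have "x \<otimes> x [^] D \<in> ?M" using R.cgenideal_self[OF xc] R.pow_in_ipow[OF rI x_rr] by (rule ideal_prod.prod)
  moreover have xDc: "x \<otimes> x [^] D \<in> carrier R" using xc by simp
  ultimately have "R.Cn (x \<otimes> x [^] D) \<in> ?N" using R.C_in_upid[OF MI] by blast
  then have "R.Cn (x \<otimes> x [^] D) \<in> R.UPr.sat ?q q'" using Ns by blast
  then obtain s where s: "s \<in> carrier (UP R)" "s \<notin> ?q" "s \<otimes>\<^bsub>UP R\<^esub> R.Cn (x \<otimes> x [^] D) \<in> q'"
    unfolding R.UPr.sat_def by blast
  have "R.Cn (x \<otimes> x [^] D) \<in> carrier (UP R)" using xDc by simp
  then have "R.Cn (x \<otimes> x [^] D) \<in> q'" using R.UPr.prime_mult_iff[OF q'p s(1)] s(2,3) q'q by blast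
  then have "x \<otimes> x [^] D \<in> ?p'" using xDc by (simp add: R.upcon_def)
  then have "x \<in> ?p'" using R.prime_mult_iff[OF p' xc R.nat_pow_closed[OF xc]] R.prime_pow[OF p' xc] by blast
  then show False using xp' by blast
qed

end

lemma prime_between:
  assumes "catenary (UP R)" "S.min_over P (ext (contract P))" "primeideal p1 R" "contract P \<subset> p1" "p1 \<subset> m"
  obtains Q where "primeideal Q S" "P \<subset> Q" "Q \<subset> F 1"
  using catenary_contradiction[OF assms] by blast

end

section \<open>Operations on chains of primes\<close>

lemma prime_chain_less:
  assumes c: "prime_chain R c n" shows "i < j \<Longrightarrow> j \<le> n \<Longrightarrow> c i \<subset> c j"
proof (induct j)
  case (Suc j)
  have s: "c j \<subset> c (Suc j)" using c Suc(3) by (simp add: prime_chain_def)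
  show ?case
  proof (cases "i = j")
    case False
    then have "c i \<subset> c j" using Suc by simp
    then show ?thesis using s by (rule psubset_trans)
  qed (use s in simp)
qed simp

lemma prime_chain_insert:
  assumes c: "prime_chain R c n" and i: "i < n" and Q: "primeideal Q R" "c i \<subset> Q" "Q \<subset> c (Suc i)"
  shows "prime_chain R (\<lambda>j. if j \<le> i then c j else if j = Suc i then Q else c (j - 1)) (Suc n)"
    (is "prime_chain R ?c (Suc n)")
  unfolding prime_chain_def
proof (intro conjI allI impI)
  fix j assume "j \<le> Suc n"
  then show "primeideal (?c j) R" using c i Q by (auto simp: prime_chain_def)
next
  fix j assume j: "j < Suc n"
  consider "j < i" | "j = i" | "j = Suc i" | "j > Suc i" by linarith
  then show "?c j \<subset> ?c (Suc j)"
  proof cases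
    case 4
    then obtain j' where j': "j = Suc j'" by (cases j) auto
    have "c j' \<subset> c (Suc j')" using c j j' by (simp add: prime_chain_def)
    then show ?thesis using 4 j' by simp
  qed (use c i Q in \<open>auto simp: prime_chain_def\<close>)
qed

text \<open>A longest chain is saturated, since a prime in between could be inserted.\<close>

lemma saturated_chain_exists:
  assumes p: "primeideal p R" "primeideal q R" "p \<subseteq> q"
    and b: "\<And>P n. prime_chain R P n \<Longrightarrow> P 0 = p \<Longrightarrow> P n = q \<Longrightarrow> n \<le> (d::nat)"
  obtains c n where "saturated_prime_chain R c n" "c 0 = p" "c n = q"
proof -
  let ?A = "{n. \<exists>c. prime_chain R c n \<and> c 0 = p \<and> c n = q}"
  have fin: "finite ?A" using b by (auto intro!: finite_subset[OF _ finite_atMost[of d]])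
  have ne: "?A \<noteq> {}"
  proof (cases "p = q")
    case True
    then have "prime_chain R (\<lambda>_. p) 0" using p by (simp add: prime_chain_def)
    then have "0 \<in> ?A" using True by blast
    then show ?thesis by blast
  next
    case False
    let ?c = "\<lambda>i::nat. if i = 0 then p else q"
    have "prime_chain R ?c 1" using p False by (auto simp: prime_chain_def)
    moreover have "?c 0 = p" "?c 1 = q" by simp_all
    ultimately have "1 \<in> ?A" by blast
    then show ?thesis by blast
  qed
  have "Max ?A \<in> ?A" by (rule Max_in[OF fin ne])
  then obtain c where c: "prime_chain R c (Max ?A)" "c 0 = p" "c (Max ?A) = q" by blast
  have "False" if i: "i < Max ?A" and Q: "primeideal Q R" "c i \<subset> Q" "Q \<subset> c (Suc i)" for i Q
  proof -
    let ?c = "\<lambda>j. if j \<le> i then c j else if j = Suc i then Q else c (j - 1)"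
    have "prime_chain R ?c (Suc (Max ?A))" by (rule prime_chain_insert[OF c(1) i Q])
    moreover have "?c 0 = p" "?c (Suc (Max ?A)) = q" using c i by simp_all
    ultimately have "Suc (Max ?A) \<in> ?A" by blast
    then have "Suc (Max ?A) \<le> Max ?A" using fin by (rule Max_ge[rotated])
    then show False by simp
  qed
  then have "saturated_prime_chain R c (Max ?A)" using c(1) unfolding saturated_prime_chain_def by blast
  then show ?thesis using c that by blast
qed

text \<open>Prefixing \<open>p\<close> to a saturated chain from \<open>r\<close> to
  \<open>q\<close> keeps it saturated, because nothing lies between \<open>p\<close> and
  \<open>r\<close>. By catenarity the result is as long as any chain from \<open>p\<close> to
  \<open>q\<close>.\<close>

lemma catenary_height_one:
  assumes cat: "catenary R" and p: "primeideal p R" and q: "primeideal q R" and r: "primeideal r R"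
    and pr: "p \<subset> r" and rq: "r \<subseteq> q" and gap: "\<And>Q. primeideal Q R \<Longrightarrow> p \<subset> Q \<Longrightarrow> Q \<subset> r \<Longrightarrow> False"
    and c: "prime_chain R c l" "c 0 = p" "c l = q"
  obtains c' l' where "prime_chain R c' l'" "c' 0 = r" "c' l' = q" "l \<le> Suc l'"
proof -
  obtain e where e: "\<And>P n. prime_chain R P n \<Longrightarrow> P 0 = r \<Longrightarrow> P n = q \<Longrightarrow> n \<le> e"
    by (rule catenaryD[OF cat r q rq]) (rule that)
  obtain c' l' where c': "saturated_prime_chain R c' l'" "c' 0 = r" "c' l' = q"
    by (rule saturated_chain_exists[OF r q rq e]) 
  have pq: "p \<subseteq> q" using pr rq by blast
  obtain d where d: "\<And>P n. prime_chain R P n \<Longrightarrow> P 0 = p \<Longrightarrow> P n = q \<Longrightarrow> n \<le> d"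
    "\<And>P n. saturated_prime_chain R P n \<Longrightarrow> P 0 = p \<Longrightarrow> P n = q \<Longrightarrow> n = d"
    by (rule catenaryD[OF cat p q pq]) (rule that)
  have "saturated_prime_chain R (case_nat p c') (Suc l')"
    using c' p pr gap unfolding saturated_prime_chain_def prime_chain_def
    by (auto split: nat.splits)
  then have "Suc l' = d" by (rule d(2)) (use c' in simp_all)
  moreover have "l \<le> d" by (rule d(1)[OF c])
  ultimately show ?thesis using c' that unfolding saturated_prime_chain_def by blast
qed

context completion_pair_with_UP
begin

lemma contract_ext_bounds:
  assumes B: "primeideal B S" and BF: "B \<subset> F 1" shows "contract B \<subset> m"
proof -
  have "contract B \<noteq> m"
  proof
    assume e: "contract B = m"
    have "F 1 = ext m" using F_eq_ext[of 1] R.ipow_1[OF R.m_ideal] by simp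
    also have "\<dots> \<subseteq> B" using ext_sub_iff[OF R.ideal_sub[OF R.m_ideal] S.primeideal_ideal[OF B]] e by blast
    finally show False using BF by blast
  qed
  then show ?thesis using R.prime_sub_m[OF contract_prime[OF B]] by blast
qed

text \<open>Ratliff's theorem as an induction on \<open>n\<close>. A general \<open>x\<close> in
  \<open>m\<close> gives a prime \<open>P'\<close> minimal over \<open>P + (h x)\<close> whose
  contraction is minimal over \<open>contract P + (x)\<close>. This contraction has height one over
  \<open>contract P\<close>, so catenarity leaves a chain of length at least \<open>l - 1\<close>
  above it, and \<open>P'\<close> is again minimal over the extension of its contraction.\<close>

lemma coheight_of_chain:
  assumes cat: "catenary R" and catX: "catenary (UP R)"
  shows "S.min_over P (ext (contract P)) \<Longrightarrow> prime_chain R c l \<Longrightarrow> c 0 = contract P \<Longrightarrow> c l = m \<Longrightarrow> n \<le> l \<Longrightarrow> S.coht P n"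
proof (induct n arbitrary: P c l)
  case 0
  then have "primeideal P S" by (simp add: S.min_over_def)
  then have "prime_chain S (\<lambda>_. P) 0" by (simp add: prime_chain_def)
  then show ?case unfolding S.coht_def by blast
next
  case (Suc n)
  note Pmin = Suc(2) and c = Suc(3,4,5) and nl = Suc(6)
  have P: "primeideal P S" using Pmin by (simp add: S.min_over_def)
  let ?p = "contract P"
  have p: "primeideal ?p R" by (rule contract_prime[OF P])
  note PI = S.primeideal_ideal[OF P] and pI = R.primeideal_ideal[OF p]
  note pE = ext_ideal[OF R.ideal_sub[OF pI]]
  have Fp: "primeideal (F 1) S" by (rule S.m_prime)
  note FI = S.primeideal_ideal[OF Fp]
  have pm: "?p \<subset> m" using prime_chain_less[OF c(1), of 0 l] c(2,3) nl by simp
  have PF: "P \<subset> F 1" using S.prime_sub_m[OF P] contract_F1 pm by blast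
  show ?case
  proof (cases n)
    case 0
    have "prime_chain S (\<lambda>_. F 1) 0" using Fp by (simp add: prime_chain_def)
    then have "S.coht (F 1) 0" unfolding S.coht_def by blast
    then show ?thesis using S.coht_less[OF P PF] 0 by simp
  next
    case (Suc n')
    have p1: "primeideal (c 1) R" "?p \<subset> c 1" "c 1 \<subset> m"
      using prime_chain_less[OF c(1), of 0 1] prime_chain_less[OF c(1), of 1 l] c nl Suc by (auto simp: prime_chain_def)
    \<comment> \<open>This prime lets the principal ideal theorem exclude \<open>P' = F 1\<close>.
      With \<open>t = 1\<close> only the strict inclusions are wanted from
      \<open>finite_bad_primes\<close>.\<close>
    obtain Q where Q: "primeideal Q S" "P \<subset> Q" "Q \<subset> F 1"
      by (rule prime_between[OF catX Pmin p1]) (rule that)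
    have one: "\<one>\<^bsub>S\<^esub> \<in> carrier S" "\<one>\<^bsub>S\<^esub> \<notin> P" using S.prime_one[OF P] by simp_all
    obtain BB where BB: "finite BB" "\<And>B. B \<in> BB \<Longrightarrow> primeideal B S \<and> B \<subset> F 1"
      "\<And>w q'. w \<in> F 1 \<Longrightarrow> (\<And>B. B \<in> BB \<Longrightarrow> w \<notin> B) \<Longrightarrow> q' \<subseteq> F 1 \<Longrightarrow> S.min_over q' (P <+>\<^bsub>S\<^esub> PIdl\<^bsub>S\<^esub> w) \<Longrightarrow>
        \<one>\<^bsub>S\<^esub> \<notin> q' \<and> q' \<subset> F 1 \<and> P \<subset> q'"
    proof (rule S.finite_bad_primes[OF P Q(1) Fp Q(2,3) one])
      fix BB assume 1: "finite BB" and 2: "\<And>B. B \<in> BB \<Longrightarrow> primeideal B S \<and> B \<subset> F 1"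
        and 3: "\<And>w q'. w \<in> F 1 \<Longrightarrow> (\<And>B. B \<in> BB \<Longrightarrow> w \<notin> B) \<Longrightarrow> q' \<subseteq> F 1 \<Longrightarrow> S.min_over q' (P <+>\<^bsub>S\<^esub> PIdl\<^bsub>S\<^esub> w) \<Longrightarrow>
          \<one>\<^bsub>S\<^esub> \<notin> q' \<and> q' \<subset> F 1 \<and> P \<subset> q'"
      show thesis by (rule that[OF 1 2 3])
    qed
    obtain F0 where F0: "finite F0" "\<And>J. J \<in> F0 \<Longrightarrow> primeideal J S \<and> ext ?p \<subseteq> J"
      "\<And>Q. primeideal Q S \<Longrightarrow> ext ?p \<subseteq> Q \<Longrightarrow> \<exists>J\<in>F0. J \<subseteq> Q"
      by (rule S.primes_above_finite[OF pE]) (rule that)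
    \<comment> \<open>Members \<open>J\<close> of \<open>F0\<close> not inside \<open>P\<close>
      might also lie in \<open>P'\<close> and spoil its minimality over the extension of
      \<open>?p + (x)\<close>. The finitely many primes chosen over \<open>P + J\<close> are
      therefore to be avoided by \<open>x\<close>.\<close>
    have "\<exists>XX. finite XX \<and> (\<forall>B\<in>XX. primeideal B S \<and> P <+>\<^bsub>S\<^esub> J \<subseteq> B) \<and> (\<forall>Q. primeideal Q S \<and> P <+>\<^bsub>S\<^esub> J \<subseteq> Q \<longrightarrow> (\<exists>B\<in>XX. B \<subseteq> Q))"
      if J: "J \<in> F0" for J
    proof -
      have "ideal (P <+>\<^bsub>S\<^esub> J) S" using F0(2)[OF J] S.primeideal_ideal S.add_ideals[OF PI] by blast
      then obtain XX where "finite XX" "\<And>B. B \<in> XX \<Longrightarrow> primeideal B S \<and> P <+>\<^bsub>S\<^esub> J \<subseteq> B"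
        "\<And>Q. primeideal Q S \<Longrightarrow> P <+>\<^bsub>S\<^esub> J \<subseteq> Q \<Longrightarrow> \<exists>B\<in>XX. B \<subseteq> Q"
        by (rule S.primes_above_finite) (rule that)
      then show ?thesis by (intro exI[of _ XX]) auto
    qed
    then have "\<forall>J\<in>F0. \<exists>XX. finite XX \<and> (\<forall>B\<in>XX. primeideal B S \<and> P <+>\<^bsub>S\<^esub> J \<subseteq> B) \<and> (\<forall>Q. primeideal Q S \<and> P <+>\<^bsub>S\<^esub> J \<subseteq> Q \<longrightarrow> (\<exists>B\<in>XX. B \<subseteq> Q))"
      by (rule ballI)
    then obtain XX where XX: "\<forall>J\<in>F0. finite (XX J) \<and> (\<forall>B\<in>XX J. primeideal B S \<and> P <+>\<^bsub>S\<^esub> J \<subseteq> B) \<and> (\<forall>Q. primeideal Q S \<and> P <+>\<^bsub>S\<^esub> J \<subseteq> Q \<longrightarrow> (\<exists>B\<in>XX J. B \<subseteq> Q))"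
      by (rule bchoice[THEN exE])
    \<comment> \<open>The maximal ideal cannot be avoided and is left out; \<open>P'\<close> lies
      strictly below it.\<close>
    define BX where "BX = (\<Union>J\<in>F0. XX J) - {F 1}"
    have BX: "finite BX" unfolding BX_def using F0(1) XX by blast
    have BXp: "primeideal B S \<and> B \<subset> F 1" if "B \<in> BX" for B
    proof -
      have "primeideal B S" "B \<noteq> F 1" using that XX unfolding BX_def by blast+
      then show ?thesis using S.prime_sub_m[of B] by blast
    qed
    let ?FF = "insert ?p (contract ` (BB \<union> BX))"
    have "\<exists>x\<in>m. \<forall>J\<in>?FF. x \<notin> J"
    proof (rule R.prime_avoidance[OF _ _ R.m_ideal])
      show "finite ?FF" using BB(1) BX by simp
      fix J assume J: "J \<in> ?FF"
      then consider "J = ?p" | B where "J = contract B" "B \<in> BB \<union> BX" by blast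
      then have "primeideal J R \<and> J \<subset> m"
      proof cases
        case 1 then show ?thesis using p pm by simp
      next
        case 2
        then have "primeideal B S \<and> B \<subset> F 1" using BB(2) BXp by blast
        then show ?thesis using contract_prime[of B] contract_ext_bounds[of B] 2(1) by simp
      qed
      then show "primeideal J R" "\<not> m \<subseteq> J" by blast+
    qed
    then obtain x where x: "x \<in> m" "x \<notin> ?p" "\<And>B. B \<in> BB \<union> BX \<Longrightarrow> x \<notin> contract B" by blast
    have xc: "x \<in> carrier R" by (rule R.ideal_carr[OF R.m_ideal x(1)])
    have hxc: "h x \<in> carrier S" by (rule h_closed[OF xc])
    have hxF: "h x \<in> F 1" using x(1) contract_F1 unfolding contract_def by blast
    have hxB: "h x \<notin> B" if "B \<in> BB \<union> BX" for B using x(3)[OF that] xc unfolding contract_def by blast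
    have hxP: "h x \<notin> P" using x(2) xc unfolding contract_def by blast
    have PxI: "ideal (P <+>\<^bsub>S\<^esub> PIdl\<^bsub>S\<^esub> (h x)) S" by (rule S.PIdl_sum_ideal[OF PI hxc])
    have PxF: "P <+>\<^bsub>S\<^esub> PIdl\<^bsub>S\<^esub> (h x) \<subseteq> F 1" by (rule S.PIdl_sum_least[OF FI _ hxF]) (use PF in blast)
    obtain P' where P': "P' \<subseteq> F 1" "S.min_over P' (P <+>\<^bsub>S\<^esub> PIdl\<^bsub>S\<^esub> (h x))"
      by (rule S.exists_min_over[OF Fp PxI PxF]) (rule that)
    have P'F: "P' \<subset> F 1" and PP': "P \<subset> P'" using BB(3)[OF hxF _ P'] hxB by blast+
    have P'p: "primeideal P' S" using P'(2) by (simp add: S.min_over_def)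
    note P'I = S.primeideal_ideal[OF P'p]
    have hxP': "h x \<in> P'" using P'(2) S.PIdl_sum_mem[OF PI hxc] unfolding S.min_over_def by blast
    \<comment> \<open>\<open>Q'\<close> contains some \<open>J\<close> from \<open>F0\<close>. If
      \<open>J\<close> lies in \<open>P\<close>, they are equal, and the choice of \<open>P'\<close>
      applies. Otherwise \<open>P'\<close> contains some \<open>B\<close> from \<open>XX J\<close>
      strictly above \<open>P\<close>; the principal ideal theorem gives \<open>B = P'\<close>,
      against the choice of \<open>x\<close>.\<close>
    have min': "Q' = P'" if Q': "primeideal Q' S" "Q' \<subseteq> P'" "ext ?p \<subseteq> Q'" "h x \<in> Q'" for Q'
    proof -
      obtain J where J: "J \<in> F0" "J \<subseteq> Q'" using F0(3)[OF Q'(1,3)] by blast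
      have Jp: "primeideal J S" "ext ?p \<subseteq> J" using F0(2)[OF J(1)] by blast+
      show ?thesis
      proof (cases "J \<subseteq> P")
        case True
        then have "J = P" using Pmin Jp unfolding S.min_over_def by blast
        then have "P <+>\<^bsub>S\<^esub> PIdl\<^bsub>S\<^esub> (h x) \<subseteq> Q'" using J(2) by (intro S.PIdl_sum_least[OF S.primeideal_ideal[OF Q'(1)] _ Q'(4)]) simp
        then show ?thesis using P'(2) Q'(1,2) unfolding S.min_over_def by blast
      next
        case False
        have "P <+>\<^bsub>S\<^esub> J \<subseteq> P'" using PP' J(2) Q'(2) by (intro S.sum_least[OF P'I]) auto
        then obtain B where B: "B \<in> XX J" "B \<subseteq> P'" using XX J(1) P'p by blast
        then have Bp: "primeideal B S" "P <+>\<^bsub>S\<^esub> J \<subseteq> B" using XX J(1) by blast+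
        have "P \<subseteq> B" using Bp(2) S.sum_ub1[OF PI S.primeideal_ideal[OF Jp(1)]] by blast
        moreover have "J \<subseteq> B" using Bp(2) S.sum_ub2[OF PI S.primeideal_ideal[OF Jp(1)]] by blast
        ultimately have PB: "P \<subset> B" using False by blast
        have "\<not> B \<subset> P'" using S.krull_height_one[OF P Bp(1) PB _ hxc P'(2)] by (rule notI)
        then have "B = P'" using B(2) by blast
        then have "B \<in> BX" unfolding BX_def using B(1) J(1) P'F by blast
        then show ?thesis using hxB[of B] hxP' \<open>B = P'\<close> by simp
      qed
    qed
    let ?p' = "contract P'"
    have p': "primeideal ?p' R" by (rule contract_prime[OF P'p])
    note p'I = R.primeideal_ideal[OF p']
    let ?I = "?p <+> PIdl x"
    have II: "ideal ?I R" by (rule R.PIdl_sum_ideal[OF pI xc])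
    have xp': "x \<in> ?p'" using hxP' xc by (simp add: contract_def)
    have pp': "?p \<subseteq> ?p'" using PP' unfolding contract_def by blast
    have Ip': "?I \<subseteq> ?p'" by (rule R.PIdl_sum_least[OF p'I pp' xp'])
    \<comment> \<open>Needed for two ideals: \<open>?I\<close>, to go down to \<open>R\<close>, and
      \<open>?p'\<close>, for the induction hypothesis.\<close>
    have min2: "S.min_over P' (ext A)" if A: "A \<subseteq> carrier R" "?I \<subseteq> A" "A \<subseteq> ?p'" for A
      unfolding S.min_over_def
    proof (intro conjI allI impI P'p)
      show "ext A \<subseteq> P'" using ext_sub_iff[OF A(1) P'I] A(3) by blast
      fix Q' assume Q': "primeideal Q' S \<and> ext A \<subseteq> Q' \<and> Q' \<subseteq> P'"
      have "?I \<subseteq> contract Q'" using ext_sub_iff[OF A(1), of Q'] Q' S.primeideal_ideal A(2) by blast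
      then have "?p \<subseteq> contract Q'" "x \<in> contract Q'" using R.PIdl_sum_sub[OF pI xc] R.PIdl_sum_mem[OF pI xc] by blast+
      then have "ext ?p \<subseteq> Q'" "h x \<in> Q'" using ext_sub_iff[OF R.ideal_sub[OF pI], of Q'] Q' S.primeideal_ideal by (auto simp: contract_def)
      then show "Q' = P'" using min' Q' by blast
    qed
    have "R.min_over ?p' ?I" by (rule going_down[OF II min2[OF R.ideal_sub[OF II] subset_refl Ip']])
    then have gap: "False" if "primeideal Q R" "?p \<subset> Q" "Q \<subset> ?p'" for Q
      using R.krull_height_one[OF p that xc] by blast
    have p'm: "?p' \<subset> m" by (rule contract_ext_bounds[OF P'p P'F])
    have pp's: "?p \<subset> ?p'" using pp' xp' x(2) by blast
    obtain c' l' where c': "prime_chain R c' l'" "c' 0 = ?p'" "c' l' = m" "l \<le> Suc l'"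
      by (rule catenary_height_one[OF cat p R.m_prime p' pp's _ gap c]) (use p'm in blast)+
    have "S.coht P' n"
      by (rule Suc.hyps[OF min2[OF R.ideal_sub[OF p'I] Ip' subset_refl] c'(1-3)]) (use c'(4) nl in simp)
    then show ?thesis by (rule S.coht_less[OF P PP'])
  qed
qed

end

section \<open>Transporting catenarity\<close>

definition preimage :: "('a, 'b) ring_scheme \<Rightarrow> ('a \<Rightarrow> 'c) \<Rightarrow> 'c set \<Rightarrow> 'a set" where
  "preimage A k P = {r \<in> carrier A. k r \<in> P}"

lemma preimage_prime:
  assumes "cring A" "ring B" "k \<in> ring_hom A B" "primeideal P B" shows "primeideal (preimage A k P) A"
proof -
  have "ring_hom_ring A B k"
    using assms(1-3) by (intro ring_hom_ring.intro ring_hom_ring_axioms.intro) (auto simp: cring_def)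
  from ring_hom_ring.primeideal_vimage[OF this assms(1,4)] show ?thesis by (simp add: preimage_def)
qed

lemma preimage_psubset:
  assumes "k ` carrier A = carrier B" "U \<subset> Y" "Y \<subseteq> carrier B" shows "preimage A k U \<subset> preimage A k Y"
proof -
  obtain y where y: "y \<in> Y" "y \<notin> U" using assms(2) by blast
  then have "y \<in> k ` carrier A" using assms(1,3) by blast
  then obtain x where "x \<in> carrier A" "k x = y" by blast
  then have "x \<in> preimage A k Y" "x \<notin> preimage A k U" using y by (auto simp: preimage_def)
  moreover have "preimage A k U \<subseteq> preimage A k Y" using assms(2) by (auto simp: preimage_def)
  ultimately show ?thesis by blast
qed

lemma primeideal_carrier: "primeideal P B \<Longrightarrow> P \<subseteq> carrier B"
  by (intro additive_subgroup.a_subset ideal.axioms(1) primeideal.axioms(1))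

lemma preimage_chain:
  assumes A: "cring A" "ring B" "k \<in> ring_hom A B" "k ` carrier A = carrier B" and c: "prime_chain B c n"
  shows "prime_chain A (\<lambda>i. preimage A k (c i)) n"
  unfolding prime_chain_def
proof (intro conjI allI impI)
  fix i assume "i \<le> n"
  then show "primeideal (preimage A k (c i)) A" using preimage_prime[OF A(1-3)] c by (simp add: prime_chain_def)
next
  fix i assume i: "i < n"
  then have "primeideal (c (Suc i)) B" "c i \<subset> c (Suc i)" using c by (simp_all add: prime_chain_def)
  then show "preimage A k (c i) \<subset> preimage A k (c (Suc i))"
    by (intro preimage_psubset[OF A(4)] primeideal_carrier)
qed

lemma catenary_ring_iso:
  assumes A: "cring A" and B: "cring B" and h: "h \<in> ring_iso B A" and cat: "catenary A"
  shows "catenary B"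
proof -
  have bij: "bij_betw h (carrier B) (carrier A)" by (rule ring_iso_memE(5)[OF h])
  define k where "k = inv_into (carrier B) h"
  have kiso: "k \<in> ring_iso A B" unfolding k_def using h ring_iso_set_sym[of B h A] B by (simp add: cring_def)
  have kh: "k \<in> ring_hom A B" and hh: "h \<in> ring_hom B A" using kiso h by (simp_all add: ring_iso_def)
  have ksurj: "k ` carrier A = carrier B" and hsurj: "h ` carrier B = carrier A"
    using ring_iso_memE(5)[OF kiso] bij by (simp_all add: bij_betw_def)
  have hk: "k (h b) = b" if "b \<in> carrier B" for b
    unfolding k_def by (rule inv_into_f_f) (use bij that in \<open>auto simp: bij_betw_def\<close>)
  have rA: "ring A" and rB: "ring B" using A B by (simp_all add: cring_def)
  have pre_pre: "preimage B h (preimage A k U) = U" if U: "U \<subseteq> carrier B" for U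
    using U hk ring_iso_memE(1)[OF h] by (auto simp: preimage_def)
  show ?thesis unfolding catenary_def
  proof (intro allI impI)
    fix p q assume pq: "primeideal p B \<and> primeideal q B \<and> p \<subseteq> q"
    have P: "primeideal (preimage A k p) A" "primeideal (preimage A k q) A" using preimage_prime[OF A rB kh] pq by blast+
    have s: "preimage A k p \<subseteq> preimage A k q" using pq by (auto simp: preimage_def)
    obtain d where d: "\<And>P n. prime_chain A P n \<Longrightarrow> P 0 = preimage A k p \<Longrightarrow> P n = preimage A k q \<Longrightarrow> n \<le> d"
      "\<And>P n. saturated_prime_chain A P n \<Longrightarrow> P 0 = preimage A k p \<Longrightarrow> P n = preimage A k q \<Longrightarrow> n = d"
      by (rule catenaryD[OF cat P s]) (rule that)
    have "n \<le> d" if "prime_chain B c n" "c 0 = p" "c n = q" for c n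
      by (rule d(1)[OF preimage_chain[OF A rB kh ksurj that(1)]]) (use that in simp_all)
    moreover have "n = d" if c: "saturated_prime_chain B c n" "c 0 = p" "c n = q" for c n
    proof (rule d(2))
      have cc: "prime_chain B c n" using c(1) by (simp add: saturated_prime_chain_def)
      have no: "False" if i: "i < n" and Q: "primeideal Q A" "preimage A k (c i) \<subset> Q" "Q \<subset> preimage A k (c (Suc i))" for i Q
      proof -
        have ci: "primeideal (c i) B" "primeideal (c (Suc i)) B" using cc i by (simp_all add: prime_chain_def)
        have "primeideal (preimage B h Q) B" by (rule preimage_prime[OF B rA hh Q(1)])
        moreover have "c i \<subset> preimage B h Q"
          using preimage_psubset[OF hsurj Q(2) primeideal_carrier[OF Q(1)]] pre_pre[OF primeideal_carrier[OF ci(1)]] by simp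
        moreover have "preimage B h Q \<subset> c (Suc i)"
          using preimage_psubset[OF hsurj Q(3)] pre_pre[OF primeideal_carrier[OF ci(2)]] by (auto simp: preimage_def)
        ultimately show False using c(1) i unfolding saturated_prime_chain_def by blast
      qed
      show "saturated_prime_chain A (\<lambda>i. preimage A k (c i)) n"
        unfolding saturated_prime_chain_def using preimage_chain[OF A rB kh ksurj cc] no by blast
    qed (use c in simp_all)
    ultimately show "\<exists>d. (\<forall>P n. prime_chain B P n \<and> P 0 = p \<and> P n = q \<longrightarrow> n \<le> d) \<and>
        (\<forall>P n. saturated_prime_chain B P n \<and> P 0 = p \<and> P n = q \<longrightarrow> n = d)" by blast
  qed
qed

text \<open>\<open>universally_catenary\<close> speaks about algebras over one fixed element type.
  An algebra over another type is copied there along an injection; the copy is again of finite type,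
  and catenarity returns along the isomorphism.\<close>

lemma catenary_of_injection:
  fixes R :: "('a, 'b) ring_scheme" and B :: "('c, 'd) ring_scheme" and \<phi> :: "'c \<Rightarrow> (nat multiset \<Rightarrow> 'a) set"
  assumes uc: "universally_catenary R" and ft: "finite_type_algebra R B h" and inj: "inj_on \<phi> (carrier B)"
  shows "catenary B"
proof -
  let ?A = "image_ring \<phi> B"
  have B: "cring B" and h: "h \<in> ring_hom R B" using ft by (simp_all add: finite_type_algebra_def)
  have iso: "\<phi> \<in> ring_iso B ?A" by (rule inj_imp_image_ring_iso[OF inj])
  have rB: "ring B" and R: "ring R" using B uc by (simp_all add: cring_def universally_catenary_def)
  have "cring (?A\<lparr>zero := \<phi> \<zero>\<^bsub>B\<^esub>\<rparr>)" by (rule cring.ring_iso_imp_img_cring[OF B iso])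
  moreover have "?A\<lparr>zero := \<phi> \<zero>\<^bsub>B\<^esub>\<rparr> = ?A" by (simp add: image_ring_def image_group_def monoid.defs)
  ultimately have A: "cring ?A" by simp
  have rA: "ring ?A" using A by (simp add: cring_def)
  have \<phi>: "\<phi> \<in> ring_hom B ?A" using iso by (simp add: ring_iso_def)
  have hom: "\<phi> \<circ> h \<in> ring_hom R ?A" by (rule ring_hom_trans[OF h \<phi>])
  interpret \<phi>: ring_hom_ring B ?A \<phi> by (intro ring_hom_ring.intro rB rA ring_hom_ring_axioms.intro \<phi>)
  obtain G where G: "G \<subseteq> carrier B" "finite G" "generate_ring B (h ` carrier R \<union> G) = carrier B"
    using ft by (auto simp: finite_type_algebra_def)
  have HB: "h ` carrier R \<union> G \<subseteq> carrier B" using G(1) h by (auto simp: ring_hom_def)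
  have GA: "\<phi> ` G \<subseteq> carrier ?A" using G(1) by (auto simp: image_ring_carrier)
  have HA: "(\<phi> \<circ> h) ` carrier R \<union> \<phi> ` G \<subseteq> carrier ?A" using HB by (auto simp: image_ring_carrier)
  have gen: "\<phi> b \<in> generate_ring ?A ((\<phi> \<circ> h) ` carrier R \<union> \<phi> ` G)" if "b \<in> generate_ring B (h ` carrier R \<union> G)" for b
    using that
  proof (induct rule: generate_ring.induct)
    case one then show ?case using generate_ring.one[of ?A] by simp
  next
    case (incl x) then show ?case by (intro generate_ring.incl) auto
  next
    case (a_inv x)
    then show ?case using generate_ring.a_inv[OF a_inv(2)] ring.generate_ring_in_carrier[OF rB HB a_inv(1)] by simp
  next
    case (eng_add x y)
    then show ?case using generate_ring.eng_add[OF eng_add(2,4)] ring.generate_ring_in_carrier[OF rB HB] by simp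
  next
    case (eng_mult x y)
    then show ?case using generate_ring.eng_mult[OF eng_mult(2,4)] ring.generate_ring_in_carrier[OF rB HB] by simp
  qed
  have "generate_ring ?A ((\<phi> \<circ> h) ` carrier R \<union> \<phi> ` G) = carrier ?A"
  proof
    show "generate_ring ?A ((\<phi> \<circ> h) ` carrier R \<union> \<phi> ` G) \<subseteq> carrier ?A" by (rule ring.generate_ring_incl[OF rA HA])
    show "carrier ?A \<subseteq> generate_ring ?A ((\<phi> \<circ> h) ` carrier R \<union> \<phi> ` G)"
      using gen G(3) by (auto simp: image_ring_carrier)
  qed
  then have "finite_type_algebra R ?A (\<phi> \<circ> h)"
    unfolding finite_type_algebra_def using A hom GA G(2) by (intro conjI exI[of _ "\<phi> ` G"]) simp_all
  then have "catenary ?A" using uc[unfolded universally_catenary_def] by blast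
  then show ?thesis by (rule catenary_ring_iso[OF A B iso])
qed

context cring
begin

lemma universally_catenary_self:
  assumes "universally_catenary R" shows "catenary R"
proof (rule catenary_of_injection[OF assms])
  have "generate_ring R (id ` carrier R \<union> {}) = carrier R"
    using generate_ring_incl[of "carrier R"] generate_ring.incl[of _ "carrier R" R] by auto
  then show "finite_type_algebra R R id"
    unfolding finite_type_algebra_def using is_cring by (intro conjI exI[of _ "{}"]) (auto simp: ring_hom_def)
  show "inj_on (\<lambda>r. {\<lambda>_. r}) (carrier R)" by (auto simp: inj_on_def dest: fun_cong)
qed

end

context cring_with_UP
begin

lemma universally_catenary_UP:
  assumes "universally_catenary R" shows "catenary UPR"
proof (rule catenary_of_injection[OF assms])
  let ?H = "(\<lambda>a. Cn a) ` carrier R \<union> {Xn}"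
  have H: "?H \<subseteq> carrier UPR" by auto
  have "generate_ring UPR ?H = carrier UPR"
  proof
    show "generate_ring UPR ?H \<subseteq> carrier UPR" by (rule UPr.generate_ring_incl[OF H])
    show "carrier UPR \<subseteq> generate_ring UPR ?H"
    proof
      fix f assume "f \<in> carrier UPR"
      then show "f \<in> generate_ring UPR ?H"
      proof (induct rule: UP_induct)
        case (const c) then show ?case by (intro generate_ring.incl) auto
      next
        case (step c f) 
        then have "Cn c \<in> generate_ring UPR ?H" "Xn \<in> generate_ring UPR ?H" by (auto intro!: generate_ring.incl)
        then show ?case using step(3) by (intro generate_ring.eng_add generate_ring.eng_mult)
      qed
    qed
  qed
  then show "finite_type_algebra R UPR (\<lambda>a. Cn a)"
    unfolding finite_type_algebra_def using UPr.is_cring ring_hom_cring.homh[OF Cn_hom]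
    by (intro conjI exI[of _ "{Xn}"]) auto
  \<comment> \<open>The function sees only the size of a multiset; every natural number is such a
    size, so all coefficients can be recovered.\<close>
  show "inj_on (\<lambda>f. {\<lambda>M :: nat multiset. f (size M)}) (carrier UPR)"
  proof (rule inj_onI)
    fix f g assume "{\<lambda>M :: nat multiset. f (size M)} = {\<lambda>M. g (size M)}"
    then have e: "f (size M) = g (size M)" for M :: "nat multiset" by (auto dest: fun_cong)
    show "f = g"
    proof
      show "f n = g n" for n using e[of "replicate_mset n 0"] by simp
    qed
  qed
qed

end

context noeth_local
begin

text \<open>The preimage of a chain in \<open>R/p\<close> starts above \<open>p\<close> and ends
  inside \<open>m\<close>. Its two ends are distinct because \<open>k > 0\<close>, and replacing
  them by \<open>p\<close> and \<open>m\<close> keeps the inclusions strict.\<close>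

lemma chain_of_quotient_dim:
  assumes p: "primeideal p R" and k: "0 < k" "enat k \<le> krull_dim (R Quot p)"
  obtains c l where "prime_chain R c l" "c 0 = p" "c l = m" "k \<le> l"
proof -
  note pI = primeideal_ideal[OF p]
  have "\<exists>n\<ge>k. \<exists>P. prime_chain (R Quot p) P n"
  proof (rule ccontr)
    assume n: "\<not> ?thesis"
    have "krull_dim (R Quot p) \<le> enat (k - 1)"
      unfolding krull_dim_def
    proof (rule Sup_least)
      fix x assume "x \<in> {enat n |n. \<exists>P. prime_chain (R Quot p) P n}"
      then obtain l where l: "x = enat l" "\<exists>P. prime_chain (R Quot p) P l" by blast
      then have "\<not> k \<le> l" using n by blast
      then show "x \<le> enat (k - 1)" using l(1) by simp
    qed
    then have "enat k \<le> enat (k - 1)" using k(2) by (rule order_trans[rotated])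
    then show False using k(1) by simp
  qed
  then obtain l P where l: "k \<le> l" "prime_chain (R Quot p) P l" by blast
  have hom: "(+>) p \<in> ring_hom R (R Quot p)" by (rule ideal.rcos_ring_hom[OF pI])
  have surj: "(+>) p ` carrier R = carrier (R Quot p)" by (auto simp: FactRing_def A_RCOSETS_def')
  note Qr = ideal.quotient_is_ring[OF pI]
  define c where "c i = preimage R ((+>) p) (P i)" for i
  have c: "prime_chain R c l" unfolding c_def by (rule preimage_chain[OF is_cring Qr hom surj l(2)])
  have pc: "p \<subseteq> c 0"
  proof
    fix r assume r: "r \<in> p"
    have rc: "r \<in> carrier R" by (rule ideal_carr[OF pI r])
    have "p +> r = p" by (rule abelian_subgroup.a_rcos_const[OF abelian_subgroupI3[OF ideal.axioms(1)[OF pI] abelian_group_axioms] r])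
    also have "p = \<zero>\<^bsub>R Quot p\<^esub>" by (simp add: FactRing_def)
    also have "\<dots> \<in> P 0"
    proof -
      have "primeideal (P 0) (R Quot p)" using l(2) by (simp add: prime_chain_def)
      then have "additive_subgroup (P 0) (R Quot p)" by (intro ideal.axioms(1) primeideal.axioms(1))
      then show ?thesis by (rule additive_subgroup.zero_closed)
    qed
    finally show "r \<in> c 0" using rc by (simp add: c_def preimage_def)
  qed
  have cm: "c l \<subseteq> m" using c prime_sub_m by (simp add: prime_chain_def)
  have l0: "0 < l" using k l by simp
  let ?c = "\<lambda>i. if i = 0 then p else if i = l then m else c i"
  have "prime_chain R ?c l"
    unfolding prime_chain_def
  proof (intro conjI allI impI)
    fix i assume "i \<le> l" then show "primeideal (?c i) R" using c p m_prime by (simp add: prime_chain_def)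
  next
    fix i assume i: "i < l"
    have "?c i \<subseteq> c i" using pc i by simp
    also have "c i \<subset> c (Suc i)" using c i by (simp add: prime_chain_def)
    also have "c (Suc i) \<subseteq> ?c (Suc i)" using cm by simp
    finally show "?c i \<subset> ?c (Suc i)" .
  qed
  then show ?thesis using l l0 by (intro that[of ?c l]) simp_all
qed

end

section \<open>Dedekind--Mertens numbers\<close>

text \<open>The infimum of the empty set is infinite, and a nonempty set of extended naturals has a
  least element.\<close>

lemma enat_Inf_attained:
  assumes "Inf {enat k | k. P k} = enat k" shows "P k"
proof -
  have "{enat k | k. P k} \<noteq> {}" (is "?A \<noteq> {}")
  proof
    assume e: "?A = {}"
    show False using assms unfolding e by (simp add: Inf_enat_def)
  qed
  then have "\<exists>x. x \<in> ?A" by blast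
  then have "(LEAST x. x \<in> ?A) \<in> ?A" by (rule LeastI_ex)
  then have "Inf ?A \<in> ?A" using \<open>?A \<noteq> {}\<close> by (simp only: Inf_enat_def if_False)
  then show ?thesis unfolding assms by auto
qed

context completion_pair_with_UP
begin

text \<open>By going-down a minimal prime of \<open>S\<close> contracts to a minimal prime of
  \<open>R\<close>, where the dimension hypothesis supplies a chain up to \<open>m\<close>.
  Minimality of \<open>P\<close> also makes it minimal over every extended ideal that it
  contains.\<close>

lemma coheight_of_minimal:
  assumes uc: "universally_catenary R" and k: "0 < k"
    and dim: "\<And>p. minimal_prime R p \<Longrightarrow> enat k \<le> krull_dim (R Quot p)"
    and P: "S.min_over P {\<zero>\<^bsub>S\<^esub>}"
  shows "S.coht P k"
proof -
  have Pp: "primeideal P S" using P by (simp add: S.min_over_def)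
  note PI = S.primeideal_ideal[OF Pp]
  have minimal: "Q = P" if "primeideal Q S" "Q \<subseteq> P" for Q
    using P that S.ideal_zero[OF S.primeideal_ideal[OF that(1)]] unfolding S.min_over_def by blast
  have min: "S.min_over P (ext A)" if "A \<subseteq> contract P" for A
  proof -
    have "A \<subseteq> carrier R" using that by (auto simp: contract_def)
    then have "ext A \<subseteq> P" using ext_sub_iff[OF _ PI] that by blast
    then show ?thesis unfolding S.min_over_def using Pp minimal by blast
  qed
  have p: "primeideal (contract P) R" by (rule contract_prime[OF Pp])
  have "{\<zero>} \<subseteq> contract P" using R.ideal_zero[OF R.primeideal_ideal[OF p]] by simp
  then have "R.min_over (contract P) {\<zero>}" by (intro going_down R.zeroideal min)
  then have "minimal_prime R (contract P)"
    using R.ideal_zero[OF R.primeideal_ideal] unfolding R.min_over_def minimal_prime_def by blast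
  then have "enat k \<le> krull_dim (R Quot contract P)" by (rule dim)
  then obtain c l where c: "prime_chain R c l" "c 0 = contract P" "c l = m" "k \<le> l"
    by (rule R.chain_of_quotient_dim[OF p k]) (rule that)
  show ?thesis
    by (rule coheight_of_chain[OF R.universally_catenary_self[OF uc] R.universally_catenary_UP[OF uc] min c]) simp
qed

lemma polarized_of_dm:
  assumes red: "reduced_ring S" and uc: "universally_catenary R" and k: "0 < k"
    and dim: "\<And>p. minimal_prime R p \<Longrightarrow> enat k \<le> krull_dim (R Quot p)"
    and g: "g \<in> carrier (UP R)" and dm: "dm_identity R g k"
  shows "polarized_dm_identity R g k"
  by (rule R.polarized_of_small_colon[OF k g dm small_colon_R[OF red coheight_of_minimal[OF uc k dim]]])

end

theorem theorem2p8:
  fixes R :: "('a, 'b) ring_scheme" and m :: "'a set" and g :: "nat \<Rightarrow> 'a" and k :: nat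
  assumes "noetherian_local_ring R m"
    and "universally_catenary R"
    and "analytically_unramified R m"
    and "g \<in> carrier (UP R)"
    and "dm_number R g = enat k"
    and "\<And>p. minimal_prime R p \<Longrightarrow> enat k \<le> krull_dim (R Quot p)"
  shows "polarized_dm_number R g \<le> enat k \<and> polarized_dm_number R g = dm_number R g"
proof -
  have R: "cring R" "noetherian_ring R" using assms(1) by (simp_all add: noetherian_local_ring_def)
  have "UP_cring R" using R(1) by (rule UP_cring.intro)
  then have UP: "cring (UP R)" by (rule UP_cring.UP_cring)
  have "noeth_local R m"
    using assms(1) by (intro noeth_local.intro noetherian_cring.intro R noeth_local_axioms.intro) (auto simp: noetherian_local_ring_def)
  then interpret noeth_local_with_UP R m
    by (intro noeth_local_with_UP.intro cring_with_UP.intro R UP)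
  interpret completion_pair_with_UP R m Sm "\<lambda>r n. resid n r" Fm
    by (intro completion_pair_with_UP.intro completion_pair_Sm noeth_local_with_UP_axioms)
  have k: "0 < k" "dm_identity R g k"
    using enat_Inf_attained[OF assms(5)[unfolded dm_number_def]] by simp_all
  have "reduced_ring Sm" using assms(3) by (simp add: analytically_unramified_def)
  then have "polarized_dm_identity R g k"
    by (rule polarized_of_dm[OF _ assms(2) k(1) assms(6,4) k(2)])
  then have le: "polarized_dm_number R g \<le> enat k"
    unfolding polarized_dm_number_def using k(1) by (intro Inf_lower) blast
  \<comment> \<open>Every order that is good for the polarized identity is good for the ordinary
    one, so the ordinary infimum runs over a larger set.\<close>
  have "dm_number R g \<le> polarized_dm_number R g"
    unfolding dm_number_def polarized_dm_number_def
    by (intro Inf_superset_mono) (use polarized_imp_dm[OF _ assms(4)] in blast)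
  then show ?thesis using le assms(5) by simp
qed

end
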